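(* There exists a discrete Beurling generalized prime system $\mathcal{P}$ such that \[ \Pi_{\mathcal{P}}(x)=\operatorname{Li}(x)+O(\log\log x), \] \[ N_{\mathcal{P}}(x)=x+O\bigl(x^{1/2}\exp(c(\log x)^{2/3})\bigr),\qquad M_{\mathcal{P}}(x)=O\bigl(x^{1/2}\exp(c(\log x)^{2/3})\bigr) \] for some constant $c>0$, and, for every $\varepsilon>0$, \[ N_{\mathcal{P}}(x)=x+\Omega\bigl(x^{1/2-\varepsilon}\bigr),\qquad M_{\mathcal{P}}(x)=\Omega\bigl(x^{1/2-\varepsilon}\bigr). \]
   Context: A Beurling generalized prime system is an unbounded non-decreasing sequence of reals $\mathcal{P}=\{p_j\}$ with $p_1>1$. Its generalized integers are the multiset of all finite products of the $p_j$ (including the empty product $1$), arranged as $1=n_0<n_1\le n_2\le\cdots$; $N_{\mathcal{P}}(x)=\#\{k: n_k\le x\}$. The zeta function is $\zeta_{\mathcal{P}}(s)=\prod_j(1-p_j^{-s})^{-1}=\sum_k n_k^{-s}$. The Riemann prime counting function is $\Pi_{\mathcal{P}}(x)=\sum_{p_j^{\nu}\le x}1/\nu=\sum_{\nu\ge1}\pi_{\mathcal{P}}(x^{1/\nu})/\nu$, where $\pi_{\mathcal{P}}(x)$ counts the $p_j\le x$. The Möbius function $\mu$ of the system is defined by $\sum_k \mu(n_k)n_k^{-s}=1/\zeta_{\mathcal{P}}(s)$ (i.e. $\mathrm{d}M$ is the multiplicative convolution inverse of $\mathrm{d}N_{\mathcal{P}}$), and $M_{\mathcal{P}}(x)=\sum_{n_k\le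 x}\mu(n_k)$. Here $\operatorname{Li}(x)=\int_1^x\frac{1-u^{-1}}{\log u}\,\mathrm{d}u$. $g(x)=\Omega(h(x))$ means $g(x)\ne o(h(x))$ as $x\to\infty$. *)

theory Defs
  imports "HOL-Analysis.Analysis" "HOL-Library.Landau_Symbols"
begin

definition beurling_primes :: "(nat \<Rightarrow> real) \<Rightarrow> bool" where
  "beurling_primes p \<longleftrightarrow> mono p \<and> \<not> bdd_above (range p) \<and> p 0 > 1"

text \<open>Generalized integers = finite products of the p j, counted with
  multiplicity, i.e. indexed by finitely supported exponent vectors e.\<close>
definition gen_int :: "(nat \<Rightarrow> real) \<Rightarrow> (nat \<Rightarrow> nat) \<Rightarrow> real" where
  "gen_int p e = (\<Prod>j\<in>{j. e j \<noteq> 0}. p j ^ e j)"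

definition N_P :: "(nat \<Rightarrow> real) \<Rightarrow> real \<Rightarrow> real" where
  "N_P p x = real (card {e :: nat \<Rightarrow> nat. finite {j. e j \<noteq> 0} \<and> gen_int p e \<le> x})"

definition Pi_P :: "(nat \<Rightarrow> real) \<Rightarrow> real \<Rightarrow> real" where
  "Pi_P p x = (\<Sum>(j,\<nu>)\<in>{(j,\<nu>). \<nu> \<ge> (1::nat) \<and> p j ^ \<nu> \<le> x}. 1 / real \<nu>)"

text \<open>Summatory Moebius function. Since 1/zeta(s) = prod_j (1 - p_j^(-s))
  = sum over finite index sets S of (-1)^|S| (prod_{j in S} p_j)^(-s), the
  measure dM (convolution inverse of dN) puts mass (-1)^|S| at prod_{j in S} p_j.\<close>
definition M_P :: "(nat \<Rightarrow> real) \<Rightarrow> real \<Rightarrow> real" where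
  "M_P p x = (\<Sum>S\<in>{S :: nat set. finite S \<and> (\<Prod>j\<in>S. p j) \<le> x}. (-1) ^ card S)"

definition Li :: "real \<Rightarrow> real" where
  "Li x = integral {1..x} (\<lambda>u. (1 - 1 / u) / ln u)"

end

theory Submission
  imports Defs "HOL-Probability.Probability" "HOL-Real_Asymp.Real_Asymp"
begin

text \<open>
  Write \<open>t = ln x\<close> and let \<open>Phi\<close> be the function with \<open>(\<Sum>\<nu>. Phi (t / \<nu>) / \<nu>) = Li (exp t)\<close>. Choose one
  log-prime at random, with density \<open>phi = Phi'\<close>, in each cell on which \<open>Phi\<close> grows by 1; then the prime
  counting function is \<open>Phi t + O(1)\<close>, which gives the estimate of \<open>\<Pi>\<close>.

  The summatory functions of the squarefree integers and of \<open>\<mu>\<close> are products of the factors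
  \<open>1 \<plusminus> \<delta>\<close> with \<open>\<delta>\<close> a point mass at a random log-prime. Convolved with the exponential of the smooth
  measure \<open>\<minusplus>dLi\<close>, these products have a mean of bounded size, and the random part is controlled by a second
  moment bound, dyadic chaining and Markov's inequality: for some choice of the log-primes all errors are
  \<open>sqrt x\<close> times a power of \<open>ln x\<close>. Undoing the convolution yields \<open>r * x + O(sqrt x * (ln x) ^ q)\<close> for the
  integers and \<open>O(sqrt x * (ln x) ^ q)\<close> for \<open>\<mu>\<close>.

  For the lower bounds, about \<open>sqrt (phi t)\<close> consecutive primes are replaced by a geometric progression, for a
  sparse sequence of heights \<open>t\<close>. This changes neither \<open>\<Pi>\<close> nor the shape of the error terms. The products of
  \<open>k\<close> primes of one progression take few values, so one value \<open>X\<close> is attained about \<open>X powr (1/2 - 1/(2*k))\<close>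
  times, and both functions jump by this amount there. For \<open>\<mu>\<close> one needs that no other
  products equal \<open>X\<close>, which holds for generic starting points of the progressions.

  Finally, removing the first few primes makes the density \<open>r\<close> small, and one further prime makes it 1.
\<close>

section \<open>The logarithmic integral and its Moebius transform\<close>

text \<open>\<open>Li\<close> is a convenient model because the convolution exponential of dLi is
  explicit, with Mellin transform s / (s - 1); compensating by it replaces contour integrals by real
  convolutions. Squarefree products are treated first because they are affine in each single point
  mass: averaging over one prime merely replaces the mass by its mean, so a second moment can be
  computed one prime at a time.

  Nothing forces large jumps in the random system, so they have to be planted. A window of about
  sqrt (phi t) primes is a compromise. It is large enough for jumps with exponent close to 1/2. It
  is also small enough that moving its primes displaces their count by O(1), and that the sum of p
  powr (-1/2) over all moved primes converges. Under this last condition infinitely many primes can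
  be exchanged at the cost of a constant factor in the error.

  The factor exp (c * (ln x) powr (2/3)) of the theorem only has to absorb a power of ln x.\<close>

definition zt :: "nat \<Rightarrow> real" where
  "zt n = (\<Sum>\<nu>. 1 / real (Suc \<nu>) ^ (n + 2))"

lemma summable_zt: "summable (\<lambda>\<nu>. 1 / real (Suc \<nu>) ^ (n + 2))"
proof -
  have "summable (\<lambda>\<nu>. inverse (real \<nu> ^ (n + 2)))"
    by (rule inverse_power_summable) simp
  hence "summable (\<lambda>\<nu>. inverse (real (Suc \<nu>) ^ (n + 2)))"
    by (subst summable_Suc_iff)
  thus ?thesis by (simp add: inverse_eq_divide)
qed

lemma zt_sums: "(\<lambda>\<nu>. 1 / real (Suc \<nu>) ^ (n + 2)) sums zt n"
  unfolding zt_def by (rule summable_sums[OF summable_zt])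

lemma sums_telescope: "(\<lambda>\<nu>. 1 / (real (Suc \<nu>) * real (Suc (Suc \<nu>)))) sums 1"
proof -
  have "(\<lambda>\<nu>. inverse (real (Suc \<nu>)) - inverse (real (Suc (Suc \<nu>)))) sums (inverse (real (Suc 0)) - 0)"
    by (rule telescope_sums'[where f = "\<lambda>\<nu>. inverse (real (Suc \<nu>))"]) (rule LIMSEQ_inverse_real_of_nat)
  moreover have "inverse (real (Suc \<nu>)) - inverse (real (Suc (Suc \<nu>))) = 1 / (real (Suc \<nu>) * real (Suc (Suc \<nu>)))" for \<nu>
    by (simp add: field_simps)
  ultimately show ?thesis by simp
qed

text \<open>\<open>zt n\<close> is the value of the zeta function at n + 2. The terms after the
  first are compared with \<open>(1/2) ^ n\<close> times the telescoping series of 1 / (k * (k +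
  1)). This geometric decay in n is what later replaces exp t by exp (t/2).\<close>

lemma zt_ge_1: "zt n \<ge> 1" and zt_le: "zt n \<le> 1 + (1/2) ^ n"
proof -
  have s: "(\<lambda>\<nu>. 1 / real (Suc (Suc \<nu>)) ^ (n + 2)) sums (zt n - 1)"
    using zt_sums[of n] by (subst sums_Suc_iff) simp
  have "0 \<le> zt n - 1" by (rule sums_le[OF _ sums_zero s]) simp
  thus "zt n \<ge> 1" by simp
  have "1 / real (Suc (Suc \<nu>)) ^ (n + 2) \<le> (1/2)^n * (1 / (real (Suc \<nu>) * real (Suc (Suc \<nu>))))" for \<nu>
  proof -
    have "1 / real (Suc (Suc \<nu>)) ^ (n + 2) = (1 / real (Suc (Suc \<nu>))) ^ n * (1 / real (Suc (Suc \<nu>)) ^ 2)"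
      by (simp only: power_add power_one_over times_divide_times_eq mult_1)
    also have "\<dots> \<le> (1/2)^n * (1 / (real (Suc \<nu>) * real (Suc (Suc \<nu>))))"
      by (intro mult_mono power_mono divide_left_mono)
         (auto simp: power2_eq_square divide_simps intro!: mult_mono)
    finally show ?thesis .
  qed
  from sums_le[OF this s sums_mult[OF sums_telescope]] show "zt n \<le> 1 + (1/2) ^ n" by simp
qed

lemma zt_le_2: "zt n \<le> 2"
  using zt_le[of n] power_le_one[of "1/2::real" n] by simp

lemma zt_pos [simp]: "zt n > 0" "zt n \<noteq> 0"
  using zt_ge_1[of n] by auto

definition ell_coeff :: "nat \<Rightarrow> real" where "ell_coeff n = 1 / fact (Suc n)"
text \<open>Moebius inversion coefficient by coefficient: summing (t / \<nu>) ^ Suc n / \<nu> over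
  \<nu> multiplies t ^ Suc n by \<open>zt n\<close>, which the denominator undoes. Integrated, this
  is Gram's series: Riemann's function R is 1 + \<open>Phi (ln x)\<close>.\<close>

definition phi_coeff :: "nat \<Rightarrow> real" where "phi_coeff n = 1 / (fact (Suc n) * zt n)"

definition ell :: "real \<Rightarrow> real" where "ell t = (\<Sum>n. ell_coeff n * t ^ n)"
definition phi :: "real \<Rightarrow> real" where "phi t = (\<Sum>n. phi_coeff n * t ^ n)"

lemma exp_minus_1_sums: "(\<lambda>n. t ^ Suc n / fact (Suc n)) sums (exp t - 1)" for t :: real
proof -
  have "(\<lambda>n. t ^ n / fact n) sums exp t"
    using exp_converges[of t] by (simp add: divide_inverse mult.commute)
  thus ?thesis by (subst sums_Suc_iff) simp
qed

lemma ell_coeff_pos: "ell_coeff n > 0" and phi_coeff_pos: "phi_coeff n > 0"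
  by (auto simp: ell_coeff_def phi_coeff_def)

lemma phi_coeff_le: "phi_coeff n \<le> ell_coeff n" and phi_coeff_ge: "ell_coeff n \<le> 2 * phi_coeff n"
proof -
  have "1 / zt n \<le> 1" using zt_ge_1[of n] by simp
  moreover have "phi_coeff n = ell_coeff n * (1 / zt n)" by (simp add: ell_coeff_def phi_coeff_def)
  ultimately show "phi_coeff n \<le> ell_coeff n"
    using mult_left_mono[of "1 / zt n" 1 "ell_coeff n"] ell_coeff_pos[of n] by simp
  have "2 * (1 / zt n) \<ge> 1" using zt_le_2[of n] zt_ge_1[of n] by (simp add: field_simps)
  hence "ell_coeff n * 1 \<le> ell_coeff n * (2 * (1 / zt n))"
    using ell_coeff_pos[of n] by (intro mult_left_mono) auto
  thus "ell_coeff n \<le> 2 * phi_coeff n" by (simp add: ell_coeff_def phi_coeff_def)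
qed

lemma summable_ell: "summable (\<lambda>n. ell_coeff n * t ^ n)"
proof (rule summable_comparison_test'[where N = 0])
  show "summable (\<lambda>n. \<bar>t\<bar> ^ n / fact n)"
    using exp_converges[of "\<bar>t\<bar>"] by (simp add: divide_inverse mult.commute sums_iff)
  have "1 / fact (Suc n) \<le> (1 / fact n :: real)" for n
    by (intro divide_left_mono fact_mono) auto
  thus "norm (ell_coeff n * t ^ n) \<le> \<bar>t\<bar> ^ n / fact n" for n
    using mult_right_mono[of "1 / fact (Suc n)" "1 / fact n :: real" "\<bar>t\<bar>^n"]
    by (simp add: ell_coeff_def abs_mult power_abs)
qed

lemma summable_phi: "summable (\<lambda>n. phi_coeff n * t ^ n)"
proof (rule summable_comparison_test'[where N = 0])
  show "summable (\<lambda>n. ell_coeff n * \<bar>t\<bar> ^ n)" by (rule summable_ell)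
  show "norm (phi_coeff n * t ^ n) \<le> ell_coeff n * \<bar>t\<bar> ^ n" for n
    using mult_right_mono[OF phi_coeff_le[of n], of "\<bar>t\<bar>^n"] phi_coeff_pos[of n]
    by (simp add: abs_mult power_abs)
qed

lemma ell_sums: "(\<lambda>n. ell_coeff n * t ^ n) sums ell t" and phi_sums: "(\<lambda>n. phi_coeff n * t ^ n) sums phi t"
  using summable_sums[OF summable_ell] summable_sums[OF summable_phi] by (auto simp: ell_def phi_def)

text \<open>Identifies \<open>ell\<close> as (exp t - 1) / t, the density of Li in the variable t =
  ln x; the power series also covers t = 0.\<close>

lemma ell_eq: "t * ell t = exp t - 1"
proof -
  have "(\<lambda>n. t * (ell_coeff n * t ^ n)) sums (t * ell t)" by (intro sums_mult ell_sums)
  moreover have "t * (ell_coeff n * t ^ n) = t ^ Suc n / fact (Suc n)" for n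
    by (simp add: ell_coeff_def)
  ultimately show ?thesis using exp_minus_1_sums[of t] sums_unique2 by fastforce
qed

lemma phi_le_ell: "t \<ge> 0 \<Longrightarrow> phi t \<le> ell t"
  by (rule sums_le[OF _ phi_sums ell_sums]) (auto intro!: mult_right_mono phi_coeff_le)

lemma phi_ge_ell: "t \<ge> 0 \<Longrightarrow> ell t \<le> 2 * phi t"
proof -
  assume t: "t \<ge> 0"
  have "(\<lambda>n. 2 * (phi_coeff n * t ^ n)) sums (2 * phi t)" by (intro sums_mult phi_sums)
  from sums_le[OF _ ell_sums this] show "ell t \<le> 2 * phi t"
    using t mult_right_mono[OF phi_coeff_ge] by (metis mult.assoc zero_le_power)
qed

lemma phi_mono: "0 \<le> s \<Longrightarrow> s \<le> t \<Longrightarrow> phi s \<le> phi t"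
  by (rule sums_le[OF _ phi_sums phi_sums])
     (auto intro!: mult_left_mono power_mono less_imp_le[OF phi_coeff_pos])

lemma phi_0: "phi 0 \<ge> 1/2"
proof -
  have "phi 0 = phi_coeff 0" unfolding phi_def by (rule powser_zero)
  thus ?thesis using zt_le_2[of 0] zt_ge_1[of 0] by (simp add: phi_coeff_def)
qed

lemma phi_ge_half: "t \<ge> 0 \<Longrightarrow> phi t \<ge> 1/2"
  using phi_mono[of 0 t] phi_0 by simp

lemma t_phi_le: "t \<ge> 0 \<Longrightarrow> t * phi t \<le> exp t"
  using mult_left_mono[OF phi_le_ell[of t], of t] ell_eq[of t] by simp

lemma ell_le_exp: "t \<ge> 0 \<Longrightarrow> ell t \<le> exp t"
proof (rule sums_le[OF _ ell_sums])
  show "(\<lambda>n. t ^ n / fact n) sums exp t"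
    using exp_converges[of t] by (simp add: divide_inverse mult.commute)
  assume "t \<ge> 0"
  have "1 / fact (Suc n) \<le> (1 / fact n :: real)" for n
    by (intro divide_left_mono fact_mono) auto
  thus "ell_coeff n * t ^ n \<le> t ^ n / fact n" for n
    using mult_right_mono[of "1 / fact (Suc n)" "1 / fact n :: real" "t^n"] \<open>t \<ge> 0\<close>
    by (simp add: ell_coeff_def)
qed

lemma phi_le_exp: "t \<ge> 0 \<Longrightarrow> phi t \<le> exp t"
  using phi_le_ell[of t] ell_le_exp[of t] by linarith

lemma phi_ge: "t \<ge> 1 \<Longrightarrow> phi t \<ge> exp t / (4 * t)"
proof -
  assume t: "t \<ge> 1"
  have "exp t \<ge> 2" using exp_ge_add_one_self[of t] t by linarith
  hence "exp t / 2 \<le> t * ell t" using ell_eq[of t] by linarith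
  also have "\<dots> \<le> t * (2 * phi t)" using phi_ge_ell[of t] t by (intro mult_left_mono) auto
  finally show ?thesis using t by (simp add: field_simps)
qed

text \<open>The coefficients of the difference carry the factor 1 - 1 / \<open>zt n\<close>, which
  is at most \<open>(1/2) ^ n\<close>, so the series is dominated by that of exp (t/2). This is the
  square root saving in the linear terms of the logarithmic derivative.\<close>

lemma ell_minus_phi:
  assumes "t \<ge> 0" shows "0 \<le> exp t - 1 - t * phi t" "exp t - 1 - t * phi t \<le> 2 * exp (t/2)"
proof -
  show "0 \<le> exp t - 1 - t * phi t"
    using mult_left_mono[OF phi_le_ell[OF assms], of t] ell_eq[of t] assms by simp
  have s1: "(\<lambda>n. t * (ell_coeff n * t ^ n - phi_coeff n * t ^ n)) sums (t * (ell t - phi t))"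
    by (intro sums_mult sums_diff ell_sums phi_sums)
  have s2: "(\<lambda>n. 2 * ((t/2) ^ Suc n / fact (Suc n))) sums (2 * (exp (t/2) - 1))"
    by (intro sums_mult exp_minus_1_sums)
  have "t * (ell_coeff n * t ^ n - phi_coeff n * t ^ n) \<le> 2 * ((t/2) ^ Suc n / fact (Suc n))" for n
  proof -
    have "1 - 1 / zt n \<le> zt n - 1"
      using zt_ge_1[of n] divide_left_mono[of 1 "zt n" "zt n - 1"] by (simp add: diff_divide_distrib)
    hence "1 - 1 / zt n \<le> (1/2)^n" using zt_le[of n] by linarith
    hence "t ^ Suc n / fact (Suc n) * (1 - 1 / zt n) \<le> t ^ Suc n / fact (Suc n) * (1/2)^n"
      using assms by (intro mult_left_mono) auto
    moreover have "t * (ell_coeff n * t ^ n - phi_coeff n * t ^ n) = t ^ Suc n / fact (Suc n) * (1 - 1 / zt n)"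
      unfolding ell_coeff_def phi_coeff_def by (simp add: divide_simps) (simp add: algebra_simps)
    moreover have "2 * ((t/2) ^ Suc n / fact (Suc n)) = t ^ Suc n / fact (Suc n) * (1/2)^n"
      by (simp add: power_divide)
    ultimately show ?thesis by linarith
  qed
  from sums_le[OF this s1 s2] show "exp t - 1 - t * phi t \<le> 2 * exp (t/2)"
    using ell_eq[of t] by (simp add: right_diff_distrib)
qed

text \<open>The coefficients of the derivative are at most \<open>ell_coeff n\<close>, hence at most
  \<open>2 * phi_coeff n\<close>, so the derivative of \<open>phi\<close> is at most 2 *
  \<open>phi\<close>. It controls the variation of the prime density over a window of equally spaced
  log-primes.\<close>

lemma phi_deriv_bound:
  assumes "0 \<le> a" "a \<le> b" shows "phi b - phi a \<le> 2 * (b - a) * phi b"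
proof -
  have d: "(phi has_real_derivative (\<Sum>n. diffs phi_coeff n * t ^ n)) (at t)" for t
  proof -
    have "((\<lambda>t. \<Sum>n. phi_coeff n * t ^ n) has_real_derivative (\<Sum>n. diffs phi_coeff n * t ^ n)) (at t)"
      by (rule termdiffs_strong_converges_everywhere) (rule summable_phi)
    thus ?thesis by (simp add: phi_def[abs_def])
  qed
  have le: "(\<Sum>n. diffs phi_coeff n * t ^ n) \<le> 2 * phi t" if "t \<ge> 0" for t
  proof -
    have s: "summable (\<lambda>n. diffs phi_coeff n * t ^ n)"
      by (rule termdiff_converges_all) (rule summable_phi)
    have "diffs phi_coeff n \<le> 2 * phi_coeff n" for n
    proof -
      have "diffs phi_coeff n \<le> real (Suc n) * (1 / fact (Suc (Suc n)))"
        using phi_coeff_le[of "Suc n"] unfolding diffs_def ell_coeff_def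
        by (intro mult_left_mono) auto
      also have "\<dots> \<le> 1 / fact (Suc n)" by (simp add: divide_simps)
      also have "\<dots> = ell_coeff n" by (simp add: ell_coeff_def)
      finally show ?thesis using phi_coeff_ge[of n] by linarith
    qed
    hence "diffs phi_coeff n * t ^ n \<le> 2 * (phi_coeff n * t ^ n)" for n
      using mult_right_mono[of "diffs phi_coeff n" "2 * phi_coeff n" "t^n"] that by (simp add: mult.assoc)
    from sums_le[OF this summable_sums[OF s] sums_mult[OF phi_sums]] show ?thesis by simp
  qed
  show ?thesis
  proof (cases "a = b")
    case False
    hence "a < b" using assms by simp
    from MVT2[OF this, of phi "\<lambda>t. \<Sum>n. diffs phi_coeff n * t ^ n"] d
    obtain z where z: "a < z" "z < b" "phi b - phi a = (b - a) * (\<Sum>n. diffs phi_coeff n * z ^ n)" by auto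
    have "phi b - phi a \<le> (b - a) * (2 * phi z)"
      unfolding z(3) using le[of z] z assms by (intro mult_left_mono) auto
    also have "\<dots> \<le> (b - a) * (2 * phi b)" using phi_mono[of z b] z assms by (intro mult_left_mono) auto
    finally show ?thesis by (simp add: mult_ac)
  qed simp
qed

lemma continuous_phi: "continuous_on A phi"
proof -
  have "isCont phi t" for t
    using isCont_powser_converges_everywhere[of phi_coeff t] summable_phi by (simp add: phi_def[abs_def])
  thus ?thesis by (simp add: continuous_at_imp_continuous_on)
qed

lemma measurable_phi [measurable]: "phi \<in> borel_measurable borel"
  by (rule borel_measurable_continuous_onI) (rule continuous_phi)

section \<open>The Gram series as smooth prime count, and its inverse\<close>

definition Phi :: "real \<Rightarrow> real" where
  "Phi t = (\<Sum>n. phi_coeff n / real (Suc n) * t ^ Suc n)"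
definition Lt :: "real \<Rightarrow> real" where
  "Lt t = (\<Sum>n. ell_coeff n / real (Suc n) * t ^ Suc n)"

lemma summable_Lt: "summable (\<lambda>n. ell_coeff n / real (Suc n) * t ^ Suc n)"
proof (rule summable_comparison_test'[where N = 0])
  show "summable (\<lambda>n. \<bar>t\<bar> * (ell_coeff n * \<bar>t\<bar> ^ n))" by (intro summable_mult summable_ell)
  have "ell_coeff n / real (Suc n) \<le> ell_coeff n" for n
    using ell_coeff_pos[of n] by (simp add: field_simps)
  hence "ell_coeff n / real (Suc n) * \<bar>t\<bar> ^ Suc n \<le> ell_coeff n * \<bar>t\<bar> ^ Suc n" for n
    by (rule mult_right_mono) simp
  thus "norm (ell_coeff n / real (Suc n) * t ^ Suc n) \<le> \<bar>t\<bar> * (ell_coeff n * \<bar>t\<bar> ^ n)" for n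
    using ell_coeff_pos[of n] by (simp add: abs_mult power_abs mult_ac del: of_nat_Suc)
qed

lemma summable_Phi: "summable (\<lambda>n. phi_coeff n / real (Suc n) * t ^ Suc n)"
proof (rule summable_comparison_test'[where N = 0])
  show "summable (\<lambda>n. ell_coeff n / real (Suc n) * \<bar>t\<bar> ^ Suc n)" by (rule summable_Lt)
  show "norm (phi_coeff n / real (Suc n) * t ^ Suc n) \<le> ell_coeff n / real (Suc n) * \<bar>t\<bar> ^ Suc n" for n
  proof -
    have "phi_coeff n / real (Suc n) * \<bar>t\<bar> ^ Suc n \<le> ell_coeff n / real (Suc n) * \<bar>t\<bar> ^ Suc n"
      by (intro mult_right_mono divide_right_mono phi_coeff_le) auto
    thus ?thesis using phi_coeff_pos[of n] by (simp add: abs_mult power_abs del: of_nat_Suc power_Suc)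
  qed
qed

lemma powser_Suc_deriv:
  fixes c :: "nat \<Rightarrow> real"
  assumes "\<And>t. summable (\<lambda>n. c n / real (Suc n) * t ^ Suc n)"
  shows "((\<lambda>t. \<Sum>n. c n / real (Suc n) * t ^ Suc n) has_real_derivative (\<Sum>n. c n * t ^ n)) (at t)"
proof -
  define d where "d n = (if n = 0 then 0 else c (n - 1) / real n)" for n
  have s: "summable (\<lambda>n. d n * t ^ n)" for t
  proof -
    have "summable (\<lambda>n. d (Suc n) * t ^ Suc n)" using assms[of t] by (simp add: d_def)
    thus ?thesis by (subst (asm) summable_Suc_iff)
  qed
  have "((\<lambda>t. \<Sum>n. d n * t ^ n) has_real_derivative (\<Sum>n. diffs d n * t ^ n)) (at t)"
    by (rule termdiffs_strong_converges_everywhere) (rule s)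
  moreover have "diffs d n = c n" for n by (simp add: diffs_def d_def)
  moreover have "(\<Sum>n. d n * t ^ n) = (\<Sum>n. c n / real (Suc n) * t ^ Suc n)" for t
    using suminf_split_head[OF s[of t]] by (simp add: d_def)
  ultimately show ?thesis by simp
qed

lemma Phi_deriv: "(Phi has_real_derivative phi t) (at t)"
  using powser_Suc_deriv[OF summable_Phi] unfolding Phi_def[abs_def] phi_def by blast

lemma Lt_deriv: "(Lt has_real_derivative ell t) (at t)"
  using powser_Suc_deriv[OF summable_Lt] unfolding Lt_def[abs_def] ell_def by blast

lemma Phi_0 [simp]: "Phi 0 = 0" and Lt_0 [simp]: "Lt 0 = 0"
  by (simp_all add: Phi_def Lt_def)

lemma Phi_MVT:
  assumes "0 \<le> a" "a \<le> b"
  shows "phi a * (b - a) \<le> Phi b - Phi a" "Phi b - Phi a \<le> phi b * (b - a)"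
proof -
  have "phi a * (b - a) \<le> Phi b - Phi a \<and> Phi b - Phi a \<le> phi b * (b - a)"
  proof (cases "a = b")
    case False
    hence "a < b" using assms by simp
    from MVT2[OF this, of Phi phi] Phi_deriv
    obtain z where z: "a < z" "z < b" "Phi b - Phi a = (b - a) * phi z" by auto
    show ?thesis unfolding z(3) using phi_mono[of a z] phi_mono[of z b] z assms
      by (simp add: mult.commute mult_left_mono)
  qed simp
  thus "phi a * (b - a) \<le> Phi b - Phi a" "Phi b - Phi a \<le> phi b * (b - a)" by auto
qed

lemma Phi_less: "0 \<le> a \<Longrightarrow> a < b \<Longrightarrow> Phi a < Phi b"
proof -
  assume a: "0 \<le> a" "a < b"
  hence "0 < phi a * (b - a)" using phi_ge_half[of a] by (intro mult_pos_pos) auto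
  thus "Phi a < Phi b" using Phi_MVT(1)[of a b] a by linarith
qed

lemma Phi_le_iff: "0 \<le> a \<Longrightarrow> 0 \<le> b \<Longrightarrow> Phi a \<le> Phi b \<longleftrightarrow> a \<le> b"
  using Phi_less[of a b] Phi_less[of b a] by (cases a b rule: linorder_cases) auto

lemma Phi_nonneg: "0 \<le> t \<Longrightarrow> 0 \<le> Phi t"
  using Phi_le_iff[of 0 t] by simp

lemma continuous_Phi: "continuous_on A Phi"
  using Phi_deriv DERIV_isCont continuous_at_imp_continuous_on by blast

lemma continuous_Lt: "continuous_on A Lt"
  using Lt_deriv DERIV_isCont continuous_at_imp_continuous_on by blast

lemma Phi_surj: "y \<ge> 0 \<Longrightarrow> \<exists>t\<ge>0. Phi t = y"
proof -
  assume y: "y \<ge> 0"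
  have "Phi (2 * y) \<ge> y"
    using Phi_MVT(1)[of 0 "2*y"] phi_0 y mult_right_mono[of "1/2" "phi 0" "2*y"] by simp
  from IVT'[of Phi 0 y "2*y"] this y show ?thesis by (auto intro: continuous_Phi)
qed

definition tau :: "nat \<Rightarrow> real" where "tau j = (SOME t. t \<ge> 0 \<and> Phi t = real j)"

lemma tau_nonneg [simp]: "tau j \<ge> 0" and Phi_tau [simp]: "Phi (tau j) = real j"
  using someI_ex[of "\<lambda>t. t \<ge> 0 \<and> Phi t = real j"] Phi_surj[of "real j"] unfolding tau_def by auto

lemma tau_le_iff: "tau i \<le> tau j \<longleftrightarrow> i \<le> j"
  using Phi_le_iff[of "tau i" "tau j"] by simp

lemma tau_less_iff: "tau i < tau j \<longleftrightarrow> i < j"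
  using tau_le_iff[of j i] by linarith

lemma tau_diff_le: "tau (Suc j) - tau j \<le> 2"
proof -
  have "phi (tau j) * (tau (Suc j) - tau j) \<le> 1"
    using Phi_MVT(1)[of "tau j" "tau (Suc j)"] tau_le_iff[of j "Suc j"] by simp
  moreover have "1/2 * (tau (Suc j) - tau j) \<le> phi (tau j) * (tau (Suc j) - tau j)"
    using phi_ge_half[of "tau j"] tau_le_iff[of j "Suc j"] by (intro mult_right_mono) auto
  ultimately have "1/2 * (tau (Suc j) - tau j) \<le> 1" by (rule order_trans[rotated])
  thus ?thesis by simp
qed

text \<open>Because \<open>Phi 1\<close> is at most \<open>ell 1\<close>, which is e - 1 and so
  below 2.\<close>

lemma tau_ge_1: "j \<ge> 2 \<Longrightarrow> tau j \<ge> 1"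
proof -
  assume "j \<ge> 2"
  have "ell 1 = exp 1 - 1" using ell_eq[of 1] by simp
  hence "Phi 1 \<le> 2" using Phi_MVT(2)[of 0 1] phi_le_ell[of 1] exp_le by simp
  hence "Phi 1 \<le> Phi (tau j)" using \<open>j \<ge> 2\<close> by simp
  thus ?thesis by (subst (asm) Phi_le_iff) auto
qed

lemma tau_unbounded: "\<exists>n. tau n > L"
proof -
  obtain n where "real n > Phi (max L 0)" using reals_Archimedean2 by blast
  hence "Phi (tau n) > Phi (max L 0)" by simp
  hence "tau n > max L 0" using Phi_le_iff[of "tau n" "max L 0"] by (simp add: not_le[symmetric])
  thus ?thesis by auto
qed

text \<open>A double series of nonnegative terms is summed in both orders; the sum over \<nu>
  produces \<open>zt n\<close> and cancels the denominator of \<open>phi_coeff\<close>. Together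
  with \<open>Li_eq\<close> it says that primes counted by \<open>Phi\<close> would have the Riemann
  count Li exactly.\<close>

lemma Phi_sum_sums:
  assumes t: "t \<ge> 0"
  shows "(\<lambda>\<nu>. Phi (t / real (Suc \<nu>)) / real (Suc \<nu>)) sums Lt t"
proof -
  define g where "g \<nu> n = phi_coeff n / real (Suc n) * (t / real (Suc \<nu>)) ^ Suc n / real (Suc \<nu>)" for \<nu> n
  have gnn: "g \<nu> n \<ge> 0" for \<nu> n
    using t phi_coeff_pos[of n] by (auto simp: g_def intro!: mult_nonneg_nonneg divide_nonneg_nonneg)
  have row: "((\<lambda>n. g \<nu> n) has_sum Phi (t / real (Suc \<nu>)) / real (Suc \<nu>)) UNIV" for \<nu>
  proof -
    have "(\<lambda>n. g \<nu> n) sums (Phi (t / real (Suc \<nu>)) / real (Suc \<nu>))"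
      unfolding g_def Phi_def by (intro sums_divide summable_sums summable_Phi)
    thus ?thesis using gnn by (intro norm_summable_imp_has_sum) (auto simp: sums_iff)
  qed
  have col: "((\<lambda>\<nu>. g \<nu> n) has_sum (ell_coeff n / real (Suc n) * t ^ Suc n)) UNIV" for n
  proof -
    have eq: "g \<nu> n = phi_coeff n / real (Suc n) * t ^ Suc n * (1 / real (Suc \<nu>) ^ (n + 2))" for \<nu>
      by (simp add: g_def power_divide)
    have "(\<lambda>\<nu>. g \<nu> n) sums (phi_coeff n / real (Suc n) * t ^ Suc n * zt n)"
      unfolding eq by (intro sums_mult zt_sums)
    also have "phi_coeff n / real (Suc n) * t ^ Suc n * zt n = ell_coeff n / real (Suc n) * t ^ Suc n"
      by (simp add: phi_coeff_def ell_coeff_def)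
    finally have "(\<lambda>\<nu>. g \<nu> n) sums (ell_coeff n / real (Suc n) * t ^ Suc n)" .
    thus ?thesis using gnn by (intro norm_summable_imp_has_sum) (auto simp: sums_iff)
  qed
  have tot: "((\<lambda>n. ell_coeff n / real (Suc n) * t ^ Suc n) has_sum Lt t) UNIV"
    using summable_Lt[of t] t ell_coeff_pos unfolding Lt_def
    by (intro norm_summable_imp_has_sum summable_sums)
       (auto simp: abs_mult less_imp_le power_abs simp del: of_nat_Suc)
  have a: "((\<lambda>(n,\<nu>). g \<nu> n) has_sum Lt t) (UNIV \<times> UNIV)"
  proof (rule has_sum_SigmaI[OF _ tot])
    show "((\<lambda>\<nu>. (case (n, \<nu>) of (n, \<nu>) \<Rightarrow> g \<nu> n)) has_sum ell_coeff n / real (Suc n) * t ^ Suc n) UNIV" for n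
      using col[of n] by simp
    show "(\<lambda>(n, \<nu>). g \<nu> n) summable_on UNIV \<times> UNIV"
      by (rule summable_on_SigmaI[where g = "\<lambda>n. ell_coeff n / real (Suc n) * t ^ Suc n"])
         (use gnn col tot in \<open>auto simp: summable_on_def\<close>)
  qed
  have b: "((\<lambda>(\<nu>,n). g \<nu> n) has_sum Lt t) (UNIV \<times> UNIV)"
    using a[unfolded has_sum_swap[of "\<lambda>(n,\<nu>). g \<nu> n"]] by (simp only: case_prod_conv)
  have "((\<lambda>\<nu>. Phi (t / real (Suc \<nu>)) / real (Suc \<nu>)) has_sum Lt t) UNIV"
    by (rule has_sum_Sigma'[OF b]) (use row in auto)
  thus ?thesis by (rule has_sum_imp_sums)
qed

lemma Li_eq: "x \<ge> 1 \<Longrightarrow> Li x = Lt (ln x)"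
proof -
  assume x: "x \<ge> 1"
  have "((\<lambda>u. (1 - 1/u) / ln u) has_integral (Lt (ln x) - Lt (ln 1))) {1..x}"
  proof (rule fundamental_theorem_of_calculus_interior)
    show "continuous_on {1..x} (\<lambda>u. Lt (ln u))"
      by (intro continuous_on_compose2[OF continuous_Lt[of UNIV]] continuous_on_ln continuous_on_id) auto
    fix u assume u: "u \<in> {1<..<x}"
    have "((\<lambda>u. Lt (ln u)) has_real_derivative (ell (ln u) * (1 / u))) (at u)"
      using u by (intro DERIV_chain2[OF Lt_deriv]) (auto intro!: derivative_eq_intros)
    moreover have "ell (ln u) * (1/u) = (1 - 1/u) / ln u"
      using ell_eq[of "ln u"] u by (simp add: field_simps)
    ultimately show "((\<lambda>u. Lt (ln u)) has_vector_derivative (1 - 1/u) / ln u) (at u)"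
      by (simp add: has_real_derivative_iff_has_vector_derivative)
  qed (use x in auto)
  thus ?thesis by (simp add: Li_def integral_unique)
qed

section \<open>The convolution algebra of measures on the half line\<close>

text \<open>Local boundedness, instead of local integrability, makes every convolution defined at
  every point, so identities between densities hold pointwise and not only almost
  everywhere.\<close>

definition dens :: "(real \<Rightarrow> real) \<Rightarrow> bool" where
  "dens f \<longleftrightarrow> f \<in> borel_measurable borel \<and> (\<forall>t<0. f t = 0) \<and> (\<forall>L. \<exists>B. \<forall>t\<le>L. \<bar>f t\<bar> \<le> B)"

lemma dens_measurable: "dens f \<Longrightarrow> f \<in> borel_measurable borel"
  and dens_neg: "dens f \<Longrightarrow> t < 0 \<Longrightarrow> f t = 0"
  by (auto simp: dens_def)

lemma dens_bound: assumes "dens f" obtains B where "B \<ge> 0" "\<And>t. t \<le> L \<Longrightarrow> \<bar>f t\<bar> \<le> B"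
proof -
  obtain B where "\<forall>t\<le>L. \<bar>f t\<bar> \<le> B" using assms unfolding dens_def by blast
  thus ?thesis by (intro that[of "max B 0"]) (auto simp: le_max_iff_disj)
qed

lemma densI:
  assumes "f \<in> borel_measurable borel" "\<And>t. t < 0 \<Longrightarrow> f t = 0" "\<And>L. L \<ge> 0 \<Longrightarrow> \<exists>B. \<forall>t. 0 \<le> t \<and> t \<le> L \<longrightarrow> \<bar>f t\<bar> \<le> B"
  shows "dens f"
  unfolding dens_def
proof (intro conjI allI impI)
  fix L :: real
  obtain B where B: "\<forall>t. 0 \<le> t \<and> t \<le> max L 0 \<longrightarrow> \<bar>f t\<bar> \<le> B" using assms(3)[of "max L 0"] by auto
  show "\<exists>B. \<forall>t\<le>L. \<bar>f t\<bar> \<le> B"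
  proof (intro exI allI impI)
    fix t assume "t \<le> L"
    thus "\<bar>f t\<bar> \<le> max B 0" using B assms(2)[of t] by (cases "t < 0") (auto simp: le_max_iff_disj)
  qed
qed (use assms in auto)

definition conv :: "(real \<Rightarrow> real) \<Rightarrow> (real \<Rightarrow> real) \<Rightarrow> real \<Rightarrow> real" where
  "conv f g t = (\<integral>s. f s * g (t - s) \<partial>lborel)"

lemma integrable_bounded_support:
  fixes f :: "real \<Rightarrow> real"
  assumes "f \<in> borel_measurable borel" "\<And>s. s \<notin> {a..b} \<Longrightarrow> f s = 0" "\<And>s. s \<in> {a..b} \<Longrightarrow> \<bar>f s\<bar> \<le> B"
  shows "integrable lborel f"
  by (rule integrableI_bounded_set[where A = "{a..b}" and B = B])
     (use assms in \<open>auto intro!: AE_I2 simp: emeasure_lborel_Icc_eq\<close>)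

lemma integrable_bounded_support2:
  fixes f :: "real \<times> real \<Rightarrow> real"
  assumes "f \<in> borel_measurable borel" "\<And>s. s \<notin> {a..b} \<times> {a'..b'} \<Longrightarrow> f s = 0"
    "\<And>s. s \<in> {a..b} \<times> {a'..b'} \<Longrightarrow> \<bar>f s\<bar> \<le> B"
  shows "integrable (lborel \<Otimes>\<^sub>M lborel) f"
proof -
  have "emeasure (lborel \<Otimes>\<^sub>M lborel) ({a..b} \<times> {a'..b'}) < \<infinity>"
    by (subst lborel.emeasure_pair_measure_Times)
       (auto simp: emeasure_lborel_Icc_eq ennreal_mult_less_top)
  moreover have "f \<in> borel_measurable (lborel \<Otimes>\<^sub>M lborel)"
    using assms(1) by (simp add: lborel_prod)
  ultimately show ?thesis
    by (intro integrableI_bounded_set[where A = "{a..b} \<times> {a'..b'}" and B = B])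
       (use assms in \<open>auto intro!: AE_I2\<close>)
qed

lemma integrable_dens: "dens f \<Longrightarrow> integrable lborel (\<lambda>s. indicator {0..L} s * f s)"
proof -
  assume f: "dens f"
  obtain B where B: "B \<ge> 0" "\<And>t. t \<le> L \<Longrightarrow> \<bar>f t\<bar> \<le> B" using dens_bound[OF f, of "L"] by blast
  note [measurable] = dens_measurable[OF f]
  show ?thesis
    by (rule integrable_bounded_support[where a = 0 and b = L and B = B])
       (use B in \<open>auto simp: indicator_def\<close>)
qed

lemma conv_integrable:
  assumes f: "dens f" and g: "dens g" shows "integrable lborel (\<lambda>s. f s * g (t - s))"
proof -
  obtain B where B: "B \<ge> 0" "\<And>s. s \<le> t \<Longrightarrow> \<bar>f s\<bar> \<le> B" using dens_bound[OF f, of "t"] by blast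
  obtain B' where B': "B' \<ge> 0" "\<And>s. s \<le> t \<Longrightarrow> \<bar>g s\<bar> \<le> B'" using dens_bound[OF g, of "t"] by blast
  note [measurable] = dens_measurable[OF f] dens_measurable[OF g]
  show ?thesis
  proof (rule integrable_bounded_support[where a = 0 and b = t and B = "B * B'"])
    fix s assume "s \<notin> {0..t}"
    thus "f s * g (t - s) = 0" using dens_neg[OF f, of s] dens_neg[OF g, of "t - s"] by auto
  next
    fix s assume "s \<in> {0..t}"
    thus "\<bar>f s * g (t - s)\<bar> \<le> B * B'" using B B' unfolding abs_mult by (intro mult_mono) auto
  qed measurable
qed

lemma conv_neg: assumes "dens f" "dens g" "t < 0" shows "conv f g t = 0"
proof -
  have "f s * g (t - s) = 0" for s
    using dens_neg[OF assms(1), of s] dens_neg[OF assms(2), of "t - s"] assms(3) by (cases "s < 0") auto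
  hence "(\<lambda>s. f s * g (t - s)) = (\<lambda>_. 0)" by blast
  thus ?thesis by (simp add: conv_def)
qed

lemma conv_abs_le: assumes "dens f" "dens g" shows "\<bar>conv f g t\<bar> \<le> conv (\<lambda>s. \<bar>f s\<bar>) (\<lambda>s. \<bar>g s\<bar>) t"
  using integral_norm_bound[of lborel "\<lambda>s. f s * g (t - s)"] by (simp add: conv_def abs_mult)

lemma dens_abs: "dens f \<Longrightarrow> dens (\<lambda>s. \<bar>f s\<bar>)"
  by (auto simp: dens_def)

lemma conv_bound:
  assumes f: "dens f" and g: "dens g" and B: "\<And>s. 0 \<le> s \<Longrightarrow> s \<le> t \<Longrightarrow> \<bar>g s\<bar> \<le> B" "B \<ge> 0"
  shows "\<bar>conv f g t\<bar> \<le> B * (\<integral>s. indicator {0..t} s * \<bar>f s\<bar> \<partial>lborel)"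
proof -
  have "\<bar>conv f g t\<bar> \<le> (\<integral>s. B * (indicator {0..t} s * \<bar>f s\<bar>) \<partial>lborel)"
    unfolding conv_def
  proof (rule order_trans[OF integral_norm_bound[of lborel "\<lambda>s. f s * g (t - s)", unfolded real_norm_def]], rule integral_mono)
    show "integrable lborel (\<lambda>s. \<bar>f s * g (t - s)\<bar>)" using conv_integrable[OF f g, of t] by simp
    show "integrable lborel (\<lambda>s. B * (indicator {0..t} s * \<bar>f s\<bar>))"
      by (intro integrable_mult_right integrable_dens dens_abs f)
    fix s
    show "\<bar>f s * g (t - s)\<bar> \<le> B * (indicator {0..t} s * \<bar>f s\<bar>)"
      using dens_neg[OF f, of s] dens_neg[OF g, of "t - s"] B(1)[of "t - s"] B(2)
      by (auto simp: indicator_def abs_mult not_le mult.commute[of B] intro: mult_left_mono)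
  qed
  thus ?thesis by simp
qed

lemma dens_conv: assumes f: "dens f" and g: "dens g" shows "dens (conv f g)"
proof (rule densI)
  note [measurable] = dens_measurable[OF f] dens_measurable[OF g]
  show "conv f g \<in> borel_measurable borel" unfolding conv_def[abs_def] by measurable
  show "conv f g t = 0" if "t < 0" for t using conv_neg[OF f g that] .
  fix L :: real assume L: "L \<ge> 0"
  obtain B' where B': "B' \<ge> 0" "\<And>s. s \<le> L \<Longrightarrow> \<bar>g s\<bar> \<le> B'" using dens_bound[OF g, of "L"] by blast
  show "\<exists>B. \<forall>t. 0 \<le> t \<and> t \<le> L \<longrightarrow> \<bar>conv f g t\<bar> \<le> B"
  proof (intro exI allI impI)
    fix t assume t: "0 \<le> t \<and> t \<le> L"
    have "\<bar>conv f g t\<bar> \<le> B' * (\<integral>s. indicator {0..t} s * \<bar>f s\<bar> \<partial>lborel)"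
      by (rule conv_bound[OF f g]) (use B' t in auto)
    also have "\<dots> \<le> B' * (\<integral>s. indicator {0..L} s * \<bar>f s\<bar> \<partial>lborel)"
      using B' t by (intro mult_left_mono integral_mono integrable_dens dens_abs f) (auto simp: indicator_def)
    finally show "\<bar>conv f g t\<bar> \<le> \<dots>" .
  qed
qed

lemma conv_commute: "conv f g t = conv g f t"
  using lborel_integral_real_affine[of "-1" "\<lambda>s. f s * g (t - s)" t]
  by (simp add: conv_def mult.commute)

lemma conv_assoc:
  assumes f: "dens f" and g: "dens g" and h: "dens h"
  shows "conv (conv f g) h t = conv f (conv g h) t"
proof -
  note [measurable] = dens_measurable[OF f] dens_measurable[OF g] dens_measurable[OF h]
  obtain B1 where B1: "B1 \<ge> 0" "\<And>s. s \<le> t \<Longrightarrow> \<bar>f s\<bar> \<le> B1" using dens_bound[OF f, of "t"] by blast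
  obtain B2 where B2: "B2 \<ge> 0" "\<And>s. s \<le> t \<Longrightarrow> \<bar>g s\<bar> \<le> B2" using dens_bound[OF g, of "t"] by blast
  obtain B3 where B3: "B3 \<ge> 0" "\<And>s. s \<le> t \<Longrightarrow> \<bar>h s\<bar> \<le> B3" using dens_bound[OF h, of "t"] by blast
  have int: "integrable (lborel \<Otimes>\<^sub>M lborel) (\<lambda>(u, s). f u * g (s - u) * h (t - s))"
  proof (rule integrable_bounded_support2[where a = 0 and b = t and a' = 0 and b' = t and B = "B1 * B2 * B3"])
    fix p :: "real \<times> real"
    obtain u s where p: "p = (u, s)" by (cases p)
    show "(case p of (u, s) \<Rightarrow> f u * g (s - u) * h (t - s)) = 0" if "p \<notin> {0..t} \<times> {0..t}"
      using that dens_neg[OF f, of u] dens_neg[OF g, of "s - u"] dens_neg[OF h, of "t - s"] unfolding p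
      by (auto; linarith)
    show "\<bar>case p of (u, s) \<Rightarrow> f u * g (s - u) * h (t - s)\<bar> \<le> B1 * B2 * B3" if "p \<in> {0..t} \<times> {0..t}"
      using that B1 B2 B3 unfolding p by (auto simp: abs_mult intro!: mult_mono)
  next
    have "(\<lambda>(u, s). f u * g (s - u) * h (t - s)) \<in> borel_measurable (borel \<Otimes>\<^sub>M borel)" by measurable
    thus "(\<lambda>(u, s). f u * g (s - u) * h (t - s)) \<in> borel_measurable borel" by (simp add: borel_prod)
  qed
  have eq: "(\<integral>s. g (s - u) * h (t - s) \<partial>lborel) = conv g h (t - u)" for u
    using lborel_integral_real_affine[of 1 "\<lambda>s. g (s - u) * h (t - s)" u]
    by (simp add: conv_def algebra_simps)
  have "conv (conv f g) h t = (\<integral>s. (\<integral>u. f u * g (s - u) * h (t - s) \<partial>lborel) \<partial>lborel)"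
    by (simp add: conv_def)
  also have "\<dots> = (\<integral>u. (\<integral>s. f u * g (s - u) * h (t - s) \<partial>lborel) \<partial>lborel)"
    by (rule lborel_pair.Fubini_integral[OF int])
  also have "\<dots> = (\<integral>u. f u * (\<integral>s. g (s - u) * h (t - s) \<partial>lborel) \<partial>lborel)"
    by (simp add: mult.assoc)
  finally show ?thesis unfolding eq by (simp add: conv_def)
qed

lemma conv_add: "dens f \<Longrightarrow> dens g \<Longrightarrow> dens h \<Longrightarrow> conv (\<lambda>s. f s + g s) h t = conv f h t + conv g h t"
  by (simp add: conv_def distrib_right conv_integrable)

lemma conv_scale: "conv (\<lambda>s. c * f s) g t = c * conv f g t"
  by (simp add: conv_def mult.assoc)

lemma dens_0: "dens (\<lambda>_. 0)"
  by (auto simp: dens_def)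

lemma dens_add: "dens f \<Longrightarrow> dens g \<Longrightarrow> dens (\<lambda>s. f s + g s)"
proof (rule densI)
  assume f: "dens f" and g: "dens g"
  show "(\<lambda>s. f s + g s) \<in> borel_measurable borel" using dens_measurable[OF f] dens_measurable[OF g] by measurable
  fix L :: real
  obtain B1 where B1: "B1 \<ge> 0" "\<And>s. s \<le> L \<Longrightarrow> \<bar>f s\<bar> \<le> B1" using dens_bound[OF f, of "L"] by blast
  obtain B2 where B2: "B2 \<ge> 0" "\<And>s. s \<le> L \<Longrightarrow> \<bar>g s\<bar> \<le> B2" using dens_bound[OF g, of "L"] by blast
  show "\<exists>B. \<forall>t. 0 \<le> t \<and> t \<le> L \<longrightarrow> \<bar>f t + g t\<bar> \<le> B"
    using B1(2) B2(2) by (intro exI[of _ "B1 + B2"]) (smt (verit))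
qed (auto simp: dens_neg)

lemma dens_scale: "dens f \<Longrightarrow> dens (\<lambda>s. c * f s)"
proof (rule densI)
  assume f: "dens f"
  show "(\<lambda>s. c * f s) \<in> borel_measurable borel" using dens_measurable[OF f] by measurable
  fix L :: real
  obtain B1 where B1: "B1 \<ge> 0" "\<And>s. s \<le> L \<Longrightarrow> \<bar>f s\<bar> \<le> B1" using dens_bound[OF f, of "L"] by blast
  show "\<exists>B. \<forall>t. 0 \<le> t \<and> t \<le> L \<longrightarrow> \<bar>c * f t\<bar> \<le> B"
    using B1 by (intro exI[of _ "\<bar>c\<bar> * B1"]) (auto simp: abs_mult intro: mult_left_mono)
qed (auto simp: dens_neg)

lemma dens_times_t: "dens f \<Longrightarrow> dens (\<lambda>s. s * f s)"
proof (rule densI)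
  assume f: "dens f"
  show "(\<lambda>s. s * f s) \<in> borel_measurable borel" using dens_measurable[OF f] by measurable
  fix L :: real
  obtain B1 where B1: "B1 \<ge> 0" "\<And>s. s \<le> L \<Longrightarrow> \<bar>f s\<bar> \<le> B1" using dens_bound[OF f, of "L"] by blast
  show "\<exists>B. \<forall>t. 0 \<le> t \<and> t \<le> L \<longrightarrow> \<bar>t * f t\<bar> \<le> B"
    using B1 by (intro exI[of _ "L * B1"]) (auto simp: abs_mult intro: mult_mono)
qed (auto simp: dens_neg)

text \<open>The pair \<open>(c, f)\<close> stands for the measure with mass \<open>c\<close> at 0 and density \<open>f\<close> on \<open>(0, \<infinity>)\<close>;
  multiplication is convolution.\<close>
typedef alg = "{(c :: real, f). dens f}"
  by (rule exI[of _ "(0, \<lambda>_. 0)"]) (auto simp: dens_0)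

setup_lifting type_definition_alg

lift_definition dc :: "alg \<Rightarrow> real" is fst .
lift_definition dn :: "alg \<Rightarrow> real \<Rightarrow> real" is snd .
lift_definition mk :: "real \<Rightarrow> (real \<Rightarrow> real) \<Rightarrow> alg" is "\<lambda>c f. if dens f then (c, f) else (c, \<lambda>_. 0)"
  by (auto simp: dens_0)
text \<open>Multiplication of the measure by t, which kills the mass at 0; on Laplace transforms it
  is minus the derivative. It serves to form logarithmic derivatives.\<close>

lift_definition DD :: "alg \<Rightarrow> alg" is "\<lambda>(c, f). (0, \<lambda>s. s * f s)"
  by (auto simp: dens_times_t)
lift_definition sc :: "real \<Rightarrow> alg" is "\<lambda>c. (c, \<lambda>_. 0)"
  by (auto simp: dens_0)

lemma dens_dn [simp]: "dens (dn x)" by transfer auto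
lemma dc_mk [simp]: "dc (mk c f) = c" by transfer auto
lemma dn_mk [simp]: "dens f \<Longrightarrow> dn (mk c f) = f" by transfer auto
lemma dc_DD [simp]: "dc (DD x) = 0" by transfer auto
lemma dn_DD [simp]: "dn (DD x) t = t * dn x t" by transfer auto
lemma dc_sc [simp]: "dc (sc c) = c" by transfer auto
lemma dn_sc [simp]: "dn (sc c) t = 0" by transfer auto

lemma alg_eqI: "dc x = dc y \<Longrightarrow> (\<And>t. dn x t = dn y t) \<Longrightarrow> x = y"
  by transfer (auto simp: prod_eq_iff)

instantiation alg :: comm_ring_1
begin
lift_definition zero_alg :: alg is "(0, \<lambda>_. 0)" by (auto simp: dens_0)
lift_definition one_alg :: alg is "(1, \<lambda>_. 0)" by (auto simp: dens_0)
lift_definition plus_alg :: "alg \<Rightarrow> alg \<Rightarrow> alg" is "\<lambda>(c, f) (d, g). (c + d, \<lambda>s. f s + g s)"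
  by (auto intro: dens_add)
lift_definition uminus_alg :: "alg \<Rightarrow> alg" is "\<lambda>(c, f). (- c, \<lambda>s. (-1) * f s)"
  using dens_scale[of _ "-1"] by auto
lift_definition minus_alg :: "alg \<Rightarrow> alg \<Rightarrow> alg" is "\<lambda>(c, f) (d, g). (c - d, \<lambda>s. f s + (-1) * g s)"
  using dens_add dens_scale[of _ "-1"] by fastforce
lift_definition times_alg :: "alg \<Rightarrow> alg \<Rightarrow> alg"
  is "\<lambda>(c, f) (d, g). (c * d, \<lambda>s. (c * g s + d * f s) + conv f g s)"
  by (auto intro!: dens_add dens_scale dens_conv)
instance
proof
  fix a b c :: alg
  show "a * b = b * a" by transfer (auto simp: conv_commute fun_eq_iff)
  show "(a * b) * c = a * (b * c)"
  proof (transfer, clarify, intro conjI ext)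
    fix a1 a2 a3 :: real and f g h :: "real \<Rightarrow> real" and s :: real
    assume d: "dens f" "dens g" "dens h"
    have 1: "conv (\<lambda>s. (a1 * g s + a2 * f s) + conv f g s) h s =
        a1 * conv g h s + a2 * conv f h s + conv f (conv g h) s"
      using d by (simp add: conv_add conv_scale dens_add dens_scale dens_conv conv_assoc)
    have "conv f (\<lambda>s. (a2 * h s + a3 * g s) + conv g h s) s =
          conv (\<lambda>s. (a2 * h s + a3 * g s) + conv g h s) f s" by (rule conv_commute)
    also have "\<dots> = a2 * conv h f s + a3 * conv g f s + conv (conv g h) f s"
      using d by (simp add: conv_add conv_scale dens_add dens_scale dens_conv)
    also have "\<dots> = a2 * conv f h s + a3 * conv f g s + conv f (conv g h) s"
      by (simp only: conv_commute[of _ f])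
    finally have 2: "conv f (\<lambda>s. (a2 * h s + a3 * g s) + conv g h s) s =
      a2 * conv f h s + a3 * conv f g s + conv f (conv g h) s" .
    show "a1 * a2 * h s + a3 * (a1 * g s + a2 * f s + conv f g s) +
       conv (\<lambda>s. a1 * g s + a2 * f s + conv f g s) h s =
       a1 * (a2 * h s + a3 * g s + conv g h s) + a2 * a3 * f s +
       conv f (\<lambda>s. a2 * h s + a3 * g s + conv g h s) s"
      unfolding 1 2 by (simp add: algebra_simps)
  qed (auto simp: mult.assoc)
  show "1 * a = a" by transfer (auto simp: conv_def)
  show "(a + b) * c = a * c + b * c"
    by transfer (auto simp: conv_add algebra_simps)
  show "(0::alg) \<noteq> 1" by transfer auto
qed (transfer; auto simp: fun_eq_iff)+
end

lemma dc_simps [simp]: "dc 0 = 0" "dc 1 = 1" "dc (x + y) = dc x + dc y" "dc (x - y) = dc x - dc y"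
    "dc (- x) = - dc x" "dc (x * y) = dc x * dc y"
  by (transfer; auto)+

lemma dn_simps [simp]: "dn 0 t = 0" "dn 1 t = 0" "dn (x + y) t = dn x t + dn y t"
    "dn (x - y) t = dn x t - dn y t" "dn (- x) t = - dn x t"
  by (transfer; auto)+

lemma dn_times: "dn (x * y) t = dc x * dn y t + dc y * dn x t + conv (dn x) (dn y) t"
  by transfer auto

lemma dc_power [simp]: "dc (x ^ n) = dc x ^ n" by (induction n) auto
lemma dc_sum [simp]: "dc (sum f A) = (\<Sum>x\<in>A. dc (f x))" by (induction A rule: infinite_finite_induct) auto
lemma dn_sum [simp]: "dn (sum f A) t = (\<Sum>x\<in>A. dn (f x) t)" by (induction A rule: infinite_finite_induct) auto

lemma dn_sc_mult [simp]: "dn (sc c * x) t = c * dn x t"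
  by (transfer) (auto simp: conv_def)

lemma dn_neg: "t < 0 \<Longrightarrow> dn x t = 0"
  by (rule dens_neg[OF dens_dn])

lemma dn_measurable [measurable]: "dn x \<in> borel_measurable borel"
  by (rule dens_measurable[OF dens_dn])

lemma sc_simps [simp]: "sc 0 = 0" "sc 1 = 1" "sc (-1) = -1"
  by (rule alg_eqI; simp)+

lemma DD_add [simp]: "DD (x + y) = DD x + DD y" and DD_1 [simp]: "DD 1 = 0" and DD_sc [simp]: "DD (sc c) = 0"
  by (rule alg_eqI; simp add: algebra_simps)+

text \<open>Since \<open>t = s + (t - s)\<close>, multiplication of densities by \<open>t\<close> is a derivation.\<close>
lemma DD_mult: "DD (x * y) = DD x * y + x * DD y"
proof (rule alg_eqI)
  fix t
  have d: "dens (\<lambda>s. s * dn x s)" "dens (\<lambda>s. s * dn y s)" by (intro dens_times_t; simp)+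
  have "t * conv (dn x) (dn y) t = (\<integral>s. (s * dn x s) * dn y (t - s) + dn x s * ((t - s) * dn y (t - s)) \<partial>lborel)"
    unfolding conv_def by (subst integral_mult_right_zero[symmetric]) (simp add: algebra_simps)
  also have "\<dots> = conv (\<lambda>s. s * dn x s) (dn y) t + conv (dn x) (\<lambda>s. s * dn y s) t"
    unfolding conv_def using conv_integrable[OF d(1) dens_dn, of y t] conv_integrable[OF dens_dn d(2), of x t]
    by (rule Bochner_Integration.integral_add)
  moreover have "dn (DD x) = (\<lambda>s. s * dn x s)" "dn (DD y) = (\<lambda>s. s * dn y s)" by auto
  ultimately show "dn (DD (x * y)) t = dn (DD x * y + x * DD y) t"
    by (simp add: dn_times distrib_left)
qed simp

lemma DD_prod:
  "finite A \<Longrightarrow> DD (prod f A) = (\<Sum>j\<in>A. DD (f j) * prod f (A - {j}))"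
proof (induction A rule: finite_induct)
  case (insert a A)
  have "DD (prod f (insert a A)) = DD (f a) * prod f A + f a * (\<Sum>j\<in>A. DD (f j) * prod f (A - {j}))"
    using insert by (simp add: DD_mult)
  also have "f a * (\<Sum>j\<in>A. DD (f j) * prod f (A - {j})) = (\<Sum>j\<in>A. DD (f j) * prod f (insert a A - {j}))"
    unfolding sum_distrib_left
  proof (rule sum.cong)
    fix j assume j: "j \<in> A"
    hence "insert a A - {j} = insert a (A - {j})" using insert by auto
    thus "f a * (DD (f j) * prod f (A - {j})) = DD (f j) * prod f (insert a A - {j})"
      using insert by (simp add: mult_ac)
  qed auto
  finally show ?case using insert by simp
qed simp

text \<open>Total variation on [0, L] with the weight exp (-s/2), which belongs to the line of real
  part 1/2. As the weight is multiplicative, the norm is submultiplicative. With the value 0 for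
  negative L the mass at 0 counts as an increment when L passes 0, in agreement with
  \<open>cum\<close>.\<close>

definition nrm :: "real \<Rightarrow> alg \<Rightarrow> real" where
  "nrm L x = (if L < 0 then 0 else \<bar>dc x\<bar> + (\<integral>s. indicator {0..L} s * (exp (-s/2) * \<bar>dn x s\<bar>) \<partial>lborel))"

lemma dens_weight: "dens f \<Longrightarrow> dens (\<lambda>s. exp (-s/2) * \<bar>f s\<bar>)"
proof (rule densI)
  assume f: "dens f"
  show "(\<lambda>s. exp (-s/2) * \<bar>f s\<bar>) \<in> borel_measurable borel" using dens_measurable[OF f] by measurable
  fix L :: real
  obtain B1 where B1: "B1 \<ge> 0" "\<And>s. s \<le> L \<Longrightarrow> \<bar>f s\<bar> \<le> B1" using dens_bound[OF f, of "L"] by blast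
  show "\<exists>B. \<forall>t. 0 \<le> t \<and> t \<le> L \<longrightarrow> \<bar>exp (-t/2) * \<bar>f t\<bar>\<bar> \<le> B"
  proof (intro exI allI impI)
    fix t assume "0 \<le> t \<and> t \<le> L"
    thus "\<bar>exp (-t/2) * \<bar>f t\<bar>\<bar> \<le> 1 * B1" using B1 unfolding abs_mult by (intro mult_mono) auto
  qed
qed (auto simp: dens_neg)

lemma integrable_nrm: "integrable lborel (\<lambda>s. indicator {0..L} s * (exp (-s/2) * \<bar>dn x s\<bar>))"
  by (intro integrable_dens dens_weight dens_dn)

lemma nrm_nonneg: "nrm L x \<ge> 0"
  by (auto simp: nrm_def intro!: add_nonneg_nonneg Bochner_Integration.integral_nonneg)

lemma nrm_mono: "L \<le> L' \<Longrightarrow> nrm L x \<le> nrm L' x"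
proof (cases "L < 0")
  case False
  assume "L \<le> L'"
  thus ?thesis using False unfolding nrm_def
    using integral_mono[OF integrable_nrm integrable_nrm, of L x L' x] by (auto simp: indicator_def)
qed (use nrm_nonneg in \<open>auto simp: nrm_def\<close>)

lemma nrm_add: "nrm L (x + y) \<le> nrm L x + nrm L y"
proof (cases "L < 0")
  case False
  have "(\<integral>s. indicator {0..L} s * (exp (-s/2) * \<bar>dn (x + y) s\<bar>) \<partial>lborel) \<le>
     (\<integral>s. indicator {0..L} s * (exp (-s/2) * \<bar>dn x s\<bar>) + indicator {0..L} s * (exp (-s/2) * \<bar>dn y s\<bar>) \<partial>lborel)"
    by (intro integral_mono integrable_nrm Bochner_Integration.integrable_add)
       (auto simp: indicator_def distrib_left[symmetric])
  also have "\<dots> = (\<integral>s. indicator {0..L} s * (exp (-s/2) * \<bar>dn x s\<bar>) \<partial>lborel) + (\<integral>s. indicator {0..L} s * (exp (-s/2) * \<bar>dn y s\<bar>) \<partial>lborel)"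
    by (intro Bochner_Integration.integral_add integrable_nrm)
  finally show ?thesis using False by (simp add: nrm_def)
qed (auto simp: nrm_def)

lemma nrm_minus [simp]: "nrm L (- x) = nrm L x"
  by (simp add: nrm_def)

lemma nrm_sc [simp]: "nrm L (sc c * x) = \<bar>c\<bar> * nrm L x"
proof -
  have "(\<integral>s. indicator {0..L} s * (exp (-s/2) * \<bar>c * dn x s\<bar>) \<partial>lborel) =
      (\<integral>s. \<bar>c\<bar> * (indicator {0..L} s * (exp (-s/2) * \<bar>dn x s\<bar>)) \<partial>lborel)"
    by (rule Bochner_Integration.integral_cong) (auto simp: abs_mult)
  thus ?thesis by (simp add: nrm_def abs_mult distrib_left)
qed

lemma integral_conv:
  assumes f: "dens f" and g: "dens g"
    and fs: "\<And>s. s > L \<Longrightarrow> f s = 0" and gs: "\<And>s. s > L \<Longrightarrow> g s = 0"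
  shows "integrable lborel (conv f g)" "(\<integral>t. conv f g t \<partial>lborel) = (\<integral>s. f s \<partial>lborel) * (\<integral>s. g s \<partial>lborel)"
proof -
  note [measurable] = dens_measurable[OF f] dens_measurable[OF g]
  obtain B1 where B1: "B1 \<ge> 0" "\<And>s. s \<le> L \<Longrightarrow> \<bar>f s\<bar> \<le> B1" using dens_bound[OF f, of "L"] by blast
  obtain B2 where B2: "B2 \<ge> 0" "\<And>s. s \<le> L \<Longrightarrow> \<bar>g s\<bar> \<le> B2" using dens_bound[OF g, of "L"] by blast
  have int: "integrable (lborel \<Otimes>\<^sub>M lborel) (\<lambda>(t, s). f s * g (t - s))"
  proof (rule integrable_bounded_support2[where a = 0 and b = "2 * L" and a' = 0 and b' = L and B = "B1 * B2"])
    fix p :: "real \<times> real"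
    obtain t s where p: "p = (t, s)" by (cases p)
    show "(case p of (t, s) \<Rightarrow> f s * g (t - s)) = 0" if "p \<notin> {0..2 * L} \<times> {0..L}"
      using that dens_neg[OF f, of s] dens_neg[OF g, of "t - s"] fs[of s] gs[of "t - s"] unfolding p
      by (auto; linarith)
    have "\<bar>f s\<bar> \<le> B1" "\<bar>g (t - s)\<bar> \<le> B2" using B1 B2 fs[of s] gs[of "t - s"] by (smt (verit))+
    thus "\<bar>case p of (t, s) \<Rightarrow> f s * g (t - s)\<bar> \<le> B1 * B2"
      using B1 unfolding p by (auto simp: abs_mult intro!: mult_mono)
  next
    have "(\<lambda>(t, s). f s * g (t - s)) \<in> borel_measurable (borel \<Otimes>\<^sub>M borel)" by measurable
    thus "(\<lambda>(t, s). f s * g (t - s)) \<in> borel_measurable borel" by (simp add: borel_prod)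
  qed
  show "integrable lborel (conv f g)"
    using lborel_pair.integrable_fst'[OF int] by (simp add: conv_def[abs_def])
  have eq: "(\<integral>t. f s * g (t - s) \<partial>lborel) = f s * (\<integral>t. g t \<partial>lborel)" for s
    using lborel_integral_real_affine[of 1 "\<lambda>t. g (t - s)" s] by simp
  have "(\<integral>t. conv f g t \<partial>lborel) = (\<integral>s. (\<integral>t. f s * g (t - s) \<partial>lborel) \<partial>lborel)"
    unfolding conv_def by (rule lborel_pair.Fubini_integral[OF int, symmetric])
  thus "(\<integral>t. conv f g t \<partial>lborel) = (\<integral>s. f s \<partial>lborel) * (\<integral>s. g s \<partial>lborel)" unfolding eq by simp
qed

lemma dens_cut: "dens f \<Longrightarrow> dens (\<lambda>s. indicator {0..L} s * f s)"
proof (rule densI)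
  assume f: "dens f"
  show "(\<lambda>s. indicator {0..L} s * f s) \<in> borel_measurable borel" using dens_measurable[OF f] by measurable
  fix L' :: real
  obtain B1 where B1: "B1 \<ge> 0" "\<And>s. s \<le> L' \<Longrightarrow> \<bar>f s\<bar> \<le> B1" using dens_bound[OF f, of "L'"] by blast
  show "\<exists>B. \<forall>t. 0 \<le> t \<and> t \<le> L' \<longrightarrow> \<bar>indicator {0..L} t * f t\<bar> \<le> B"
    using B1 by (intro exI[of _ B1]) (auto simp: indicator_def)
qed auto

lemma nrm_mult: "nrm L (x * y) \<le> nrm L x * nrm L y"
proof (cases "L < 0")
  case False
  define f where "f s = indicator {0..L} s * (exp (-s/2) * \<bar>dn x s\<bar>)" for s
  define g where "g s = indicator {0..L} s * (exp (-s/2) * \<bar>dn y s\<bar>)" for s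
  have d: "dens f" "dens g" unfolding f_def g_def by (intro dens_cut dens_weight dens_dn)+
  have z: "f s = 0" "g s = 0" if "s > L" for s using that by (auto simp: f_def g_def)
  have "(\<integral>t. indicator {0..L} t * (exp (-t/2) * \<bar>dn (x * y) t\<bar>) \<partial>lborel) \<le>
        (\<integral>t. \<bar>dc x\<bar> * g t + \<bar>dc y\<bar> * f t + conv f g t \<partial>lborel)"
  proof (rule integral_mono[OF integrable_nrm])
    show "integrable lborel (\<lambda>t. \<bar>dc x\<bar> * g t + \<bar>dc y\<bar> * f t + conv f g t)"
      unfolding f_def g_def
      by (intro Bochner_Integration.integrable_add integrable_mult_right integrable_nrm
            integral_conv(1)[of _ _ L] dens_cut dens_weight dens_dn) auto
    fix t
    show "indicator {0..L} t * (exp (-t/2) * \<bar>dn (x * y) t\<bar>) \<le> \<bar>dc x\<bar> * g t + \<bar>dc y\<bar> * f t + conv f g t"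
    proof (cases "t \<in> {0..L}")
      case True
      have "exp (-t/2) * \<bar>conv (dn x) (dn y) t\<bar> \<le> exp (-t/2) * conv (\<lambda>s. \<bar>dn x s\<bar>) (\<lambda>s. \<bar>dn y s\<bar>) t"
        by (intro mult_left_mono conv_abs_le) auto
      also have "\<dots> = (\<integral>s. exp (-t/2) * (\<bar>dn x s\<bar> * \<bar>dn y (t - s)\<bar>) \<partial>lborel)"
        by (simp add: conv_def)
      also have "\<dots> = conv f g t"
        unfolding conv_def
      proof (rule Bochner_Integration.integral_cong)
        fix s
        show "exp (-t/2) * (\<bar>dn x s\<bar> * \<bar>dn y (t - s)\<bar>) = f s * g (t - s)"
        proof (cases "0 \<le> s \<and> s \<le> t")
          case s: True
          have "exp (-t/2) = exp (-s/2) * exp (-(t-s)/2)" by (simp add: mult_exp_exp[symmetric] field_simps flip: exp_add)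
          thus ?thesis using s True by (simp add: f_def g_def)
        qed (auto simp: f_def g_def dn_neg)
      qed auto
      finally have *: "exp (-t/2) * \<bar>conv (dn x) (dn y) t\<bar> \<le> conv f g t" .
      have "exp (-t/2) * \<bar>dn (x * y) t\<bar> \<le> exp (-t/2) * (\<bar>dc x\<bar> * \<bar>dn y t\<bar> + \<bar>dc y\<bar> * \<bar>dn x t\<bar> + \<bar>conv (dn x) (dn y) t\<bar>)"
        unfolding dn_times by (intro mult_left_mono) (auto simp: abs_mult[symmetric])
      also have "\<dots> \<le> \<bar>dc x\<bar> * g t + \<bar>dc y\<bar> * f t + conv f g t"
        using * True by (simp add: f_def g_def algebra_simps)
      finally show ?thesis using True by simp
    next
      case False
      have "conv f g t \<ge> 0" unfolding conv_def
        by (intro Bochner_Integration.integral_nonneg) (auto simp: f_def g_def)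
      thus ?thesis using False by (auto simp: f_def g_def indicator_def)
    qed
  qed
  also have "\<dots> = \<bar>dc x\<bar> * (\<integral>t. g t \<partial>lborel) + \<bar>dc y\<bar> * (\<integral>t. f t \<partial>lborel) + (\<integral>t. f t \<partial>lborel) * (\<integral>t. g t \<partial>lborel)"
  proof -
    have i: "integrable lborel f" "integrable lborel g" unfolding f_def g_def by (intro integrable_nrm)+
    show ?thesis using i integral_conv[OF d z] by simp
  qed
  finally show ?thesis using False unfolding nrm_def f_def g_def
    by (simp add: algebra_simps abs_mult)
qed (auto simp: nrm_def)

section \<open>Distribution functions of measures\<close>

definition hh :: alg where "hh = mk 0 (indicator {0..})"

lemma dens_indicator: "dens (indicator {0..})"
  by (rule densI) (auto simp: indicator_def intro!: exI[of _ 1])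

definition cum :: "alg \<Rightarrow> real \<Rightarrow> real" where "cum x = dn (x * hh)"

lemma cum_neg: "t < 0 \<Longrightarrow> cum x t = 0"
  by (simp add: cum_def dn_neg)

lemma cum_measurable [measurable]: "cum x \<in> borel_measurable borel"
  by (simp add: cum_def)

lemma cum_eq: "t \<ge> 0 \<Longrightarrow> cum x t = dc x + (\<integral>s. indicator {0..t} s * dn x s \<partial>lborel)"
proof -
  assume t: "t \<ge> 0"
  have "conv (dn x) (indicator {0..}) t = (\<integral>s. indicator {0..t} s * dn x s \<partial>lborel)"
    unfolding conv_def by (rule Bochner_Integration.integral_cong) (auto simp: indicator_def dn_neg)
  thus ?thesis using t by (simp add: cum_def dn_times hh_def dens_indicator)
qed

lemma cum_mult: "dc m = 0 \<Longrightarrow> cum (m * x) t = conv (dn m) (cum x) t"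
proof -
  assume "dc m = 0"
  moreover have "dc (x * hh) = 0" by (simp add: hh_def)
  moreover have "cum (m * x) t = dn (m * (x * hh)) t" by (simp add: cum_def mult.assoc)
  ultimately show ?thesis by (simp add: dn_times cum_def)
qed

lemma cum_add: "cum (x + y) t = cum x t + cum y t"
  by (simp add: cum_def distrib_right)

lemma cum_sc: "cum (sc c * x) t = c * cum x t"
  by (simp add: cum_def mult.assoc)

text \<open>On (s, t] the weight in \<open>nrm\<close> is at least exp (-t/2), so undoing it costs
  the factor exp (t/2). For s < 0 \<le> t the increment includes the mass at 0.\<close>

lemma cum_diff_le:
  assumes "s \<le> t"
  shows "\<bar>cum x t - cum x s\<bar> \<le> exp (t/2) * (nrm t x - nrm s x)"
proof (cases "t < 0")
  case True
  thus ?thesis using assms by (simp add: cum_neg nrm_def)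
next
  case t: False
  let ?I = "\<lambda>a b. (\<integral>u. indicator {a<..b} u * (exp (-u/2) * \<bar>dn x u\<bar>) \<partial>lborel)"
  have b: "\<bar>indicator {0..t} u * dn x u\<bar> \<le> exp (t/2) * (indicator {0..t} u * (exp (-u/2) * \<bar>dn x u\<bar>))" for u
  proof (cases "u \<in> {0..t}")
    case True
    have "1 \<le> exp (t/2) * exp (-u/2)" using True by (simp add: flip: exp_add)
    hence "1 * \<bar>dn x u\<bar> \<le> exp (t/2) * exp (-u/2) * \<bar>dn x u\<bar>" by (intro mult_right_mono) auto
    thus ?thesis using True by (simp add: mult.assoc)
  qed auto
  show ?thesis
  proof (cases "s < 0")
    case True
    have "\<bar>cum x t\<bar> \<le> \<bar>dc x\<bar> + (\<integral>u. \<bar>indicator {0..t} u * dn x u\<bar> \<partial>lborel)"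
      using t integral_norm_bound[of lborel "\<lambda>u. indicator {0..t} u * dn x u"]
        abs_triangle_ineq[of "dc x" "\<integral>u. indicator {0..t} u * dn x u \<partial>lborel"]
      unfolding real_norm_def cum_eq[OF leI[OF t]] by linarith
    also have "\<dots> \<le> \<bar>dc x\<bar> + (\<integral>u. exp (t/2) * (indicator {0..t} u * (exp (-u/2) * \<bar>dn x u\<bar>)) \<partial>lborel)"
      using b integrable_dens[OF dens_dn[of x], of t]
      by (intro add_left_mono integral_mono integrable_mult_right integrable_nrm integrable_abs) auto
    also have "\<dots> \<le> exp (t/2) * \<bar>dc x\<bar> + exp (t/2) * (\<integral>u. indicator {0..t} u * (exp (-u/2) * \<bar>dn x u\<bar>) \<partial>lborel)"
      using t mult_right_mono[of 1 "exp (t/2)" "\<bar>dc x\<bar>"] by simp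
    finally show ?thesis using True t by (simp add: cum_neg nrm_def distrib_left)
  next
    case False
    let ?i = "\<lambda>u. indicator {0..t} u - indicator {0..s} u :: real"
    have "cum x t - cum x s = (\<integral>u. indicator {0..t} u * dn x u - indicator {0..s} u * dn x u \<partial>lborel)"
      using t False by (subst Bochner_Integration.integral_diff) (auto simp: cum_eq integrable_dens)
    hence "\<bar>cum x t - cum x s\<bar> \<le> (\<integral>u. \<bar>indicator {0..t} u * dn x u - indicator {0..s} u * dn x u\<bar> \<partial>lborel)"
      using integral_norm_bound[of lborel "\<lambda>u. indicator {0..t} u * dn x u - indicator {0..s} u * dn x u"] by simp
    also have "\<dots> \<le> (\<integral>u. exp (t/2) * (indicator {0..t} u * (exp (-u/2) * \<bar>dn x u\<bar>) - indicator {0..s} u * (exp (-u/2) * \<bar>dn x u\<bar>)) \<partial>lborel)"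
    proof (intro integral_mono integrable_abs Bochner_Integration.integrable_diff integrable_mult_right integrable_nrm integrable_dens dens_dn)
      fix u show "\<bar>indicator {0..t} u * dn x u - indicator {0..s} u * dn x u\<bar> \<le> exp (t/2) * (indicator {0..t} u * (exp (-u/2) * \<bar>dn x u\<bar>) - indicator {0..s} u * (exp (-u/2) * \<bar>dn x u\<bar>))"
        using b[of u] assms by (cases "u \<in> {0..s}") (auto simp: indicator_def)
    qed
    also have "\<dots> = exp (t/2) * (nrm t x - nrm s x)"
      using t False unfolding nrm_def integral_mult_right_zero
      by (subst Bochner_Integration.integral_diff[OF integrable_nrm integrable_nrm]) simp
    finally show ?thesis .
  qed
qed

section \<open>Means of truncated Euler products\<close>

text \<open>The first two units of mass are skipped, so that every cell starts at 1 or later. Hence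
  each additional factor of a product adds at least 1 to its logarithm, and all the means
  \<open>mm i\<close> have norm at most exp (-1/2).\<close>

definition T :: "nat \<Rightarrow> real" where "T i = tau (i + 2)"

lemma T_ge_1: "T i \<ge> 1" by (simp add: T_def tau_ge_1)
lemma T_le_iff: "T i \<le> T j \<longleftrightarrow> i \<le> j" by (simp add: T_def tau_le_iff)
lemma T_less_iff: "T i < T j \<longleftrightarrow> i < j" by (simp add: T_def tau_less_iff)
lemma T_Suc_le: "T (Suc i) \<le> T i + 2" using tau_diff_le[of "i + 2"] by (simp add: T_def)
lemma Phi_T: "Phi (T i) = real i + 2" by (simp add: T_def)
lemma T_unbounded: "\<exists>n. T n > L"
proof -
  obtain n where "tau n > L" using tau_unbounded by blast
  moreover have "tau n \<le> T n" by (simp add: T_def tau_le_iff)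
  ultimately show ?thesis by (intro exI[of _ n]) linarith
qed

lemma dens_phi_cell: "a \<ge> 0 \<Longrightarrow> dens (\<lambda>s. indicator {a..<b} s * phi s)"
proof (rule densI)
  assume a: "a \<ge> 0"
  fix L :: real
  show "\<exists>B. \<forall>t. 0 \<le> t \<and> t \<le> L \<longrightarrow> \<bar>indicator {a..<b} t * phi t\<bar> \<le> B"
  proof (intro exI allI impI)
    fix t assume "0 \<le> t \<and> t \<le> L"
    thus "\<bar>indicator {a..<b} t * phi t\<bar> \<le> phi L"
      using phi_mono[of t L] phi_ge_half[of t] phi_ge_half[of L] by (auto simp: indicator_def)
  qed
qed auto

definition mm :: "nat \<Rightarrow> alg" where "mm i = mk 0 (\<lambda>s. indicator {T i..<T (Suc i)} s * phi s)"

lemma dc_mm [simp]: "dc (mm i) = 0" by (simp add: mm_def)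
lemma dn_mm: "dn (mm i) = (\<lambda>s. indicator {T i..<T (Suc i)} s * phi s)"
  unfolding mm_def by (rule dn_mk) (use T_ge_1[of i] in \<open>auto intro: dens_phi_cell\<close>)

lemma has_bochner_integral_mm: "has_bochner_integral lborel (dn (mm i)) 1"
proof -
  have "has_bochner_integral lborel (\<lambda>s. indicator {T i..T (Suc i)} s *\<^sub>R phi s) (Phi (T (Suc i)) - Phi (T i))"
  proof (rule has_bochner_integral_FTC_Icc)
    show "T i \<le> T (Suc i)" by (simp add: T_le_iff)
    show "(Phi has_vector_derivative phi x) (at x within {T i..T (Suc i)})" for x
      using Phi_deriv[of x] has_field_derivative_at_within has_real_derivative_iff_has_vector_derivative by blast
  qed (rule continuous_phi)
  also have "?this \<longleftrightarrow> has_bochner_integral lborel (dn (mm i)) (Phi (T (Suc i)) - Phi (T i))"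
  proof (rule has_bochner_integral_cong_AE)
    have "AE s in lborel. s \<noteq> T (Suc i)" by (rule AE_lborel_singleton)
    thus "AE s in lborel. indicator {T i..T (Suc i)} s *\<^sub>R phi s = dn (mm i) s"
      by eventually_elim (auto simp: dn_mm indicator_def)
  qed (auto simp: dn_mm)
  finally show ?thesis by (simp add: Phi_T)
qed

lemma dn_mm_nonneg: "dn (mm i) s \<ge> 0"
  using phi_ge_half[of s] T_ge_1[of i] by (auto simp: dn_mm indicator_def)

text \<open>Unit mass at or beyond \<open>T i\<close> has weight at most exp (- T i / 2). As
  \<open>T i\<close> is at least 1, powers of \<open>mm i\<close> decay geometrically in
  norm.\<close>

lemma nrm_mm: "nrm L (mm i) \<le> exp (- T i / 2)"
proof (cases "L < 0")
  case False
  have "(\<integral>s. indicator {0..L} s * (exp (-s/2) * \<bar>dn (mm i) s\<bar>) \<partial>lborel) \<le> (\<integral>s. exp (- T i / 2) * dn (mm i) s \<partial>lborel)"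
  proof (intro integral_mono integrable_nrm integrable_mult_right)
    show "integrable lborel (dn (mm i))" using has_bochner_integral_mm by (auto simp: has_bochner_integral_iff)
    show "indicator {0..L} s * (exp (-s/2) * \<bar>dn (mm i) s\<bar>) \<le> exp (- T i / 2) * dn (mm i) s" for s
      using dn_mm_nonneg[of i s] by (auto simp: indicator_def dn_mm intro!: mult_right_mono)
  qed
  also have "\<dots> = exp (- T i / 2)" using has_bochner_integral_mm[of i] by (simp add: has_bochner_integral_iff)
  finally show ?thesis using False by (simp add: nrm_def)
qed (simp add: nrm_def)

text \<open>The Laplace transforms are (s - 1) / s for \<open>tht 1\<close> and s / (s - 1) for
  \<open>tht (-1)\<close>. The first compensates the counting function of squarefree integers, the
  second the Moebius sum.\<close>

definition tht :: "real \<Rightarrow> alg" where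
  "tht e = mk 1 (\<lambda>t. indicator {0..} t * (if e = 1 then -1 else exp t))"
definition Eell :: alg where "Eell = mk 0 (\<lambda>t. indicator {0..} t * (exp t - 1))"

lemma dens_exp: "dens (\<lambda>t. indicator {0..} t * (a + b * exp t))"
proof (rule densI)
  fix L :: real
  show "\<exists>B. \<forall>t. 0 \<le> t \<and> t \<le> L \<longrightarrow> \<bar>indicator {0..} t * (a + b * exp t)\<bar> \<le> B"
  proof (intro exI allI impI)
    fix t assume "0 \<le> t \<and> t \<le> L"
    hence "\<bar>b * exp t\<bar> \<le> \<bar>b\<bar> * exp L" by (simp add: abs_mult mult_left_mono)
    thus "\<bar>indicator {0..} t * (a + b * exp t)\<bar> \<le> \<bar>a\<bar> + \<bar>b\<bar> * exp L"
      by (auto simp: indicator_def)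
  qed
qed auto

lemma dc_tht [simp]: "dc (tht e) = 1" by (simp add: tht_def)
lemma dn_tht: "dn (tht e) = (\<lambda>t. indicator {0..} t * (if e = 1 then -1 else exp t))"
  unfolding tht_def using dens_exp[of "-1" 0] dens_exp[of 0 1] by (subst dn_mk) (cases "e = 1"; simp)+
lemma dc_Eell [simp]: "dc Eell = 0" by (simp add: Eell_def)
lemma dn_Eell: "dn Eell = (\<lambda>t. indicator {0..} t * (exp t - 1))"
  unfolding Eell_def using dens_exp[of "-1" 1] by (subst dn_mk) (auto simp: add.commute)

lemma integral_Icc_FTC:
  fixes F f :: "real \<Rightarrow> real"
  assumes "a \<le> b" "\<And>x. (F has_real_derivative f x) (at x)" "continuous_on {a..b} f"
  shows "(\<integral>s. indicator {a..b} s * f s \<partial>lborel) = F b - F a"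
proof -
  have "has_bochner_integral lborel (\<lambda>s. indicator {a..b} s *\<^sub>R f s) (F b - F a)"
    by (rule has_bochner_integral_FTC_Icc)
       (use assms has_field_derivative_at_within has_real_derivative_iff_has_vector_derivative in blast)+
  thus ?thesis by (simp add: has_bochner_integral_iff)
qed

lemma cum_tht: "t \<ge> 0 \<Longrightarrow> cum (tht e) t = (if e = 1 then 1 - t else exp t)"
proof -
  assume t: "t \<ge> 0"
  show ?thesis
  proof (cases "e = 1")
    case True
    have "(\<integral>s. indicator {0..t} s * dn (tht e) s \<partial>lborel) = (\<integral>s. indicator {0..t} s * (-1) \<partial>lborel)"
      by (rule Bochner_Integration.integral_cong) (auto simp: dn_tht True indicator_def)
    also have "\<dots> = - t - (- 0)"
      by (rule integral_Icc_FTC) (use t in \<open>auto intro!: derivative_eq_intros\<close>)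
    finally show ?thesis using t True by (simp add: cum_eq)
  next
    case False
    have "(\<integral>s. indicator {0..t} s * dn (tht e) s \<partial>lborel) = (\<integral>s. indicator {0..t} s * exp s \<partial>lborel)"
      by (rule Bochner_Integration.integral_cong) (auto simp: dn_tht False indicator_def)
    also have "\<dots> = exp t - exp 0"
      by (rule integral_Icc_FTC) (use t in \<open>auto intro!: derivative_eq_intros continuous_intros\<close>)
    finally show ?thesis using t False by (simp add: cum_eq)
  qed
qed

text \<open>The measures \<open>tht 1\<close> and \<open>tht (-1)\<close> are the convolution exponentials of minus and plus
  the measure with density \<open>ell\<close>; as in Chebyshev's identity this is visible after applying \<open>DD\<close>.\<close>
lemma DD_tht: assumes "e = 1 \<or> e = -1" shows "DD (tht e) = - (sc e * Eell * tht e)"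
proof (rule alg_eqI)
  fix t :: real
  show "dn (DD (tht e)) t = dn (- (sc e * Eell * tht e)) t"
  proof (cases "t < 0")
    case True thus ?thesis by (simp add: dn_neg)
  next
    case t: False
    have c: "conv (dn Eell) (dn (tht e)) t = (if e = 1 then - (exp t - t - 1) else t * exp t - exp t + 1)"
    proof (cases "e = 1")
      case True
      have "conv (dn Eell) (dn (tht e)) t = (\<integral>s. indicator {0..t} s * (1 - exp s) \<partial>lborel)"
        unfolding conv_def by (rule Bochner_Integration.integral_cong) (auto simp: dn_tht dn_Eell True indicator_def)
      also have "\<dots> = (t - exp t) - (0 - exp 0)"
        by (rule integral_Icc_FTC) (use t in \<open>auto intro!: derivative_eq_intros continuous_intros\<close>)
      finally show ?thesis using True by simp
    next
      case False
      have "conv (dn Eell) (dn (tht e)) t = (\<integral>s. indicator {0..t} s * (exp t - exp (t - s)) \<partial>lborel)"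
        unfolding conv_def by (rule Bochner_Integration.integral_cong)
          (auto simp: dn_tht dn_Eell False indicator_def algebra_simps simp flip: exp_add)
      also have "\<dots> = (t * exp t + exp (t - t)) - (0 * exp t + exp (t - 0))"
        by (rule integral_Icc_FTC) (use t in \<open>auto intro!: derivative_eq_intros continuous_intros\<close>)
      finally show ?thesis using False by simp
    qed
    have "dn (sc e * Eell * tht e) t = e * (dn Eell t + conv (dn Eell) (dn (tht e)) t)"
      by (simp add: mult.assoc) (simp add: dn_times)
    thus ?thesis using t assms unfolding c by (auto simp: dn_tht dn_Eell algebra_simps)
  qed
qed simp

section \<open>Supports and sizes of convolution powers\<close>

definition supp0 :: "real \<Rightarrow> alg \<Rightarrow> bool" where
  "supp0 a x \<longleftrightarrow> dc x = 0 \<and> (\<forall>t<a. dn x t = 0)"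
definition supp1 :: "real \<Rightarrow> alg \<Rightarrow> bool" where
  "supp1 b x \<longleftrightarrow> dc x = 0 \<and> (\<forall>t\<ge>b. dn x t = 0)"

lemma conv_eq_0: "(\<And>s. f s = 0 \<or> g (t - s) = 0) \<Longrightarrow> conv f g t = 0"
proof -
  assume "\<And>s. f s = 0 \<or> g (t - s) = 0"
  hence "(\<lambda>s. f s * g (t - s)) = (\<lambda>_. 0)" by auto
  thus ?thesis by (simp add: conv_def)
qed

lemma supp0_mult: "supp0 a x \<Longrightarrow> supp0 b y \<Longrightarrow> supp0 (a + b) (x * y)"
  unfolding supp0_def
proof (intro conjI allI impI)
  fix t assume a: "dc x = 0 \<and> (\<forall>t<a. dn x t = 0)" "dc y = 0 \<and> (\<forall>t<b. dn y t = 0)" "t < a + b"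
  have "dn x s = 0 \<or> dn y (t - s) = 0" for s using a by (cases "s < a") auto
  thus "dn (x * y) t = 0" using a conv_eq_0 by (simp add: dn_times)
qed simp

lemma supp1_mult: "supp1 a x \<Longrightarrow> supp1 b y \<Longrightarrow> supp1 (a + b) (x * y)"
  unfolding supp1_def
proof (intro conjI allI impI)
  fix t assume a: "dc x = 0 \<and> (\<forall>t\<ge>a. dn x t = 0)" "dc y = 0 \<and> (\<forall>t\<ge>b. dn y t = 0)" "t \<ge> a + b"
  have "dn x s = 0 \<or> dn y (t - s) = 0" for s using a by (cases "s \<ge> a") auto
  thus "dn (x * y) t = 0" using a conv_eq_0 by (simp add: dn_times)
qed simp

lemma supp0_mult_right: "supp0 a x \<Longrightarrow> supp0 a (x * y)"
  unfolding supp0_def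
proof (intro conjI allI impI)
  fix t assume a: "dc x = 0 \<and> (\<forall>t<a. dn x t = 0)" "t < a"
  have "dn x s = 0 \<or> dn y (t - s) = 0" for s using a by (cases "s < a") (auto simp: dn_neg)
  thus "dn (x * y) t = 0" using a conv_eq_0 by (simp add: dn_times)
qed simp

lemma supp0_add: "supp0 a x \<Longrightarrow> supp0 a y \<Longrightarrow> supp0 a (x + y)"
  and supp0_weaken: "supp0 a x \<Longrightarrow> b \<le> a \<Longrightarrow> supp0 b x"
  and supp0_0: "supp0 a 0"
  by (auto simp: supp0_def)

lemma supp0_sum: "(\<And>x. x \<in> A \<Longrightarrow> supp0 a (f x)) \<Longrightarrow> supp0 a (sum f A)"
  by (induction A rule: infinite_finite_induct) (auto intro: supp0_add supp0_0)

lemma supp_mm: "supp0 (T i) (mm i)" "supp1 (T (Suc i)) (mm i)"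
  by (auto simp: supp0_def supp1_def dn_mm)
lemma supp_DD: "supp0 a x \<Longrightarrow> supp0 a (DD x)" "supp1 a x \<Longrightarrow> supp1 a (DD x)"
  by (auto simp: supp0_def supp1_def)

lemma supp_mm_power:
  "supp0 (real (Suc k) * T i) (DD (mm i) * mm i ^ k)" "supp1 (real (Suc k) * T (Suc i)) (DD (mm i) * mm i ^ k)"
proof (induction k)
  case (Suc k)
  have eq: "DD (mm i) * mm i ^ Suc k = DD (mm i) * mm i ^ k * mm i" by (simp add: mult_ac)
  show "supp0 (real (Suc (Suc k)) * T i) (DD (mm i) * mm i ^ Suc k)"
    using supp0_mult[OF Suc(1) supp_mm(1)[of i]] unfolding eq by (simp add: algebra_simps)
  show "supp1 (real (Suc (Suc k)) * T (Suc i)) (DD (mm i) * mm i ^ Suc k)"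
    using supp1_mult[OF Suc(2) supp_mm(2)[of i]] unfolding eq by (simp add: algebra_simps)
qed (auto intro: supp_DD supp_mm)

lemma conv_bound_weighted:
  assumes f: "dens f" and g: "dens g" and B: "\<And>s. 0 \<le> s \<Longrightarrow> s \<le> t \<Longrightarrow> exp (-s/2) * \<bar>g s\<bar> \<le> B" "B \<ge> 0"
  shows "exp (-t/2) * \<bar>conv f g t\<bar> \<le> B * (\<integral>s. indicator {0..t} s * (exp (-s/2) * \<bar>f s\<bar>) \<partial>lborel)"
proof -
  let ?f = "\<lambda>s. exp (-s/2) * \<bar>f s\<bar>" and ?g = "\<lambda>s. exp (-s/2) * \<bar>g s\<bar>"
  have "exp (-t/2) * \<bar>conv f g t\<bar> \<le> exp (-t/2) * conv (\<lambda>s. \<bar>f s\<bar>) (\<lambda>s. \<bar>g s\<bar>) t"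
    by (intro mult_left_mono conv_abs_le f g) auto
  also have "\<dots> = conv ?f ?g t"
    unfolding conv_def integral_mult_right_zero[symmetric]
    by (rule Bochner_Integration.integral_cong) (auto simp: field_simps simp flip: exp_add)
  also have "\<dots> \<le> \<bar>conv ?f ?g t\<bar>" by simp
  also have "\<dots> \<le> B * (\<integral>s. indicator {0..t} s * \<bar>?f s\<bar> \<partial>lborel)"
    by (rule conv_bound[OF dens_weight[OF f] dens_weight[OF g]]) (use B in auto)
  finally show ?thesis by simp
qed

lemma nrm_power_le: "nrm L x \<le> c \<Longrightarrow> L \<ge> 0 \<Longrightarrow> nrm L (x ^ k) \<le> c ^ k"
proof (induction k)
  case 0 thus ?case by (simp add: nrm_def)
next
  case (Suc k)
  have "c \<ge> 0" using Suc(2) nrm_nonneg[of L x] by linarith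
  have "nrm L (x ^ Suc k) \<le> nrm L x * nrm L (x ^ k)" by (simp add: nrm_mult)
  also have "\<dots> \<le> c * c ^ k" using Suc \<open>c \<ge> 0\<close> nrm_nonneg by (intro mult_mono) auto
  finally show ?case by simp
qed

text \<open>Since s * phi s \<le> exp s, the weighted density of \<open>DD (mm i)\<close> is at most
  exp (T (Suc i) / 2). One factor \<open>mm i\<close> has norm at most exp (- T i / 2) and cancels
  this up to a constant, because cells have length at most 2; the other k - 1 factors give the
  geometric decay.\<close>

lemma second_order_term:
  assumes t: "t \<ge> 0" and k: "k \<ge> 1"
  shows "\<bar>dn (DD (mm i) * mm i ^ k) t\<bar> \<le>
     (if real (Suc k) * T i \<le> t \<and> t < real (Suc k) * T (Suc i) then exp 1 * exp (-1/2) ^ (k - 1) * exp (t/2) else 0)"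
proof (cases "real (Suc k) * T i \<le> t \<and> t < real (Suc k) * T (Suc i)")
  case False
  have "dn (DD (mm i) * mm i ^ k) t = 0"
  proof (cases "real (Suc k) * T i \<le> t")
    case True
    hence "real (Suc k) * T (Suc i) \<le> t" using False by simp
    thus ?thesis using supp_mm_power(2)[of k i] unfolding supp1_def by blast
  next
    case False
    hence "t < real (Suc k) * T i" by simp
    thus ?thesis using supp_mm_power(1)[of k i] unfolding supp0_def by blast
  qed
  thus ?thesis using False by (simp only: if_False abs_zero)
next
  case True
  have dk: "dc (mm i ^ k) = 0" using k by simp
  have eq: "dn (DD (mm i) * mm i ^ k) t = conv (dn (mm i ^ k)) (dn (DD (mm i))) t"
    using k by (subst mult.commute) (simp add: dn_times)
  have "exp (-t/2) * \<bar>conv (dn (mm i ^ k)) (dn (DD (mm i))) t\<bar> \<le> exp (T (Suc i) / 2) *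
     (\<integral>s. indicator {0..t} s * (exp (-s/2) * \<bar>dn (mm i ^ k) s\<bar>) \<partial>lborel)"
  proof (rule conv_bound_weighted)
    fix s :: real assume s: "0 \<le> s" "s \<le> t"
    show "exp (-s/2) * \<bar>dn (DD (mm i)) s\<bar> \<le> exp (T (Suc i) / 2)"
    proof (cases "s \<in> {T i..<T (Suc i)}")
      case True
      have "exp (-s/2) * \<bar>dn (DD (mm i)) s\<bar> = exp (-s/2) * (s * phi s)"
        using True s phi_ge_half[of s] by (simp add: dn_mm)
      also have "\<dots> \<le> exp (-s/2) * exp s" using t_phi_le[OF s(1)] by (intro mult_left_mono) auto
      also have "\<dots> = exp (s/2)" by (simp flip: exp_add)
      also have "\<dots> \<le> exp (T (Suc i) / 2)" using True by simp
      finally show ?thesis .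
    qed (simp add: dn_mm)
  qed auto
  also have "(\<integral>s. indicator {0..t} s * (exp (-s/2) * \<bar>dn (mm i ^ k) s\<bar>) \<partial>lborel) = nrm t (mm i ^ k)"
    using t dk by (simp add: nrm_def)
  also have "exp (T (Suc i) / 2) * nrm t (mm i ^ k) \<le> exp (1 + T i / 2) * exp (- T i / 2) ^ k"
    using T_Suc_le[of i] t by (intro mult_mono nrm_power_le nrm_mm nrm_nonneg) auto
  also have "\<dots> = exp 1 * exp (- T i / 2) ^ (k - 1)"
  proof -
    obtain k' where k': "k = Suc k'" using k by (cases k) auto
    have "exp (1 + T i / 2) * exp (- T i / 2) = exp 1" by (simp flip: exp_add)
    thus ?thesis by (simp add: k' flip: mult.assoc)
  qed
  also have "\<dots> \<le> exp 1 * exp (-1/2) ^ (k - 1)"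
    using T_ge_1[of i] by (intro mult_left_mono power_mono) auto
  finally have "exp (-t/2) * \<bar>dn (DD (mm i) * mm i ^ k) t\<bar> \<le> exp 1 * exp (-1/2) ^ (k - 1)" unfolding eq .
  hence "exp (t/2) * (exp (-t/2) * \<bar>dn (DD (mm i) * mm i ^ k) t\<bar>) \<le> exp (t/2) * (exp 1 * exp (-1/2) ^ (k - 1))"
    by (intro mult_left_mono) auto
  also have "exp (t/2) * (exp (-t/2) * \<bar>dn (DD (mm i) * mm i ^ k) t\<bar>) = \<bar>dn (DD (mm i) * mm i ^ k) t\<bar>"
    by (simp flip: exp_add mult.assoc)
  finally show ?thesis using True by (simp add: mult_ac)
qed

lemma sum_disjoint_le:
  fixes c :: real
  assumes "finite A" "c \<ge> 0" "\<And>i j. i \<in> A \<Longrightarrow> j \<in> A \<Longrightarrow> P i \<Longrightarrow> P j \<Longrightarrow> i = j"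
  shows "(\<Sum>i\<in>A. if P i then c else 0) \<le> c"
proof -
  have "(\<Sum>i\<in>A. if P i then c else 0) = (\<Sum>i\<in>{i\<in>A. P i}. c)"
    by (rule sum.inter_filter[symmetric, OF assms(1)])
  also have "\<dots> = real (card {i\<in>A. P i}) * c" by simp
  also have "card {i\<in>A. P i} \<le> 1" by (rule card_le_Suc0_iff_eq[THEN iffD2, simplified One_nat_def[symmetric]]) (use assms in auto)
  hence "real (card {i\<in>A. P i}) * c \<le> 1 * c" using assms by (intro mult_right_mono) auto
  finally show ?thesis by simp
qed

lemma T_cell_unique: "T i \<le> s \<Longrightarrow> s < T (Suc i) \<Longrightarrow> T j \<le> s \<Longrightarrow> s < T (Suc j) \<Longrightarrow> i = j"
  using T_less_iff[of i "Suc j"] T_less_iff[of j "Suc i"] by linarith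

lemma T_cell_exists: "T 0 \<le> s \<Longrightarrow> s < T n \<Longrightarrow> \<exists>i<n. T i \<le> s \<and> s < T (Suc i)"
proof (induction n)
  case (Suc n)
  thus ?case by (cases "s < T n") (auto simp: not_less intro: less_SucI)
qed auto

lemma sum_dn_mm: "t < T n \<Longrightarrow> (\<Sum>i<n. dn (mm i) t) = (if T 0 \<le> t then phi t else 0)"
proof (cases "T 0 \<le> t")
  case True
  assume t: "t < T n"
  obtain i where i: "i < n" "T i \<le> t" "t < T (Suc i)" using T_cell_exists[OF True t] by blast
  have "dn (mm j) t = (if j = i then phi t else 0)" for j
  proof (cases "j = i")
    case True thus ?thesis using i by (simp add: dn_mm)
  next
    case False
    hence "t \<notin> {T j..<T (Suc j)}" using T_cell_unique[of j t i] i by auto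
    thus ?thesis using False by (simp add: dn_mm)
  qed
  thus ?thesis using i True by simp
next
  case False
  have "dn (mm i) t = 0" for i
  proof -
    have "t < T i" using False T_le_iff[of 0 i] by linarith
    thus ?thesis by (simp add: dn_mm)
  qed
  thus ?thesis using False by simp
qed

text \<open>Logarithmic derivative of the compensated mean product \<open>BB\<close>: each 1 / (1 +
  e * mm j) is expanded into K terms of the geometric series, and \<open>Eell\<close> is the
  contribution of \<open>tht e\<close>.\<close>

definition FF :: "real \<Rightarrow> nat \<Rightarrow> nat \<Rightarrow> alg" where
  "FF e n K = (\<Sum>j<n. sc e * DD (mm j) * (\<Sum>k<K. (- (sc e * mm j)) ^ k)) - sc e * Eell"

text \<open>The terms with k = 0 combine to t * phi t against exp t - 1, which leaves O(exp (t/2))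
  by \<open>ell_minus_phi\<close>. For each k \<ge> 1 the supports belonging to different cells are
  disjoint, so at most one cell contributes at a given t, and the sum over k is geometric. The
  constant is thus independent of n and K.\<close>

lemma FF_bound: "\<exists>C>0. \<forall>e n K t. (e = 1 \<or> e = -1) \<longrightarrow> K > 0 \<longrightarrow> 0 \<le> t \<longrightarrow> t < T n \<longrightarrow> \<bar>dn (FF e n K) t\<bar> \<le> C * exp (t/2)"
proof -
  define C where "C = exp (T 0) + 2 + exp 1 * (1 / (1 - exp (-1/2)))"
  have "C > 0" unfolding C_def by (intro add_pos_pos) auto
  moreover have "\<bar>dn (FF e n K) t\<bar> \<le> C * exp (t/2)" if e: "e = 1 \<or> e = -1" and K: "K > 0" and t: "0 \<le> t" "t < T n" for e n K t
  proof -
    have pw: "(- (sc e * mm j)) ^ k = sc ((-e)^k) * mm j ^ k" for j k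
    proof (induction k)
      case (Suc k)
      have "- (sc e * mm j) = sc (-e) * mm j" by (rule alg_eqI) auto
      moreover have "sc (-e) * (sc ((-e)^k) * x) = sc ((-e) ^ Suc k) * x" for x by (rule alg_eqI) auto
      ultimately show ?case using Suc by (simp add: mult_ac)
    qed simp
    have "sc (e * (-e)^k) = sc e * sc ((-e)^k)" for k by (rule alg_eqI) auto
    hence eq: "sc e * DD (mm j) * (- (sc e * mm j)) ^ k = sc (e * (-e)^k) * (DD (mm j) * mm j ^ k)" for j k
      unfolding pw by (simp only: mult_ac)
    have "dn (FF e n K) t = (\<Sum>j<n. \<Sum>k<K. e * (-e)^k * dn (DD (mm j) * mm j ^ k) t) - e * (exp t - 1)"
      unfolding FF_def sum_distrib_left eq using t by (simp add: dn_Eell)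
    also have "(\<Sum>j<n. \<Sum>k<K. e * (-e)^k * dn (DD (mm j) * mm j ^ k) t) =
       (\<Sum>k<K. \<Sum>j<n. e * (-e)^k * dn (DD (mm j) * mm j ^ k) t)" by (rule sum.swap)
    also have "\<dots> = (\<Sum>j<n. e * (t * dn (mm j) t)) + (\<Sum>k\<in>{1..<K}. \<Sum>j<n. e * (-e)^k * dn (DD (mm j) * mm j ^ k) t)"
    proof -
      have "{..<K} = insert 0 {1..<K}" using K by auto
      thus ?thesis by simp
    qed
    finally have "dn (FF e n K) t = e * (t * (\<Sum>j<n. dn (mm j) t) - (exp t - 1)) +
        (\<Sum>k\<in>{1..<K}. \<Sum>j<n. e * (-e)^k * dn (DD (mm j) * mm j ^ k) t)"
      by (simp add: sum_distrib_left algebra_simps)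
    moreover have "\<bar>e * (t * (\<Sum>j<n. dn (mm j) t) - (exp t - 1))\<bar> \<le> (exp (T 0) + 2) * exp (t/2)"
    proof (cases "T 0 \<le> t")
      case True
      have "\<bar>e * (t * (\<Sum>j<n. dn (mm j) t) - (exp t - 1))\<bar> \<le> 2 * exp (t/2)"
        using e ell_minus_phi[OF t(1)] True sum_dn_mm[OF t(2)] by (auto simp: abs_mult)
      also have "\<dots> \<le> (exp (T 0) + 2) * exp (t/2)" by (intro mult_right_mono) auto
      finally show ?thesis .
    next
      case False
      have "\<bar>e * (t * (\<Sum>j<n. dn (mm j) t) - (exp t - 1))\<bar> = \<bar>exp t - 1\<bar>"
        using e False sum_dn_mm[OF t(2)] by (auto simp: abs_mult)
      also have "\<dots> \<le> exp (T 0) * 1"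
      proof -
        have "exp t \<le> exp (T 0)" "1 \<le> exp t" using False t by auto
        thus ?thesis by linarith
      qed
      also have "\<dots> \<le> (exp (T 0) + 2) * exp (t/2)" using t by (intro mult_mono) auto
      finally show ?thesis .
    qed
    moreover have "\<bar>\<Sum>k\<in>{1..<K}. \<Sum>j<n. e * (-e)^k * dn (DD (mm j) * mm j ^ k) t\<bar> \<le> exp 1 * (1 / (1 - exp (-1/2))) * exp (t/2)"
    proof -
      have "\<bar>\<Sum>k\<in>{1..<K}. \<Sum>j<n. e * (-e)^k * dn (DD (mm j) * mm j ^ k) t\<bar> \<le>
         (\<Sum>k\<in>{1..<K}. \<Sum>j<n. \<bar>e * (-e)^k * dn (DD (mm j) * mm j ^ k) t\<bar>)"
        by (intro order_trans[OF sum_abs] sum_mono sum_abs)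
      also have "\<dots> \<le> (\<Sum>k\<in>{1..<K}. \<Sum>j<n. if real (Suc k) * T j \<le> t \<and> t < real (Suc k) * T (Suc j) then exp 1 * exp (-1/2) ^ (k - 1) * exp (t/2) else 0)"
      proof (intro sum_mono)
        fix k j assume k: "k \<in> {1..<K}"
        have "\<bar>e * (-e)^k * dn (DD (mm j) * mm j ^ k) t\<bar> = \<bar>dn (DD (mm j) * mm j ^ k) t\<bar>"
          using e by (auto simp: abs_mult power_abs)
        thus "\<bar>e * (-e)^k * dn (DD (mm j) * mm j ^ k) t\<bar> \<le> (if real (Suc k) * T j \<le> t \<and> t < real (Suc k) * T (Suc j) then exp 1 * exp (-1/2) ^ (k - 1) * exp (t/2) else 0)"
          using second_order_term[OF t(1), of k j] k by simp
      qed
      also have "\<dots> \<le> (\<Sum>k\<in>{1..<K}. exp 1 * exp (-1/2) ^ (k - 1) * exp (t/2))"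
      proof (intro sum_mono sum_disjoint_le)
        fix k i j assume "real (Suc k) * T i \<le> t \<and> t < real (Suc k) * T (Suc i)" "real (Suc k) * T j \<le> t \<and> t < real (Suc k) * T (Suc j)"
        hence "T i \<le> t / real (Suc k)" "t / real (Suc k) < T (Suc i)" "T j \<le> t / real (Suc k)" "t / real (Suc k) < T (Suc j)"
          by (auto simp: field_simps simp del: of_nat_Suc)
        thus "i = j" by (rule T_cell_unique)
      qed auto
      also have "\<dots> = (exp 1 * exp (t/2)) * (\<Sum>k<K-1. exp (-1/2) ^ k)"
        unfolding sum_distrib_left
        by (rule sum.reindex_bij_witness[of _ Suc "\<lambda>k. k - 1"]) auto
      also have "\<dots> \<le> (exp 1 * exp (t/2)) * (1 / (1 - exp (-1/2)))"
      proof (intro mult_left_mono)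
        have "summable (\<lambda>k. exp (-1/2 :: real) ^ k)" by (rule summable_geometric) simp
        hence "(\<Sum>k<K-1. exp (-1/2 :: real) ^ k) \<le> (\<Sum>k. exp (-1/2 :: real) ^ k)" by (rule sum_le_suminf) auto
        also have "\<dots> = 1 / (1 - exp (-1/2))" by (rule suminf_geometric) simp
        finally show "(\<Sum>k<K-1. exp (-1/2 :: real) ^ k) \<le> 1 / (1 - exp (-1/2))" .
      qed auto
      finally show ?thesis by (simp add: mult_ac)
    qed
    ultimately show ?thesis unfolding C_def distrib_right by linarith
  qed
  ultimately show ?thesis by blast
qed

text \<open>Mean of the compensated random product, every point mass being replaced by its
  expectation \<open>mm j\<close>.\<close>

definition BB :: "real \<Rightarrow> nat set \<Rightarrow> alg" where "BB e A = (\<Prod>j\<in>A. 1 + sc e * mm j) * tht e"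

text \<open>The remainder of the truncated geometric series contains
  \<open>DD (mm j) * mm j ^ K\<close>, which lives at (K + 1) * T j and beyond; below K the
  truncated logarithmic derivative is therefore exact.\<close>

lemma DD_BB:
  assumes e: "e = 1 \<or> e = -1" and K: "K > 0" "t < real K"
  shows "t * dn (BB e {..<n}) t = dn (FF e n K * BB e {..<n}) t"
proof -
  define P where "P A = (\<Prod>j\<in>A. 1 + sc e * mm j)" for A
  have DDm: "DD (1 + sc e * mm j) = sc e * DD (mm j)" for j by (simp add: DD_mult)
  have "DD (BB e {..<n}) = (\<Sum>j<n. sc e * DD (mm j) * P ({..<n} - {j})) * tht e - P {..<n} * (sc e * Eell * tht e)"
    unfolding BB_def by (simp add: DD_mult DD_prod DDm DD_tht[OF e] P_def)
  also have "\<dots> = (\<Sum>j<n. sc e * DD (mm j) * BB e ({..<n} - {j})) - sc e * Eell * BB e {..<n}"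
    by (simp add: BB_def P_def sum_distrib_left sum_distrib_right mult_ac)
  also have "(\<Sum>j<n. sc e * DD (mm j) * BB e ({..<n} - {j})) =
     (\<Sum>j<n. sc e * DD (mm j) * ((\<Sum>k<K. (- (sc e * mm j)) ^ k) * BB e {..<n} + (- (sc e * mm j)) ^ K * BB e ({..<n} - {j})))"
  proof (rule sum.cong)
    fix j assume j: "j \<in> {..<n}"
    \<comment> \<open>Division by 1 - y in finite form: 1 is (1 - y) times the partial geometric
      sum, plus y ^ K. The product without j plays the role of \<open>BB e {..<n}\<close> divided by
      1 - y.\<close>
    define y where "y = - (sc e * mm j)"
    have "BB e {..<n} = (1 - y) * BB e ({..<n} - {j})"
      unfolding BB_def y_def using prod.remove[of "{..<n}" j "\<lambda>j. 1 + sc e * mm j"] j by (simp add: mult.assoc)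
    hence "(\<Sum>k<K. y ^ k) * BB e {..<n} = ((1 - y) * (\<Sum>k<K. y ^ k)) * BB e ({..<n} - {j})" by (simp add: mult_ac)
    also have "\<dots> = (1 - y ^ K) * BB e ({..<n} - {j})" by (simp only: one_diff_power_eq)
    finally have "BB e ({..<n} - {j}) = (\<Sum>k<K. y ^ k) * BB e {..<n} + y ^ K * BB e ({..<n} - {j})"
      by (simp add: algebra_simps)
    thus "sc e * DD (mm j) * BB e ({..<n} - {j}) = sc e * DD (mm j) * ((\<Sum>k<K. (- (sc e * mm j)) ^ k) * BB e {..<n} + (- (sc e * mm j)) ^ K * BB e ({..<n} - {j}))"
      unfolding y_def by simp
  qed auto
  finally have "DD (BB e {..<n}) = FF e n K * BB e {..<n} + (\<Sum>j<n. sc e * DD (mm j) * ((- (sc e * mm j)) ^ K * BB e ({..<n} - {j})))"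
  proof -
    assume *: "DD (BB e {..<n}) = (\<Sum>j<n. sc e * DD (mm j) * ((\<Sum>k<K. (- (sc e * mm j)) ^ k) * BB e {..<n} + (- (sc e * mm j)) ^ K * BB e ({..<n} - {j}))) - sc e * Eell * BB e {..<n}"
    have "(\<Sum>j<n. a j * (g j * B + r j)) - E * B = ((\<Sum>j<n. a j * g j) - E) * B + (\<Sum>j<n. a j * r j)" for a g r and E B :: alg
      by (simp add: distrib_left sum.distrib sum_distrib_right mult.assoc left_diff_distrib)
    thus ?thesis unfolding * FF_def .
  qed
  moreover have "supp0 (real K) (\<Sum>j<n. sc e * DD (mm j) * ((- (sc e * mm j)) ^ K * BB e ({..<n} - {j})))"
  proof (rule supp0_sum)
    fix j
    have "sc e * DD (mm j) * ((- (sc e * mm j)) ^ K * BB e ({..<n} - {j})) =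
      (DD (mm j) * mm j ^ K) * (sc e * (- sc e) ^ K * BB e ({..<n} - {j}))"
    proof -
      have "(- (sc e * mm j)) ^ K = (- sc e) ^ K * mm j ^ K"
        by (simp only: minus_mult_left power_mult_distrib)
      thus ?thesis by (simp only: mult_ac)
    qed
    moreover have "real K \<le> real (Suc K) * T j" using T_ge_1[of j] mult_mono[of "real K" "real (Suc K)" 1 "T j"] by simp
    ultimately show "supp0 (real K) (sc e * DD (mm j) * ((- (sc e * mm j)) ^ K * BB e ({..<n} - {j})))"
      using supp0_mult_right[OF supp0_weaken[OF supp_mm_power(1)]] by metis
  qed
  ultimately have "dn (DD (BB e {..<n})) t = dn (FF e n K * BB e {..<n}) t"
    using K by (simp add: supp0_def)
  thus ?thesis by simp
qed

lemma dc_BB [simp]: "dc (BB e A) = 1"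
proof -
  have "dc (\<Prod>j\<in>A. 1 + sc e * mm j) = 1" by (induction A rule: infinite_finite_induct) auto
  thus ?thesis by (simp add: BB_def)
qed

lemma BB_low: "t < 1 \<Longrightarrow> dn (BB e A) t = dn (tht e) t"
proof -
  assume t: "t < 1"
  have "supp0 1 ((\<Prod>j\<in>A. 1 + sc e * mm j) - 1)"
  proof (induction A rule: infinite_finite_induct)
    case (insert a A)
    have eq: "(\<Prod>j\<in>insert a A. 1 + sc e * mm j) - 1 = ((\<Prod>j\<in>A. 1 + sc e * mm j) - 1) + mm a * (sc e * (\<Prod>j\<in>A. 1 + sc e * mm j))"
      using insert by (simp add: algebra_simps)
    show ?case unfolding eq using insert T_ge_1[of a]
      by (intro supp0_add supp0_mult_right[OF supp0_weaken[OF supp_mm(1)]])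
  qed (auto simp: supp0_0)
  from supp0_mult_right[OF this, of "tht e"] have "supp0 1 (BB e A - tht e)"
    by (simp add: BB_def algebra_simps)
  thus ?thesis using t by (simp add: supp0_def)
qed

lemma integral_power_le:
  assumes "t \<ge> 0"
  shows "(\<integral>s. indicator {0..t} s * (1 + s) ^ p \<partial>lborel) = ((1 + t) ^ Suc p - 1) / real (Suc p)"
proof -
  have "(\<integral>s. indicator {0..t} s * (1 + s) ^ p \<partial>lborel) = (1 + t) ^ Suc p / real (Suc p) - (1 + 0) ^ Suc p / real (Suc p)"
  proof (rule integral_Icc_FTC)
    show "((\<lambda>s. (1 + s) ^ Suc p / real (Suc p)) has_real_derivative (1 + s) ^ p) (at s)" for s :: real
    proof -
      have "((\<lambda>s. (1 + s) ^ Suc p) has_real_derivative real (Suc p) * (1 + s) ^ p) (at s)"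
        by (auto intro!: derivative_eq_intros simp del: of_nat_Suc power_Suc)
      from DERIV_cdivide[OF this, of "real (Suc p)"] show ?thesis by (simp del: of_nat_Suc power_Suc)
    qed
  qed (use assms in \<open>auto intro!: continuous_intros\<close>)
  thus ?thesis by (simp add: diff_divide_distrib)
qed

text \<open>A Gronwall argument for t * b t = F t + conv F b t with F of size exp (t/2). After
  division by t the convolution can be absorbed by polynomial growth whose degree is about 4 *
  C.\<close>

lemma BB_bound:
  "\<exists>C p. C > 0 \<and> (\<forall>e n t. (e = 1 \<or> e = -1) \<longrightarrow> 0 \<le> t \<longrightarrow> t < T n \<longrightarrow> \<bar>dn (BB e {..<n}) t\<bar> \<le> C * exp (t/2) * (1 + t) ^ p)"
proof -
  obtain C where C: "C > 0" "\<And>e n K t. (e = 1 \<or> e = -1) \<Longrightarrow> K > 0 \<Longrightarrow> 0 \<le> t \<Longrightarrow> t < T n \<Longrightarrow> \<bar>dn (FF e n K) t\<bar> \<le> C * exp (t/2)"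
    using FF_bound by blast
  \<comment> \<open>With p + 1 \<ge> 4 * C and 1 + t \<le> 2 * t for t \<ge> 1, the convolution term
    costs at most half of the supremum \<open>M\<close>.\<close>
  obtain p :: nat where p: "4 * C \<le> real (Suc p)"
    using real_arch_simple[of "4 * C"] by (metis of_nat_Suc add.commute le_add_same_cancel2 order_trans zero_le_one)
  have "\<bar>dn (BB e {..<n}) t0\<bar> \<le> (2 * C + 3) * exp (t0/2) * (1 + t0) ^ p"
    if e: "e = 1 \<or> e = -1" and t0: "0 \<le> t0" "t0 < T n" for e n t0
  proof -
    define b where "b = dn (BB e {..<n})"
    define w where "w t = exp (t/2) * (1 + t) ^ p" for t :: real
    have w: "w t \<ge> 1" if "t \<ge> 0" for t
      using mult_mono[of 1 "exp (t/2)" 1 "(1 + t) ^ p"] that unfolding w_def by (simp add: one_le_power)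
    define M where "M = (SUP t\<in>{0..t0}. \<bar>b t\<bar> / w t)"
    obtain Bb where Bb: "Bb \<ge> 0" "\<And>t. t \<le> t0 \<Longrightarrow> \<bar>b t\<bar> \<le> Bb" using dens_bound[OF dens_dn, of "t0" "BB e {..<n}"] unfolding b_def by blast
    have bdd: "bdd_above ((\<lambda>t. \<bar>b t\<bar> / w t) ` {0..t0})"
    proof (rule bdd_aboveI2)
      fix t assume t: "t \<in> {0..t0}"
      have "\<bar>b t\<bar> / w t \<le> \<bar>b t\<bar> / 1" using w[of t] t by (intro divide_left_mono) auto
      thus "\<bar>b t\<bar> / w t \<le> Bb" using Bb(2)[of t] t by simp
    qed
    have Mub: "\<bar>b t\<bar> \<le> M * w t" if "0 \<le> t" "t \<le> t0" for t
    proof -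
      have "\<bar>b t\<bar> / w t \<le> M" unfolding M_def using that by (intro cSUP_upper bdd) auto
      thus ?thesis using w[of t] that by (simp add: field_simps)
    qed
    have M0: "M \<ge> 0" using Mub[of 0] w[of 0] t0 by (smt (verit) mult_neg_pos)
    have key: "\<bar>b t\<bar> / w t \<le> max 3 (C + M / 2)" if t: "0 \<le> t" "t \<le> t0" for t
    proof (cases "t < 1")
      case True
      have "\<bar>b t\<bar> \<le> exp 1" using True t by (auto simp: b_def BB_low dn_tht indicator_def)
      also have "\<dots> \<le> 3" by (rule exp_le)
      also have "\<dots> \<le> 3 * w t" using w[of t] t by simp
      finally have "\<bar>b t\<bar> / w t \<le> 3" using w[of t] t by (simp add: field_simps)
      thus ?thesis by simp
    next
      case False
      define K where "K = nat \<lceil>t\<rceil> + 1"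
      have K: "K > 0" "t < real K" unfolding K_def using t by (auto, linarith)
      define F where "F = dn (FF e n K)"
      have "t * b t = F t + conv F b t"
        using DD_BB[OF e K, of n] unfolding b_def F_def by (simp add: dn_times FF_def)
      moreover have "\<bar>F t\<bar> \<le> C * exp (t/2)" unfolding F_def using C(2)[OF e K(1)] t t0 by simp
      moreover have "\<bar>conv F b t\<bar> \<le> C * M * exp (t/2) * ((1 + t) ^ Suc p / real (Suc p))"
      proof -
        have "\<bar>conv F b t\<bar> = \<bar>conv b F t\<bar>" by (simp add: conv_commute)
        also have "\<dots> \<le> (\<integral>s. \<bar>b s * F (t - s)\<bar> \<partial>lborel)"
          unfolding conv_def using integral_norm_bound[of lborel "\<lambda>s. b s * F (t - s)"] by simp
        also have "\<dots> \<le> (\<integral>s. C * M * exp (t/2) * (indicator {0..t} s * (1 + s) ^ p) \<partial>lborel)"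
        proof (rule integral_mono)
          show "integrable lborel (\<lambda>s. \<bar>b s * F (t - s)\<bar>)" unfolding b_def F_def
            by (intro integrable_abs conv_integrable dens_dn)
          have "integrable lborel (\<lambda>s. indicator {0..t} s *\<^sub>R (1 + s) ^ p)"
            by (rule borel_integrable_compact) (auto intro!: continuous_intros)
          thus "integrable lborel (\<lambda>s. C * M * exp (t/2) * (indicator {0..t} s * (1 + s) ^ p))" by simp
          fix s
          show "\<bar>b s * F (t - s)\<bar> \<le> C * M * exp (t/2) * (indicator {0..t} s * (1 + s) ^ p)"
          proof (cases "s \<in> {0..t}")
            case True
            have "\<bar>b s * F (t - s)\<bar> \<le> (M * w s) * (C * exp ((t - s)/2))"
              unfolding abs_mult F_def using C(2)[OF e K(1), of "t - s" n] Mub[of s] True t t0 M0 w[of s]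
              by (intro mult_mono) auto
            also have "\<dots> = C * M * (exp (s/2) * exp ((t-s)/2)) * (1 + s) ^ p" by (simp add: w_def mult_ac)
            also have "exp (s/2) * exp ((t-s)/2) = exp (t/2)" by (simp add: field_simps flip: exp_add)
            finally show ?thesis using True by simp
          next
            case False
            thus ?thesis by (auto simp: b_def F_def dn_neg)
          qed
        qed
        also have "\<dots> = C * M * exp (t/2) * (((1 + t) ^ Suc p - 1) / real (Suc p))"
          using t by (simp add: integral_power_le)
        also have "\<dots> \<le> C * M * exp (t/2) * ((1 + t) ^ Suc p / real (Suc p))"
          using C M0 by (intro mult_left_mono divide_right_mono) auto
        finally show ?thesis .
      qed
      ultimately have "t * \<bar>b t\<bar> \<le> C * exp (t/2) + C * M * exp (t/2) * ((1 + t) ^ Suc p / real (Suc p))"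
        using abs_triangle_ineq[of "F t" "conv F b t"] abs_mult[of t "b t"] t by simp
      also have "\<dots> \<le> t * (C * w t) + t * (M / 2 * w t)"
      proof (rule add_mono)
        have "C * exp (t/2) * 1 \<le> C * exp (t/2) * (t * (1 + t) ^ p)"
          using False C mult_mono[of 1 t 1 "(1 + t) ^ p"] by (intro mult_left_mono) auto
        thus "C * exp (t/2) \<le> t * (C * w t)" by (simp add: w_def mult_ac)
        have "C / real (Suc p) * (1 + t) \<le> 1/4 * (2 * t)"
          using p False C by (intro mult_mono) (auto simp: field_simps simp del: of_nat_Suc)
        hence "(C / real (Suc p) * (1 + t)) * (M * w t) \<le> (1/4 * (2 * t)) * (M * w t)"
          using M0 w[of t] t by (intro mult_right_mono) auto
        thus "C * M * exp (t/2) * ((1 + t) ^ Suc p / real (Suc p)) \<le> t * (M / 2 * w t)"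
          by (simp add: w_def field_simps del: of_nat_Suc)
      qed
      also have "\<dots> = t * ((C + M / 2) * w t)" by (simp add: algebra_simps)
      finally have "\<bar>b t\<bar> \<le> (C + M / 2) * w t" using False by simp
      hence "\<bar>b t\<bar> / w t \<le> C + M / 2" using w[of t] t by (simp add: field_simps)
      thus ?thesis by simp
    qed
    \<comment> \<open>\<open>M\<close> is finite because densities are locally bounded, so the
      inequality M \<le> C + M / 2 can be solved for it. The 3 bounds exp 1 and takes care of t < 1,
      where only \<open>tht e\<close> contributes.\<close>
    have "M \<le> max 3 (C + M / 2)" unfolding M_def by (rule cSUP_least) (use t0 key in \<open>auto simp: M_def\<close>)
    hence "M \<le> 2 * C + 3" using C by (auto simp: max_def split: if_splits)
    hence "M * w t0 \<le> (2 * C + 3) * w t0" using w[of t0] t0 by (intro mult_right_mono) auto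
    hence "\<bar>b t0\<bar> \<le> (2 * C + 3) * w t0" using Mub[of t0] t0 by linarith
    thus ?thesis by (simp only: b_def w_def mult.assoc)
  qed
  thus ?thesis using C(1) by (intro exI[of _ "2 * C + 3"] exI[of _ p]) auto
qed

lemma nrm_BB: "\<exists>C p. C > 0 \<and> (\<forall>e n L. (e = 1 \<or> e = -1) \<longrightarrow> 0 \<le> L \<longrightarrow> L < T n \<longrightarrow> nrm L (BB e {..<n}) \<le> C * (1 + L) ^ p)"
proof -
  obtain C p where C: "C > 0" "\<And>e n t. (e = 1 \<or> e = -1) \<Longrightarrow> 0 \<le> t \<Longrightarrow> t < T n \<Longrightarrow> \<bar>dn (BB e {..<n}) t\<bar> \<le> C * exp (t/2) * (1 + t) ^ p"
    using BB_bound by blast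
  have "nrm L (BB e {..<n}) \<le> (1 + C) * (1 + L) ^ Suc p" if e: "e = 1 \<or> e = -1" and L: "0 \<le> L" "L < T n" for e n L
  proof -
    have "(\<integral>s. indicator {0..L} s * (exp (-s/2) * \<bar>dn (BB e {..<n}) s\<bar>) \<partial>lborel) \<le> (\<integral>s. C * (indicator {0..L} s * (1 + s) ^ p) \<partial>lborel)"
    proof (rule integral_mono[OF integrable_nrm])
      have "integrable lborel (\<lambda>s. indicator {0..L} s *\<^sub>R (1 + s) ^ p)"
        by (rule borel_integrable_compact) (auto intro!: continuous_intros)
      thus "integrable lborel (\<lambda>s. C * (indicator {0..L} s * (1 + s) ^ p))" by simp
      fix s show "indicator {0..L} s * (exp (-s/2) * \<bar>dn (BB e {..<n}) s\<bar>) \<le> C * (indicator {0..L} s * (1 + s) ^ p)"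
      proof (cases "s \<in> {0..L}")
        case True
        have "exp (-s/2) * \<bar>dn (BB e {..<n}) s\<bar> \<le> exp (-s/2) * (C * exp (s/2) * (1 + s) ^ p)"
          using C(2)[OF e, of s n] True L by (intro mult_left_mono) auto
        also have "\<dots> = C * (1 + s) ^ p" by (simp add: exp_minus field_simps)
        finally show ?thesis using True by simp
      qed auto
    qed
    also have "\<dots> = C * (((1 + L) ^ Suc p - 1) / real (Suc p))" using L by (simp add: integral_power_le)
    also have "\<dots> \<le> C * ((1 + L) ^ Suc p)"
    proof (intro mult_left_mono)
      have "(1 + L) ^ Suc p \<ge> 0" using L by (intro zero_le_power) auto
      hence "((1 + L) ^ Suc p - 1) / real (Suc p) \<le> ((1 + L) ^ Suc p) / 1" using L
        by (intro frac_le) auto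
      thus "((1 + L) ^ Suc p - 1) / real (Suc p) \<le> (1 + L) ^ Suc p" by simp
    qed (use C in auto)
    finally have "nrm L (BB e {..<n}) \<le> 1 + C * (1 + L) ^ Suc p" using L by (simp add: nrm_def)
    moreover have "1 \<le> (1 + L) ^ Suc p" using L by (intro one_le_power) auto
    ultimately show ?thesis unfolding distrib_right by linarith
  qed
  thus ?thesis using C by (intro exI[of _ "1 + C"] exI[of _ "Suc p"]) auto
qed

text \<open>Leaving out factors is harmless, because \<open>1 + e * mm j\<close> is a small perturbation of 1.\<close>
lemma nrm_BB_remove:
  assumes e: "e = 1 \<or> e = -1" and "finite A" "S \<subseteq> A"
  shows "nrm L (BB e (A - S)) \<le> nrm L (BB e A) * (1 / (1 - exp (-1/2))) ^ card S"
  using finite_subset[OF assms(3,2)] assms(3)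
proof (induction S rule: finite_induct)
  case (insert a S)
  let ?x = "BB e (A - insert a S)" and ?y = "BB e (A - S)"
  have "(\<Prod>j\<in>A - S. 1 + sc e * mm j) = (1 + sc e * mm a) * (\<Prod>j\<in>A - S - {a}. 1 + sc e * mm j)"
    using insert assms by (intro prod.remove) auto
  moreover have "A - S - {a} = A - insert a S" by auto
  ultimately have "?y = ?x + sc e * mm a * ?x" by (simp add: BB_def algebra_simps)
  hence "?x = ?y + (- (sc e * (mm a * ?x)))" by (simp add: algebra_simps)
  hence "nrm L ?x \<le> nrm L ?y + nrm L (mm a * ?x)" using nrm_add[of L ?y "- (sc e * (mm a * ?x))"] e by auto
  also have "nrm L (mm a * ?x) \<le> exp (-1/2) * nrm L ?x"
  proof -
    have "nrm L (mm a * ?x) \<le> nrm L (mm a) * nrm L ?x" by (rule nrm_mult)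
    also have "nrm L (mm a) \<le> exp (-1/2)" using T_ge_1[of a] by (intro order_trans[OF nrm_mm]) simp
    finally show ?thesis using nrm_nonneg by (simp add: mult_right_mono)
  qed
  finally have "nrm L ?x * (1 - exp (-1/2)) \<le> nrm L ?y" by (simp add: algebra_simps)
  hence "nrm L ?x \<le> nrm L ?y * (1 / (1 - exp (-1/2)))" by (simp add: field_simps)
  also have "\<dots> \<le> nrm L (BB e A) * (1 / (1 - exp (-1/2))) ^ card S * (1 / (1 - exp (-1/2)))"
    using insert by (intro mult_right_mono) auto
  finally show ?case using insert by (simp add: mult_ac)
qed simp

section \<open>Second moments and dyadic chaining\<close>

definition MM :: "nat \<Rightarrow> real measure" where "MM i = density lborel (\<lambda>s. ennreal (dn (mm i) s))"

lemma sets_MM [measurable_cong, simp]: "sets (MM i) = sets borel" by (simp add: MM_def)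
lemma space_MM [simp]: "space (MM i) = UNIV" by (simp add: MM_def)

lemma prob_space_MM: "prob_space (MM i)"
proof
  have "emeasure (MM i) (space (MM i)) = (\<integral>\<^sup>+s. ennreal (dn (mm i) s) \<partial>lborel)"
    unfolding MM_def by (subst emeasure_density) auto
  also have "\<dots> = ennreal 1"
    using nn_integral_eq_integral[of lborel "dn (mm i)"] has_bochner_integral_mm[of i] dn_mm_nonneg[of i]
    by (auto simp: has_bochner_integral_iff)
  finally show "emeasure (MM i) (space (MM i)) = 1" by simp
qed

lemma AE_MM: "AE s in MM i. T i \<le> s \<and> s < T (Suc i)"
  unfolding MM_def by (subst AE_density) (auto intro!: AE_I2 simp: dn_mm indicator_def split: if_splits)

interpretation MM: product_prob_space MM UNIV
  by (intro product_prob_space.intro product_sigma_finite.intro product_prob_space_axioms.intro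
        prob_space_imp_sigma_finite prob_space_MM)

text \<open>Distribution function of x convolved with the product over J of 1 + e * (point mass at
  \<open>om j\<close>). It is expanded over subsets because point masses away from 0 are not
  elements of \<open>alg\<close>.\<close>

definition Q :: "real \<Rightarrow> nat set \<Rightarrow> alg \<Rightarrow> (nat \<Rightarrow> real) \<Rightarrow> real \<Rightarrow> real" where
  "Q e J x om t = (\<Sum>R\<in>Pow J. e ^ card R * cum x (t - (\<Sum>j\<in>R. om j)))"

lemma Q_empty [simp]: "Q e {} x om t = cum x t" by (simp add: Q_def)

lemma Q_insert:
  assumes "finite J" "j \<notin> J"
  shows "Q e (insert j J) x om t = Q e J x om t + e * Q e J x om (t - om j)"
proof -
  have inj: "inj_on (insert j) (Pow J)" using assms by (auto simp: inj_on_def)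
  have "Q e (insert j J) x om t = Q e J x om t + (\<Sum>R\<in>insert j ` Pow J. e ^ card R * cum x (t - (\<Sum>j\<in>R. om j)))"
    unfolding Q_def Pow_insert using assms by (subst sum.union_disjoint) auto
  also have "(\<Sum>R\<in>insert j ` Pow J. e ^ card R * cum x (t - (\<Sum>j\<in>R. om j))) =
      (\<Sum>R\<in>Pow J. e ^ card (insert j R) * cum x (t - (\<Sum>i\<in>insert j R. om i)))"
    by (simp add: sum.reindex[OF inj])
  also have "\<dots> = e * Q e J x om (t - om j)"
    unfolding Q_def sum_distrib_left
  proof (rule sum.cong)
    fix R assume "R \<in> Pow J"
    hence "finite R" "j \<notin> R" using assms by (auto intro: finite_subset)
    thus "e ^ card (insert j R) * cum x (t - (\<Sum>i\<in>insert j R. om i)) = e * (e ^ card R * cum x (t - om j - (\<Sum>j\<in>R. om j)))"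
      by (simp add: diff_diff_eq)
  qed auto
  finally show ?thesis .
qed

lemma Q_cong: "(\<And>j. j \<in> J \<Longrightarrow> om j = om' j) \<Longrightarrow> Q e J x om t = Q e J x om' t"
  unfolding Q_def by (intro sum.cong refl arg_cong2[where f = "(*)"] arg_cong[where f = "cum x"] arg_cong2[where f = "(-)"]) auto

lemma Q_add: "Q e J (x + y) om t = Q e J x om t + Q e J y om t"
  by (simp add: Q_def cum_add sum.distrib distrib_left)
lemma Q_sc: "Q e J (sc c * x) om t = c * Q e J x om t"
  unfolding Q_def cum_sc sum_distrib_left by (intro sum.cong refl) simp

lemma measurable_Q_pair:
  assumes "finite J" "\<And>j. j \<in> J \<Longrightarrow> (\<lambda>z. g z j) \<in> borel_measurable N" "h \<in> borel_measurable N"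
  shows "(\<lambda>z. Q e J x (g z) (h z)) \<in> borel_measurable N"
  unfolding Q_def
proof (intro borel_measurable_sum borel_measurable_times borel_measurable_const)
  fix R assume "R \<in> Pow J"
  hence "(\<lambda>z. h z - (\<Sum>j\<in>R. g z j)) \<in> borel_measurable N"
    using assms by (intro borel_measurable_diff borel_measurable_sum) auto
  from measurable_compose[OF this cum_measurable]
  show "(\<lambda>z. cum x (h z - (\<Sum>j\<in>R. g z j))) \<in> borel_measurable N" .
qed

lemma measurable_Q: "finite J \<Longrightarrow> J \<subseteq> I \<Longrightarrow> (\<lambda>om. Q e J x om t) \<in> borel_measurable (PiM I MM)"
proof (rule measurable_Q_pair)
  fix j assume "J \<subseteq> I" "j \<in> J"
  hence "j \<in> I" by auto
  thus "(\<lambda>om. om j) \<in> borel_measurable (PiM I MM)"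
    using measurable_component_singleton[of j I MM] by (simp cong: measurable_cong_sets)
qed auto

lemma Q_bound: "finite J \<Longrightarrow> \<exists>B\<ge>0. \<forall>t\<le>t0. \<bar>Q e J x om t\<bar> \<le> B"
proof -
  assume J: "finite J"
  have "\<exists>B\<ge>0. \<forall>t\<le>t0. \<bar>\<Sum>R\<in>P. e ^ card R * cum x (t - (\<Sum>j\<in>R. om j))\<bar> \<le> B" if "finite P" for P
    using that
  proof (induction P rule: finite_induct)
    case (insert R P)
    obtain B where B: "B \<ge> 0" "\<And>t. t \<le> t0 \<Longrightarrow> \<bar>\<Sum>R\<in>P. e ^ card R * cum x (t - (\<Sum>j\<in>R. om j))\<bar> \<le> B"
      using insert by blast
    obtain B' where B': "B' \<ge> 0" "\<And>t. t \<le> t0 - (\<Sum>j\<in>R. om j) \<Longrightarrow> \<bar>cum x t\<bar> \<le> B'"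
      using dens_bound[OF dens_dn, of "t0 - (\<Sum>j\<in>R. om j)" "x * hh"] unfolding cum_def by blast
    show ?case
    proof (intro exI[of _ "\<bar>e ^ card R\<bar> * B' + B"] conjI allI impI)
      fix t assume t: "t \<le> t0"
      have "\<bar>e ^ card R * cum x (t - (\<Sum>j\<in>R. om j))\<bar> \<le> \<bar>e ^ card R\<bar> * B'"
        unfolding abs_mult using B' t by (intro mult_left_mono) auto
      thus "\<bar>\<Sum>R\<in>insert R P. e ^ card R * cum x (t - (\<Sum>j\<in>R. om j))\<bar> \<le> \<bar>e ^ card R\<bar> * B' + B"
        using B(2)[OF t] insert by simp
    qed (use B B' in auto)
  qed auto
  thus ?thesis unfolding Q_def using J by simp
qed

lemma integral_MM:
  assumes "f \<in> borel_measurable borel" shows "(\<integral>y. f y \<partial>MM j) = (\<integral>y. dn (mm j) y * f y \<partial>lborel)"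
  unfolding MM_def using assms by (subst integral_density) (auto intro: AE_I2 dn_mm_nonneg)

lemma measurable_MM: "f \<in> borel_measurable (MM j) \<longleftrightarrow> f \<in> borel_measurable borel"
  by (rule arg_cong[where f = "\<lambda>M. f \<in> M"]) (rule measurable_cong_sets; simp)

text \<open>Averaging a shift by y over the law of the j-th log-prime is convolution with
  \<open>mm j\<close>, and convolution commutes with the other, fixed factors.\<close>

lemma expect_Q:
  assumes "finite J"
  shows "(\<integral>y. Q e J x om (t - y) \<partial>MM j) = Q e J (mm j * x) om t"
proof -
  have m: "(\<lambda>y. Q e J x om (t - y)) \<in> borel_measurable borel"
    by (rule measurable_Q_pair) (use assms in auto)
  have int: "integrable lborel (\<lambda>y. dn (mm j) y * cum x (t - s - y))" for s
    unfolding cum_def by (rule conv_integrable) auto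
  have eq: "dn (mm j) y * Q e J x om (t - y) =
    (\<Sum>R\<in>Pow J. e ^ card R * (dn (mm j) y * cum x (t - (\<Sum>j\<in>R. om j) - y)))" for y
    unfolding Q_def sum_distrib_left by (intro sum.cong refl) (simp add: algebra_simps)
  have "(\<integral>y. Q e J x om (t - y) \<partial>MM j) = (\<Sum>R\<in>Pow J. e ^ card R * (\<integral>y. dn (mm j) y * cum x (t - (\<Sum>j\<in>R. om j) - y) \<partial>lborel))"
    unfolding integral_MM[OF m] eq using int
    by (subst Bochner_Integration.integral_sum) auto
  also have "\<dots> = Q e J (mm j * x) om t"
    unfolding Q_def by (simp add: cum_mult conv_def)
  finally show ?thesis .
qed

text \<open>As e is 1 or -1, the left side equals the square of the mean plus the variance of X, and
  the variance is at most the second moment. Dropping the centring in this way keeps the recursion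
  free of mixed terms.\<close>

lemma (in prob_space) variance_step:
  fixes X :: "'a \<Rightarrow> real"
  assumes "integrable M X" "integrable M (\<lambda>y. (X y)\<^sup>2)" "e = 1 \<or> e = -1"
  shows "integrable M (\<lambda>y. (a + e * X y)\<^sup>2)"
    "(\<integral>y. (a + e * X y)\<^sup>2 \<partial>M) \<le> (a + e * (\<integral>y. X y \<partial>M))\<^sup>2 + (\<integral>y. (X y)\<^sup>2 \<partial>M)"
proof -
  have eq: "(a + e * X y)\<^sup>2 = a\<^sup>2 + (2 * a * e) * X y + (X y)\<^sup>2" for y
    using assms(3) by (auto simp: power2_eq_square algebra_simps)
  show "integrable M (\<lambda>y. (a + e * X y)\<^sup>2)" unfolding eq using assms by auto
  have "(\<integral>y. (a + e * X y)\<^sup>2 \<partial>M) = a\<^sup>2 + (2 * a * e) * (\<integral>y. X y \<partial>M) + (\<integral>y. (X y)\<^sup>2 \<partial>M)"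
    unfolding eq using assms by (simp add: prob_space)
  also have "\<dots> \<le> (a + e * (\<integral>y. X y \<partial>M))\<^sup>2 + (\<integral>y. (X y)\<^sup>2 \<partial>M)"
    using assms(3) by (auto simp: power2_eq_square algebra_simps)
  finally show "(\<integral>y. (a + e * X y)\<^sup>2 \<partial>M) \<le> (a + e * (\<integral>y. X y \<partial>M))\<^sup>2 + (\<integral>y. (X y)\<^sup>2 \<partial>M)" .
qed

text \<open>One step of the recursion over primes: the random factor j is either frozen at its mean,
  which multiplies x by 1 + e * mm j, or it shifts all arguments by its position y.\<close>

lemma inner_bound:
  fixes N :: nat
  assumes J: "finite J" and e: "e = 1 \<or> e = -1"
  shows "(\<integral>\<^sup>+y. ennreal (\<Sum>i<N. ((Q e J x om (s (Suc i)) + e * Q e J x om (s (Suc i) - y)) - (Q e J x om (s i) + e * Q e J x om (s i - y)))\<^sup>2) \<partial>MM j)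
    \<le> ennreal (\<Sum>i<N. (Q e J ((1 + sc e * mm j) * x) om (s (Suc i)) - Q e J ((1 + sc e * mm j) * x) om (s i))\<^sup>2)
      + (\<integral>\<^sup>+y. ennreal (\<Sum>i<N. (Q e J x om (s (Suc i) - y) - Q e J x om (s i - y))\<^sup>2) \<partial>MM j)"
proof -
  note variance_step = prob_space.variance_step[OF prob_space_MM[of j]]
  have fin: "finite_measure (MM j)" using prob_space_MM[of j] by (simp add: prob_space_def)
  define X where "X i y = Q e J x om (s (Suc i) - y) - Q e J x om (s i - y)" for i y
  define a where "a i = Q e J x om (s (Suc i)) - Q e J x om (s i)" for i
  have mQ: "(\<lambda>y. Q e J x om (t - y)) \<in> borel_measurable borel" for t
    by (rule measurable_Q_pair) (use J in auto)
  have mX [measurable]: "X i \<in> borel_measurable borel" for i unfolding X_def[abs_def] by (intro borel_measurable_diff mQ)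
  have bQ: "\<exists>B. AE y in MM j. \<bar>Q e J x om (t - y)\<bar> \<le> B" for t
  proof -
    obtain B where B: "\<forall>u\<le>t. \<bar>Q e J x om u\<bar> \<le> B" using Q_bound[OF J, of t e x om] by blast
    have "AE y in MM j. \<bar>Q e J x om (t - y)\<bar> \<le> B"
      using AE_MM[of j] by eventually_elim (use B T_ge_1[of j] in auto)
    thus ?thesis by blast
  qed
  have iQ: "integrable (MM j) (\<lambda>y. Q e J x om (t - y))" for t
  proof -
    obtain B where "AE y in MM j. \<bar>Q e J x om (t - y)\<bar> \<le> B" using bQ by blast
    thus ?thesis by (intro finite_measure.integrable_const_bound[OF fin, where B = B]) (use mQ[of t] in \<open>auto simp: measurable_MM\<close>)
  qed
  have iX: "integrable (MM j) (X i)" for i unfolding X_def[abs_def] by (intro Bochner_Integration.integrable_diff iQ)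
  have iX2: "integrable (MM j) (\<lambda>y. (X i y)\<^sup>2)" for i
  proof -
    obtain B1 B2 where "AE y in MM j. \<bar>Q e J x om (s (Suc i) - y)\<bar> \<le> B1" "AE y in MM j. \<bar>Q e J x om (s i - y)\<bar> \<le> B2"
      using bQ by meson
    hence "AE y in MM j. norm ((X i y)\<^sup>2) \<le> (B1 + B2)\<^sup>2"
    proof eventually_elim
      case (elim y)
      hence "\<bar>X i y\<bar> \<le> \<bar>B1 + B2\<bar>" unfolding X_def by linarith
      hence "(X i y)\<^sup>2 \<le> (B1 + B2)\<^sup>2" by (simp only: abs_le_square_iff)
      thus ?case by simp
    qed
    thus ?thesis by (rule finite_measure.integrable_const_bound[OF fin]) (auto simp: measurable_MM)
  qed
  have EX: "(\<integral>y. X i y \<partial>MM j) = Q e J (mm j * x) om (s (Suc i)) - Q e J (mm j * x) om (s i)" for i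
    unfolding X_def by (simp add: iQ expect_Q[OF J])
  have lin: "a i + e * (\<integral>y. X i y \<partial>MM j) = Q e J ((1 + sc e * mm j) * x) om (s (Suc i)) - Q e J ((1 + sc e * mm j) * x) om (s i)" for i
    unfolding EX a_def distrib_right mult_1 Q_add mult.assoc Q_sc by (simp add: algebra_simps)
  have "(\<integral>\<^sup>+y. ennreal (\<Sum>i<N. (a i + e * X i y)\<^sup>2) \<partial>MM j) = ennreal (\<integral>y. (\<Sum>i<N. (a i + e * X i y)\<^sup>2) \<partial>MM j)"
    using variance_step(1)[OF iX iX2 e] by (intro nn_integral_eq_integral Bochner_Integration.integrable_sum) (auto intro!: sum_nonneg AE_I2)
  also have "(\<integral>y. (\<Sum>i<N. (a i + e * X i y)\<^sup>2) \<partial>MM j) = (\<Sum>i<N. \<integral>y. (a i + e * X i y)\<^sup>2 \<partial>MM j)"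
    using variance_step(1)[OF iX iX2 e] by (intro Bochner_Integration.integral_sum)
  also have "ennreal \<dots> \<le> ennreal (\<Sum>i<N. (a i + e * (\<integral>y. X i y \<partial>MM j))\<^sup>2 + (\<integral>y. (X i y)\<^sup>2 \<partial>MM j))"
    using variance_step(2)[OF iX iX2 e] by (intro ennreal_leI sum_mono) auto
  also have "\<dots> = ennreal ((\<Sum>i<N. (a i + e * (\<integral>y. X i y \<partial>MM j))\<^sup>2) + (\<integral>y. (\<Sum>i<N. (X i y)\<^sup>2) \<partial>MM j))"
    using iX2 by (subst Bochner_Integration.integral_sum) (auto simp: sum.distrib)
  also have "\<dots> = ennreal (\<Sum>i<N. (a i + e * (\<integral>y. X i y \<partial>MM j))\<^sup>2) + ennreal (\<integral>y. (\<Sum>i<N. (X i y)\<^sup>2) \<partial>MM j)"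
    by (intro ennreal_plus sum_nonneg Bochner_Integration.integral_nonneg) auto
  also have "ennreal (\<integral>y. (\<Sum>i<N. (X i y)\<^sup>2) \<partial>MM j) = (\<integral>\<^sup>+y. ennreal (\<Sum>i<N. (X i y)\<^sup>2) \<partial>MM j)"
    using iX2 by (intro nn_integral_eq_integral[symmetric] Bochner_Integration.integrable_sum) (auto intro!: sum_nonneg AE_I2)
  finally show ?thesis unfolding lin unfolding X_def a_def by (simp add: algebra_simps)
qed

lemma telescoping_squares_le:
  fixes V :: "nat \<Rightarrow> real"
  assumes "\<And>i. i < N \<Longrightarrow> V i \<le> V (Suc i)" "V 0 \<ge> 0"
  shows "(\<Sum>i<N. (V (Suc i) - V i)\<^sup>2) \<le> (V N)\<^sup>2"
  using assms
proof (induction N)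
  case (Suc N)
  have "V N \<ge> 0"
    using Suc.prems by (induction N) (auto intro: order_trans)
  hence "(V (Suc N) - V N)\<^sup>2 + (V N)\<^sup>2 \<le> (V (Suc N))\<^sup>2"
    using Suc.prems(1)[of N] mult_nonneg_nonneg[of "V N" "V (Suc N) - V N"] by (simp add: power2_eq_square algebra_simps)
  thus ?case using Suc by simp
qed auto

text \<open>Only the weighted variation norms of the truncated products enter; the measures
  \<open>exp (- T j)\<close> bound the mean of \<open>exp (- om j)\<close>.\<close>
lemma second_moment:
  fixes N :: nat and r c L :: real
  assumes J: "finite J" and e: "e = 1 \<or> e = -1" and r: "r \<ge> 0"
  assumes "\<And>S. S \<subseteq> J \<Longrightarrow> (nrm L0 ((\<Prod>j\<in>J - S. 1 + sc e * mm j) * x))\<^sup>2 \<le> c * r ^ card S"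
    and "\<And>i. i < N \<Longrightarrow> s i \<le> s (Suc i)" "s N \<le> L" "L \<le> L0"
  shows "(\<integral>\<^sup>+om. ennreal (\<Sum>i<N. (Q e J x om (s (Suc i)) - Q e J x om (s i))\<^sup>2) \<partial>PiM J MM)
    \<le> ennreal (exp L * c * (\<Prod>j\<in>J. 1 + exp (- T j) * r))"
  using J assms(4-)
proof (induction J arbitrary: x s L c rule: finite_induct)
  \<comment> \<open>No randomness is left. The increments of \<open>cum\<close> are at most exp
    (L/2) times those of the norm, and the squares of the increments of a monotone function add up
    to at most the square of its last value.\<close>
  case empty
  have c: "(nrm L0 x)\<^sup>2 \<le> c" using empty(1)[of "{}"] by simp
  have mono: "s i \<le> s j" if "i \<le> j" "j \<le> N" for i j
    using that
  proof (induction j)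
    case (Suc j)
    show ?case
    proof (cases "i = Suc j")
      case False
      hence "s i \<le> s j" using Suc by simp
      also have "s j \<le> s (Suc j)" using Suc by (intro empty(2)) simp
      finally show ?thesis .
    qed simp
  qed simp
  have "(\<Sum>i<N. (cum x (s (Suc i)) - cum x (s i))\<^sup>2) \<le> (\<Sum>i<N. exp L * (nrm (s (Suc i)) x - nrm (s i) x)\<^sup>2)"
  proof (rule sum_mono)
    fix i assume i: "i \<in> {..<N}"
    have "\<bar>cum x (s (Suc i)) - cum x (s i)\<bar> \<le> exp (s (Suc i) / 2) * (nrm (s (Suc i)) x - nrm (s i) x)"
      using i empty(2) by (intro cum_diff_le) auto
    also have "\<dots> \<le> exp (L / 2) * (nrm (s (Suc i)) x - nrm (s i) x)"
      using i mono[of "Suc i" N] empty by (intro mult_right_mono) (auto intro: nrm_mono)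
    finally have "\<bar>cum x (s (Suc i)) - cum x (s i)\<bar>\<^sup>2 \<le> (exp (L / 2) * (nrm (s (Suc i)) x - nrm (s i) x))\<^sup>2"
      by (intro power_mono) auto
    thus "(cum x (s (Suc i)) - cum x (s i))\<^sup>2 \<le> exp L * (nrm (s (Suc i)) x - nrm (s i) x)\<^sup>2"
      by (simp add: power_mult_distrib flip: exp_double)
  qed
  also have "\<dots> = exp L * (\<Sum>i<N. (nrm (s (Suc i)) x - nrm (s i) x)\<^sup>2)" by (simp add: sum_distrib_left)
  also have "\<dots> \<le> exp L * (nrm (s N) x)\<^sup>2"
    by (intro mult_left_mono telescoping_squares_le nrm_mono nrm_nonneg empty) auto
  also have "\<dots> \<le> exp L * c"
    using c empty power_mono[OF nrm_mono[of "s N" L0 x] nrm_nonneg, of 2] by (intro mult_left_mono) auto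
  finally show ?case by (simp add: PiM_empty ennreal_leI)
next
  case (insert j J)
  define F where "F om = (\<Sum>i<N. (Q e (insert j J) x om (s (Suc i)) - Q e (insert j J) x om (s i))\<^sup>2)" for om
  define G where "G om = (\<Sum>i<N. (Q e J x om (s (Suc i) - om j) - Q e J x om (s i - om j))\<^sup>2)" for om
  define H where "H om = (\<Sum>i<N. (Q e J ((1 + sc e * mm j) * x) om (s (Suc i)) - Q e J ((1 + sc e * mm j) * x) om (s i))\<^sup>2)" for om
  have comp: "(\<lambda>om. om k) \<in> borel_measurable (PiM (insert j J) MM)" if "k \<in> insert j J" for k
    using measurable_component_singleton[OF that, of MM] by (simp cong: measurable_cong_sets)
  have mF: "(\<lambda>om. ennreal (F om)) \<in> borel_measurable (PiM (insert j J) MM)"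
    unfolding F_def using insert(1) by (intro measurable_compose[OF _ measurable_ennreal] borel_measurable_sum borel_measurable_power borel_measurable_diff measurable_Q) auto
  have mG [measurable]: "(\<lambda>om. ennreal (G om)) \<in> borel_measurable (PiM (insert j J) MM)"
    unfolding G_def using insert(1)
    by (intro measurable_compose[OF _ measurable_ennreal] borel_measurable_sum borel_measurable_power borel_measurable_diff measurable_Q_pair comp borel_measurable_const) auto
  have mH: "(\<lambda>om. ennreal (H om)) \<in> borel_measurable (PiM J MM)"
    unfolding H_def using insert(1) by (intro measurable_compose[OF _ measurable_ennreal] borel_measurable_sum borel_measurable_power borel_measurable_diff measurable_Q) auto
  have upd: "Q e J y (fun_upd om j u) t = Q e J y om t" for y om u t
    using insert(2) by (intro Q_cong) auto
  have c0: "c \<ge> 0" using insert.prems(1)[of "{}"] by (simp add: order_trans[OF zero_le_power2])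
  have pr0: "(\<Prod>j\<in>J. 1 + exp (- T j) * r) \<ge> 0" using r by (intro prod_nonneg) (auto intro: add_nonneg_nonneg)
  have "(\<integral>\<^sup>+om. ennreal (F om) \<partial>PiM (insert j J) MM) = (\<integral>\<^sup>+om. (\<integral>\<^sup>+y. ennreal (F (fun_upd om j y)) \<partial>MM j) \<partial>PiM J MM)"
    by (rule MM.product_nn_integral_insert[OF insert(1,2) mF])
  also have "\<dots> \<le> (\<integral>\<^sup>+om. ennreal (H om) + (\<integral>\<^sup>+y. ennreal (G (fun_upd om j y)) \<partial>MM j) \<partial>PiM J MM)"
    unfolding F_def G_def H_def Q_insert[OF insert(1,2)] upd fun_upd_same
    by (intro nn_integral_mono inner_bound insert(1) e)
  also have "\<dots> = (\<integral>\<^sup>+om. ennreal (H om) \<partial>PiM J MM) + (\<integral>\<^sup>+om. (\<integral>\<^sup>+y. ennreal (G (fun_upd om j y)) \<partial>MM j) \<partial>PiM J MM)"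
    by (intro nn_integral_add mH) measurable
  also have "(\<integral>\<^sup>+om. (\<integral>\<^sup>+y. ennreal (G (fun_upd om j y)) \<partial>MM j) \<partial>PiM J MM) = (\<integral>\<^sup>+om. ennreal (G om) \<partial>PiM (insert j J) MM)"
    by (rule MM.product_nn_integral_insert[OF insert(1,2) mG, symmetric])
  also have "\<dots> = (\<integral>\<^sup>+y. (\<integral>\<^sup>+om. ennreal (G (fun_upd om j y)) \<partial>PiM J MM) \<partial>MM j)"
    by (rule MM.product_nn_integral_insert_rev[OF insert(1,2) mG])
  also have "\<dots> \<le> (\<integral>\<^sup>+y. ennreal (exp L * (c * exp (- T j) * r) * (\<Prod>j\<in>J. 1 + exp (- T j) * r)) \<partial>MM j)"
  proof (rule nn_integral_mono_AE)
    show "AE y in MM j. (\<integral>\<^sup>+om. ennreal (G (fun_upd om j y)) \<partial>PiM J MM) \<le> ennreal (exp L * (c * exp (- T j) * r) * (\<Prod>j\<in>J. 1 + exp (- T j) * r))"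
      using AE_MM[of j]
    proof eventually_elim
      \<comment> \<open>The shift lowers the bound L by y \<ge> T j, which produces the factor exp
        (- T j). The factor j is then absent from the product, which costs one factor r in the
        hypothesis on S.\<close>
      case (elim y)
      have "(\<integral>\<^sup>+om. ennreal (G (fun_upd om j y)) \<partial>PiM J MM) \<le> ennreal (exp (L - y) * (c * r) * (\<Prod>j\<in>J. 1 + exp (- T j) * r))"
        unfolding G_def upd fun_upd_same
      proof (rule insert.IH)
        fix S assume S: "S \<subseteq> J"
        have "(nrm L0 ((\<Prod>j\<in>insert j J - insert j S. 1 + sc e * mm j) * x))\<^sup>2 \<le> c * r ^ card (insert j S)"
          using S by (intro insert.prems) auto
        moreover have "insert j J - insert j S = J - S" using S insert(2) by auto
        moreover have "card (insert j S) = Suc (card S)" using S insert(1,2) by (intro card_insert_disjoint) (auto intro: finite_subset)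
        ultimately show "(nrm L0 ((\<Prod>j\<in>J - S. 1 + sc e * mm j) * x))\<^sup>2 \<le> c * r * r ^ card S" by simp
      next
        show "s N - y \<le> L - y" using insert.prems by simp
        show "L - y \<le> L0" using insert.prems elim T_ge_1[of j] by linarith
      qed (use insert.prems in auto)
      also have "\<dots> \<le> ennreal (exp L * (c * exp (- T j) * r) * (\<Prod>j\<in>J. 1 + exp (- T j) * r))"
      proof (intro ennreal_leI mult_right_mono pr0)
        have "exp (L - y) \<le> exp L * exp (- T j)" using elim by (simp flip: exp_add)
        hence "exp (L - y) * (c * r) \<le> exp L * exp (- T j) * (c * r)" using c0 r by (intro mult_right_mono) auto
        thus "exp (L - y) * (c * r) \<le> exp L * (c * exp (- T j) * r)" by (simp add: mult_ac)
      qed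
      finally show ?case .
    qed
  qed
  also have "\<dots> = ennreal (exp L * (c * exp (- T j) * r) * (\<Prod>j\<in>J. 1 + exp (- T j) * r))"
    using prob_space.emeasure_space_1[OF prob_space_MM[of j]] by simp
  also have "(\<integral>\<^sup>+om. ennreal (H om) \<partial>PiM J MM) \<le> ennreal (exp L * c * (\<Prod>j\<in>J. 1 + exp (- T j) * r))"
    unfolding H_def
  proof (rule insert.IH)
    \<comment> \<open>With j frozen at its mean, its factor is moved into x; the set S of shifted
      indices and the constant c do not change.\<close>
    fix S assume S: "S \<subseteq> J"
    have "(nrm L0 ((\<Prod>j\<in>insert j J - S. 1 + sc e * mm j) * x))\<^sup>2 \<le> c * r ^ card S"
      using S by (intro insert.prems) auto
    moreover have "insert j J - S = insert j (J - S)" using S insert(2) by auto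
    moreover have "(\<Prod>j\<in>insert j (J - S). 1 + sc e * mm j) = (1 + sc e * mm j) * (\<Prod>j\<in>J - S. 1 + sc e * mm j)"
      using insert(1,2) by (intro prod.insert) auto
    ultimately show "(nrm L0 ((\<Prod>j\<in>J - S. 1 + sc e * mm j) * ((1 + sc e * mm j) * x)))\<^sup>2 \<le> c * r ^ card S"
      by (simp add: mult_ac)
  qed (use insert.prems in auto)
  finally have "(\<integral>\<^sup>+om. ennreal (F om) \<partial>PiM (insert j J) MM) \<le> ennreal (exp L * c * (\<Prod>j\<in>J. 1 + exp (- T j) * r)) +
     ennreal (exp L * (c * exp (- T j) * r) * (\<Prod>j\<in>J. 1 + exp (- T j) * r))" by simp
  also have "\<dots> = ennreal (exp L * c * (\<Prod>j\<in>J. 1 + exp (- T j) * r) + exp L * (c * exp (- T j) * r) * (\<Prod>j\<in>J. 1 + exp (- T j) * r))"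
    using c0 r pr0 by (intro ennreal_plus[symmetric]) (auto intro!: mult_nonneg_nonneg)
  also have "exp L * c * (\<Prod>j\<in>J. 1 + exp (- T j) * r) + exp L * (c * exp (- T j) * r) * (\<Prod>j\<in>J. 1 + exp (- T j) * r) =
     exp L * c * (\<Prod>j\<in>insert j J. 1 + exp (- T j) * r)"
    using insert(1,2) by (simp add: algebra_simps)
  finally show ?case unfolding F_def .
qed

text \<open>The binary expansion of \<open>m\<close> splits \<open>[0, m]\<close> into at most one dyadic interval per level.\<close>
lemma dyadic_chaining:
  fixes f :: "nat \<Rightarrow> real"
  assumes "m \<le> 2 ^ k"
  shows "(f m - f 0)\<^sup>2 \<le> (\<Sum>l\<le>k. \<Sum>i<2^(k-l). (f (Suc i * 2 ^ l) - f (i * 2 ^ l))\<^sup>2) * real (Suc k)"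
proof -
  \<comment> \<open>\<open>g l\<close> evaluates f at m rounded down to a multiple of 2 ^ l; at
    level k + 1 this is 0.\<close>
  define g where "g l = f (m div 2 ^ l * 2 ^ l)" for l
  have "m < 2 ^ Suc k" using assms by (simp add: order_le_less_trans[of m "2^k"])
  hence "f m - f 0 = g 0 - g (Suc k)" by (simp add: g_def)
  also have "\<dots> = (\<Sum>l<Suc k. g l - g (Suc l))" by (rule sum_lessThan_telescope'[symmetric])
  finally have eq: "f m - f 0 = (\<Sum>l\<le>k. g l - g (Suc l))" by (simp only: lessThan_Suc_atMost)
  \<comment> \<open>Cauchy-Schwarz over the k + 1 levels.\<close>
  have "(f m - f 0)\<^sup>2 \<le> (\<Sum>l\<le>k. (g l - g (Suc l))\<^sup>2) * real (Suc k)"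
    unfolding eq using sum_squared_le_sum_of_squares[of "\<lambda>l. g l - g (Suc l)" "{..k}"] by simp
  also have "(\<Sum>l\<le>k. (g l - g (Suc l))\<^sup>2) \<le> (\<Sum>l\<le>k. \<Sum>i<2^(k-l). (f (Suc i * 2 ^ l) - f (i * 2 ^ l))\<^sup>2)"
  proof (rule sum_mono)
    fix l assume l: "l \<in> {..k}"
    define a where "a = m div 2 ^ l"
    have S: "m div 2 ^ Suc l = a div 2" by (simp only: a_def power_Suc2 div_mult2_eq)
    show "(g l - g (Suc l))\<^sup>2 \<le> (\<Sum>i<2^(k-l). (f (Suc i * 2 ^ l) - f (i * 2 ^ l))\<^sup>2)"
    proof (cases "even a")
      case True
      have "g l = g (Suc l)" using True unfolding g_def S a_def[symmetric] by (simp add: mult.assoc[symmetric])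
      thus ?thesis by (auto intro: sum_nonneg)
    next
      case False
      define i where "i = a - 1"
      have a: "a = Suc i" "even i" using False by (auto simp: i_def elim!: oddE)
      have "a * 2 ^ l \<le> m" by (simp add: a_def)
      also have "m \<le> 2 ^ (k - l) * 2 ^ l" using assms l by (simp flip: power_add)
      finally have "i < 2 ^ (k - l)" using a mult_right_le_imp_le[of a "2^l" "2^(k-l)"] by simp
      moreover have "g l - g (Suc l) = f (Suc i * 2 ^ l) - f (i * 2 ^ l)"
        using a unfolding g_def S a_def[symmetric] by (simp add: mult.assoc[symmetric])
      ultimately show ?thesis by (auto intro!: member_le_sum[where f = "\<lambda>i. (f (Suc i * 2 ^ l) - f (i * 2 ^ l))\<^sup>2" and i = i, simplified])
    qed
  qed
  finally show ?thesis by (simp add: mult_right_mono)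
qed

text \<open>Mertens' estimate for the cells. Unit mass and t * phi t \<le> exp t give exp (- T (Suc
  n)) \<le> 1 - T n / T (Suc n) \<le> ln (T (Suc n)) - ln (T n), which telescopes. Euler products
  over the primes up to x are thereby kept within powers of ln x.\<close>

lemma sum_exp_T: "(\<Sum>j<n. exp (- T j)) \<le> 1 + ln (T n)"
proof -
  have "(\<Sum>j<n. exp (- T j)) + exp (- T n) \<le> 1 + ln (T n)"
  proof (induction n)
    case 0
    have "exp (- T 0) \<le> 1" using T_ge_1[of 0] by simp
    thus ?case using T_ge_1[of 0] by (simp add: add_increasing2)
  next
    case (Suc n)
    let ?a = "T n" and ?b = "T (Suc n)"
    have ab: "1 \<le> ?a" "?a < ?b" using T_ge_1 by (auto simp: T_less_iff)
    have "1 = Phi ?b - Phi ?a" by (simp add: Phi_T)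
    also have "\<dots> \<le> phi ?b * (?b - ?a)" using ab by (intro Phi_MVT) auto
    also have "\<dots> \<le> exp ?b / ?b * (?b - ?a)"
      using t_phi_le[of ?b] ab by (intro mult_right_mono) (auto simp: field_simps)
    finally have "exp (- ?b) * 1 \<le> exp (- ?b) * (exp ?b / ?b * (?b - ?a))"
      by (intro mult_left_mono) auto
    also have "\<dots> = 1 - ?a / ?b" using ab by (simp add: exp_minus field_simps)
    also have "\<dots> \<le> ln (?b / ?a)"
      using ln_le_minus_one[of "?a / ?b"] ab by (simp add: ln_div)
    also have "\<dots> = ln ?b - ln ?a" using ab by (simp add: ln_div)
    finally show ?case using Suc by simp
  qed
  thus ?thesis by (smt (verit) exp_gt_zero)
qed

text \<open>The default -1 is negative, so the distribution functions vanish there. An increment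
  from m = 0 is thus a value, and chaining bounds values instead of differences only.\<close>

definition lg :: "nat \<Rightarrow> real" where "lg m = (if m = 0 then -1 else ln (real m))"

lemma lg_mono: "m \<le> n \<Longrightarrow> lg m \<le> lg n"
  by (auto simp: lg_def intro: order_trans[of _ 0])

text \<open>Enough cells for the range up to 2 ^ k: all points from cell \<open>nn k\<close> on lie
  above k * ln 2.\<close>

definition nn :: "nat \<Rightarrow> nat" where "nn k = (LEAST n. T n > real k * ln 2)"

lemma nn_gt: "T (nn k) > real k * ln 2" and nn_le: "T (nn k) \<le> real k + T 0 + 2"
proof -
  show "T (nn k) > real k * ln 2" unfolding nn_def using T_unbounded by (rule LeastI_ex)
  show "T (nn k) \<le> real k + T 0 + 2"
  proof (cases "nn k")
    case (Suc n)
    hence "\<not> T n > real k * ln 2" using not_less_Least[of n "\<lambda>n. T n > real k * ln 2"] by (simp add: nn_def)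
    moreover have "real k * ln 2 \<le> real k * 1" using ln_2_less_1 by (intro mult_left_mono) auto
    ultimately show ?thesis using T_Suc_le[of n] Suc T_ge_1[of 0] by auto
  qed simp
qed

text \<open>Squared increments of the compensated distribution function on the grid of the ln m with
  m \<le> 2 ^ k, added over all dyadic levels. Through \<open>dyadic_chaining\<close> this single
  random variable controls all grid points at once.\<close>

definition ZZ :: "nat \<Rightarrow> real \<Rightarrow> (nat \<Rightarrow> real) \<Rightarrow> real" where
  "ZZ k e om = (\<Sum>l\<le>k. \<Sum>i<2^(k-l). (Q e {..<nn k} (tht e) om (lg (Suc i * 2 ^ l)) - Q e {..<nn k} (tht e) om (lg (i * 2 ^ l)))\<^sup>2)"

lemma ZZ_nonneg: "ZZ k e om \<ge> 0" by (auto simp: ZZ_def intro!: sum_nonneg)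

lemma measurable_ZZ: "{..<nn k} \<subseteq> I \<Longrightarrow> (\<lambda>om. ZZ k e om) \<in> borel_measurable (PiM I MM)"
  unfolding ZZ_def by (intro borel_measurable_sum borel_measurable_power borel_measurable_diff measurable_Q) auto

text \<open>\<open>second_moment\<close> is applied on each of the k + 1 levels. Its constant c
  comes from \<open>nrm_BB\<close> and r from \<open>nrm_BB_remove\<close>, while the product of the
  1 + exp (- T j) * r is at most a power of T (nn k) by \<open>sum_exp_T\<close>.\<close>

lemma expect_ZZ: "\<exists>C q. C > 0 \<and> (\<forall>k e. (e = 1 \<or> e = -1) \<longrightarrow>
   (\<integral>\<^sup>+om. ennreal (ZZ k e om) \<partial>PiM UNIV MM) \<le> ennreal (C * 2 ^ k * (1 + real k) ^ q))"
proof -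
  obtain C p where C: "C > 0" "\<And>e n L. (e = 1 \<or> e = -1) \<Longrightarrow> 0 \<le> L \<Longrightarrow> L < T n \<Longrightarrow> nrm L (BB e {..<n}) \<le> C * (1 + L) ^ p"
    using nrm_BB by blast
  define \<kappa> :: real where "\<kappa> = 1 / (1 - exp (-1/2))"
  have \<kappa>: "\<kappa> \<ge> 1" unfolding \<kappa>_def by simp
  define r where "r = \<kappa>\<^sup>2"
  have r: "r \<ge> 1" using \<kappa> by (simp add: r_def)
  define b where "b = nat \<lceil>r\<rceil>"
  have b: "r \<le> real b" using r by (simp add: b_def)
  define A where "A = exp r * (T 0 + 2) ^ b * C\<^sup>2"
  have "A > 0" unfolding A_def using T_ge_1[of 0] C by (intro mult_pos_pos zero_less_power) auto
  moreover have "(\<integral>\<^sup>+om. ennreal (ZZ k e om) \<partial>PiM UNIV MM) \<le> ennreal (A * 2 ^ k * (1 + real k) ^ (b + 2 * p + 1))"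
    if e: "e = 1 \<or> e = -1" for k e
  proof -
    define J where "J = {..<nn k}"
    define L where "L = real k * ln 2"
    have L: "0 \<le> L" "L < T (nn k)" using nn_gt by (auto simp: L_def)
    have expL: "exp L = 2 ^ k" by (simp add: L_def exp_of_nat_mult)
    have Lk: "L \<le> real k" unfolding L_def using ln_2_less_1 mult_left_mono[of "ln 2" 1 "real k"] by simp
    define c where "c = (nrm L (BB e J))\<^sup>2"
    have cle: "c \<le> C\<^sup>2 * (1 + real k) ^ (2 * p)"
    proof -
      have "nrm L (BB e J) \<le> C * (1 + L) ^ p" unfolding J_def by (rule C(2)[OF e L])
      also have "\<dots> \<le> C * (1 + real k) ^ p" using C Lk L by (intro mult_left_mono power_mono) auto
      finally have "c \<le> (C * (1 + real k) ^ p)\<^sup>2" unfolding c_def by (intro power_mono nrm_nonneg)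
      thus ?thesis by (simp add: power_mult_distrib mult.commute flip: power_mult)
    qed
    have pr: "(\<Prod>j\<in>J. 1 + exp (- T j) * r) \<le> exp r * (T 0 + 2) ^ b * (1 + real k) ^ b"
    proof -
      have "(\<Prod>j\<in>J. 1 + exp (- T j) * r) \<le> (\<Prod>j\<in>J. exp (exp (- T j) * r))"
        using r by (intro prod_mono) (auto intro: add_nonneg_nonneg)
      also have "\<dots> = exp ((\<Sum>j<nn k. exp (- T j)) * r)" by (simp add: exp_sum J_def sum_distrib_right)
      also have "\<dots> \<le> exp ((1 + ln (T (nn k))) * r)" using sum_exp_T r by (simp add: mult_right_mono)
      also have "\<dots> = exp r * exp (ln (T (nn k)) * r)" by (simp add: algebra_simps flip: exp_add)
      also have "exp (ln (T (nn k)) * r) \<le> exp (ln (T (nn k)) * real b)"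
        using b T_ge_1 by (simp add: mult_left_mono)
      also have "\<dots> = T (nn k) ^ b" using T_ge_1[of "nn k"] by (simp add: mult.commute exp_of_nat_mult)
      also have "\<dots> \<le> ((T 0 + 2) * (1 + real k)) ^ b"
      proof (rule power_mono)
        have "real k \<le> real k * (T 0 + 2)" using T_ge_1[of 0] mult_left_mono[of 1 "T 0 + 2" "real k"] by simp
        thus "T (nn k) \<le> (T 0 + 2) * (1 + real k)" using nn_le[of k] by (simp add: algebra_simps)
      qed (use T_ge_1[of "nn k"] in auto)
      finally show ?thesis by (simp add: power_mult_distrib mult_ac)
    qed
    have lev: "(\<integral>\<^sup>+om. ennreal (\<Sum>i<2^(k-l). (Q e J (tht e) om (lg (Suc i * 2 ^ l)) - Q e J (tht e) om (lg (i * 2 ^ l)))\<^sup>2) \<partial>PiM J MM)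
        \<le> ennreal (A * 2 ^ k * (1 + real k) ^ (b + 2 * p))" if l: "l \<le> k" for l
    proof -
      have "(\<integral>\<^sup>+om. ennreal (\<Sum>i<2^(k-l). (Q e J (tht e) om (lg (Suc i * 2 ^ l)) - Q e J (tht e) om (lg (i * 2 ^ l)))\<^sup>2) \<partial>PiM J MM)
         \<le> ennreal (exp L * c * (\<Prod>j\<in>J. 1 + exp (- T j) * r))"
      proof (rule second_moment[where s = "\<lambda>i. lg (i * 2 ^ l)" and ?L0.0 = L])
        fix S assume S: "S \<subseteq> J"
        have "nrm L (BB e (J - S)) \<le> nrm L (BB e J) * \<kappa> ^ card S"
          unfolding \<kappa>_def by (rule nrm_BB_remove[OF e _ S]) (simp add: J_def)
        hence "(nrm L (BB e (J - S)))\<^sup>2 \<le> (nrm L (BB e J) * \<kappa> ^ card S)\<^sup>2" by (intro power_mono nrm_nonneg)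
        also have "\<dots> = c * r ^ card S" by (simp add: c_def r_def power_mult_distrib mult.commute flip: power_mult)
        finally show "(nrm L ((\<Prod>j\<in>J - S. 1 + sc e * mm j) * tht e))\<^sup>2 \<le> c * r ^ card S" by (simp add: BB_def)
      next
        have "(2::nat) ^ (k - l) * 2 ^ l = 2 ^ k" using l by (simp flip: power_add)
        thus "lg (2 ^ (k - l) * 2 ^ l) \<le> L" by (simp add: lg_def L_def ln_realpow)
      qed (use e r in \<open>auto simp: J_def intro!: lg_mono\<close>)
      also have "\<dots> \<le> ennreal (2 ^ k * (C\<^sup>2 * (1 + real k) ^ (2 * p)) * (exp r * (T 0 + 2) ^ b * (1 + real k) ^ b))"
        unfolding expL using cle pr r C
        by (intro ennreal_leI mult_mono mult_left_mono prod_nonneg mult_nonneg_nonneg add_nonneg_nonneg) (auto simp: c_def)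
      also have "\<dots> = ennreal (A * 2 ^ k * (1 + real k) ^ (b + 2 * p))" by (simp add: A_def power_add mult_ac)
      finally show ?thesis .
    qed
    have m: "(\<lambda>om. ennreal (\<Sum>i<2^(k-l). (Q e J (tht e) om (lg (Suc i * 2 ^ l)) - Q e J (tht e) om (lg (i * 2 ^ l)))\<^sup>2)) \<in> borel_measurable (PiM J MM)" for l
      by (intro measurable_compose[OF _ measurable_ennreal] borel_measurable_sum borel_measurable_power borel_measurable_diff measurable_Q) (auto simp: J_def)
    have "(\<integral>\<^sup>+om. ennreal (ZZ k e om) \<partial>PiM J MM) = (\<integral>\<^sup>+om. (\<Sum>l\<le>k. ennreal (\<Sum>i<2^(k-l). (Q e J (tht e) om (lg (Suc i * 2 ^ l)) - Q e J (tht e) om (lg (i * 2 ^ l)))\<^sup>2)) \<partial>PiM J MM)"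
      unfolding ZZ_def J_def by (subst sum_ennreal[symmetric]) (auto intro: sum_nonneg)
    also have "\<dots> = (\<Sum>l\<le>k. (\<integral>\<^sup>+om. ennreal (\<Sum>i<2^(k-l). (Q e J (tht e) om (lg (Suc i * 2 ^ l)) - Q e J (tht e) om (lg (i * 2 ^ l)))\<^sup>2) \<partial>PiM J MM))"
      by (intro nn_integral_sum m)
    also have "\<dots> \<le> (\<Sum>l\<le>k. ennreal (A * 2 ^ k * (1 + real k) ^ (b + 2 * p)))"
      by (intro sum_mono lev) auto
    also have "\<dots> = ennreal (\<Sum>l\<le>k. A * 2 ^ k * (1 + real k) ^ (b + 2 * p))"
      using \<open>A > 0\<close> by (intro sum_ennreal) auto
    also have "(\<Sum>l\<le>k. A * 2 ^ k * (1 + real k) ^ (b + 2 * p)) = A * 2 ^ k * (1 + real k) ^ (b + 2 * p + 1)"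
      by (simp add: mult_ac)
    finally have fin: "(\<integral>\<^sup>+om. ennreal (ZZ k e om) \<partial>PiM J MM) \<le> ennreal (A * 2 ^ k * (1 + real k) ^ (b + 2 * p + 1))" .
    have "(\<integral>\<^sup>+om. ennreal (ZZ k e om) \<partial>PiM J MM) = (\<integral>\<^sup>+om. ennreal (ZZ k e om) \<partial>distr (PiM UNIV MM) (PiM J MM) (\<lambda>x. restrict x J))"
      by (subst MM.distr_PiM_restrict_finite) (auto simp: J_def)
    also have "\<dots> = (\<integral>\<^sup>+om. ennreal (ZZ k e (restrict om J)) \<partial>PiM UNIV MM)"
      by (rule nn_integral_distr) (auto intro!: measurable_restrict_subset measurable_compose[OF _ measurable_ennreal] measurable_ZZ simp: J_def)
    also have "\<dots> = (\<integral>\<^sup>+om. ennreal (ZZ k e om) \<partial>PiM UNIV MM)"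
    proof -
      have "Q e J x (restrict om J) t = Q e J x om t" for x om t by (rule Q_cong) auto
      thus ?thesis unfolding ZZ_def J_def by simp
    qed
    finally show ?thesis using fin by simp
  qed
  ultimately show ?thesis by blast
qed

text \<open>The sum of all ZZ, divided by their expected sizes and by a further (1 + k) ^ 2 for
  convergence, has finite expectation. It is therefore finite at almost every sample, and at almost
  every sample all points lie in their cells; any sample with both properties serves.\<close>

lemma good_sample:
  "\<exists>om C q. C > 0 \<and> (\<forall>j. T j \<le> om j \<and> om j < T (Suc j)) \<and>
     (\<forall>k e. (e = 1 \<or> e = -1) \<longrightarrow> ZZ k e om \<le> C * 2 ^ k * (1 + real k) ^ q)"
proof -
  obtain C q where C: "C > 0" "\<And>k e. (e = 1 \<or> e = -1) \<Longrightarrow>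
     (\<integral>\<^sup>+om. ennreal (ZZ k e om) \<partial>PiM UNIV MM) \<le> ennreal (C * 2 ^ k * (1 + real k) ^ q)"
    using expect_ZZ by blast
  define w :: "nat \<Rightarrow> real" where "w k = 1 / (2 ^ k * (1 + real k) ^ (q + 2))" for k
  have w: "w k > 0" for k by (auto simp: w_def)
  define G where "G om = (\<Sum>k. ennreal (w k * (ZZ k 1 om + ZZ k (-1) om)))" for om
  have m [measurable]: "(\<lambda>om. ZZ k e om) \<in> borel_measurable (PiM UNIV MM)" for k e by (rule measurable_ZZ) auto
  have mG [measurable]: "G \<in> borel_measurable (PiM UNIV MM)" unfolding G_def[abs_def] by measurable
  have "(\<integral>\<^sup>+om. G om \<partial>PiM UNIV MM) = (\<Sum>k. (\<integral>\<^sup>+om. ennreal (w k * (ZZ k 1 om + ZZ k (-1) om)) \<partial>PiM UNIV MM))"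
    unfolding G_def by (rule nn_integral_suminf) measurable
  also have "\<dots> \<le> (\<Sum>k. ennreal (2 * C * (1 / real (Suc k) ^ 2)))"
  proof (rule suminf_le[OF _ summableI summableI])
    fix k
    have "(\<integral>\<^sup>+om. ennreal (w k * (ZZ k 1 om + ZZ k (-1) om)) \<partial>PiM UNIV MM) =
      (\<integral>\<^sup>+om. ennreal (w k) * (ennreal (ZZ k 1 om) + ennreal (ZZ k (-1) om)) \<partial>PiM UNIV MM)"
      using w[of k] by (simp add: ennreal_mult ennreal_plus ZZ_nonneg add_nonneg_nonneg)
    also have "\<dots> = ennreal (w k) * ((\<integral>\<^sup>+om. ennreal (ZZ k 1 om) \<partial>PiM UNIV MM) + (\<integral>\<^sup>+om. ennreal (ZZ k (-1) om) \<partial>PiM UNIV MM))"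
      by (simp add: nn_integral_cmult nn_integral_add)
    also have "\<dots> \<le> ennreal (w k) * (ennreal (C * 2 ^ k * (1 + real k) ^ q) + ennreal (C * 2 ^ k * (1 + real k) ^ q))"
      using C(2) by (intro mult_left_mono add_mono) auto
    also have "\<dots> = ennreal (w k * (C * 2 ^ k * (1 + real k) ^ q + C * 2 ^ k * (1 + real k) ^ q))"
    proof -
      have nn: "0 \<le> C * 2 ^ k * (1 + real k) ^ q" using C(1) by simp
      show ?thesis using nn w[of k]
        by (simp only: ennreal_plus[symmetric] ennreal_mult[symmetric] add_nonneg_nonneg less_imp_le)
    qed
    also have "w k * (C * 2 ^ k * (1 + real k) ^ q + C * 2 ^ k * (1 + real k) ^ q) = 2 * C * (1 / real (Suc k) ^ 2)"
    proof -
      have gen: "X \<noteq> 0 \<Longrightarrow> (1 / X * s) * (C * X + C * X) = 2 * C * s" for X s :: real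
        by (simp add: field_simps)
      have "w k = 1 / (2 ^ k * (1 + real k) ^ q) * (1 / real (Suc k) ^ 2)"
        by (simp add: w_def power_add mult.assoc power2_eq_square del: One_nat_def)
      thus ?thesis using gen[of "2 ^ k * (1 + real k) ^ q" "1 / real (Suc k) ^ 2"] by (simp only: mult.assoc) simp
    qed
    finally show "(\<integral>\<^sup>+om. ennreal (w k * (ZZ k 1 om + ZZ k (-1) om)) \<partial>PiM UNIV MM) \<le> ennreal (2 * C * (1 / real (Suc k) ^ 2))" .
  qed
  also have "\<dots> = ennreal (\<Sum>k. 2 * C * (1 / real (Suc k) ^ 2))"
    using summable_zt[of 0] C(1) by (intro suminf_ennreal2 summable_mult) (auto simp: power2_eq_square)
  also have "\<dots> < \<infinity>" by simp
  finally have "(\<integral>\<^sup>+om. G om \<partial>PiM UNIV MM) \<noteq> \<infinity>" by simp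
  from nn_integral_PInf_AE[OF mG this] have "AE om in PiM UNIV MM. G om \<noteq> \<infinity>" .
  moreover have "AE om in PiM UNIV MM. \<forall>j. T j \<le> om j \<and> om j < T (Suc j)"
    unfolding AE_all_countable by (intro allI MM.AE_component AE_MM) auto
  ultimately have ae: "AE om in PiM UNIV MM. G om \<noteq> \<infinity> \<and> (\<forall>j. T j \<le> om j \<and> om j < T (Suc j))" by eventually_elim auto
  have "\<exists>om. G om \<noteq> \<infinity> \<and> (\<forall>j. T j \<le> om j \<and> om j < T (Suc j))"
  proof (rule ccontr)
    assume no: "\<nexists>om. G om \<noteq> \<infinity> \<and> (\<forall>j. T j \<le> om j \<and> om j < T (Suc j))"
    from ae have "AE om in PiM UNIV MM. False"
    proof (rule eventually_mono)
      fix om assume *: "G om \<noteq> \<infinity> \<and> (\<forall>j. T j \<le> om j \<and> om j < T (Suc j))"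
      show False using no by (rule notE) (rule exI[of _ om], rule *)
    qed
    thus False by (simp only: MM.P.AE_False)
  qed
  then obtain om where om: "G om \<noteq> \<infinity>" "\<forall>j. T j \<le> om j \<and> om j < T (Suc j)" by blast
  define D where "D = enn2real (G om)"
  have GD: "G om = ennreal D" using om(1) by (simp add: D_def less_top)
  have "ZZ k e om \<le> (D + 1) * 2 ^ k * (1 + real k) ^ (q + 2)" if "e = 1 \<or> e = -1" for k e
  proof -
    have "ennreal (w k * (ZZ k 1 om + ZZ k (-1) om)) \<le> G om"
      unfolding G_def using sum_le_suminf[OF summableI, of "{k}" "\<lambda>k. ennreal (w k * (ZZ k 1 om + ZZ k (-1) om))"] by simp
    hence "w k * (ZZ k 1 om + ZZ k (-1) om) \<le> D" unfolding GD by (subst (asm) ennreal_le_iff) (auto simp: D_def)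
    moreover have "w k * ZZ k e om \<le> w k * (ZZ k 1 om + ZZ k (-1) om)"
      using that w[of k] ZZ_nonneg by (intro mult_left_mono) auto
    ultimately have "w k * ZZ k e om \<le> D + 1" by linarith
    moreover have "2 ^ k * (1 + real k) ^ (q + 2) > 0" by (intro mult_pos_pos zero_less_power) auto
    ultimately show ?thesis unfolding w_def by (simp only: mult.assoc pos_divide_le_eq times_divide_eq_left mult_1)
  qed
  moreover have "D + 1 > 0" unfolding D_def by (simp add: add_nonneg_pos)
  ultimately show ?thesis using om(2) by blast
qed

section \<open>Squarefree integers of the random system\<close>

text \<open>Cut off at 1, so that its powers are at least 1 and monotone on all positive x,
  including x < 1.\<close>

definition LL :: "real \<Rightarrow> real" where "LL x = 1 + max 0 (ln x)"

lemma LL_ge_1 [simp]: "LL x \<ge> 1" by (simp add: LL_def)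
lemma LL_pos [simp]: "LL x > 0" using LL_ge_1[of x] by linarith
lemma LL_mono: "0 < x \<Longrightarrow> x \<le> y \<Longrightarrow> LL x \<le> LL y"
  using ln_le_cancel_iff[of x y] unfolding LL_def by (auto simp: max_def)
lemma LL_eq: "x \<ge> 1 \<Longrightarrow> LL x = 1 + ln x" by (simp add: LL_def)
lemma LL_power_nonneg [simp]: "0 \<le> LL x ^ q" by (intro zero_le_power less_imp_le[OF LL_pos])
lemma LL_double: "x \<ge> 1 \<Longrightarrow> y \<le> 2 * x \<Longrightarrow> 0 < y \<Longrightarrow> LL y \<le> 2 * LL x"
proof -
  assume x: "x \<ge> 1" "y \<le> 2 * x" "0 < y"
  have "LL y \<le> LL (2 * x)" using x by (intro LL_mono) auto
  also have "\<dots> = 1 + ln 2 + ln x" using x by (simp add: LL_eq ln_mult)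
  also have "\<dots> \<le> 2 * LL x"
  proof -
    have "0 \<le> ln x" using x(1) by (rule ln_ge_zero)
    moreover have "ln 2 \<le> (1 :: real)" using ln_le_minus_one[of "2::real"] by simp
    ultimately show ?thesis unfolding LL_eq[OF x(1)] by argo
  qed
  finally show ?thesis .
qed

definition sub :: "(nat \<Rightarrow> real) \<Rightarrow> real \<Rightarrow> nat set set" where
  "sub om t = {R. finite R \<and> (\<Sum>j\<in>R. om j) \<le> t}"

definition cell_pts :: "(nat \<Rightarrow> real) \<Rightarrow> bool" where
  "cell_pts om \<longleftrightarrow> (\<forall>j. T j \<le> om j \<and> om j < T (Suc j))"

lemma cell_ptsD: "cell_pts om \<Longrightarrow> T j \<le> om j" "cell_pts om \<Longrightarrow> om j < T (Suc j)" "cell_pts om \<Longrightarrow> om j \<ge> 1"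
  using T_ge_1[of j] unfolding cell_pts_def by (auto intro: order_trans)

lemma sum_om_nonneg: "cell_pts om \<Longrightarrow> (\<Sum>j\<in>R. om j) \<ge> 0"
  using cell_ptsD(3)[of om] by (intro sum_nonneg) (auto intro: order_trans[of 0 1])

lemma sub_subset:
  assumes "cell_pts om" "T n > t" "R \<in> sub om t" shows "R \<subseteq> {..<n}"
proof
  fix j assume j: "j \<in> R"
  have R: "finite R" "(\<Sum>j\<in>R. om j) \<le> t" using assms by (auto simp: sub_def)
  have "om j \<le> (\<Sum>j\<in>R. om j)" using R(1) j cell_ptsD(3)[OF assms(1)]
    by (intro member_le_sum) (auto intro: order_trans[of 0 1])
  hence "T j < T n" using R assms cell_ptsD(1)[OF assms(1), of j] by linarith
  thus "j \<in> {..<n}" by (simp add: T_less_iff)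
qed

lemma finite_sub: "cell_pts om \<Longrightarrow> finite (sub om t)"
proof -
  assume "cell_pts om"
  obtain n where "T n > t" using T_unbounded by blast
  hence "sub om t \<subseteq> Pow {..<n}" using sub_subset[OF \<open>cell_pts om\<close>] by blast
  thus ?thesis by (rule finite_subset) simp
qed

lemma sub_mono: "s \<le> t \<Longrightarrow> sub om s \<subseteq> sub om t"
  by (auto simp: sub_def)

lemma sub_neg: "cell_pts om \<Longrightarrow> t < 0 \<Longrightarrow> sub om t = {}"
proof -
  assume "cell_pts om" "t < 0"
  hence "\<not> (\<Sum>j\<in>R. om j) \<le> t" for R using sum_om_nonneg[of om R] by linarith
  thus ?thesis by (simp add: sub_def)
qed

lemma sub_0: "cell_pts om \<Longrightarrow> sub om 0 = {{}}"
proof -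
  assume c: "cell_pts om"
  have "R = {}" if R: "finite R" "(\<Sum>j\<in>R. om j) \<le> 0" for R
  proof (rule ccontr)
    assume "R \<noteq> {}"
    then obtain j where j: "j \<in> R" by blast
    have "om j \<le> (\<Sum>j\<in>R. om j)" using R(1) j cell_ptsD(3)[OF c]
      by (intro member_le_sum) (auto intro: order_trans[of 0 1])
    thus False using R(2) cell_ptsD(3)[OF c, of j] by linarith
  qed
  thus ?thesis by (auto simp: sub_def)
qed

text \<open>Compensated sums over squarefree n with ln n \<le> t. By \<open>cum_tht\<close>, for e =
  1 it is the sum of 1 - (t - ln n), and for e = -1 it is exp t times the sum of \<mu>(n) /
  n.\<close>

definition US :: "real \<Rightarrow> (nat \<Rightarrow> real) \<Rightarrow> real \<Rightarrow> real" where
  "US e om t = (\<Sum>R\<in>sub om t. e ^ card R * cum (tht e) (t - (\<Sum>j\<in>R. om j)))"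

lemma Q_eq_US:
  assumes "cell_pts om" "T n > t"
  shows "Q e {..<n} (tht e) om t = US e om t"
  unfolding Q_def US_def
proof (rule sum.mono_neutral_right)
  show "sub om t \<subseteq> Pow {..<n}" using sub_subset[OF assms] by blast
  show "\<forall>R\<in>Pow {..<n} - sub om t. e ^ card R * cum (tht e) (t - (\<Sum>j\<in>R. om j)) = 0"
    by (auto simp: sub_def cum_neg finite_subset)
qed auto

text \<open>Choose k with m \<le> 2 ^ k \<le> 2 * m. The value at ln m is an increment from
  \<open>lg 0\<close>, so chaining and \<open>good_sample\<close> bound its square by 2 ^ k times a
  power of k.\<close>

lemma random_bound:
  "\<exists>om C q. C > 0 \<and> cell_pts om \<and>
     (\<forall>e m. (e = 1 \<or> e = -1) \<longrightarrow> m \<ge> 1 \<longrightarrow> \<bar>US e om (ln (real m))\<bar> \<le> C * sqrt (real m) * LL (real m) ^ q)"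
proof -
  obtain om C q where C: "C > 0" and om: "cell_pts om" and
    Z: "\<And>k e. (e = 1 \<or> e = -1) \<Longrightarrow> ZZ k e om \<le> C * 2 ^ k * (1 + real k) ^ q"
    using good_sample unfolding cell_pts_def by blast
  have "\<bar>US e om (ln (real m))\<bar> \<le> (sqrt (2 * C * 3 ^ Suc q)) * sqrt (real m) * LL (real m) ^ Suc q"
    if e: "e = 1 \<or> e = -1" and m: "m \<ge> 1" for e m
  proof -
    obtain k where k: "m \<le> 2 ^ k" "2 ^ k \<le> 2 * m"
    proof -
      define k where "k = (LEAST k. m \<le> 2 ^ k)"
      have "m \<le> 2 ^ m" using less_exp[of m] by simp
      hence 1: "m \<le> 2 ^ k" unfolding k_def by (rule LeastI)
      have "2 ^ k \<le> 2 * m"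
      proof (cases k)
        case (Suc k')
        hence "\<not> m \<le> 2 ^ k'" using not_less_Least[of k' "\<lambda>k. m \<le> 2 ^ k"] by (simp add: k_def)
        thus ?thesis using Suc by simp
      qed (use m in simp)
      thus ?thesis using that 1 by blast
    qed
    have kr: "real m \<le> 2 ^ k" "2 ^ k \<le> 2 * real m" using k
      by (metis of_nat_le_iff of_nat_numeral of_nat_power, metis of_nat_le_iff of_nat_numeral of_nat_power of_nat_mult)
    have lnm: "ln (real m) \<le> real k * ln 2"
      using kr(1) m ln_le_cancel_iff[of "real m" "2 ^ k"] by (simp add: ln_realpow)
    have kk: "1 + real k \<le> 3 * LL (real m)"
    proof -
      have "real k * ln 2 \<le> ln 2 + ln (real m)"
        using kr(2) m ln_le_cancel_iff[of "2 ^ k" "2 * real m"] by (simp add: ln_realpow ln_mult)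
      moreover have "real k * (1/2) \<le> real k * ln 2" using ln2_ge_two_thirds by (intro mult_left_mono) auto
      moreover have "ln (real m) \<ge> 0" using m by simp
      ultimately have "real k \<le> 2 + 3 * ln (real m)" using ln_2_less_1 by linarith
      thus ?thesis using m by (simp add: LL_eq)
    qed
    define f where "f m = Q e {..<nn k} (tht e) om (lg m)" for m
    have f0: "f 0 = 0"
    proof -
      have "lg 0 - (\<Sum>j\<in>R. om j) < 0" for R using sum_om_nonneg[OF om, of R] by (simp add: lg_def)
      thus ?thesis unfolding f_def Q_def by (simp add: cum_neg)
    qed
    have fm: "f m = US e om (ln (real m))"
      unfolding f_def using m lnm nn_gt[of k] by (subst Q_eq_US[OF om]) (auto simp: lg_def)
    have Zf: "ZZ k e om = (\<Sum>l\<le>k. \<Sum>i<2^(k-l). (f (Suc i * 2 ^ l) - f (i * 2 ^ l))\<^sup>2)"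
      by (simp only: ZZ_def f_def)
    have "(US e om (ln (real m)))\<^sup>2 \<le> ZZ k e om * real (Suc k)"
      using dyadic_chaining[OF k(1), of f] unfolding f0 fm Zf by (simp only: diff_zero)
    also have "\<dots> \<le> C * 2 ^ k * (1 + real k) ^ q * real (Suc k)"
      by (intro mult_right_mono Z e) auto
    also have "\<dots> = C * 2 ^ k * (1 + real k) ^ Suc q" by simp
    also have "\<dots> \<le> C * (2 * real m) * (3 * LL (real m)) ^ Suc q"
      using C kr kk by (intro mult_mono power_mono mult_nonneg_nonneg zero_le_power) (auto intro: order_trans)
    also have "\<dots> = (2 * C * 3 ^ Suc q) * real m * LL (real m) ^ Suc q"
      by (simp add: power_mult_distrib mult_ac del: power_Suc)
    \<comment> \<open>Squaring the power of \<open>LL\<close> wastes logarithms but leaves a perfect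
      square.\<close>
    also have "\<dots> \<le> (2 * C * 3 ^ Suc q) * real m * (LL (real m) ^ Suc q)\<^sup>2"
    proof (intro mult_left_mono)
      show "LL (real m) ^ Suc q \<le> (LL (real m) ^ Suc q)\<^sup>2"
        using mult_left_mono[of 1 "LL (real m) ^ Suc q" "LL (real m) ^ Suc q"] one_le_power[of "LL (real m)" "Suc q"]
        by (simp add: power2_eq_square del: power_Suc)
    qed (use C in auto)
    also have "\<dots> = (sqrt (2 * C * 3 ^ Suc q) * sqrt (real m) * LL (real m) ^ Suc q)\<^sup>2"
      using C by (simp add: power_mult_distrib del: power_Suc)
    finally have "\<bar>US e om (ln (real m))\<bar> \<le> \<bar>sqrt (2 * C * 3 ^ Suc q) * sqrt (real m) * LL (real m) ^ Suc q\<bar>"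
      by (simp only: abs_le_square_iff)
    moreover have "0 \<le> sqrt (2 * C * 3 ^ Suc q) * sqrt (real m) * LL (real m) ^ Suc q"
      using C by (intro mult_nonneg_nonneg real_sqrt_ge_zero LL_power_nonneg) auto
    ultimately show ?thesis by (simp only: abs_of_nonneg)
  qed
  moreover have "sqrt (2 * C * 3 ^ Suc q) > 0" using C by simp
  ultimately show ?thesis using om by blast
qed

text \<open>For x \<ge> 1 this is the integral of LL u ^ q * u powr (-3/2) over u \<ge> x, in closed
  form by repeated integration by parts.\<close>

fun tailf :: "nat \<Rightarrow> real \<Rightarrow> real" where
  "tailf 0 x = 2 / sqrt x"
| "tailf (Suc q) x = 2 * LL x ^ Suc q / sqrt x + 2 * real (Suc q) * tailf q x"

lemma tailf_nonneg: "x > 0 \<Longrightarrow> tailf q x \<ge> 0"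
  by (induction q) (auto intro!: add_nonneg_nonneg mult_nonneg_nonneg divide_nonneg_nonneg zero_le_power less_imp_le[OF LL_pos])

lemma tailf_le: "\<exists>K>0. \<forall>x>0. tailf q x \<le> K * LL x ^ q / sqrt x"
proof (induction q)
  case 0
  show ?case by (rule exI[of _ 2]) auto
next
  case (Suc q)
  then obtain K where K: "K > 0" "\<And>x. x > 0 \<Longrightarrow> tailf q x \<le> K * LL x ^ q / sqrt x" by blast
  have "tailf (Suc q) x \<le> (2 + 2 * real (Suc q) * K) * LL x ^ Suc q / sqrt x" if x: "x > 0" for x
  proof -
    have "tailf q x \<le> K * LL x ^ Suc q / sqrt x"
    proof (rule order_trans[OF K(2)[OF x]])
      have "LL x ^ q \<le> LL x ^ Suc q" by (rule power_increasing) auto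
      thus "K * LL x ^ q / sqrt x \<le> K * LL x ^ Suc q / sqrt x"
        using K x by (intro divide_right_mono mult_left_mono) auto
    qed
    hence "2 * real (Suc q) * tailf q x \<le> 2 * real (Suc q) * (K * LL x ^ Suc q / sqrt x)" by (intro mult_left_mono) auto
    thus ?thesis by (simp add: add_divide_distrib distrib_right del: power_Suc of_nat_Suc)
  qed
  moreover have "2 + 2 * real (Suc q) * K > 0" using K by (intro add_pos_nonneg) auto
  ultimately show ?case by blast
qed

lemma tailf_deriv: "x > 1 \<Longrightarrow> (tailf q has_real_derivative - (LL x ^ q / (x * sqrt x))) (at x)"
proof (induction q)
  case 0
  have "((\<lambda>x. 2 / sqrt x) has_real_derivative - (1 / (x * sqrt x))) (at x)"
    using 0 by (auto intro!: derivative_eq_intros simp: field_simps)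
  thus ?case by simp
next
  case (Suc q)
  define g where "g x = (1 + ln x) ^ Suc q" for x :: real
  have g: "(g has_real_derivative real (Suc q) * (1 + ln x) ^ q / x) (at x)"
    unfolding g_def using Suc(2) by (auto intro!: derivative_eq_intros simp del: power_Suc of_nat_Suc)
  have s: "((\<lambda>x. 2 / sqrt x) has_real_derivative - (1 / (x * sqrt x))) (at x)"
    using Suc(2) by (auto intro!: derivative_eq_intros simp: field_simps)
  have "((\<lambda>x. g x * (2 / sqrt x) + 2 * real (Suc q) * tailf q x) has_real_derivative
     (real (Suc q) * (1 + ln x) ^ q / x * (2 / sqrt x) + (- (1 / (x * sqrt x))) * g x) + 2 * real (Suc q) * (- (LL x ^ q / (x * sqrt x)))) (at x)"
    by (intro DERIV_add DERIV_mult g s DERIV_cmult Suc)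
  also have "(real (Suc q) * (1 + ln x) ^ q / x * (2 / sqrt x) + (- (1 / (x * sqrt x))) * g x) + 2 * real (Suc q) * (- (LL x ^ q / (x * sqrt x))) = - (LL x ^ Suc q / (x * sqrt x))"
    using Suc(2) by (simp add: LL_eq g_def del: power_Suc of_nat_Suc)
  finally have d: "((\<lambda>x. g x * (2 / sqrt x) + 2 * real (Suc q) * tailf q x) has_real_derivative - (LL x ^ Suc q / (x * sqrt x))) (at x)" .
  show ?case
  proof (rule has_field_derivative_transform_within_open[OF d, of "{1<..}"])
    fix y :: real assume "y \<in> {1<..}"
    thus "g y * (2 / sqrt y) + 2 * real (Suc q) * tailf q y = tailf (Suc q) y"
      by (simp add: g_def LL_eq del: power_Suc of_nat_Suc)
  qed (use Suc(2) in auto)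
qed

lemma tailf_step:
  assumes k: "k \<ge> (2::nat)"
  shows "LL (real k) ^ q / (real k * sqrt (real k)) \<le> 4 * (tailf q (real k) - tailf q (real (Suc k)))"
proof -
  have "\<exists>z. z > real k \<and> z < real (Suc k) \<and> tailf q (real (Suc k)) - tailf q (real k) = (real (Suc k) - real k) * - (LL z ^ q / (z * sqrt z))"
    using k by (intro MVT2) (auto intro!: tailf_deriv)
  then obtain z where z: "z > real k" "z < real (Suc k)" "tailf q (real k) - tailf q (real (Suc k)) = LL z ^ q / (z * sqrt z)" by auto
  have z2: "z \<le> 2 * real k" using z k by simp
  have "z * sqrt z \<le> (2 * real k) * sqrt (4 * real k)"
    using z z2 k by (intro mult_mono real_sqrt_le_mono) auto
  hence zz: "z * sqrt z \<le> 4 * (real k * sqrt (real k))" by (simp add: real_sqrt_mult)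
  have "LL (real k) ^ q / (real k * sqrt (real k)) \<le> LL z ^ q / (real k * sqrt (real k))"
    using z k by (intro divide_right_mono power_mono LL_mono) (auto intro: less_imp_le[OF LL_pos])
  also have "\<dots> \<le> LL z ^ q * 4 / (z * sqrt z)"
    using zz z k LL_pos[of z] by (simp add: field_simps mult_left_mono)
  also have "LL z ^ q * 4 / (z * sqrt z) = 4 * (LL z ^ q / (z * sqrt z))" by simp
  finally show ?thesis unfolding z(3) .
qed

text \<open>Adding 4 * D * \<open>tailf\<close> makes the sequence decreasing, subtracting it makes
  it increasing. The limit is caught between the two, which gives the rate of convergence as
  well.\<close>

lemma converge_with_tail:
  fixes a :: "nat \<Rightarrow> real"
  assumes D: "D > 0" and a: "\<And>k. k \<ge> 2 \<Longrightarrow> \<bar>a (Suc k) - a k\<bar> \<le> D * LL (real k) ^ q / (real k * sqrt (real k))"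
    and nn: "\<And>k. k \<ge> 2 \<Longrightarrow> a k \<ge> 0"
  shows "\<exists>r K. r \<ge> 0 \<and> K > 0 \<and> (\<forall>m\<ge>2. \<bar>a m - r\<bar> \<le> K * LL (real m) ^ q / sqrt (real m))"
proof -
  define b where "b k = a (k + 2) + 4 * D * tailf q (real (k + 2))" for k
  define c where "c k = a (k + 2) - 4 * D * tailf q (real (k + 2))" for k
  have st: "D * LL (real k) ^ q / (real k * sqrt (real k)) \<le> 4 * D * (tailf q (real k) - tailf q (real (Suc k)))" if "k \<ge> 2" for k
    using mult_left_mono[OF tailf_step[OF that, of q], of D] D by (simp add: mult_ac)
  have bd: "decseq b"
  proof (rule decseq_SucI)
    fix k show "b (Suc k) \<le> b k"
      using a[of "k + 2"] st[of "k + 2"] unfolding b_def by (simp add: algebra_simps)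
  qed
  have ci: "incseq c"
  proof (rule incseq_SucI)
    fix k show "c k \<le> c (Suc k)"
      using a[of "k + 2"] st[of "k + 2"] unfolding c_def by (simp add: algebra_simps)
  qed
  have cb: "c k \<le> b k" for k unfolding b_def c_def using tailf_nonneg[of "real (k+2)" q] D
    mult_nonneg_nonneg[of "4 * D" "tailf q (real (k+2))"] by simp
  have cb': "c i \<le> b j" for i j
  proof -
    have "c i \<le> c (max i j)" using ci by (auto simp: incseq_def)
    also have "\<dots> \<le> b (max i j)" by (rule cb)
    also have "\<dots> \<le> b j" using bd by (auto simp: decseq_def)
    finally show ?thesis .
  qed
  obtain r where r: "b \<longlonglongrightarrow> r" "\<And>i. r \<le> b i" using decseq_convergent[OF bd, of "c 0"] cb' by blast
  have cr: "c i \<le> r" for i using cb' by (intro LIMSEQ_le_const[OF r(1)]) auto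
  have b0: "b i \<ge> 0" for i unfolding b_def using nn[of "i+2"] tailf_nonneg[of "real (i+2)" q] D by simp
  have r0: "r \<ge> 0" using b0 by (intro LIMSEQ_le_const[OF r(1)]) auto
  obtain K where K: "K > 0" "\<And>x. x > 0 \<Longrightarrow> tailf q x \<le> K * LL x ^ q / sqrt x" using tailf_le by blast
  have "\<bar>a m - r\<bar> \<le> (4 * D * K) * LL (real m) ^ q / sqrt (real m)" if m: "m \<ge> 2" for m
  proof -
    have "\<bar>a m - r\<bar> \<le> 4 * D * tailf q (real m)"
    proof -
      have "m - 2 + 2 = m" using m by simp
      thus ?thesis using r(2)[of "m - 2"] cr[of "m - 2"] unfolding b_def c_def by simp
    qed
    also have "\<dots> \<le> 4 * D * (K * LL (real m) ^ q / sqrt (real m))" using K(2)[of "real m"] m D by (intro mult_left_mono) auto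
    finally show ?thesis by simp
  qed
  moreover have "4 * D * K > 0" using D K by simp
  ultimately show ?thesis using r0 by blast
qed

section \<open>Counting squarefree integers and summing their Moebius function\<close>

definition Nq :: "(nat \<Rightarrow> real) \<Rightarrow> real \<Rightarrow> real" where "Nq om x = real (card (sub om (ln x)))"
definition Mq :: "(nat \<Rightarrow> real) \<Rightarrow> real \<Rightarrow> real" where "Mq om x = (\<Sum>R\<in>sub om (ln x). (-1) ^ card R)"

lemma Nq_mono: "cell_pts om \<Longrightarrow> 0 < x \<Longrightarrow> x \<le> y \<Longrightarrow> Nq om x \<le> Nq om y"
  unfolding Nq_def by (intro of_nat_mono card_mono finite_sub sub_mono) auto

lemma Mq_diff:
  assumes "cell_pts om" "0 < x" "x \<le> y" shows "\<bar>Mq om y - Mq om x\<bar> \<le> Nq om y - Nq om x"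
proof -
  have s: "sub om (ln x) \<subseteq> sub om (ln y)" using assms by (intro sub_mono) auto
  have f: "finite (sub om t)" for t using assms finite_sub by auto
  have "Mq om y - Mq om x = (\<Sum>R\<in>sub om (ln y) - sub om (ln x). (-1) ^ card R)"
    unfolding Mq_def by (rule sum_diff[OF f s, symmetric])
  also have "\<bar>\<dots>\<bar> \<le> (\<Sum>R\<in>sub om (ln y) - sub om (ln x). \<bar>(-1) ^ card R\<bar>)" by (rule sum_abs)
  also have "\<dots> = real (card (sub om (ln y) - sub om (ln x)))" by (simp add: power_abs)
  also have "\<dots> = Nq om y - Nq om x" unfolding Nq_def using card_Diff_subset[OF f s] card_mono[OF f s] by simp
  finally show ?thesis .
qed

text \<open>Rankin's trick with exponent 1: every squarefree n \<le> x is given the weight x / n,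
  and the resulting Euler product is at most exp (1 + ln (T n)) by \<open>sum_exp_T\<close>. It is
  the a priori bound for the steps between consecutive integers in \<open>Nq_asymp\<close>.\<close>

lemma Nq_Rankin: "\<exists>C>0. \<forall>om x. cell_pts om \<longrightarrow> x \<ge> 1 \<longrightarrow> Nq om x \<le> C * x * LL x"
proof -
  have "Nq om x \<le> (exp 1 * (T 0 + 2)) * x * LL x" if om: "cell_pts om" and x: "x \<ge> 1" for om x
  proof -
    define n where "n = (LEAST n. T n > ln x)"
    have n: "T n > ln x" unfolding n_def using T_unbounded by (rule LeastI_ex)
    have nle: "T n \<le> (T 0 + 2) * LL x"
    proof -
      have "T n \<le> ln x + T 0 + 2"
      proof (cases n)
        case (Suc n')
        hence "\<not> T n' > ln x" using not_less_Least[of n' "\<lambda>n. T n > ln x"] by (simp add: n_def)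
        thus ?thesis using T_Suc_le[of n'] Suc T_ge_1[of 0] by auto
      qed (use x in simp)
      also have "\<dots> \<le> (T 0 + 2) * LL x" using T_ge_1[of 0] x mult_right_mono[of 1 "T 0 + 2" "ln x"] by (simp add: LL_eq algebra_simps)
      finally show ?thesis .
    qed
    have "Nq om x = (\<Sum>R\<in>sub om (ln x). 1)" by (simp add: Nq_def)
    also have "\<dots> \<le> (\<Sum>R\<in>sub om (ln x). x * (\<Prod>j\<in>R. exp (- om j)))"
    proof (rule sum_mono)
      fix R assume "R \<in> sub om (ln x)"
      hence "finite R" "(\<Sum>j\<in>R. om j) \<le> ln x" by (auto simp: sub_def)
      have "(\<Prod>j\<in>R. exp (- om j)) = exp (- (\<Sum>j\<in>R. om j))" using \<open>finite R\<close> by (simp add: exp_sum[symmetric] sum_negf)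
      moreover have "1 = x * exp (- ln x)" using x by (simp add: exp_minus)
      moreover have "exp (- ln x) \<le> exp (- (\<Sum>j\<in>R. om j))" using \<open>(\<Sum>j\<in>R. om j) \<le> ln x\<close> by simp
      ultimately show "1 \<le> x * (\<Prod>j\<in>R. exp (- om j))" using x by (metis mult_left_mono order_trans zero_le_one)
    qed
    also have "\<dots> \<le> (\<Sum>R\<in>Pow {..<n}. x * (\<Prod>j\<in>R. exp (- om j)))"
      using sub_subset[OF om n] x by (intro sum_mono2) (auto intro!: mult_nonneg_nonneg prod_nonneg)
    also have "\<dots> = x * (\<Prod>j<n. 1 + exp (- om j))"
      using prod_add[of "{..<n}" "\<lambda>j. exp (- om j)" "\<lambda>_. 1"] by (simp add: sum_distrib_left add.commute)
    also have "(\<Prod>j<n. 1 + exp (- om j)) \<le> (\<Prod>j<n. exp (exp (- T j)))"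
      using cell_ptsD(1)[OF om] by (intro prod_mono) (auto intro!: order_trans[OF exp_ge_add_one_self] add_nonneg_nonneg simp del: exp_ge_add_one_self)
    also have "\<dots> = exp (\<Sum>j<n. exp (- T j))" by (simp add: exp_sum)
    also have "\<dots> \<le> exp (1 + ln (T n))" using sum_exp_T by simp
    also have "\<dots> = exp 1 * T n" using T_ge_1[of n] by (simp add: exp_add)
    also have "\<dots> \<le> exp 1 * ((T 0 + 2) * LL x)" using nle by simp
    finally show ?thesis using x by (simp add: mult_ac)
  qed
  moreover have "exp 1 * (T 0 + 2) > 0" using T_ge_1[of 0] by simp
  ultimately show ?thesis by blast
qed

definition U_bound :: "(nat \<Rightarrow> real) \<Rightarrow> real \<Rightarrow> nat \<Rightarrow> bool" where
  "U_bound om C q \<longleftrightarrow> C > 0 \<and> cell_pts om \<and>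
     (\<forall>e m. (e = 1 \<or> e = -1) \<longrightarrow> m \<ge> 1 \<longrightarrow> \<bar>US e om (ln (real m))\<bar> \<le> C * sqrt (real m) * LL (real m) ^ q)"

lemma Nq_below_1: "cell_pts om \<Longrightarrow> 0 < x \<Longrightarrow> x < 1 \<Longrightarrow> Nq om x = 0"
  and Mq_below_1: "cell_pts om \<Longrightarrow> 0 < x \<Longrightarrow> x < 1 \<Longrightarrow> Mq om x = 0"
  by (simp_all add: Nq_def Mq_def sub_neg)

lemma LL_power_mono: "0 < x \<Longrightarrow> x \<le> y \<Longrightarrow> LL x ^ q \<le> LL y ^ q"
  by (intro power_mono LL_mono) (auto intro: less_imp_le[OF LL_pos])

lemma LL_power_ge_1: "LL x ^ q \<ge> 1" by (intro one_le_power) simp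

text \<open>For natural numbers \<open>m\<close>, \<open>Nq m = I m + U m\<close>, where \<open>I\<close> is an integral of \<open>Nq\<close>;
  smallness of \<open>U\<close> makes \<open>I m / m\<close> converge.\<close>
lemma Nq_asymp:
  assumes "U_bound om C q"
  shows "\<exists>r K p. r \<ge> 0 \<and> K > 0 \<and> (\<forall>x>0. \<bar>Nq om x - r * x\<bar> \<le> K * sqrt x * LL x ^ p)"
proof -
  have C: "C > 0" and om: "cell_pts om" and
    U: "\<And>m. m \<ge> 1 \<Longrightarrow> \<bar>US 1 om (ln (real m))\<bar> \<le> C * sqrt (real m) * LL (real m) ^ q"
    using assms by (auto simp: U_bound_def)
  have fin: "finite (sub om t)" for t by (rule finite_sub[OF om])
  define p where "p = q + 1"
  define I where "I m = (\<Sum>R\<in>sub om (ln (real m)). ln (real m) - (\<Sum>j\<in>R. om j))" for m :: nat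
  define N where "N m = Nq om (real m)" for m :: nat
  define u where "u m = US 1 om (ln (real m))" for m :: nat
  have NIU: "N m = I m + u m" for m
  proof -
    have "u m = (\<Sum>R\<in>sub om (ln (real m)). 1 - (ln (real m) - (\<Sum>j\<in>R. om j)))"
      unfolding u_def US_def by (rule sum.cong) (auto simp: sub_def cum_tht)
    thus ?thesis by (simp add: N_def Nq_def I_def sum_subtractf)
  qed
  have I0: "I m \<ge> 0" for m unfolding I_def by (rule sum_nonneg) (auto simp: sub_def)
  obtain K0 where K0: "K0 > 0" "\<And>x. x \<ge> 1 \<Longrightarrow> Nq om x \<le> K0 * x * LL x"
    using Nq_Rankin om by blast
  have dI: "N m * ln (1 + 1 / real m) \<le> I (Suc m) - I m" "I (Suc m) - I m \<le> N (Suc m) * ln (1 + 1 / real m)" if m: "m \<ge> 1" for m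
  proof -
    have l: "ln (1 + 1 / real m) = ln (real (Suc m)) - ln (real m)"
    proof -
      have "1 + 1 / real m = real (Suc m) / real m" using m by (simp add: field_simps)
      thus ?thesis using m by (simp add: ln_div)
    qed
    have ss: "sub om (ln (real m)) \<subseteq> sub om (ln (real (Suc m)))" using m by (intro sub_mono) auto
    let ?D = "sub om (ln (real (Suc m))) - sub om (ln (real m))"
    have "I (Suc m) = (\<Sum>R\<in>sub om (ln (real m)). ln (real (Suc m)) - (\<Sum>j\<in>R. om j)) + (\<Sum>R\<in>?D. ln (real (Suc m)) - (\<Sum>j\<in>R. om j))"
      unfolding I_def using sum.subset_diff[OF ss fin, of "\<lambda>R. ln (real (Suc m)) - (\<Sum>j\<in>R. om j)"] by (simp add: add.commute)
    also have "(\<Sum>R\<in>sub om (ln (real m)). ln (real (Suc m)) - (\<Sum>j\<in>R. om j)) = I m + N m * ln (1 + 1 / real m)"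
      unfolding I_def N_def Nq_def l by (simp add: sum_subtractf algebra_simps)
    finally have eq: "I (Suc m) - I m = N m * ln (1 + 1 / real m) + (\<Sum>R\<in>?D. ln (real (Suc m)) - (\<Sum>j\<in>R. om j))" by simp
    have "(\<Sum>R\<in>?D. ln (real (Suc m)) - (\<Sum>j\<in>R. om j)) \<ge> 0" by (rule sum_nonneg) (auto simp: sub_def)
    thus "N m * ln (1 + 1 / real m) \<le> I (Suc m) - I m" using eq by simp
    have "(\<Sum>R\<in>?D. ln (real (Suc m)) - (\<Sum>j\<in>R. om j)) \<le> (\<Sum>R\<in>?D. ln (1 + 1 / real m))"
      unfolding l by (rule sum_mono) (auto simp: sub_def)
    also have "\<dots> = (N (Suc m) - N m) * ln (1 + 1 / real m)"
      unfolding N_def Nq_def using card_Diff_subset[OF fin ss] card_mono[OF fin ss] by simp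
    finally show "I (Suc m) - I m \<le> N (Suc m) * ln (1 + 1 / real m)" using eq by (simp add: algebra_simps)
  qed
  define D where "D = 4 * 2 ^ p * (C + K0)"
  have D: "D > 0" using C K0 by (simp add: D_def)
  \<comment> \<open>Discrete form of the equation x * I' - I = Nq - I = U. The discretisation costs
    N (Suc m) / m, which is only logarithmic by the Rankin bound.\<close>
  have key: "\<bar>real m * (I (Suc m) - I m) - I m\<bar> \<le> D * sqrt (real m) * LL (real m) ^ p" if m: "m \<ge> 1" for m
  proof -
    have l1: "ln (1 + 1 / real m) \<le> 1 / real m" using m by (intro ln_add_one_self_le_self2) (auto intro: less_le_trans[of _ 0])
    have l2: "ln (1 + 1 / real m) \<ge> 1 / real (Suc m)"
    proof -
      have "ln (real m / real (Suc m)) \<le> real m / real (Suc m) - 1" using m by (intro ln_le_minus_one) auto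
      also have "ln (real m / real (Suc m)) = - ln (1 + 1 / real m)"
      proof -
        have "1 + 1 / real m = real (Suc m) / real m" using m by (simp add: field_simps)
        thus ?thesis using m by (simp add: ln_div)
      qed
      also have "real m / real (Suc m) - 1 = - (1 / real (Suc m))" by (simp add: field_simps)
      finally show ?thesis by simp
    qed
    have N0: "N m \<ge> 0" "N m \<le> N (Suc m)" using Nq_mono[OF om, of "real m" "real (Suc m)"] m by (auto simp: N_def Nq_def)
    have "N (Suc m) \<le> K0 * real (Suc m) * LL (real (Suc m))" unfolding N_def by (rule K0) simp
    also have "\<dots> \<le> K0 * (2 * real m) * (2 * LL (real m))"
      using K0 m by (intro mult_mono LL_double) (auto intro: less_imp_le[OF LL_pos])
    finally have NS: "N (Suc m) / real m \<le> 4 * K0 * LL (real m)" using m by (simp add: field_simps)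
    have sq: "1 \<le> sqrt (real m)" using m by simp
    have NS': "N (Suc m) / real m \<le> 4 * K0 * (sqrt (real m) * LL (real m) ^ p)"
    proof (rule order_trans[OF NS], rule mult_left_mono)
      have "LL (real m) ^ 1 \<le> LL (real m) ^ p" by (rule power_increasing) (auto simp: p_def)
      hence "1 * LL (real m) \<le> sqrt (real m) * LL (real m) ^ p" using sq by (intro mult_mono) (auto intro: less_imp_le[OF LL_pos])
      thus "LL (real m) \<le> sqrt (real m) * LL (real m) ^ p" by simp
    qed (use K0 in auto)
    have Lqp: "LL (real m) ^ q \<le> LL (real m) ^ p" by (rule power_increasing) (auto simp: p_def)
    have Um: "\<bar>u m\<bar> \<le> C * (sqrt (real m) * LL (real m) ^ p)"
    proof -
      have "\<bar>u m\<bar> \<le> C * sqrt (real m) * LL (real m) ^ q" unfolding u_def by (rule U[OF m])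
      also have "\<dots> \<le> C * sqrt (real m) * LL (real m) ^ p" using C Lqp by (intro mult_left_mono) auto
      finally show ?thesis by (simp add: mult.assoc)
    qed
    have US: "\<bar>u (Suc m)\<bar> \<le> 2 * 2 ^ p * C * (sqrt (real m) * LL (real m) ^ p)"
    proof -
      have "\<bar>u (Suc m)\<bar> \<le> C * sqrt (real (Suc m)) * LL (real (Suc m)) ^ q" unfolding u_def by (rule U) simp
      also have "\<dots> \<le> C * sqrt (4 * real m) * (2 * LL (real m)) ^ q"
        using C m by (intro mult_mono power_mono LL_double real_sqrt_le_mono) (auto intro: less_imp_le[OF LL_pos])
      also have "\<dots> \<le> C * sqrt (4 * real m) * (2 * LL (real m)) ^ p"
      proof -
        have "1 \<le> 2 * LL (real m)" using LL_ge_1[of "real m"] by linarith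
        thus ?thesis using C m by (intro mult_left_mono power_increasing) (auto simp: p_def)
      qed
      finally show ?thesis by (simp add: real_sqrt_mult power_mult_distrib mult_ac)
    qed
    let ?E = "sqrt (real m) * LL (real m) ^ p"
    have E0: "?E \<ge> 0" by (intro mult_nonneg_nonneg zero_le_power) (auto intro: less_imp_le[OF LL_pos])
    have p2: "(2::real) ^ p \<ge> 1" by simp
    have lo: "real m * (I (Suc m) - I m) - I m \<ge> - \<bar>u m\<bar> - N (Suc m) / real m"
    proof -
      have "real m * (N m * (1 / real (Suc m))) \<le> real m * (N m * ln (1 + 1 / real m))"
        using l2 N0 by (intro mult_left_mono) auto
      also have "\<dots> \<le> real m * (I (Suc m) - I m)" using dI(1)[OF m] by (intro mult_left_mono) auto
      finally have "N m - N m / real (Suc m) \<le> real m * (I (Suc m) - I m)" by (simp add: field_simps)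
      moreover have "N m / real (Suc m) \<le> N (Suc m) / real m" using N0 m by (intro frac_le) auto
      ultimately show ?thesis using NIU[of m] by linarith
    qed
    have hi: "real m * (I (Suc m) - I m) - I m \<le> \<bar>u (Suc m)\<bar> + N (Suc m) / real m"
    proof -
      have d: "I (Suc m) - I m \<le> N (Suc m) / real m"
        using dI(2)[OF m] mult_left_mono[OF l1, of "N (Suc m)"] N0 by simp
      hence "real m * (I (Suc m) - I m) \<le> N (Suc m)" using m by (simp add: field_simps)
      thus ?thesis using NIU[of "Suc m"] d by linarith
    qed
    have "\<bar>real m * (I (Suc m) - I m) - I m\<bar> \<le> \<bar>u m\<bar> + \<bar>u (Suc m)\<bar> + N (Suc m) / real m"
      using lo hi by linarith
    also have "\<dots> \<le> C * ?E + 2 * 2 ^ p * C * ?E + 4 * K0 * ?E" using Um US NS' by linarith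
    also have "\<dots> = (C + 2 * 2 ^ p * C + 4 * K0) * ?E" by (simp add: algebra_simps)
    also have "\<dots> \<le> D * ?E"
    proof (intro mult_right_mono E0)
      have "1 \<le> 2 * (2::real) ^ p" using p2 by linarith
      hence "C * 1 \<le> C * (2 * 2 ^ p)" using C by (intro mult_left_mono) auto
      moreover have "4 * K0 * 1 \<le> 4 * K0 * 2 ^ p" using K0 p2 by (intro mult_left_mono) auto
      ultimately show "C + 2 * 2 ^ p * C + 4 * K0 \<le> D" unfolding D_def by (simp add: algebra_simps)
    qed
    finally show ?thesis by (simp add: mult.assoc)
  qed
  have A: "\<bar>I (Suc m) / real (Suc m) - I m / real m\<bar> \<le> D * LL (real m) ^ p / (real m * sqrt (real m))" if m: "m \<ge> 2" for m
  proof -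
    have "I (Suc m) / real (Suc m) - I m / real m = (real m * (I (Suc m) - I m) - I m) / (real m * real (Suc m))"
      using m by (simp add: field_simps)
    hence "\<bar>I (Suc m) / real (Suc m) - I m / real m\<bar> = \<bar>real m * (I (Suc m) - I m) - I m\<bar> / (real m * real (Suc m))"
      using m by (simp add: abs_mult)
    also have "\<dots> \<le> (D * sqrt (real m) * LL (real m) ^ p) / (real m * real m)"
      using key[of m] m D by (intro frac_le mult_left_mono) (auto intro!: mult_nonneg_nonneg zero_le_power less_imp_le[OF LL_pos])
    also have "\<dots> = D * LL (real m) ^ p / (real m * sqrt (real m))"
      using m real_sqrt_mult_self[of "real m"] by (simp add: field_simps)
    finally show ?thesis .
  qed
  \<comment> \<open>By \<open>key\<close> the increments of I m / m are of size m powr (-3/2) up to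
    logarithms; the limit r is the density.\<close>
  obtain r K where r: "r \<ge> 0" "K > 0" "\<And>m. m \<ge> 2 \<Longrightarrow> \<bar>I m / real m - r\<bar> \<le> K * LL (real m) ^ p / sqrt (real m)"
    using converge_with_tail[of D "\<lambda>m. I m / real m" p] D A I0 by auto
  define K1 where "K1 = K + C"
  have nat_bound: "\<bar>N m - r * real m\<bar> \<le> K1 * (sqrt (real m) * LL (real m) ^ p)" if m: "m \<ge> 2" for m
  proof -
    have "I m - r * real m = real m * (I m / real m - r)" using m by (simp add: field_simps)
    hence "\<bar>I m - r * real m\<bar> = real m * \<bar>I m / real m - r\<bar>" using m by (simp add: abs_mult)
    also have "\<dots> \<le> real m * (K * LL (real m) ^ p / sqrt (real m))" using r(3)[OF m] by (intro mult_left_mono) auto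
    also have "\<dots> = K * (sqrt (real m) * LL (real m) ^ p)"
      using m real_sqrt_mult_self[of "real m"] by (simp add: field_simps)
    finally have 1: "\<bar>I m - r * real m\<bar> \<le> K * (sqrt (real m) * LL (real m) ^ p)" .
    have "\<bar>u m\<bar> \<le> C * sqrt (real m) * LL (real m) ^ q" unfolding u_def using m by (intro U) auto
    also have "\<dots> \<le> C * sqrt (real m) * LL (real m) ^ p" using C by (intro mult_left_mono power_increasing) (auto simp: p_def)
    finally show ?thesis using 1 NIU[of m] unfolding K1_def by (simp add: algebra_simps abs_if split: if_splits)
  qed
  define K2 where "K2 = K1 * (2 * 2 ^ p) + r + Nq om 2 + 2 * r"
  have K1: "K1 > 0" using r C by (simp add: K1_def)
  have Nq2: "Nq om 2 \<ge> 0" by (simp add: Nq_def)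
  have "K1 * (2 * 2 ^ p) > 0" using K1 by simp
  hence K2: "K2 > 0" using r Nq2 unfolding K2_def by linarith
  have "\<bar>Nq om x - r * x\<bar> \<le> K2 * sqrt x * LL x ^ p" if x: "x > 0" for x
  proof -
    have LLp: "LL x ^ p \<ge> 1" by (rule LL_power_ge_1)
    consider "x < 1" | "1 \<le> x" "x < 2" | "x \<ge> 2" by linarith
    thus ?thesis
    proof cases
      case 1
      have "\<bar>Nq om x - r * x\<bar> = r * x" using 1 x r by (simp add: Nq_below_1[OF om])
      also have "r * x \<le> r * sqrt x" using 1 x r by (intro mult_left_mono) (auto simp: real_le_rsqrt power2_eq_square mult_left_le)
      also have "r * sqrt x \<le> K2 * sqrt x" using \<open>K1 * (2 * 2 ^ p) > 0\<close> Nq2 r x by (intro mult_right_mono) (auto simp: K2_def)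
      also have "\<dots> \<le> K2 * sqrt x * LL x ^ p" using LLp K2 x mult_left_mono[OF LLp, of "K2 * sqrt x"] by simp
      finally show ?thesis .
    next
      case 2
      have "Nq om x \<le> Nq om 2" using 2 by (intro Nq_mono[OF om]) auto
      moreover have "0 \<le> Nq om x" by (simp add: Nq_def)
      moreover have "0 \<le> r * x" "r * x \<le> r * 2" using 2 r by (auto intro: mult_left_mono)
      ultimately have "\<bar>Nq om x - r * x\<bar> \<le> Nq om 2 + 2 * r" by linarith
      also have "\<dots> \<le> K2 * 1" using \<open>K1 * (2 * 2 ^ p) > 0\<close> r by (simp add: K2_def)
      also have "\<dots> \<le> K2 * (sqrt x * LL x ^ p)" using LLp K2 2 mult_mono[of 1 "sqrt x" 1 "LL x ^ p"] by (intro mult_left_mono) auto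
      finally show ?thesis by (simp add: mult.assoc)
    next
      case 3
      \<comment> \<open>Between integers the bound follows from monotonicity of \<open>Nq\<close>,
        while r * x changes by at most r.\<close>
      define m where "m = nat \<lfloor>x\<rfloor>"
      have m: "m \<ge> 2" "real m \<le> x" "x < real (Suc m)" using 3 unfolding m_def by (linarith, linarith, linarith)
      have E: "sqrt (real k) * LL (real k) ^ p \<le> 2 * 2 ^ p * (sqrt x * LL x ^ p)" if "k = m \<or> k = Suc m" for k
      proof -
        have "sqrt (real k) * LL (real k) ^ p \<le> sqrt (4 * x) * (2 * LL x) ^ p"
          using that m 3 by (intro mult_mono power_mono LL_double real_sqrt_le_mono) (auto intro: less_imp_le[OF LL_pos])
        thus ?thesis by (simp add: real_sqrt_mult power_mult_distrib mult_ac)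
      qed
      have b: "\<bar>N k - r * real k\<bar> \<le> K1 * (2 * 2 ^ p) * (sqrt x * LL x ^ p)" if k: "k = m \<or> k = Suc m" for k
      proof -
        have "\<bar>N k - r * real k\<bar> \<le> K1 * (sqrt (real k) * LL (real k) ^ p)" using k m by (intro nat_bound) auto
        also have "\<dots> \<le> K1 * (2 * 2 ^ p * (sqrt x * LL x ^ p))" using E[OF k] K1 by (intro mult_left_mono) auto
        finally show ?thesis by (simp only: mult.assoc)
      qed
      have b1: "N (Suc m) - r * real (Suc m) \<le> K1 * (2 * 2 ^ p) * (sqrt x * LL x ^ p)" using b[of "Suc m"] by linarith
      have b2: "N m - r * real m \<ge> - (K1 * (2 * 2 ^ p) * (sqrt x * LL x ^ p))" using b[of m] by linarith
      have "N m \<le> Nq om x" "Nq om x \<le> N (Suc m)" unfolding N_def using m by (auto intro!: Nq_mono[OF om])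
      moreover have "r * real (Suc m) \<le> r * x + r" "r * x - r \<le> r * real m"
        using m r mult_left_mono[of "real (Suc m)" "x + 1" r] mult_left_mono[of "x - 1" "real m" r] by (auto simp: algebra_simps)
      ultimately have "\<bar>Nq om x - r * x\<bar> \<le> K1 * (2 * 2 ^ p) * (sqrt x * LL x ^ p) + r" using b1 b2 by linarith
      also have "\<dots> \<le> K1 * (2 * 2 ^ p) * (sqrt x * LL x ^ p) + r * (sqrt x * LL x ^ p)"
        using r LLp 3 mult_mono[of 1 "sqrt x" 1 "LL x ^ p"] mult_left_mono[of 1 "sqrt x * LL x ^ p" r] by simp
      also have "\<dots> = (K1 * (2 * 2 ^ p) + r) * (sqrt x * LL x ^ p)" by (simp add: algebra_simps)
      also have "\<dots> \<le> K2 * (sqrt x * LL x ^ p)"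
        using r Nq2 3 LLp by (intro mult_right_mono) (auto simp: K2_def)
      finally show ?thesis by (simp add: mult.assoc)
    qed
  qed
  thus ?thesis using r(1) K2 by blast
qed

text \<open>For e = -1 the random bound says that K' m, the sum of \<mu>(n) / n over n \<le> m, is
  of size m powr (-1/2) up to logarithms. Partial summation passes to the sum of \<mu>(n): on (m, m
  + 1] the weight m / n differs from 1 by at most 1 / m, and \<open>Nq_asymp\<close> bounds the
  number of integers there.\<close>

lemma Mq_asymp:
  assumes "U_bound om C q"
  shows "\<exists>K p. K > 0 \<and> (\<forall>x>0. \<bar>Mq om x\<bar> \<le> K * sqrt x * LL x ^ p)"
proof -
  have C: "C > 0" and om: "cell_pts om" and
    U: "\<And>m. m \<ge> 1 \<Longrightarrow> \<bar>US (-1) om (ln (real m))\<bar> \<le> C * sqrt (real m) * LL (real m) ^ q"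
    using assms by (auto simp: U_bound_def)
  have fin: "finite (sub om t)" for t by (rule finite_sub[OF om])
  obtain r K p' where N: "r \<ge> 0" "K > 0" "\<And>x. x > 0 \<Longrightarrow> \<bar>Nq om x - r * x\<bar> \<le> K * sqrt x * LL x ^ p'"
    using Nq_asymp[OF assms] by blast
  define p where "p = q + p'"
  define E where "E x = sqrt x * LL x ^ p" for x
  have Lq: "LL x ^ q \<le> LL x ^ p" "LL x ^ p' \<le> LL x ^ p" for x by (rule power_increasing; simp add: p_def)+
  have E1: "E x \<ge> 1" if "x \<ge> 1" for x unfolding E_def using that LL_power_ge_1[of x p] mult_mono[of 1 "sqrt x" 1 "LL x ^ p"] by simp
  have E0: "E x \<ge> 0" if "x > 0" for x unfolding E_def using that by (intro mult_nonneg_nonneg zero_le_power) (auto intro: less_imp_le[OF LL_pos])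
  have Edb: "E y \<le> 2 * 2 ^ p * E x" if "x \<ge> 1" "0 < y" "y \<le> 2 * x" for x y
  proof -
    have "E y \<le> sqrt (4 * x) * (2 * LL x) ^ p" unfolding E_def
      using that by (intro mult_mono power_mono LL_double real_sqrt_le_mono) (auto intro: less_imp_le[OF LL_pos])
    thus ?thesis by (simp add: E_def real_sqrt_mult power_mult_distrib mult_ac)
  qed
  have NE: "\<bar>Nq om x - r * x\<bar> \<le> K * E x" if "x > 0" for x
  proof -
    have "K * sqrt x * LL x ^ p' \<le> K * sqrt x * LL x ^ p" using N that Lq by (intro mult_left_mono) auto
    thus ?thesis using N(3)[OF that] by (simp add: E_def mult.assoc)
  qed
  have UE: "\<bar>US (-1) om (ln (real m))\<bar> \<le> C * E (real m)" if "m \<ge> 1" for m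
  proof -
    have "C * sqrt (real m) * LL (real m) ^ q \<le> C * sqrt (real m) * LL (real m) ^ p" using C that Lq by (intro mult_left_mono) auto
    thus ?thesis using U[OF that] by (simp add: E_def mult.assoc)
  qed
  define G where "G = 2 * 2 ^ p * (2 * K + C) + r"
  have G: "G > 0" using C N by (simp add: G_def add_pos_nonneg)
  have dN: "Nq om y - Nq om x \<le> G * E x" if xy: "1 \<le> x" "x \<le> y" "y \<le> x + 1" for x y
  proof -
    have y2: "y \<le> 2 * x" using xy by simp
    have "Nq om y - Nq om x \<le> r * (y - x) + K * E y + K * E x"
      using NE[of y] NE[of x] xy by (simp add: algebra_simps abs_le_iff)
    also have "r * (y - x) \<le> r * E x" using xy E1[of x] N by (intro mult_left_mono) auto
    also have "K * E y \<le> K * (2 * 2 ^ p * E x)" using Edb[of x y] xy N by (intro mult_left_mono) auto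
    also have "K * E x \<le> K * (2 * 2 ^ p * E x)"
    proof (rule mult_left_mono)
      have "1 \<le> 2 * (2::real) ^ p" using one_le_power[of "2::real" p] by linarith
      thus "E x \<le> 2 * 2 ^ p * E x" using E0[of x] xy mult_right_mono[of 1 "2 * 2 ^ p" "E x"] by simp
    qed (use N in auto)
    finally have "Nq om y - Nq om x \<le> (r + 2 * (2 * 2 ^ p * K)) * E x" by (simp add: algebra_simps)
    also have "\<dots> \<le> G * E x" using C E0[of x] xy by (intro mult_right_mono) (auto simp: G_def algebra_simps)
    finally show ?thesis .
  qed
  define K' where "K' m = (\<Sum>R\<in>sub om (ln (real m)). (-1) ^ card R * exp (- (\<Sum>j\<in>R. om j)))" for m :: nat
  have UK: "US (-1) om (ln (real m)) = real m * K' m" if m: "m \<ge> 1" for m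
  proof -
    have "US (-1) om (ln (real m)) = (\<Sum>R\<in>sub om (ln (real m)). (-1) ^ card R * exp (ln (real m) - (\<Sum>j\<in>R. om j)))"
      unfolding US_def by (rule sum.cong) (auto simp: sub_def cum_tht)
    also have "\<dots> = real m * K' m"
      unfolding K'_def sum_distrib_left using m by (intro sum.cong) (auto simp: exp_diff exp_minus field_simps)
    finally show ?thesis .
  qed
  define M where "M m = Mq om (real m)" for m :: nat
  \<comment> \<open>The increments of D are of size E m / m, so that D m is of size E m, the same as
    m * K' m.\<close>
  define D where "D m = M m - real m * K' m" for m :: nat
  have D1: "D 1 = 0"
    by (simp add: D_def M_def Mq_def K'_def sub_0[OF om])
  have stepD: "\<bar>D (Suc m) - D m\<bar> \<le> 2 * G * (LL (real m) ^ p / sqrt (real m))" if m: "m \<ge> 1" for m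
  proof -
    have ss: "sub om (ln (real m)) \<subseteq> sub om (ln (real (Suc m)))" using m by (intro sub_mono) auto
    let ?X = "sub om (ln (real (Suc m))) - sub om (ln (real m))"
    have dM: "M (Suc m) - M m = (\<Sum>R\<in>?X. (-1) ^ card R)"
      unfolding M_def Mq_def by (rule sum_diff[OF fin ss, symmetric])
    have dK: "K' (Suc m) - K' m = (\<Sum>R\<in>?X. (-1) ^ card R * exp (- (\<Sum>j\<in>R. om j)))"
      unfolding K'_def by (rule sum_diff[OF fin ss, symmetric])
    have "\<bar>(M (Suc m) - M m) - real m * (K' (Suc m) - K' m)\<bar> = \<bar>\<Sum>R\<in>?X. (-1) ^ card R * (1 - real m * exp (- (\<Sum>j\<in>R. om j)))\<bar>"
      unfolding dM dK by (simp add: sum_distrib_left sum_subtractf algebra_simps)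
    also have "\<dots> \<le> (\<Sum>R\<in>?X. 1 / real m)"
    proof (rule order_trans[OF sum_abs], rule sum_mono)
      fix R assume "R \<in> ?X"
      hence R: "ln (real m) < (\<Sum>j\<in>R. om j)" "(\<Sum>j\<in>R. om j) \<le> ln (real (Suc m))" by (auto simp: sub_def)
      have "exp (- (\<Sum>j\<in>R. om j)) \<le> exp (- ln (real m))" using R by simp
      hence 1: "real m * exp (- (\<Sum>j\<in>R. om j)) \<le> 1" using m by (simp add: exp_minus field_simps)
      have "exp (- ln (real (Suc m))) \<le> exp (- (\<Sum>j\<in>R. om j))" using R by simp
      hence "real m * exp (- ln (real (Suc m))) \<le> real m * exp (- (\<Sum>j\<in>R. om j))" by (intro mult_left_mono) auto
      moreover have "real m * exp (- ln (real (Suc m))) = 1 - 1 / real (Suc m)" by (simp add: exp_minus field_simps)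
      moreover have "1 / real (Suc m) \<le> 1 / real m" using m by (intro frac_le) auto
      ultimately have "\<bar>1 - real m * exp (- (\<Sum>j\<in>R. om j))\<bar> \<le> 1 / real m" using 1 by linarith
      thus "\<bar>(-1) ^ card R * (1 - real m * exp (- (\<Sum>j\<in>R. om j)))\<bar> \<le> 1 / real m" by (simp add: abs_mult power_abs)
    qed
    also have "\<dots> = (Nq om (real (Suc m)) - Nq om (real m)) / real m"
      unfolding Nq_def using card_Diff_subset[OF fin ss] card_mono[OF fin ss] by simp
    also have "\<dots> \<le> (G * E (real m)) / real m" using dN[of "real m" "real (Suc m)"] m by (intro divide_right_mono) auto
    finally have 1: "\<bar>(M (Suc m) - M m) - real m * (K' (Suc m) - K' m)\<bar> \<le> G * E (real m) / real m" .
    have "real (Suc m) * \<bar>K' (Suc m)\<bar> \<le> C * E (real (Suc m))" using UE[of "Suc m"] UK[of "Suc m"] by (simp add: abs_mult)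
    also have "\<dots> \<le> C * (2 * 2 ^ p * E (real m))" using C m by (intro mult_left_mono Edb) auto
    also have "\<dots> \<le> G * E (real m)" using N E0[of "real m"] m
      by (auto simp: G_def algebra_simps intro!: add_increasing2 mult_nonneg_nonneg)
    finally have "real m * \<bar>K' (Suc m)\<bar> \<le> G * E (real m)" by (simp add: algebra_simps)
    hence 2: "\<bar>K' (Suc m)\<bar> \<le> G * E (real m) / real m" using m by (simp add: field_simps)
    have "D (Suc m) - D m = ((M (Suc m) - M m) - real m * (K' (Suc m) - K' m)) - K' (Suc m)"
      by (simp add: D_def algebra_simps)
    hence "\<bar>D (Suc m) - D m\<bar> \<le> G * E (real m) / real m + G * E (real m) / real m" using 1 2 by linarith
    also have "\<dots> = 2 * G * (LL (real m) ^ p / sqrt (real m))"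
      using m real_sqrt_mult_self[of "real m"] by (simp add: E_def field_simps)
    finally show ?thesis .
  qed
  have DbS: "\<bar>D (Suc m)\<bar> \<le> 4 * G * E (real m)" if "m \<ge> 1" for m
    using that
  proof (induction m rule: dec_induct)
    case base
    have "\<bar>D (Suc 1)\<bar> \<le> 2 * G * (LL (real 1) ^ p / sqrt (real 1))" using stepD[of 1] D1 by simp
    also have "\<dots> \<le> 4 * G * E (real 1)" using G by (simp add: E_def)
    finally show ?case .
  next
    case (step m)
    \<comment> \<open>The induction rests on 1 / sqrt (m + 1) \<le> 2 * (sqrt (m + 1) - sqrt m),
      from (b - a) * (a + b) = 1.\<close>
    define a where "a = sqrt (real m)"
    define b where "b = sqrt (real (Suc m))"
    have ab: "a \<ge> 0" "b > 0" "a \<le> b" by (auto simp: a_def b_def)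
    have "b\<^sup>2 = a\<^sup>2 + 1" by (simp add: a_def b_def)
    hence "(b - a) * (a + b) = 1" by (simp add: power2_eq_square algebra_simps)
    moreover have "(b - a) * (a + b) \<le> (b - a) * (2 * b)" using ab by (intro mult_left_mono) auto
    ultimately have "1 \<le> (b - a) * (2 * b)" by simp
    hence "1 / (2 * b) \<le> b - a" using ab by (simp add: field_simps)
    hence s: "2 * a + 1 / b \<le> 2 * b" by simp
    have "\<bar>D (Suc (Suc m))\<bar> \<le> 4 * G * E (real m) + 2 * G * (LL (real (Suc m)) ^ p / sqrt (real (Suc m)))"
      using stepD[of "Suc m"] step by linarith
    also have "4 * G * E (real m) \<le> 4 * G * (a * LL (real (Suc m)) ^ p)"
      unfolding E_def a_def[symmetric] using G step ab by (intro mult_left_mono LL_power_mono) auto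
    also have "4 * G * (a * LL (real (Suc m)) ^ p) + 2 * G * (LL (real (Suc m)) ^ p / sqrt (real (Suc m))) =
       2 * G * LL (real (Suc m)) ^ p * (2 * a + 1 / b)" by (simp add: b_def algebra_simps)
    also have "\<dots> \<le> 2 * G * LL (real (Suc m)) ^ p * (2 * b)"
      using G s by (intro mult_left_mono) auto
    also have "\<dots> = 4 * G * E (real (Suc m))" by (simp add: E_def b_def)
    finally show ?case by simp
  qed
  have Emono: "E x \<le> E y" if "1 \<le> x" "x \<le> y" for x y
    unfolding E_def using that by (intro mult_mono LL_power_mono) auto
  have Mb: "\<bar>M m\<bar> \<le> (4 * G + C) * E (real m)" if m: "m \<ge> 1" for m
  proof -
    have "\<bar>D m\<bar> \<le> 4 * G * E (real m)"
    proof (cases "m = 1")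
      case True
      thus ?thesis using D1 G E0[of 1] by simp
    next
      case False
      then obtain m' where m': "m = Suc m'" "m' \<ge> 1" using m by (cases m) auto
      have "\<bar>D m\<bar> \<le> 4 * G * E (real m')" using DbS[of m'] m' by simp
      also have "\<dots> \<le> 4 * G * E (real m)" using G m' by (intro mult_left_mono Emono) auto
      finally show ?thesis .
    qed
    moreover have "\<bar>real m * K' m\<bar> \<le> C * E (real m)" using UE[OF m] UK[OF m] by simp
    moreover have "M m = D m + real m * K' m" by (simp add: D_def)
    ultimately show ?thesis by (simp add: distrib_right)
  qed
  have "\<bar>Mq om x\<bar> \<le> (5 * G + C) * sqrt x * LL x ^ p" if x: "x > 0" for x
  proof (cases "x < 1")
    case True
    thus ?thesis using x G C by (simp add: Mq_below_1[OF om])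
  next
    case False
    define m where "m = nat \<lfloor>x\<rfloor>"
    have m: "m \<ge> 1" "real m \<le> x" "x \<le> real m + 1" using False unfolding m_def by (linarith, linarith, linarith)
    have "\<bar>Mq om x - M m\<bar> \<le> Nq om x - Nq om (real m)"
      unfolding M_def by (rule Mq_diff[OF om]) (use m in auto)
    also have "\<dots> \<le> G * E (real m)" by (rule dN) (use m in auto)
    finally have "\<bar>Mq om x\<bar> \<le> (5 * G + C) * E (real m)" using Mb[OF m(1)] by (simp add: distrib_right)
    also have "\<dots> \<le> (5 * G + C) * E x" using G C m by (intro mult_left_mono Emono) auto
    finally show ?thesis by (simp add: E_def mult.assoc)
  qed
  moreover have "5 * G + C > 0" using G C by simp
  ultimately show ?thesis by blast
qed

section \<open>Adding and removing generators\<close>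

definition loc_fin :: "(nat \<Rightarrow> real) \<Rightarrow> bool" where
  "loc_fin p \<longleftrightarrow> (\<forall>j. p j > 1) \<and> (\<forall>x. finite {j. p j \<le> x})"

text \<open>The exponent of generator j is confined to the set \<open>A j\<close>. One notion thus
  covers all integers (UNIV), squarefree ones ({..<2}) and integers avoiding a generator ({0}), and
  generators can be changed one at a time.\<close>

definition gints :: "(nat \<Rightarrow> real) \<Rightarrow> (nat \<Rightarrow> nat set) \<Rightarrow> real \<Rightarrow> (nat \<Rightarrow> nat) set" where
  "gints p A x = {e. finite {j. e j \<noteq> 0} \<and> (\<forall>j. e j \<in> A j) \<and> gen_int p e \<le> x}"

definition cnt :: "(nat \<Rightarrow> real) \<Rightarrow> (nat \<Rightarrow> nat set) \<Rightarrow> real \<Rightarrow> real" where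
  "cnt p A x = real (card (gints p A x))"

definition sfree :: "(nat \<Rightarrow> real) \<Rightarrow> nat set \<Rightarrow> real \<Rightarrow> nat set set" where
  "sfree p I x = {S. finite S \<and> S \<subseteq> I \<and> (\<Prod>j\<in>S. p j) \<le> x}"

definition msum :: "(nat \<Rightarrow> real) \<Rightarrow> nat set \<Rightarrow> real \<Rightarrow> real" where
  "msum p I x = (\<Sum>S\<in>sfree p I x. (-1) ^ card S)"

lemma gen_int_superset:
  assumes "finite J" "{j. e j \<noteq> 0} \<subseteq> J" shows "gen_int p e = (\<Prod>j\<in>J. p j ^ e j)"
  unfolding gen_int_def by (rule prod.mono_neutral_left) (use assms in auto)

lemma prod_ge_elem:
  fixes f :: "nat \<Rightarrow> real"
  assumes "finite J" "\<And>j. j \<in> J \<Longrightarrow> f j \<ge> 1" "i \<in> J" shows "f i \<le> (\<Prod>j\<in>J. f j)"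
proof -
  have "(\<Prod>j\<in>J. f j) = f i * (\<Prod>j\<in>J - {i}. f j)" using assms by (simp add: prod.remove)
  moreover have "(\<Prod>j\<in>J - {i}. f j) \<ge> 1" using assms by (intro prod_ge_1) auto
  ultimately show ?thesis using assms(2)[OF assms(3)] mult_left_mono[of 1 "\<Prod>j\<in>J - {i}. f j" "f i"] by simp
qed

lemma gen_int_ge_1: "loc_fin p \<Longrightarrow> gen_int p e \<ge> 1"
  unfolding gen_int_def loc_fin_def by (intro prod_ge_1 one_le_power) (auto intro: less_imp_le)

lemma finite_gints:
  assumes p: "loc_fin p" shows "finite (gints p A x)"
proof -
  define J where "J = {j. p j \<le> x}"
  have J: "finite J" using p by (simp add: J_def loc_fin_def)
  have p1: "p j > 1" for j using p by (simp add: loc_fin_def)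
  have "\<exists>n. \<forall>j\<in>J. x < p j ^ n"
  proof -
    have "\<forall>j. \<exists>n. x < p j ^ n" using p1 real_arch_pow by blast
    then obtain n where n: "\<And>j. x < p j ^ n j" by metis
    have "x < p j ^ (\<Sum>j\<in>J. n j)" if "j \<in> J" for j
    proof -
      have "n j \<le> (\<Sum>j\<in>J. n j)" using J that by (intro member_le_sum) auto
      hence "p j ^ n j \<le> p j ^ (\<Sum>j\<in>J. n j)" using p1[of j] by (intro power_increasing) auto
      thus ?thesis using n[of j] by linarith
    qed
    thus ?thesis by blast
  qed
  then obtain n where n: "\<And>j. j \<in> J \<Longrightarrow> x < p j ^ n" by blast
  have "gints p A x \<subseteq> {e. \<forall>j. (j \<in> J \<longrightarrow> e j \<in> {..n}) \<and> (j \<notin> J \<longrightarrow> e j = 0)}"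
  proof (clarify, intro conjI impI)
    fix e j assume "e \<in> gints p A x"
    hence e: "finite {j. e j \<noteq> 0}" "gen_int p e \<le> x" by (auto simp: gints_def)
    have le: "p j ^ e j \<le> x" if "e j \<noteq> 0"
    proof -
      have "1 \<le> p j ^ e j" for j using p1[of j] by (intro one_le_power) auto
      hence "p j ^ e j \<le> gen_int p e" unfolding gen_int_def using e that by (intro prod_ge_elem) auto
      thus ?thesis using e by linarith
    qed
    {
      assume j: "j \<notin> J"
      show "e j = 0"
      proof (rule ccontr)
        assume 0: "e j \<noteq> 0"
        have "p j ^ 1 \<le> p j ^ e j" using p1[of j] 0 by (intro power_increasing) auto
        thus False using le[OF 0] j by (simp add: J_def)
      qed
    next
      assume j: "j \<in> J"
      show "e j \<in> {..n}"
      proof (rule ccontr)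
        assume "e j \<notin> {..n}"
        hence "n \<le> e j" "e j \<noteq> 0" by auto
        hence "p j ^ n \<le> p j ^ e j" using p1[of j] by (intro power_increasing) auto
        thus False using le[OF \<open>e j \<noteq> 0\<close>] n[OF j] by simp
      qed
    }
  qed
  moreover have "finite {e :: nat \<Rightarrow> nat. \<forall>j. (j \<in> J \<longrightarrow> e j \<in> {..n}) \<and> (j \<notin> J \<longrightarrow> e j = 0)}"
    by (rule finite_set_of_finite_funs) (use J in auto)
  ultimately show ?thesis by (rule finite_subset)
qed

lemma finite_sfree: assumes p: "loc_fin p" shows "finite (sfree p I x)"
proof -
  have "sfree p I x \<subseteq> Pow {j. p j \<le> x}"
  proof (clarify)
    fix S j assume S: "S \<in> sfree p I x" "j \<in> S"
    hence "p j \<le> (\<Prod>j\<in>S. p j)" using p by (intro prod_ge_elem) (auto simp: sfree_def loc_fin_def intro: less_imp_le)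
    thus "p j \<le> x" using S by (auto simp: sfree_def)
  qed
  moreover have "finite (Pow {j. p j \<le> x})" using p by (simp add: loc_fin_def)
  ultimately show ?thesis by (rule finite_subset)
qed

lemma cnt_below_1: "loc_fin p \<Longrightarrow> x < 1 \<Longrightarrow> cnt p A x = 0"
proof -
  assume p: "loc_fin p" and x: "x < 1"
  have "gints p A x = {}" unfolding gints_def using gen_int_ge_1[OF p] x by (auto simp: not_le intro: less_le_trans)
  thus ?thesis by (simp add: cnt_def)
qed

lemma msum_below_1: "loc_fin p \<Longrightarrow> x < 1 \<Longrightarrow> msum p I x = 0"
proof -
  assume p: "loc_fin p" and x: "x < 1"
  have "(\<Prod>j\<in>S. p j) \<ge> 1" for S using p by (intro prod_ge_1) (auto simp: loc_fin_def less_imp_le)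
  hence "sfree p I x = {}" unfolding sfree_def using x by (auto simp: not_le intro: less_le_trans)
  thus ?thesis by (simp add: msum_def)
qed

lemma gen_int_upd:
  assumes "finite {j. e j \<noteq> 0}" shows "gen_int p (e(a := e a + c)) = p a ^ c * gen_int p e"
proof -
  define J where "J = insert a {j. e j \<noteq> 0}"
  have J: "finite J" "a \<in> J" using assms by (auto simp: J_def)
  have "gen_int p (e(a := e a + c)) = (\<Prod>j\<in>J. p j ^ (e(a := e a + c)) j)"
    by (rule gen_int_superset) (use assms in \<open>auto simp: J_def\<close>)
  also have "\<dots> = p a ^ (e a + c) * (\<Prod>j\<in>J - {a}. p j ^ e j)"
    using J by (simp add: prod.remove)
  also have "\<dots> = p a ^ c * (\<Prod>j\<in>J. p j ^ e j)" using J by (simp add: prod.remove power_add)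
  also have "(\<Prod>j\<in>J. p j ^ e j) = gen_int p e" by (rule gen_int_superset[symmetric]) (use assms in \<open>auto simp: J_def\<close>)
  finally show ?thesis .
qed

lemma finite_supp_upd: "finite {j. (e :: nat \<Rightarrow> nat) j \<noteq> 0} \<Longrightarrow> finite {j. (e(a := v)) j \<noteq> 0}"
  by (rule finite_subset[of _ "insert a {j. e j \<noteq> 0}"]) auto

text \<open>Either the exponent at a is below c, or c can be subtracted from it, which divides the
  integer by p a ^ c. With c = 1 the generator a disappears; with c = 2 its exponent is limited to 0
  and 1.\<close>

lemma cnt_step:
  assumes p: "loc_fin p"
  shows "cnt p (A(a := UNIV)) x = cnt p (A(a := {..<c})) x + cnt p (A(a := UNIV)) (x / p a ^ c)"
proof -
  have "p a > 1" using p by (simp add: loc_fin_def)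
  hence pa: "p a ^ c > 0" by (intro zero_less_power) linarith
  define f where "f e = e(a := e a + c)" for e :: "nat \<Rightarrow> nat"
  have inj: "inj_on f X" for X
  proof (rule inj_onI)
    fix e e' assume "f e = f e'"
    hence "f e j = f e' j" for j by simp
    hence "e j = e' j" for j unfolding f_def by (cases "j = a") (metis add_right_cancel fun_upd_same, metis fun_upd_other)
    thus "e = e'" by auto
  qed
  have "gints p (A(a := UNIV)) x = gints p (A(a := {..<c})) x \<union> f ` gints p (A(a := UNIV)) (x / p a ^ c)"
  proof (intro set_eqI iffI)
    fix e assume e: "e \<in> gints p (A(a := UNIV)) x"
    show "e \<in> gints p (A(a := {..<c})) x \<union> f ` gints p (A(a := UNIV)) (x / p a ^ c)"
    proof (cases "e a < c")
      case True
      have "e j \<in> (A(a := {..<c})) j" for j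
      proof -
        have "e j \<in> (A(a := UNIV)) j" using e by (simp add: gints_def)
        thus ?thesis using True by (cases "j = a") auto
      qed
      thus ?thesis using e unfolding gints_def by blast
    next
      case False
      define e' where "e' = e(a := e a - c)"
      have fe: "f e' = e" using False by (auto simp: f_def e'_def)
      have fin: "finite {j. e' j \<noteq> 0}" unfolding e'_def using e by (intro finite_supp_upd) (auto simp: gints_def)
      have "gen_int p e = p a ^ c * gen_int p e'" using gen_int_upd[OF fin, of p a c] fe by (simp add: f_def)
      moreover have "gen_int p e \<le> x" using e by (simp add: gints_def)
      ultimately have "gen_int p e' \<le> x / p a ^ c" using pa by (simp add: pos_le_divide_eq mult.commute)
      moreover have "e' j \<in> (A(a := UNIV)) j" for j
      proof -
        have "e j \<in> (A(a := UNIV)) j" using e by (simp add: gints_def)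
        thus ?thesis by (cases "j = a") (auto simp: e'_def)
      qed
      ultimately have "e' \<in> gints p (A(a := UNIV)) (x / p a ^ c)"
        using fin unfolding gints_def by blast
      thus ?thesis using fe by blast
    qed
  next
    fix e assume "e \<in> gints p (A(a := {..<c})) x \<union> f ` gints p (A(a := UNIV)) (x / p a ^ c)"
    thus "e \<in> gints p (A(a := UNIV)) x"
    proof
      assume "e \<in> gints p (A(a := {..<c})) x"
      thus ?thesis by (auto simp: gints_def split: if_splits)
    next
      assume "e \<in> f ` gints p (A(a := UNIV)) (x / p a ^ c)"
      then obtain e' where e': "e = f e'" "e' \<in> gints p (A(a := UNIV)) (x / p a ^ c)" by blast
      have fin: "finite {j. e' j \<noteq> 0}" using e' by (auto simp: gints_def)
      have "gen_int p e = p a ^ c * gen_int p e'" using gen_int_upd[OF fin, of p a c] e' by (simp add: f_def)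
      moreover have "finite {j. e j \<noteq> 0}" unfolding e'(1) f_def by (rule finite_supp_upd[OF fin])
      moreover have "gen_int p e' \<le> x / p a ^ c" using e' by (simp add: gints_def)
      hence "p a ^ c * gen_int p e' \<le> x" using pa by (simp add: pos_le_divide_eq mult.commute)
      moreover have "e j \<in> (A(a := UNIV)) j" for j
      proof -
        have "e' j \<in> (A(a := UNIV)) j" using e' by (simp add: gints_def)
        thus ?thesis by (cases "j = a") (auto simp: e'(1) f_def)
      qed
      ultimately show ?thesis unfolding gints_def by simp
    qed
  qed
  moreover have "gints p (A(a := {..<c})) x \<inter> f ` gints p (A(a := UNIV)) (x / p a ^ c) = {}"
  proof -
    have "e a < c" if "e \<in> gints p (A(a := {..<c})) x" for e
    proof -
      have "e a \<in> (A(a := {..<c})) a" using that unfolding gints_def by blast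
      thus ?thesis by simp
    qed
    thus ?thesis by (auto simp: f_def) (metis fun_upd_same not_add_less2)
  qed
  ultimately have "card (gints p (A(a := UNIV)) x) = card (gints p (A(a := {..<c})) x) + card (f ` gints p (A(a := UNIV)) (x / p a ^ c))"
    using finite_gints[OF p] by (simp add: card_Un_disjoint)
  also have "card (f ` gints p (A(a := UNIV)) (x / p a ^ c)) = card (gints p (A(a := UNIV)) (x / p a ^ c))"
    by (rule card_image[OF inj])
  finally show ?thesis unfolding cnt_def by linarith
qed

text \<open>A set gains a sign when a is inserted. Admitting a generator v multiplies the Dirichlet
  series of the Moebius function by 1 - v powr (-s), so in Moebius sums it is the removal of a
  generator that acts as division by this factor.\<close>

lemma msum_step:
  assumes p: "loc_fin p" and a: "a \<notin> I"
  shows "msum p I x = msum p (insert a I) x + msum p I (x / p a)"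
proof -
  have pa: "p a > 0" using p by (auto simp: loc_fin_def intro: less_trans[of 0 1])
  have inj: "inj_on (insert a) (sfree p I y)" for y
  proof (rule inj_onI)
    fix S S' assume "S \<in> sfree p I y" "S' \<in> sfree p I y" "insert a S = insert a S'"
    thus "S = S'" using a by (auto simp: sfree_def)
  qed
  have "sfree p (insert a I) x = sfree p I x \<union> insert a ` sfree p I (x / p a)"
  proof (intro set_eqI iffI)
    fix S assume S: "S \<in> sfree p (insert a I) x"
    show "S \<in> sfree p I x \<union> insert a ` sfree p I (x / p a)"
    proof (cases "a \<in> S")
      case True
      have "S - {a} \<in> sfree p I (x / p a)" using S True pa by (auto simp: sfree_def prod.remove field_simps)
      moreover have "S = insert a (S - {a})" using True by auto
      ultimately show ?thesis by blast
    next
      case False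
      thus ?thesis using S by (auto simp: sfree_def)
    qed
  next
    fix S assume "S \<in> sfree p I x \<union> insert a ` sfree p I (x / p a)"
    thus "S \<in> sfree p (insert a I) x"
    proof
      assume "S \<in> insert a ` sfree p I (x / p a)"
      then obtain S' where S': "S = insert a S'" "S' \<in> sfree p I (x / p a)" by blast
      moreover have "a \<notin> S'" using S' a by (auto simp: sfree_def)
      ultimately show ?thesis using pa by (auto simp: sfree_def field_simps)
    qed (auto simp: sfree_def)
  qed
  moreover have "sfree p I x \<inter> insert a ` sfree p I (x / p a) = {}" using a by (auto simp: sfree_def)
  ultimately have "msum p (insert a I) x = msum p I x + (\<Sum>S\<in>insert a ` sfree p I (x / p a). (-1) ^ card S)"
    unfolding msum_def using finite_sfree[OF p] by (simp add: sum.union_disjoint)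
  also have "(\<Sum>S\<in>insert a ` sfree p I (x / p a). (-1::real) ^ card S) = (\<Sum>S\<in>sfree p I (x / p a). (-1) ^ card (insert a S))"
    by (simp add: sum.reindex[OF inj])
  also have "\<dots> = (\<Sum>S\<in>sfree p I (x / p a). - ((-1) ^ card S))"
  proof (rule sum.cong)
    fix S assume "S \<in> sfree p I (x / p a)"
    hence "finite S" "a \<notin> S" using a by (auto simp: sfree_def)
    thus "(-1::real) ^ card (insert a S) = - ((-1) ^ card S)" by simp
  qed simp
  finally show ?thesis by (simp add: msum_def sum_negf)
qed

text \<open>Generators above x do not divide any integer up to x, and a generator that only admits
  exponent 0 may have any value.\<close>

lemma cnt_cong:
  assumes p: "loc_fin p" and "\<And>j. p j \<le> x \<Longrightarrow> A j = B j" "\<And>j. 0 \<in> A j" "\<And>j. 0 \<in> B j"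
    and pp: "\<And>j. A j \<noteq> {0} \<Longrightarrow> p j = p' j" "loc_fin p'" "\<And>j. p' j \<le> x \<Longrightarrow> A j = B j"
  shows "cnt p A x = cnt p' B x"
proof -
  have z: "e j = 0" if "loc_fin p" "finite {j. e j \<noteq> 0}" "gen_int p e \<le> x" "\<not> p j \<le> x" for e j p
  proof (rule ccontr)
    assume 0: "e j \<noteq> 0"
    have "p j \<le> p j ^ e j" using that(1) 0 power_increasing[of 1 "e j" "p j"] by (auto simp: loc_fin_def less_imp_le)
    also have "\<dots> \<le> gen_int p e" unfolding gen_int_def
    proof (rule prod_ge_elem)
      fix j
      have "p j > 1" using that(1) by (simp add: loc_fin_def)
      thus "1 \<le> p j ^ e j" by (intro one_le_power) auto
    qed (use that 0 in auto)
    finally show False using that by simp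
  qed
  have g: "gen_int p e = gen_int p' e" if "\<And>j. e j \<in> A j" for e
    unfolding gen_int_def
  proof (rule prod.cong)
    fix j assume "j \<in> {j. e j \<noteq> 0}"
    hence "A j \<noteq> {0}" using that[of j] by fastforce
    hence "p j = p' j" by (rule pp(1))
    thus "p j ^ e j = p' j ^ e j" by (simp only:)
  qed simp
  have "gints p A x = gints p' B x"
  proof (intro set_eqI iffI)
    fix e assume e: "e \<in> gints p A x"
    hence eA: "\<And>j. e j \<in> A j" and eg: "finite {j. e j \<noteq> 0}" "gen_int p e \<le> x" unfolding gints_def by blast+
    have "e j \<in> B j" for j
    proof (cases "p j \<le> x")
      case True from assms(2)[OF this] show ?thesis using eA[of j] by metis
    next
      case False from z[OF p eg this] show ?thesis using assms(4)[of j] by metis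
    qed
    thus "e \<in> gints p' B x" using eg g[OF eA] unfolding gints_def by simp
  next
    fix e assume e: "e \<in> gints p' B x"
    hence eB: "\<And>j. e j \<in> B j" and eg: "finite {j. e j \<noteq> 0}" "gen_int p' e \<le> x" unfolding gints_def by blast+
    have eA: "e j \<in> A j" for j
    proof (cases "p' j \<le> x")
      case True from pp(3)[OF this] show ?thesis using eB[of j] by metis
    next
      case False from z[OF pp(2) eg this] show ?thesis using assms(3)[of j] by metis
    qed
    thus "e \<in> gints p A x" using eA eg g[OF eA] unfolding gints_def by simp
  qed
  thus ?thesis by (simp add: cnt_def)
qed

lemma msum_cong:
  assumes p: "loc_fin p" "loc_fin p'" and "\<And>j. p j \<le> x \<Longrightarrow> j \<in> I \<longleftrightarrow> j \<in> I'" "\<And>j. p' j \<le> x \<Longrightarrow> j \<in> I \<longleftrightarrow> j \<in> I'"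
    and pp: "\<And>j. j \<in> I \<Longrightarrow> p j = p' j"
  shows "msum p I x = msum p' I' x"
proof -
  have z: "p j \<le> x" if "loc_fin p" "S \<in> sfree p I x" "j \<in> S" for p I S j
  proof -
    have "p j \<le> (\<Prod>j\<in>S. p j)" using that by (intro prod_ge_elem) (auto simp: sfree_def loc_fin_def intro: less_imp_le)
    thus ?thesis using that by (auto simp: sfree_def)
  qed
  have "sfree p I x = sfree p' I' x"
  proof (intro set_eqI iffI)
    fix S assume S: "S \<in> sfree p I x"
    hence SI: "S \<subseteq> I" by (auto simp: sfree_def)
    have "S \<subseteq> I'" using z[OF p(1) S] assms(3) SI by blast
    moreover have "(\<Prod>j\<in>S. p j) = (\<Prod>j\<in>S. p' j)" using SI pp by (intro prod.cong) auto
    ultimately show "S \<in> sfree p' I' x" using S by (auto simp: sfree_def)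
  next
    fix S assume S: "S \<in> sfree p' I' x"
    hence SI: "S \<subseteq> I'" by (auto simp: sfree_def)
    have "S \<subseteq> I" using z[OF p(2) S] assms(4) SI by blast
    moreover from this have "(\<Prod>j\<in>S. p j) = (\<Prod>j\<in>S. p' j)" using pp by (intro prod.cong) auto
    ultimately show "S \<in> sfree p I x" using S by (auto simp: sfree_def)
  qed
  thus ?thesis by (simp add: msum_def)
qed

text \<open>\<open>G\<close> arises from \<open>H\<close> by admitting all powers of a further generator \<open>v\<close>, that is,
  by dividing the Dirichlet series by \<open>1 - v powr (-s)\<close>.\<close>
definition Step :: "real \<Rightarrow> (real \<Rightarrow> real) \<Rightarrow> (real \<Rightarrow> real) \<Rightarrow> bool" where
  "Step v H G \<longleftrightarrow> (\<forall>x>0. G x = H x + G (x / v)) \<and> (\<forall>x>0. x < 1 \<longrightarrow> G x = 0)"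

text \<open>The clause r \<le> C serves x < 1: there a counting function is 0 and its whole error r
  * x has to be covered by C * E x.\<close>

definition asym :: "(real \<Rightarrow> real) \<Rightarrow> real \<Rightarrow> real \<Rightarrow> (real \<Rightarrow> real) \<Rightarrow> bool" where
  "asym E r C f \<longleftrightarrow> 0 \<le> r \<and> r \<le> C \<and> (\<forall>x>0. \<bar>f x - r * x\<bar> \<le> C * E x)"

text \<open>Unfolding the recursion writes G x as the sum of the H (x / v ^ n). The densities form a
  geometric series of ratio 1 / v and the errors one of ratio at most w.\<close>

lemma step_add:
  assumes S: "Step v H G" and A: "asym E r C H" and v: "v > 1" and w: "1 / v \<le> w" "w < 1"
    and E: "\<And>x. x > 0 \<Longrightarrow> E (x / v) \<le> w * E x" "\<And>x. 0 < x \<Longrightarrow> x < 1 \<Longrightarrow> x \<le> E x"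
  shows "asym E (r / (1 - 1 / v)) (C / (1 - w)) G"
proof -
  have r: "0 \<le> r" "r \<le> C" and H: "\<And>x. x > 0 \<Longrightarrow> \<bar>H x - r * x\<bar> \<le> C * E x" using A by (auto simp: asym_def)
  define r' where "r' = r / (1 - 1 / v)"
  define C' where "C' = C / (1 - w)"
  have v1: "1 - 1 / v > 0" using v by simp
  have r': "0 \<le> r'" using r v1 by (simp add: r'_def)
  have rC: "r' \<le> C'" unfolding r'_def C'_def using r w v1 by (intro frac_le) auto
  have C0: "C' \<ge> 0" using r' rC by linarith
  have Ceq: "C + C' * w = C'" unfolding C'_def using w by (simp add: field_simps)
  have req: "r' = r + r' / v" unfolding r'_def using v1 v by (simp add: field_simps)
  have "\<bar>G x - r' * x\<bar> \<le> C' * E x" if "x > 0" "x < v ^ n" for n x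
    using that
  proof (induction n arbitrary: x)
    case 0
    have "\<forall>x>0. x < 1 \<longrightarrow> G x = 0" using S unfolding Step_def by blast
    hence "G x = 0" using 0 by (metis power_0)
    hence "\<bar>G x - r' * x\<bar> = r' * x" using r' 0 by simp
    also have "\<dots> \<le> C' * E x" using rC r' 0 E(2)[of x] C0 by (intro mult_mono) auto
    finally show ?case .
  next
    case (Suc n)
    have IH: "\<bar>G (x / v) - r' * (x / v)\<bar> \<le> C' * E (x / v)"
      using Suc v by (intro Suc.IH) (auto simp: field_simps)
    have "G x - r' * x = (H x - r * x) + (G (x / v) - r' * (x / v))"
    proof -
      have "\<forall>x>0. G x = H x + G (x / v)" using S unfolding Step_def by blast
      hence "G x = H x + G (x / v)" using Suc(2) by blast
      thus ?thesis by (subst req) (simp add: algebra_simps)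
    qed
    hence "\<bar>G x - r' * x\<bar> \<le> C * E x + C' * E (x / v)" using H[OF Suc(2)] IH by linarith
    also have "\<dots> \<le> C * E x + C' * (w * E x)" using E(1)[OF Suc(2)] C0 by (intro add_left_mono mult_left_mono) auto
    also have "\<dots> = (C + C' * w) * E x" by (simp add: algebra_simps)
    finally show ?case unfolding Ceq .
  qed
  moreover have "\<exists>n. x < v ^ n" for x using real_arch_pow[OF v] .
  ultimately show ?thesis using r' rC unfolding asym_def r'_def C'_def by blast
qed

text \<open>H is the difference of G at x and at x / v, which costs 1 + w; this is relaxed to 1 / (1
  - w) so that both directions share one constant.\<close>

lemma step_remove:
  assumes S: "Step v H G" and A: "asym E r C G" and v: "v > 1" and w: "1 / v \<le> w" "w < 1"
    and E: "\<And>x. x > 0 \<Longrightarrow> E (x / v) \<le> w * E x" "\<And>x. x > 0 \<Longrightarrow> E x \<ge> 0"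
  shows "asym E (r * (1 - 1 / v)) (C / (1 - w)) H"
proof -
  have r: "0 \<le> r" "r \<le> C" and G: "\<And>x. x > 0 \<Longrightarrow> \<bar>G x - r * x\<bar> \<le> C * E x" using A by (auto simp: asym_def)
  have v1: "1 - 1 / v > 0" "1 - 1 / v \<le> 1" using v by auto
  have "0 \<le> w" using w v by (auto intro: order_trans[of _ "1/v"])
  hence w1: "1 + w \<le> 1 / (1 - w)" using w by (simp add: field_simps)
  have C1: "C * (1 + w) \<le> C / (1 - w)" using mult_left_mono[OF w1, of C] r by simp
  have "\<bar>H x - r * (1 - 1 / v) * x\<bar> \<le> C / (1 - w) * E x" if x: "x > 0" for x
  proof -
    have "H x - r * (1 - 1 / v) * x = (G x - r * x) - (G (x / v) - r * (x / v))"
      using S x by (simp add: Step_def algebra_simps)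
    hence "\<bar>H x - r * (1 - 1 / v) * x\<bar> \<le> C * E x + C * E (x / v)" using G[OF x] G[of "x / v"] x v by force
    also have "\<dots> \<le> C * E x + C * (w * E x)" using E(1)[OF x] r by (intro add_left_mono mult_left_mono) auto
    also have "\<dots> = C * (1 + w) * E x" by (simp add: algebra_simps)
    also have "\<dots> \<le> C / (1 - w) * E x" using C1 E(2)[OF x] by (intro mult_right_mono) auto
    finally show ?thesis .
  qed
  moreover have "1 - 1 / v \<le> 1 + w" using v1 \<open>0 \<le> w\<close> by linarith
  hence "r * (1 - 1 / v) \<le> C * (1 + w)" using r v1 by (intro mult_mono) auto
  ultimately show ?thesis using r v1 C1 unfolding asym_def by auto
qed

section \<open>Finite and infinite chains of steps for the error function \<open>EE\<close>\<close>

definition EE :: "nat \<Rightarrow> real \<Rightarrow> real" where "EE q x = sqrt x * LL x ^ q"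

lemma EE_div: "x > 0 \<Longrightarrow> v > 1 \<Longrightarrow> EE q (x / v) \<le> (1 / sqrt v) * EE q x"
proof -
  assume x: "x > 0" and v: "v > 1"
  have "LL (x / v) ^ q \<le> LL x ^ q" using x v by (intro LL_power_mono) (auto simp: field_simps)
  hence "sqrt (x / v) * LL (x / v) ^ q \<le> sqrt (x / v) * LL x ^ q" using x v by (intro mult_left_mono) auto
  thus ?thesis by (simp add: EE_def real_sqrt_divide)
qed

lemma EE_small: "0 < x \<Longrightarrow> x < 1 \<Longrightarrow> x \<le> EE q x"
proof -
  assume x: "0 < x" "x < 1"
  have "x \<le> sqrt x * 1" using x by (simp add: real_le_rsqrt power2_eq_square mult_left_le)
  also have "\<dots> \<le> sqrt x * LL x ^ q" using x LL_power_ge_1 by (intro mult_left_mono) auto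
  finally show ?thesis by (simp add: EE_def)
qed

lemma EE_nonneg: "x > 0 \<Longrightarrow> EE q x \<ge> 0" by (simp add: EE_def)

lemma inverse_sqrt_facts: "v > 1 \<Longrightarrow> 1 / v \<le> 1 / sqrt v \<and> 1 / sqrt v < 1"
proof -
  assume v: "v > (1::real)"
  have "sqrt v \<le> v" using v real_sqrt_le_mono[of v "v * v"] by (simp add: mult_left_le_one_le)
  thus ?thesis using v by (auto intro: divide_left_mono simp: field_simps)
qed

lemmas step_add_EE = step_add[where E = "EE q" and w = "1 / sqrt v" for q v, OF _ _ _ _ _ EE_div EE_small]
lemmas step_remove_EE = step_remove[where E = "EE q" and w = "1 / sqrt v" for q v, OF _ _ _ _ _ EE_div EE_nonneg]

text \<open>The steps have \<open>v = 1 / y n\<close>; \<open>y n = 0\<close> marks an idle step.\<close>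
lemma chain:
  fixes F :: "nat \<Rightarrow> real \<Rightarrow> real" and y :: "nat \<Rightarrow> real"
  assumes A: "asym (EE q) r0 C0 (F 0)"
    and y: "\<And>n. 0 \<le> y n" "\<And>n. y n \<le> 1/2" "summable y"
    and step: "\<And>n. (y n = 0 \<and> F (Suc n) = F n) \<or> (y n > 0 \<and> (Step (1 / y n) (F n) (F (Suc n)) \<or> Step (1 / y n) (F (Suc n)) (F n)))"
    and lim: "\<And>n x. x > 0 \<Longrightarrow> (\<And>i. i \<ge> n \<Longrightarrow> y i * x < 1) \<Longrightarrow> Finf x = F n x"
  shows "\<exists>r K. 0 \<le> r \<and> (\<forall>n x. x > 0 \<longrightarrow> (\<forall>i\<ge>n. y i * x < 1) \<longrightarrow>
     \<bar>Finf x - r * x\<bar> \<le> C0 * (\<Prod>i<n. 1 / (1 - sqrt (y i))) * EE q x + K * x * (\<Sum>i. y (i + n))) \<and> (r0 = 0 \<longrightarrow> r = 0)"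
proof -
  define \<kappa> where "\<kappa> n = (\<Prod>i<n. 1 / (1 - sqrt (y i)))" for n
  have sq1: "sqrt (y i) < 1" for i using y(2)[of i] real_sqrt_less_mono[of "y i" 1] by simp
  have \<kappa>1: "\<kappa> n \<ge> 1" for n unfolding \<kappa>_def using sq1 y by (intro prod_ge_1) (auto simp: field_simps)
  \<comment> \<open>Either direction multiplies the error constant by 1 / (1 - sqrt (y n)) and the
    density by 1 - y n or its inverse. The densities are obtained by dependent choice because the
    direction may vary with n.\<close>
  have "\<exists>\<rho>. \<rho> 0 = r0 \<and> (\<forall>n. asym (EE q) (\<rho> n) (C0 * \<kappa> n) (F n) \<and> (\<rho> (Suc n) = \<rho> n \<or> \<rho> (Suc n) = \<rho> n * (1 - y n) \<or> \<rho> (Suc n) = \<rho> n / (1 - y n)))"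
  proof -
    have "\<exists>r'. asym (EE q) r' (C0 * \<kappa> (Suc n)) (F (Suc n)) \<and> (r' = r \<or> r' = r * (1 - y n) \<or> r' = r / (1 - y n))"
      if a: "asym (EE q) r (C0 * \<kappa> n) (F n)" for n r
    proof -
      have kS: "C0 * \<kappa> (Suc n) = C0 * \<kappa> n / (1 - sqrt (y n))" by (simp add: \<kappa>_def)
      from step[of n] consider "y n = 0" "F (Suc n) = F n" | "y n > 0" "Step (1 / y n) (F n) (F (Suc n))" | "y n > 0" "Step (1 / y n) (F (Suc n)) (F n)" by blast
      thus ?thesis
      proof cases
        case 1
        thus ?thesis using a kS by auto
      next
        case 2
        have v: "1 / y n > 1" using y(2)[of n] 2 by (simp add: field_simps)
        have "asym (EE q) (r / (1 - 1 / (1 / y n))) (C0 * \<kappa> n / (1 - 1 / sqrt (1 / y n))) (F (Suc n))"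
          by (rule step_add_EE[OF 2(2) a v]) (use inverse_sqrt_facts[OF v] v in auto)
        thus ?thesis using 2 kS by (auto simp: real_sqrt_divide)
      next
        case 3
        have v: "1 / y n > 1" using y(2)[of n] 3 by (simp add: field_simps)
        have "asym (EE q) (r * (1 - 1 / (1 / y n))) (C0 * \<kappa> n / (1 - 1 / sqrt (1 / y n))) (F (Suc n))"
          by (rule step_remove_EE[OF 3(2) a v]) (use inverse_sqrt_facts[OF v] v in auto)
        thus ?thesis using 3 kS by (auto simp: real_sqrt_divide)
      qed
    qed
    hence "\<exists>\<rho>. \<forall>n. (asym (EE q) (\<rho> n) (C0 * \<kappa> n) (F n) \<and> (n = 0 \<longrightarrow> \<rho> n = r0)) \<and> (\<rho> (Suc n) = \<rho> n \<or> \<rho> (Suc n) = \<rho> n * (1 - y n) \<or> \<rho> (Suc n) = \<rho> n / (1 - y n))"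
      using A by (intro dependent_nat_choice) (auto simp: \<kappa>_def)
    thus ?thesis by metis
  qed
  then obtain \<rho> where \<rho>0: "\<rho> 0 = r0" and \<rho>a: "\<And>n. asym (EE q) (\<rho> n) (C0 * \<kappa> n) (F n)"
    and \<rho>s: "\<And>n. \<rho> (Suc n) = \<rho> n \<or> \<rho> (Suc n) = \<rho> n * (1 - y n) \<or> \<rho> (Suc n) = \<rho> n / (1 - y n)" by metis
  have \<rho>nn: "\<rho> n \<ge> 0" for n using \<rho>a[of n] by (simp add: asym_def)
  have inv: "1 / (1 - y n) \<le> 1 + 2 * y n" for n
  proof -
    have "0 \<le> y n * (1 - 2 * y n)" using y(1)[of n] y(2)[of n] by (intro mult_nonneg_nonneg) auto
    thus ?thesis using y(2)[of n] by (simp add: field_simps)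
  qed
  have \<rho>up: "\<rho> (Suc n) \<le> \<rho> n * (1 + 2 * y n)" for n
  proof -
    have "\<rho> n * 1 \<le> \<rho> n * (1 + 2 * y n)" "\<rho> n * (1 - y n) \<le> \<rho> n * (1 + 2 * y n)"
      using \<rho>nn y by (intro mult_left_mono; simp)+
    moreover have "\<rho> n / (1 - y n) \<le> \<rho> n * (1 + 2 * y n)" using mult_left_mono[OF inv \<rho>nn, of n n] by simp
    ultimately show ?thesis using \<rho>s[of n] by auto
  qed
  \<comment> \<open>Uniform bound for the densities, from 1 / (1 - y) \<le> 1 + 2 * y \<le> exp (2 *
    y) for 0 \<le> y \<le> 1/2.\<close>
  define R where "R = r0 * exp (2 * suminf y)"
  have "\<rho> n \<le> r0 * exp (2 * (\<Sum>i<n. y i))" for n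
  proof (induction n)
    case (Suc n)
    have "\<rho> (Suc n) \<le> \<rho> n * exp (2 * y n)"
      using \<rho>up[of n] mult_left_mono[OF exp_ge_add_one_self[of "2 * y n"] \<rho>nn[of n]] by linarith
    also have "\<dots> \<le> r0 * exp (2 * (\<Sum>i<n. y i)) * exp (2 * y n)" using Suc by (intro mult_right_mono) auto
    finally show ?case by (simp add: mult.assoc distrib_left flip: exp_add)
  qed (simp add: \<rho>0)
  moreover have "(\<Sum>i<n. y i) \<le> suminf y" for n using y by (intro sum_le_suminf) auto
  moreover have r00: "r0 \<ge> 0" using \<rho>nn[of 0] \<rho>0 by simp
  ultimately have \<rho>R: "\<rho> n \<le> R" for n unfolding R_def
    by (meson exp_le_cancel_iff mult_left_mono order_trans zero_le_numeral)
  have dif: "\<bar>\<rho> (Suc n) - \<rho> n\<bar> \<le> 2 * R * y n" for n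
  proof -
    have "\<bar>\<rho> (Suc n) - \<rho> n\<bar> \<le> \<rho> n * (2 * y n)"
    proof -
      have "\<rho> (Suc n) \<ge> \<rho> n * (1 - y n)"
      proof -
        have "\<rho> n * (1 - y n) \<le> \<rho> n * 1" "\<rho> n * 1 \<le> \<rho> n * (1 / (1 - y n))"
          using \<rho>nn[of n] y(1,2)[of n] by (intro mult_left_mono; simp add: field_simps)+
        thus ?thesis using \<rho>s[of n] by auto
      qed
      moreover have "\<rho> n * y n \<ge> 0" using \<rho>nn y by simp
      ultimately show ?thesis using \<rho>up[of n] by (simp add: algebra_simps abs_le_iff)
    qed
    also have "\<dots> \<le> R * (2 * y n)" using \<rho>R[of n] y by (intro mult_right_mono) auto
    finally show ?thesis by simp
  qed
  have sd: "summable (\<lambda>n. \<rho> (Suc n) - \<rho> n)"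
    by (rule summable_comparison_test'[where N = 0 and g = "\<lambda>n. 2 * R * y n"]) (use dif y in \<open>auto intro: summable_mult\<close>)
  define r where "r = \<rho> 0 + (\<Sum>n. \<rho> (Suc n) - \<rho> n)"
  have "(\<lambda>n. \<rho> 0 + (\<Sum>i<n. \<rho> (Suc i) - \<rho> i)) \<longlonglongrightarrow> r"
    unfolding r_def by (intro tendsto_add tendsto_const summable_LIMSEQ sd)
  hence rlim: "\<rho> \<longlonglongrightarrow> r" by (simp add: sum_lessThan_telescope)
  have r0': "r \<ge> 0" by (rule LIMSEQ_le_const[OF rlim]) (use \<rho>nn in auto)
  \<comment> \<open>For a given x the chain is stopped as soon as the later steps no longer act
    below x; the density reached by then is off by at most a tail of the series of the
    \<open>y i\<close>.\<close>
  have tail: "\<bar>\<rho> n - r\<bar> \<le> 2 * R * (\<Sum>i. y (i + n))" for n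
  proof -
    have s1: "summable (\<lambda>i. \<rho> (Suc (i + n)) - \<rho> (i + n))" using summable_ignore_initial_segment[OF sd, of n] by simp
    have s2: "summable (\<lambda>i. y (i + n))" using summable_ignore_initial_segment[OF y(3), of n] .
    have s3: "summable (\<lambda>i. \<bar>\<rho> (Suc (i + n)) - \<rho> (i + n)\<bar>)"
      by (rule summable_comparison_test'[where N = 0 and g = "\<lambda>i. 2 * R * y (i + n)"]) (use dif s2 in \<open>auto intro: summable_mult\<close>)
    have "(\<lambda>i. \<rho> (i + n)) \<longlonglongrightarrow> r" using LIMSEQ_ignore_initial_segment[OF rlim, of n] .
    hence "(\<lambda>m. \<Sum>i<m. \<rho> (Suc (i + n)) - \<rho> (i + n)) \<longlonglongrightarrow> r - \<rho> n"
      using sum_lessThan_telescope[of "\<lambda>i. \<rho> (i + n)"] by (auto intro!: tendsto_intros)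
    hence "(\<Sum>i. \<rho> (Suc (i + n)) - \<rho> (i + n)) = r - \<rho> n"
      using LIMSEQ_unique summable_LIMSEQ[OF s1] by blast
    hence "\<bar>r - \<rho> n\<bar> \<le> (\<Sum>i. \<bar>\<rho> (Suc (i + n)) - \<rho> (i + n)\<bar>)" using summable_rabs[OF s3] by simp
    also have "\<dots> \<le> (\<Sum>i. 2 * R * y (i + n))" by (intro suminf_le s3 summable_mult s2 dif)
    also have "\<dots> = 2 * R * (\<Sum>i. y (i + n))" by (rule suminf_mult[OF s2])
    finally show ?thesis by linarith
  qed
  have "\<bar>Finf x - r * x\<bar> \<le> C0 * \<kappa> n * EE q x + (2 * R) * x * (\<Sum>i. y (i + n))" if x: "x > 0" "\<forall>i\<ge>n. y i * x < 1" for n x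
  proof -
    have "Finf x = F n x" using x by (intro lim) auto
    moreover have "\<bar>F n x - \<rho> n * x\<bar> \<le> C0 * \<kappa> n * EE q x" using \<rho>a[of n] x by (simp add: asym_def)
    moreover have "\<bar>\<rho> n * x - r * x\<bar> \<le> (2 * R) * x * (\<Sum>i. y (i + n))"
    proof -
      have "\<bar>\<rho> n * x - r * x\<bar> = \<bar>\<rho> n - r\<bar> * x" using x by (simp add: left_diff_distrib[symmetric] abs_mult)
      also have "\<dots> \<le> 2 * R * (\<Sum>i. y (i + n)) * x" using tail x by (intro mult_right_mono) auto
      finally show ?thesis by (simp only: mult_ac)
    qed
    ultimately show ?thesis by linarith
  qed
  moreover have "r0 = 0 \<longrightarrow> r = 0"
  proof
    assume "r0 = 0"
    hence "\<rho> n = 0" for n using \<rho>R[of n] \<rho>nn[of n] by (simp add: R_def)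
    hence "\<rho> = (\<lambda>_. 0)" by auto
    hence "(\<lambda>_::nat. 0::real) \<longlonglongrightarrow> r" using rlim by simp
    thus "r = 0" by (simp add: LIMSEQ_const_iff)
  qed
  ultimately show ?thesis using r0' unfolding \<kappa>_def by blast
qed

text \<open>The hypothesis says that the sum of v powr (-1/2) over the exchanged generators
  converges. Then the product of the 1 / (1 - sqrt (y i)) is bounded, and x * y i \<le> sqrt x *
  sqrt (y i) whenever y i * x < 1, so the missing tail of the density also costs only sqrt
  x.\<close>

lemma chain_summable:
  fixes F :: "nat \<Rightarrow> real \<Rightarrow> real" and y :: "nat \<Rightarrow> real"
  assumes A: "asym (EE q) r0 C0 (F 0)"
    and y: "\<And>n. 0 \<le> y n" "\<And>n. y n \<le> 1/2" "summable (\<lambda>n. sqrt (y n))"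
    and step: "\<And>n. (y n = 0 \<and> F (Suc n) = F n) \<or> (y n > 0 \<and> (Step (1 / y n) (F n) (F (Suc n)) \<or> Step (1 / y n) (F (Suc n)) (F n)))"
    and lim: "\<And>n x. x > 0 \<Longrightarrow> (\<And>i. i \<ge> n \<Longrightarrow> y i * x < 1) \<Longrightarrow> Finf x = F n x"
  shows "\<exists>r C. asym (EE q) r C Finf \<and> (r0 = 0 \<longrightarrow> r = 0)"
proof -
  have le: "y n \<le> sqrt (y n)" for n using y(1,2)[of n] by (intro real_le_rsqrt) (auto simp: power2_eq_square mult_left_le)
  have sy: "summable y" by (rule summable_comparison_test'[OF y(3), of 0]) (use le y in auto)
  obtain r K where r: "0 \<le> r" "r0 = 0 \<longrightarrow> r = 0" and K: "\<And>n x. x > 0 \<Longrightarrow> (\<forall>i\<ge>n. y i * x < 1) \<Longrightarrow>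
     \<bar>Finf x - r * x\<bar> \<le> C0 * (\<Prod>i<n. 1 / (1 - sqrt (y i))) * EE q x + K * x * (\<Sum>i. y (i + n))"
    using chain[OF A y(1,2) sy step lim] by blast
  have C0: "C0 \<ge> 0" using A by (auto simp: asym_def)
  define Z where "Z = (\<Sum>n. sqrt (y n))"
  have Z0: "Z \<ge> 0" unfolding Z_def by (intro suminf_nonneg y(3)) (use y in auto)
  define C where "C = C0 * exp (4 * Z) + \<bar>K\<bar> * Z + r"
  have "\<bar>Finf x - r * x\<bar> \<le> C * EE q x" if x: "x > 0" for x
  proof -
    have "y \<longlonglongrightarrow> 0" by (rule summable_LIMSEQ_zero[OF sy])
    hence "\<forall>\<^sub>F i in sequentially. y i < 1 / x" by (rule order_tendstoD) (use x in auto)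
    then obtain n where n: "\<And>i. i \<ge> n \<Longrightarrow> y i < 1 / x" by (auto simp: eventually_at_top_linorder)
    hence n': "\<forall>i\<ge>n. y i * x < 1" using x by (auto simp: field_simps)
    have "(\<Prod>i<n. 1 / (1 - sqrt (y i))) \<le> (\<Prod>i<n. exp (4 * sqrt (y i)))"
    proof (intro prod_mono conjI)
      fix i
      \<comment> \<open>As 1/2 < 9/16, the root is at most 3/4, and there 1 / (1 - u) \<le> 1 + 4 *
        u; hence the factor 4 in the exponent.\<close>
      have s: "sqrt (y i) \<le> 3/4"
      proof -
        have "sqrt (y i) \<le> sqrt ((3/4)\<^sup>2)" using y(2)[of i] by (intro real_sqrt_le_mono) (simp add: power2_eq_square)
        thus ?thesis by simp
      qed
      have s0: "sqrt (y i) \<ge> 0" using y by simp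
      have "0 \<le> 1 - sqrt (y i)" using s by linarith
      thus "0 \<le> 1 / (1 - sqrt (y i))" by (rule divide_nonneg_nonneg[OF zero_le_one])
      have "0 \<le> sqrt (y i) * (3 - 4 * sqrt (y i))" using s s0 by (intro mult_nonneg_nonneg) auto
      hence "1 \<le> (1 + 4 * sqrt (y i)) * (1 - sqrt (y i))" by (simp add: algebra_simps)
      moreover have "0 < 1 - sqrt (y i)" using s by linarith
      ultimately have "1 / (1 - sqrt (y i)) \<le> 1 + 4 * sqrt (y i)" by (simp only: pos_divide_le_eq)
      also have "\<dots> \<le> exp (4 * sqrt (y i))" by (rule exp_ge_add_one_self)
      finally show "1 / (1 - sqrt (y i)) \<le> exp (4 * sqrt (y i))" .
    qed
    also have "\<dots> = exp (4 * (\<Sum>i<n. sqrt (y i)))" by (simp add: exp_sum sum_distrib_left)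
    also have "\<dots> \<le> exp (4 * Z)" unfolding Z_def using y by (auto intro!: sum_le_suminf)
    finally have P: "(\<Prod>i<n. 1 / (1 - sqrt (y i))) \<le> exp (4 * Z)" .
    have T: "x * (\<Sum>i. y (i + n)) \<le> Z * sqrt x"
    proof -
      have s2: "summable (\<lambda>i. y (i + n))" using summable_ignore_initial_segment[OF sy, of n] .
      have s3: "summable (\<lambda>i. sqrt (y (i + n)))" using summable_ignore_initial_segment[OF y(3), of n] .
      have "sqrt x * y (i + n) \<le> sqrt (y (i + n))" for i
      proof -
        have "y (i + n) * x \<le> 1" using n' by (simp add: less_imp_le)
        hence "sqrt (y (i + n)) * sqrt x \<le> 1" using real_sqrt_le_mono[of "y (i+n) * x" 1] by (simp add: real_sqrt_mult)
        hence "sqrt (y (i + n)) * (sqrt (y (i + n)) * sqrt x) \<le> sqrt (y (i + n)) * 1" using y by (intro mult_left_mono) auto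
        moreover have "sqrt (y (i + n)) * (sqrt (y (i + n)) * sqrt x) = sqrt x * y (i + n)" using y by (simp add: mult.assoc[symmetric])
        ultimately show ?thesis by simp
      qed
      hence "(\<Sum>i. sqrt x * y (i + n)) \<le> (\<Sum>i. sqrt (y (i + n)))" by (intro suminf_le summable_mult s2 s3)
      also have "\<dots> \<le> Z" unfolding Z_def using suminf_split_initial_segment[OF y(3), of n] y by (simp add: sum_nonneg)
      finally have "sqrt x * (\<Sum>i. y (i + n)) \<le> Z" using suminf_mult[OF s2, of "sqrt x"] by simp
      hence "sqrt x * (sqrt x * (\<Sum>i. y (i + n))) \<le> sqrt x * Z" using x by (intro mult_left_mono) auto
      thus ?thesis using x by (simp add: mult.assoc[symmetric] mult.commute)
    qed
    have sE: "sqrt x \<le> EE q x" unfolding EE_def using LL_power_ge_1[of x q] x mult_left_mono[of 1 "LL x ^ q" "sqrt x"] by simp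
    have "\<bar>Finf x - r * x\<bar> \<le> C0 * (\<Prod>i<n. 1 / (1 - sqrt (y i))) * EE q x + K * x * (\<Sum>i. y (i + n))" by (rule K[OF x n'])
    also have "C0 * (\<Prod>i<n. 1 / (1 - sqrt (y i))) * EE q x \<le> C0 * exp (4 * Z) * EE q x"
      using P C0 EE_nonneg[OF x] by (intro mult_right_mono mult_left_mono) auto
    also have "K * x * (\<Sum>i. y (i + n)) \<le> \<bar>K\<bar> * (x * (\<Sum>i. y (i + n)))"
    proof -
      have "(\<Sum>i. y (i + n)) \<ge> 0" by (intro suminf_nonneg summable_ignore_initial_segment sy y)
      thus ?thesis using x by (simp add: mult.assoc mult_right_mono)
    qed
    also have "\<dots> \<le> \<bar>K\<bar> * (Z * sqrt x)" using T by (intro mult_left_mono) auto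
    also have "\<dots> \<le> \<bar>K\<bar> * (Z * EE q x)" using sE Z0 by (intro mult_left_mono) auto
    finally have "\<bar>Finf x - r * x\<bar> \<le> (C0 * exp (4 * Z) + \<bar>K\<bar> * Z) * EE q x" by (simp add: algebra_simps)
    also have "\<dots> \<le> C * EE q x" unfolding C_def using r EE_nonneg[OF x] by (intro mult_right_mono) auto
    finally show ?thesis .
  qed
  moreover have "r \<le> C" unfolding C_def using C0 Z0 by simp
  ultimately show ?thesis using r unfolding asym_def by blast
qed

section \<open>From squarefree integers to all integers\<close>

text \<open>In \<open>NR p R\<close> and \<open>MR p R\<close> the generators with index in \<open>R\<close> are left out.\<close>
definition NR :: "(nat \<Rightarrow> real) \<Rightarrow> nat set \<Rightarrow> real \<Rightarrow> real" where
  "NR p R = cnt p (\<lambda>j. if j \<in> R then {0} else UNIV)"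

definition MR :: "(nat \<Rightarrow> real) \<Rightarrow> nat set \<Rightarrow> real \<Rightarrow> real" where
  "MR p R = msum p (- R)"

lemma NR_step: assumes "loc_fin p" "a \<notin> R" shows "Step (p a) (NR p (insert a R)) (NR p R)"
proof -
  let ?A = "\<lambda>j. if j \<in> R then {0} else UNIV :: nat set"
  have 1: "?A(a := UNIV) = ?A" using assms by (auto simp: fun_eq_iff)
  have 2: "?A(a := {..<1}) = (\<lambda>j. if j \<in> insert a R then {0} else UNIV)" by (auto simp: fun_eq_iff)
  have "NR p R x = NR p (insert a R) x + NR p R (x / p a)" for x
    using cnt_step[OF assms(1), of ?A a x 1] unfolding 1 2 NR_def power_one_right .
  thus ?thesis using cnt_below_1[OF assms(1)] unfolding Step_def NR_def by blast
qed

lemma MR_step: assumes "loc_fin p" "a \<notin> R" shows "Step (p a) (MR p R) (MR p (insert a R))"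
proof -
  have 1: "insert a (- insert a R) = - R" using assms by auto
  have "MR p (insert a R) x = MR p R x + MR p (insert a R) (x / p a)" for x
    using msum_step[OF assms(1), of a "- insert a R" x] unfolding 1 MR_def by blast
  thus ?thesis using msum_below_1[OF assms(1)] unfolding Step_def MR_def by blast
qed

lemma NR_cong:
  assumes "loc_fin p" "loc_fin p'" "\<And>j. j \<notin> R \<inter> R' \<Longrightarrow> p j = p' j"
    "\<And>j. p j \<le> x \<Longrightarrow> j \<in> R \<longleftrightarrow> j \<in> R'" "\<And>j. p' j \<le> x \<Longrightarrow> j \<in> R \<longleftrightarrow> j \<in> R'"
  shows "NR p R x = NR p' R' x"
  unfolding NR_def
proof (rule cnt_cong[OF assms(1) _ _ _ _ assms(2)])
  fix j
  show "p j \<le> x \<Longrightarrow> (if j \<in> R then {0} else UNIV) = (if j \<in> R' then {0} else UNIV :: nat set)" using assms(4) by simp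
  show "p' j \<le> x \<Longrightarrow> (if j \<in> R then {0} else UNIV) = (if j \<in> R' then {0} else UNIV :: nat set)" using assms(5) by simp
  show "(if j \<in> R then {0} else UNIV) \<noteq> {0 :: nat} \<Longrightarrow> p j = p' j" using assms(3)[of j] by (auto split: if_splits)
qed auto

lemma MR_cong:
  assumes "loc_fin p" "loc_fin p'" "\<And>j. j \<notin> R \<inter> R' \<Longrightarrow> p j = p' j"
    "\<And>j. p j \<le> x \<Longrightarrow> j \<in> R \<longleftrightarrow> j \<in> R'" "\<And>j. p' j \<le> x \<Longrightarrow> j \<in> R \<longleftrightarrow> j \<in> R'"
  shows "MR p R x = MR p' R' x"
  unfolding MR_def
proof (rule msum_cong[OF assms(1,2)])
  fix j
  show "p j \<le> x \<Longrightarrow> j \<in> - R \<longleftrightarrow> j \<in> - R'" using assms(4)[of j] by blast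
  show "p' j \<le> x \<Longrightarrow> j \<in> - R \<longleftrightarrow> j \<in> - R'" using assms(5)[of j] by blast
  show "j \<in> - R \<Longrightarrow> p j = p' j" using assms(3)[of j] by blast
qed

text \<open>Passing from the removed set \<open>R0\<close> to \<open>R1\<close>, one prime of the symmetric difference at a time.\<close>
lemma chain_set:
  fixes G :: "nat set \<Rightarrow> real \<Rightarrow> real"
  assumes p: "\<And>j. p j \<ge> 2"
    and stp: "\<And>a R. a \<notin> R \<Longrightarrow> Step (p a) (G R) (G (insert a R)) \<or> Step (p a) (G (insert a R)) (G R)"
    and cong: "\<And>R R' x. (\<And>j. p j \<le> x \<Longrightarrow> j \<in> R \<longleftrightarrow> j \<in> R') \<Longrightarrow> G R x = G R' x"
    and sm: "summable (\<lambda>j. if j \<in> (R0 - R1) \<union> (R1 - R0) then 1 / sqrt (p j) else 0)"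
    and A: "asym (EE q) r0 C0 (G R0)"
  shows "\<exists>r C. asym (EE q) r C (G R1) \<and> (r0 = 0 \<longrightarrow> r = 0)"
proof -
  define D where "D = (R0 - R1) \<union> (R1 - R0)"
  define Rn where "Rn n = (R1 \<inter> {..<n}) \<union> (R0 \<inter> {n..})" for n
  define y where "y n = (if n \<in> D then 1 / p n else 0)" for n
  have pp: "p j > 0" for j using p[of j] by linarith
  show ?thesis
  proof (rule chain_summable[where F = "\<lambda>n. G (Rn n)" and y = y])
    show "asym (EE q) r0 C0 (G (Rn 0))" using A by (simp add: Rn_def)
    show "0 \<le> y n" for n using pp[of n] by (simp add: y_def)
    show "y n \<le> 1/2" for n using p[of n] by (simp add: y_def field_simps)
    have "(\<lambda>n. sqrt (y n)) = (\<lambda>j. if j \<in> D then 1 / sqrt (p j) else 0)"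
      by (auto simp: y_def real_sqrt_divide)
    thus "summable (\<lambda>n. sqrt (y n))" using sm unfolding D_def by simp
    show "(y n = 0 \<and> G (Rn (Suc n)) = G (Rn n)) \<or> (y n > 0 \<and> (Step (1 / y n) (G (Rn n)) (G (Rn (Suc n))) \<or> Step (1 / y n) (G (Rn (Suc n))) (G (Rn n))))" for n
    proof -
      consider "n \<notin> D" | "n \<in> R1 - R0" | "n \<in> R0 - R1" unfolding D_def by blast
      thus ?thesis
      proof cases
        case 1
        have "j \<in> Rn (Suc n) \<longleftrightarrow> j \<in> Rn n" for j
          using 1 by (cases j n rule: linorder_cases) (auto simp: Rn_def D_def)
        hence "Rn (Suc n) = Rn n" by blast
        thus ?thesis using 1 by (simp add: y_def)
      next
        case 2
        have "j \<in> Rn (Suc n) \<longleftrightarrow> j \<in> insert n (Rn n)" for j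
          using 2 by (cases j n rule: linorder_cases) (auto simp: Rn_def)
        hence "Rn (Suc n) = insert n (Rn n)" by blast
        moreover have "n \<notin> Rn n" using 2 by (auto simp: Rn_def)
        moreover have "y n = 1 / p n" using 2 by (simp add: y_def D_def)
        ultimately show ?thesis using stp[of n "Rn n"] pp[of n] by auto
      next
        case 3
        have "j \<in> Rn n \<longleftrightarrow> j \<in> insert n (Rn (Suc n))" for j
          using 3 by (cases j n rule: linorder_cases) (auto simp: Rn_def)
        hence "Rn n = insert n (Rn (Suc n))" by blast
        moreover have "n \<notin> Rn (Suc n)" using 3 by (auto simp: Rn_def)
        moreover have "y n = 1 / p n" using 3 by (simp add: y_def D_def)
        ultimately show ?thesis using stp[of n "Rn (Suc n)"] pp[of n] by auto
      qed
    qed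
    fix n x assume x: "(x::real) > 0" "\<And>i. i \<ge> n \<Longrightarrow> y i * x < 1"
    show "G R1 x = G (Rn n) x"
    proof (rule cong)
      fix j assume j: "p j \<le> x"
      show "j \<in> R1 \<longleftrightarrow> j \<in> Rn n"
      proof (cases "j < n")
        case True thus ?thesis by (simp add: Rn_def)
      next
        case False
        have "j \<notin> D"
        proof
          assume "j \<in> D"
          hence "1 / p j * x < 1" using x(2)[of j] False by (simp add: y_def)
          thus False using j pp[of j] by (simp add: field_simps)
        qed
        thus ?thesis using False by (auto simp: Rn_def D_def)
      qed
    qed
  qed
qed

lemma NR_chain_set:
  assumes "loc_fin p" "\<And>j. p j \<ge> 2" "summable (\<lambda>j. if j \<in> (R0 - R1) \<union> (R1 - R0) then 1 / sqrt (p j) else 0)"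
    "asym (EE q) r0 C0 (NR p R0)"
  shows "\<exists>r C. asym (EE q) r C (NR p R1)"
proof -
  have "\<exists>r C. asym (EE q) r C (NR p R1) \<and> (r0 = 0 \<longrightarrow> r = 0)"
  proof (rule chain_set[where p = p and ?R0.0 = R0 and ?C0.0 = C0])
    show "Step (p a) (NR p R) (NR p (insert a R)) \<or> Step (p a) (NR p (insert a R)) (NR p R)" if "a \<notin> R" for a R
      using NR_step[OF assms(1) that] by blast
    show "NR p R x = NR p R' x" if "\<And>j. p j \<le> x \<Longrightarrow> j \<in> R \<longleftrightarrow> j \<in> R'" for R R' x
      by (rule NR_cong[OF assms(1,1) refl that that])
  qed (rule assms)+
  thus ?thesis by blast
qed

lemma MR_chain_set:
  assumes "loc_fin p" "\<And>j. p j \<ge> 2" "summable (\<lambda>j. if j \<in> (R0 - R1) \<union> (R1 - R0) then 1 / sqrt (p j) else 0)"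
    "asym (EE q) 0 C0 (MR p R0)"
  shows "\<exists>C. asym (EE q) 0 C (MR p R1)"
proof -
  have "\<exists>r C. asym (EE q) r C (MR p R1) \<and> ((0::real) = 0 \<longrightarrow> r = 0)"
  proof (rule chain_set[where p = p and ?R0.0 = R0 and ?C0.0 = C0])
    show "Step (p a) (MR p R) (MR p (insert a R)) \<or> Step (p a) (MR p (insert a R)) (MR p R)" if "a \<notin> R" for a R
      using MR_step[OF assms(1) that] by blast
    show "MR p R x = MR p R' x" if "\<And>j. p j \<le> x \<Longrightarrow> j \<in> R \<longleftrightarrow> j \<in> R'" for R R' x
      by (rule MR_cong[OF assms(1,1) refl that that])
  qed (rule assms)+
  thus ?thesis by blast
qed

text \<open>Since \<open>phi\<close> is at most exp, a cell of unit mass has length at least exp (-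
  T (Suc i)). The sum of the inverse squares of the primes thus has a telescoping majorant, with
  tails of size exp (- T i).\<close>

lemma exp_neg_2T_le: "exp (- 2 * T (Suc i)) \<le> exp (- T i) - exp (- T (Suc i))"
proof -
  have TT: "T i \<le> T (Suc i)" "T i \<ge> 0" using T_le_iff[of i "Suc i"] T_ge_1[of i] by auto
  define d where "d = T (Suc i) - T i"
  have "1 \<le> phi (T (Suc i)) * d" using Phi_MVT(2)[of "T i" "T (Suc i)"] TT by (simp add: Phi_T d_def)
  also have "\<dots> \<le> exp (T (Suc i)) * d" using TT by (intro mult_right_mono phi_le_exp) (auto simp: d_def)
  finally have "exp (- T (Suc i)) * 1 \<le> exp (- T (Suc i)) * (exp (T (Suc i)) * d)" by (intro mult_left_mono) auto
  hence d: "exp (- T (Suc i)) \<le> d" by (simp add: mult.assoc[symmetric] flip: exp_add)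
  have "exp (- T (Suc i)) \<le> exp d - 1" using d exp_ge_add_one_self[of d] by linarith
  hence "exp (- T (Suc i)) * exp (- T (Suc i)) \<le> exp (- T (Suc i)) * (exp d - 1)"
    by (intro mult_left_mono) auto
  also have "\<dots> = exp (- T i) - exp (- T (Suc i))" by (simp add: right_diff_distrib d_def flip: exp_add)
  finally show ?thesis by (simp flip: exp_add)
qed

text \<open>Converse of the estimate behind \<open>sum_exp_T\<close>, now from phi t \<ge> exp t /
  (4 * t). It yields divergence of the sum of the reciprocals of the primes, which is needed to push
  the density below 1/2.\<close>

lemma exp_neg_T_ge: "exp (- T i) \<ge> (ln (T (Suc i)) - ln (T i)) / 4"
proof -
  have TT: "T i \<le> T (Suc i)" "T i \<ge> 1" using T_le_iff[of i "Suc i"] T_ge_1[of i] by auto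
  define d where "d = T (Suc i) - T i"
  have "exp (T i) / (4 * T i) * d \<le> phi (T i) * d" using TT by (intro mult_right_mono phi_ge) (auto simp: d_def)
  also have "\<dots> \<le> 1" using Phi_MVT(1)[of "T i" "T (Suc i)"] TT by (simp add: Phi_T d_def)
  finally have "exp (- T i) * (exp (T i) / (4 * T i) * d) \<le> exp (- T i) * 1" by (intro mult_left_mono) auto
  moreover have "exp (- T i) * (exp (T i) / (4 * T i) * d) = d / T i / 4" by (simp add: exp_minus field_simps)
  ultimately have 1: "d / T i / 4 \<le> exp (- T i)" by simp
  have "ln (T (Suc i)) - ln (T i) = ln (T (Suc i) / T i)" using TT by (simp add: ln_div)
  also have "\<dots> \<le> T (Suc i) / T i - 1" using TT by (intro ln_le_minus_one) auto
  also have "\<dots> = d / T i" using TT by (simp add: d_def diff_divide_distrib)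
  finally show ?thesis using 1 by simp
qed

lemma sum_exp_neg_T_unbounded: "\<exists>n. (\<Sum>j<n. exp (- T (Suc j))) > B"
proof -
  have *: "(\<Sum>j<n. exp (- T (Suc j))) \<ge> (ln (T (Suc n)) - ln (T 1)) / 4" for n
  proof (induction n)
    case (Suc n)
    thus ?case using exp_neg_T_ge[of "Suc n"] by (simp add: field_simps)
  qed simp
  define L where "L = exp (4 * B + ln (T 1) + 1)"
  obtain n where n: "T n > L" using T_unbounded by blast
  have "T (Suc n) > L" using n T_le_iff[of n "Suc n"] by simp
  moreover have "T (Suc n) > 0" using T_ge_1[of "Suc n"] by linarith
  ultimately have "ln (T (Suc n)) > ln L" by (subst ln_less_cancel_iff) (auto simp: L_def)
  hence "ln (T (Suc n)) > 4 * B + ln (T 1)" by (simp add: L_def)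
  hence "B < (ln (T (Suc n)) - ln (T 1)) / 4" by (simp add: field_simps)
  thus ?thesis using *[of n] by (meson less_le_trans)
qed

lemma exp_om_facts:
  assumes "cell_pts om"
  shows "loc_fin (\<lambda>j. exp (om j))" "exp (om j) \<ge> 2"
proof -
  show "exp (om j) \<ge> 2" using exp_ge_add_one_self[of "om j"] cell_ptsD(3)[OF assms, of j] by linarith
  show "loc_fin (\<lambda>j. exp (om j))"
    unfolding loc_fin_def
  proof (intro conjI allI)
    show "exp (om j) > 1" for j using cell_ptsD(3)[OF assms, of j] by simp
    fix x :: real
    obtain n where n: "T n > ln x" using T_unbounded by blast
    have "{j. exp (om j) \<le> x} \<subseteq> {..<n}"
    proof
      fix j assume "j \<in> {j. exp (om j) \<le> x}"
      hence "exp (om j) \<le> x" by simp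
      hence "om j \<le> ln x" using ln_mono[of "exp (om j)" x] by simp
      hence "T j < T n" using n cell_ptsD(1)[OF assms, of j] by linarith
      thus "j \<in> {..<n}" by (simp add: T_less_iff)
    qed
    thus "finite {j. exp (om j) \<le> x}" by (rule finite_subset) simp
  qed
qed

lemma Mq_eq:
  assumes "cell_pts om" "x > 0" shows "Mq om x = MR (\<lambda>j. exp (om j)) {} x"
proof -
  have "(\<Prod>j\<in>S. exp (om j)) \<le> x \<longleftrightarrow> (\<Sum>j\<in>S. om j) \<le> ln x" if "finite S" for S
    using assms that by (simp add: exp_sum[symmetric] ln_ge_iff[of x])
  hence "sub om (ln x) = sfree (\<lambda>j. exp (om j)) UNIV x" by (auto simp: sub_def sfree_def)
  thus ?thesis by (simp add: Mq_def MR_def msum_def)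
qed

lemma Nq_eq:
  assumes "cell_pts om" "x > 0" shows "Nq om x = cnt (\<lambda>j. exp (om j)) (\<lambda>_. {..<2}) x"
proof -
  have bij: "bij_betw (\<lambda>S j. if j \<in> S then 1 else 0 :: nat) (sub om (ln x)) (gints (\<lambda>j. exp (om j)) (\<lambda>_. {..<2}) x)"
  proof (rule bij_betw_byWitness[where f' = "\<lambda>e. {j. e j \<noteq> 0}"])
    have eq: "gen_int (\<lambda>j. exp (om j)) e = exp (\<Sum>j\<in>{j. e j \<noteq> 0}. om j)"
      if "finite {j. e j \<noteq> 0}" "\<And>j. e j \<in> {..<2}" for e
    proof -
      have "exp (om j) ^ e j = exp (om j)" if "e j \<noteq> 0" for j
      proof -
        have "e j < 2" using \<open>\<And>j. e j \<in> {..<2}\<close>[of j] by simp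
        hence "e j = 1" using that by linarith
        thus ?thesis by simp
      qed
      thus ?thesis using that by (simp add: gen_int_def exp_sum)
    qed
    have le: "exp t \<le> x \<longleftrightarrow> t \<le> ln x" for t using assms by (simp add: ln_ge_iff)
    show "\<forall>a\<in>sub om (ln x). {j. (if j \<in> a then 1 else 0 :: nat) \<noteq> 0} = a" by auto
    show "\<forall>e\<in>gints (\<lambda>j. exp (om j)) (\<lambda>_. {..<2}) x. (\<lambda>j. if j \<in> {j. e j \<noteq> 0} then 1 else 0) = e"
    proof (intro ballI ext)
      fix e j assume "e \<in> gints (\<lambda>j. exp (om j)) (\<lambda>_. {..<2}) x"
      hence "e j < 2" by (simp add: gints_def)
      thus "(if j \<in> {j. e j \<noteq> 0} then 1 else 0) = e j" by auto
    qed
    show "(\<lambda>S j. if j \<in> S then 1 else 0 :: nat) ` sub om (ln x) \<subseteq> gints (\<lambda>j. exp (om j)) (\<lambda>_. {..<2}) x"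
    proof clarify
      fix S assume S: "S \<in> sub om (ln x)"
      define e where "e = (\<lambda>j. if j \<in> S then 1 else 0 :: nat)"
      have e: "{j. e j \<noteq> 0} = S" "\<And>j. e j \<in> {..<2}" by (auto simp: e_def)
      have "gen_int (\<lambda>j. exp (om j)) e \<le> x" using S eq[of e] e by (simp add: sub_def le)
      hence "e \<in> gints (\<lambda>j. exp (om j)) (\<lambda>_. {..<2}) x" using S e by (simp add: gints_def sub_def)
      thus "(\<lambda>j. if j \<in> S then 1 else 0) \<in> gints (\<lambda>j. exp (om j)) (\<lambda>_. {..<2}) x" by (simp add: e_def)
    qed
    show "(\<lambda>e. {j. e j \<noteq> 0}) ` gints (\<lambda>j. exp (om j)) (\<lambda>_. {..<2}) x \<subseteq> sub om (ln x)"
    proof clarify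
      fix e assume "e \<in> gints (\<lambda>j. exp (om j)) (\<lambda>_. {..<2}) x"
      hence e: "finite {j. e j \<noteq> 0}" "\<And>j. e j \<in> {..<2}" "gen_int (\<lambda>j. exp (om j)) e \<le> x" unfolding gints_def by blast+
      thus "{j. e j \<noteq> 0} \<in> sub om (ln x)" using eq[OF e(1,2)] by (simp add: sub_def le)
    qed
  qed
  show ?thesis using bij_betw_same_card[OF bij] by (simp add: Nq_def cnt_def)
qed

lemma MR_random:
  assumes "U_bound om C q"
  shows "\<exists>q C. asym (EE q) 0 C (MR (\<lambda>j. exp (om j)) {})"
proof -
  obtain K p where K: "K > 0" "\<And>x. x > 0 \<Longrightarrow> \<bar>Mq om x\<bar> \<le> K * sqrt x * LL x ^ p" using Mq_asymp[OF assms] by blast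
  have om: "cell_pts om" using assms by (simp add: U_bound_def)
  have "asym (EE p) 0 K (MR (\<lambda>j. exp (om j)) {})"
    using K Mq_eq[OF om] unfolding asym_def EE_def by (simp add: mult.assoc)
  thus ?thesis by blast
qed

text \<open>Dividing 1 + p powr (-s) ... by 1 - p powr (-2 * s) turns squarefree integers into all
  integers, so the n-th step has v = p n ^ 2. Here sqrt (y n) is 1 / p n, whose sum diverges, so
  \<open>chain\<close> is used with a cut depending on x: the constant then grows like LL x ^ 2 by
  Mertens' estimate, and the omitted density is O(1 / sqrt x).\<close>

lemma NR_random:
  assumes "U_bound om C q"
  shows "\<exists>q r C. asym (EE q) r C (NR (\<lambda>j. exp (om j)) {})"
proof -
  obtain r0 C0' q where r0: "r0 \<ge> 0" "C0' > 0" and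
    NN: "\<And>x. x > 0 \<Longrightarrow> \<bar>Nq om x - r0 * x\<bar> \<le> C0' * sqrt x * LL x ^ q" using Nq_asymp[OF assms] by blast
  have om: "cell_pts om" using assms by (simp add: U_bound_def)
  define p where "p = (\<lambda>j. exp (om j))"
  have p: "loc_fin p" "\<And>j. p j \<ge> 2" unfolding p_def using exp_om_facts[OF om] by auto
  define B where "B n j = (if j < n then UNIV else {..<2} :: nat set)" for n j :: nat
  define F where "F n = cnt p (B n)" for n
  define y where "y n = exp (- 2 * om n)" for n
  define C0 where "C0 = C0' + r0"
  have A: "asym (EE q) r0 C0 (F 0)"
  proof -
    have "\<bar>F 0 x - r0 * x\<bar> \<le> C0 * EE q x" if x: "x > 0" for x
    proof -
      have "B 0 = (\<lambda>_. {..<2})" by (auto simp: B_def)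
      hence "F 0 x = Nq om x" using Nq_eq[OF om x] by (simp add: F_def p_def)
      hence "\<bar>F 0 x - r0 * x\<bar> \<le> C0' * EE q x" using NN[OF x] by (simp add: EE_def mult.assoc)
      also have "\<dots> \<le> C0 * EE q x" using EE_nonneg[OF x] r0 by (intro mult_right_mono) (auto simp: C0_def)
      finally show ?thesis .
    qed
    thus ?thesis using r0 by (simp add: asym_def C0_def)
  qed
  have yT: "y n \<le> exp (- 2 * T n)" for n using cell_ptsD(1)[OF om, of n] by (simp add: y_def)
  have y0: "y n \<ge> 0" for n by (simp add: y_def)
  have y12: "y n \<le> 1/2" for n
  proof -
    have "y n \<le> exp (-1)" unfolding y_def using cell_ptsD(3)[OF om, of n] by simp
    also have "\<dots> \<le> 1/2" using exp_ge_add_one_self[of "1::real"] by (simp add: exp_minus field_simps)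
    finally show ?thesis .
  qed
  have tl: "(\<Sum>i<m. y (i + Suc n)) \<le> exp (- T n)" for m n
  proof -
    have "(\<Sum>i<m. y (i + Suc n)) \<le> exp (- T n) - exp (- T (m + n))"
    proof (induction m)
      case (Suc m)
      thus ?case using yT[of "m + Suc n"] exp_neg_2T_le[of "m + n"] by simp
    qed simp
    thus ?thesis using exp_gt_zero[of "- T (m + n)"] by linarith
  qed
  have sS: "summable (\<lambda>i. y (i + Suc n))" for n
    by (rule summableI_nonneg_bounded[OF y0 tl])
  have sy: "summable y" using sS[of 0] summable_iff_shift[of y 1] by simp
  have tail: "(\<Sum>i. y (i + n)) \<le> exp (- 2 * T n) + exp (- T n)" for n
  proof -
    have "(\<Sum>i. y (i + n)) = y n + (\<Sum>i. y (i + Suc n))"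
      using suminf_split_head[OF summable_ignore_initial_segment[OF sy, of n]] by simp
    moreover have "(\<Sum>i. y (i + Suc n)) \<le> exp (- T n)" by (rule suminf_le_const[OF sS tl])
    ultimately show ?thesis using yT[of n] by linarith
  qed
  have "\<exists>r K. 0 \<le> r \<and> (\<forall>n x. x > 0 \<longrightarrow> (\<forall>i\<ge>n. y i * x < 1) \<longrightarrow>
     \<bar>NR p {} x - r * x\<bar> \<le> C0 * (\<Prod>i<n. 1 / (1 - sqrt (y i))) * EE q x + K * x * (\<Sum>i. y (i + n))) \<and> (r0 = 0 \<longrightarrow> r = 0)"
  proof (rule chain[where F = F, OF A y0 y12 sy])
    fix n
    have B1: "(B n)(n := {..<2}) = B n" and B2: "(B n)(n := UNIV) = B (Suc n)" by (auto simp: B_def fun_eq_iff less_Suc_eq)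
    have "F (Suc n) x = F n x + F (Suc n) (x / p n ^ 2)" for x using cnt_step[OF p(1), of "B n" n x 2] unfolding B1 B2 F_def .
    moreover have "1 / y n = p n ^ 2" by (simp add: y_def p_def exp_minus field_simps power2_eq_square flip: exp_add)
    moreover have "\<forall>x>0. x < 1 \<longrightarrow> F (Suc n) x = 0" unfolding F_def using cnt_below_1[OF p(1)] by blast
    ultimately have "Step (1 / y n) (F n) (F (Suc n))" unfolding Step_def by metis
    moreover have "y n > 0" by (simp add: y_def)
    ultimately show "(y n = 0 \<and> F (Suc n) = F n) \<or> (y n > 0 \<and> (Step (1 / y n) (F n) (F (Suc n)) \<or> Step (1 / y n) (F (Suc n)) (F n)))"
      by blast
  next
    fix n x assume x: "(x::real) > 0" "\<And>i. i \<ge> n \<Longrightarrow> y i * x < 1"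
    have "gints p (\<lambda>j. if j \<in> {} then {0} else UNIV) x = gints p (B n) x"
    proof (intro set_eqI iffI)
      fix e assume "e \<in> gints p (\<lambda>j. if j \<in> {} then {0} else UNIV) x"
      hence e: "finite {j. e j \<noteq> 0}" "gen_int p e \<le> x" by (auto simp: gints_def)
      have "e j \<in> B n j" for j
      proof (rule ccontr)
        assume "e j \<notin> B n j"
        hence j: "j \<ge> n" "e j \<ge> 2" by (auto simp: B_def split: if_splits)
        have p1: "p j \<ge> 1" for j using p(2)[of j] by linarith
        have "p j ^ 2 \<le> p j ^ e j" using j p1[of j] by (intro power_increasing) auto
        also have "\<dots> \<le> gen_int p e" unfolding gen_int_def
          by (rule prod_ge_elem) (use e j p1 in \<open>auto intro: one_le_power\<close>)
        finally have "p j ^ 2 \<le> x" using e by simp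
        moreover have "y j * p j ^ 2 = 1" by (simp add: y_def p_def power2_eq_square flip: exp_add)
        ultimately have "1 \<le> y j * x" using y0[of j] mult_left_mono[of "p j ^ 2" x "y j"] by simp
        thus False using x(2)[OF j(1)] by simp
      qed
      thus "e \<in> gints p (B n) x" using e by (auto simp: gints_def)
    qed (auto simp: gints_def)
    thus "NR p {} x = F n x" by (simp only: NR_def F_def cnt_def)
  qed
  then obtain r K where r: "0 \<le> r" and K: "\<And>n x. x > 0 \<Longrightarrow> (\<forall>i\<ge>n. y i * x < 1) \<Longrightarrow>
     \<bar>NR p {} x - r * x\<bar> \<le> C0 * (\<Prod>i<n. 1 / (1 - sqrt (y i))) * EE q x + K * x * (\<Sum>i. y (i + n))" by blast
  have C0: "C0 \<ge> 0" using r0 by (simp add: C0_def)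
  \<comment> \<open>From exp (2 * (1 + ln (T n))) and T n \<le> (T 0 + 2) * LL x.\<close>
  define D where "D = exp 2 * (T 0 + 2)^2"
  have "\<bar>NR p {} x - r * x\<bar> \<le> (C0 * D + 2 * \<bar>K\<bar> + r) * EE (q + 2) x" if x: "x > 0" for x
  proof (cases "x < 1")
    case True
    have "NR p {} x = 0" unfolding NR_def by (rule cnt_below_1[OF p(1) True])
    hence "\<bar>NR p {} x - r * x\<bar> = r * x" using r x by simp
    also have "\<dots> \<le> (C0 * D + 2 * \<bar>K\<bar> + r) * EE (q + 2) x"
      using EE_small[OF x True, of "q+2"] r C0 x by (intro mult_mono) (auto simp: D_def)
    finally show ?thesis .
  next
    case False
    \<comment> \<open>From index n on the primes exceed sqrt x, so their squares exceed x and the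
      later steps have no effect up to x.\<close>
    define n where "n = (LEAST n. T n > ln x / 2)"
    have n: "T n > ln x / 2" unfolding n_def by (rule LeastI_ex) (rule T_unbounded)
    have Tn: "T n \<le> (T 0 + 2) * LL x"
    proof -
      have L1: "LL x \<ge> 1" by simp
      show ?thesis
      proof (cases n)
        case 0
        have "(T 0 + 2) * 1 \<le> (T 0 + 2) * LL x" using L1 T_ge_1[of 0] by (intro mult_left_mono) auto
        thus ?thesis using 0 by simp
      next
        case (Suc m)
        have "\<not> T m > ln x / 2" using not_less_Least[of m "\<lambda>n. T n > ln x / 2"] Suc n_def by auto
        hence "T n \<le> ln x / 2 + 2" using T_Suc_le[of m] Suc by simp
        also have "\<dots> \<le> 2 * LL x" using False by (simp add: LL_eq)
        also have "\<dots> \<le> (T 0 + 2) * LL x" using T_ge_1[of 0] by (intro mult_right_mono less_imp_le[OF LL_pos]) auto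
        finally show ?thesis .
      qed
    qed
    have T0: "T n > 0" using T_ge_1[of n] by linarith
    have sx: "exp (- T n) * sqrt x \<le> 1"
    proof -
      have "exp (ln x / 2) = exp (ln (sqrt x))" by (simp only: ln_sqrt[OF less_imp_le[OF x]])
      also have "\<dots> = sqrt x" using x by (intro exp_ln) simp
      finally have "sqrt x = exp (ln x / 2)" by (rule sym)
      thus ?thesis using n by (simp flip: exp_add)
    qed
    have c: "\<forall>i\<ge>n. y i * x < 1"
    proof (intro allI impI)
      fix i assume "i \<ge> n"
      hence "T i \<ge> T n" by (simp add: T_le_iff)
      hence "om i > ln x / 2" using n cell_ptsD(1)[OF om, of i] by linarith
      hence "exp (- 2 * om i + ln x) < 1" by simp
      moreover have "exp (- 2 * om i + ln x) = y i * x" using x unfolding y_def exp_add by (simp only: exp_ln)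
      ultimately show "y i * x < 1" by metis
    qed
    have P: "(\<Prod>i<n. 1 / (1 - sqrt (y i))) \<le> D * LL x ^ 2"
    proof -
      have "(\<Prod>i<n. 1 / (1 - sqrt (y i))) \<le> (\<Prod>i<n. exp (2 * exp (- T i)))"
      proof (intro prod_mono conjI)
        fix i
        have sq: "sqrt (y i) = exp (- om i)"
        proof -
          have "y i = (exp (- om i))\<^sup>2" by (simp add: y_def power2_eq_square flip: exp_add)
          thus ?thesis by simp
        qed
        define u where "u = exp (- om i)"
        have u: "0 < u" "u \<le> exp (- T i)" using cell_ptsD(1)[OF om, of i] by (auto simp: u_def)
        have u2: "u \<le> 1/2"
        proof -
          have "2 \<le> exp (om i)" using p(2)[of i] by (simp add: p_def)
          thus ?thesis by (simp add: u_def exp_minus field_simps)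
        qed
        show "0 \<le> 1 / (1 - sqrt (y i))" using u2 by (simp add: sq flip: u_def)
        have "0 \<le> u * (1 - 2 * u)" using u u2 by (intro mult_nonneg_nonneg) auto
        hence "1 \<le> (1 + 2 * u) * (1 - u)" by (simp add: algebra_simps)
        moreover have "0 < 1 - u" using u2 by linarith
        ultimately have "1 / (1 - u) \<le> 1 + 2 * u" by (simp only: pos_divide_le_eq)
        also have "\<dots> \<le> exp (2 * u)" by (rule exp_ge_add_one_self)
        also have "\<dots> \<le> exp (2 * exp (- T i))" using u by simp
        finally show "1 / (1 - sqrt (y i)) \<le> exp (2 * exp (- T i))" by (simp add: sq u_def)
      qed
      also have "\<dots> = exp (2 * (\<Sum>i<n. exp (- T i)))" by (simp add: exp_sum sum_distrib_left)
      also have "\<dots> \<le> exp (2 * (1 + ln (T n)))" using sum_exp_T[of n] by simp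
      also have "\<dots> = exp 2 * (exp (ln (T n)))\<^sup>2" by (simp add: distrib_left exp_add exp_double)
      also have "\<dots> = exp 2 * (T n)\<^sup>2" using T0 by simp
      also have "\<dots> \<le> exp 2 * ((T 0 + 2) * LL x)\<^sup>2" using Tn T0 by (intro mult_left_mono power_mono) auto
      finally show ?thesis by (simp add: D_def power_mult_distrib mult.assoc)
    qed
    have sE: "sqrt x \<le> EE (q + 2) x" unfolding EE_def using LL_power_ge_1[of x "q+2"] x mult_left_mono[of 1 "LL x ^ (q+2)" "sqrt x"] by simp
    have tt: "x * (\<Sum>i. y (i + n)) \<le> 2 * EE (q + 2) x"
    proof -
      have "exp (- 2 * T n) \<le> exp (- T n)" using T0 by simp
      hence "(\<Sum>i. y (i + n)) \<le> 2 * exp (- T n)" using tail[of n] by linarith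
      hence "x * (\<Sum>i. y (i + n)) \<le> x * (2 * exp (- T n))" using x by (intro mult_left_mono) auto
      also have "\<dots> = 2 * sqrt x * (exp (- T n) * sqrt x)" using x by simp
      also have "\<dots> \<le> 2 * sqrt x * 1" using sx x by (intro mult_left_mono) auto
      finally show ?thesis using sE by simp
    qed
    have "\<bar>NR p {} x - r * x\<bar> \<le> C0 * (\<Prod>i<n. 1 / (1 - sqrt (y i))) * EE q x + K * x * (\<Sum>i. y (i + n))" by (rule K[OF x c])
    also have "C0 * (\<Prod>i<n. 1 / (1 - sqrt (y i))) * EE q x \<le> C0 * (D * LL x ^ 2) * EE q x"
      using P C0 EE_nonneg[OF x] by (intro mult_right_mono mult_left_mono) auto
    also have "\<dots> = C0 * D * EE (q + 2) x" by (simp add: EE_def power_add power2_eq_square mult_ac)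
    also have "K * x * (\<Sum>i. y (i + n)) \<le> \<bar>K\<bar> * (x * (\<Sum>i. y (i + n)))"
    proof -
      have "(\<Sum>i. y (i + n)) \<ge> 0" by (intro suminf_nonneg summable_ignore_initial_segment sy y0)
      thus ?thesis using x by (simp add: mult.assoc mult_right_mono)
    qed
    also have "\<dots> \<le> \<bar>K\<bar> * (2 * EE (q + 2) x)" using tt by (intro mult_left_mono) auto
    finally have "\<bar>NR p {} x - r * x\<bar> \<le> (C0 * D + 2 * \<bar>K\<bar>) * EE (q + 2) x" by (simp add: algebra_simps)
    also have "\<dots> \<le> (C0 * D + 2 * \<bar>K\<bar> + r) * EE (q + 2) x" using r EE_nonneg[OF x] by (intro mult_right_mono) auto
    finally show ?thesis .
  qed
  moreover have "r \<le> C0 * D + 2 * \<bar>K\<bar> + r" using C0 by (simp add: D_def)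
  ultimately have "asym (EE (q + 2)) r (C0 * D + 2 * \<bar>K\<bar> + r) (NR p {})" using r unfolding asym_def by blast
  thus ?thesis unfolding p_def by blast
qed

section \<open>Arithmetic progressions of log-primes\<close>

text \<open>The log-primes in the cells \<open>JJ i, \<dots>, JJ i + K i - 1\<close> are replaced by the arithmetic progression
  with step \<open>dl i\<close> and first term \<open>tt i + dl i * s ^ Suc i\<close>. Different windows
  carry different powers of \<open>s\<close>, so that for generic \<open>s\<close> only sums inside one window can coincide.\<close>
locale windows =
  fixes om :: "nat \<Rightarrow> real" and JJ :: "nat \<Rightarrow> nat" and s :: real
  assumes om: "cell_pts om"
    and JJ_big: "T (JJ i) \<ge> 4 ^ i"
    and JJ_step: "JJ i + nat \<lfloor>sqrt (phi (T (JJ i)))\<rfloor> < JJ (Suc i)"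
    and s01: "0 < s" "s < 1"
begin

definition tt :: "nat \<Rightarrow> real" where "tt i = T (JJ i)"
definition K :: "nat \<Rightarrow> nat" where "K i = nat \<lfloor>sqrt (phi (tt i))\<rfloor>"
definition W :: "nat \<Rightarrow> nat set" where "W i = {JJ i..<JJ i + K i}"
text \<open>The spacing is the inverse of the density at the right end of the window, where the
  density is largest, so the progression never runs ahead of the cells: \<open>sg j\<close> stays at
  most \<open>T (Suc j)\<close>.\<close>

definition dl :: "nat \<Rightarrow> real" where "dl i = 1 / phi (T (JJ i + K i))"
definition A :: "nat set" where "A = (\<Union>i. W i)"
definition wi :: "nat \<Rightarrow> nat" where "wi j = (SOME i. j \<in> W i)"
definition sg :: "nat \<Rightarrow> real" where
  "sg j = (if j \<in> A then tt (wi j) + dl (wi j) * s ^ Suc (wi j) + real (j - JJ (wi j)) * dl (wi j) else om j)"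

lemma JJ_mono: "i < i' \<Longrightarrow> JJ i + K i < JJ i'"
proof (induction i')
  case (Suc i')
  have "JJ i' + K i' < JJ (Suc i')" using JJ_step[of i'] by (simp add: K_def tt_def)
  thus ?case using Suc by (cases "i = i'") auto
qed simp

lemma JJ_ge: "i \<le> JJ i"
proof (induction i)
  case (Suc i)
  thus ?case using JJ_mono[of i "Suc i"] by simp
qed simp

lemma W_unique: "j \<in> W i \<Longrightarrow> j \<in> W i' \<Longrightarrow> i = i'"
  using JJ_mono[of i i'] JJ_mono[of i' i] by (cases i i' rule: linorder_cases) (auto simp: W_def)

lemma wi_eq: "j \<in> W i \<Longrightarrow> wi j = i"
  unfolding wi_def by (rule some_equality) (auto dest: W_unique)

lemma sg_W: "j \<in> W i \<Longrightarrow> sg j = tt i + dl i * s ^ Suc i + real (j - JJ i) * dl i"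
  using wi_eq[of j i] by (auto simp: sg_def A_def)

lemma sg_not_A: "j \<notin> A \<Longrightarrow> sg j = om j" by (simp add: sg_def)

lemma tt_ge: "tt i \<ge> 1" "tt i \<ge> 4 ^ i" using T_ge_1 JJ_big by (auto simp: tt_def)

lemma K_le: "real (K i) \<le> sqrt (phi (tt i))" and K_ge: "real (K i) \<ge> sqrt (phi (tt i)) - 1"
proof -
  have "phi (tt i) \<ge> 0" using phi_ge_half[of "tt i"] tt_ge(1)[of i] by linarith
  thus "real (K i) \<le> sqrt (phi (tt i))" "real (K i) \<ge> sqrt (phi (tt i)) - 1" unfolding K_def by (auto simp: of_nat_floor)
qed

lemma dl_pos: "dl i > 0" and dl_le_2: "dl i \<le> 2" and dl_le: "dl i \<le> 1 / phi (tt i)"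
proof -
  have h: "phi (tt i) \<ge> 1/2" "phi (T (JJ i + K i)) \<ge> phi (tt i)"
    using phi_ge_half[of "tt i"] tt_ge(1)[of i] phi_mono[of "tt i" "T (JJ i + K i)"] T_le_iff[of "JJ i" "JJ i + K i"] by (auto simp: tt_def)
  show "dl i > 0" using h by (simp add: dl_def)
  show "dl i \<le> 1 / phi (tt i)" unfolding dl_def using h by (intro divide_left_mono) auto
  also have "\<dots> \<le> 2" using h by (simp add: field_simps)
  finally show "dl i \<le> 2" .
qed

lemma sg_W_bounds:
  assumes "j \<in> W i"
  shows "tt i + real (j - JJ i) * dl i \<le> sg j" "sg j \<le> T (Suc j)" "sg j \<le> tt i + real (Suc (j - JJ i)) * dl i"
proof -
  define r where "r = j - JJ i"
  have r: "j = JJ i + r" "r < K i" using assms by (auto simp: W_def r_def)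
  have "0 \<le> s ^ Suc i" "s ^ Suc i \<le> 1" using s01 by (auto intro!: power_le_one simp del: power_Suc)
  hence d: "0 \<le> dl i * s ^ Suc i" "dl i * s ^ Suc i \<le> dl i * 1"
    using dl_pos[of i] by (auto intro!: mult_nonneg_nonneg mult_left_mono simp del: power_Suc)
  show "tt i + real (j - JJ i) * dl i \<le> sg j" using d(1) sg_W[OF assms] by simp
  show *: "sg j \<le> tt i + real (Suc (j - JJ i)) * dl i" using d(2) sg_W[OF assms] by (simp add: algebra_simps)
  define b where "b = T (Suc j)"
  have b: "tt i \<le> b" "b \<le> T (JJ i + K i)" using r by (auto simp: b_def tt_def T_le_iff)
  have t0: "0 \<le> tt i" using tt_ge(1)[of i] by linarith
  have "real (Suc r) = Phi b - Phi (tt i)" by (simp add: b_def tt_def Phi_T r)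
  also have "\<dots> \<le> phi b * (b - tt i)" using Phi_MVT(2)[OF t0 b(1)] .
  also have "\<dots> \<le> phi (T (JJ i + K i)) * (b - tt i)" using b t0 by (intro mult_right_mono phi_mono) auto
  finally have "real (Suc r) * dl i \<le> phi (T (JJ i + K i)) * (b - tt i) * dl i" using dl_pos[of i] by (intro mult_right_mono) auto
  also have "\<dots> = b - tt i" using dl_pos[of i] by (simp add: dl_def)
  finally show "sg j \<le> T (Suc j)" using * by (simp add: r_def b_def)
qed

lemma sg_le: "sg j \<le> T (Suc j)"
  using sg_W_bounds(2) cell_ptsD(2)[OF om, of j] sg_not_A[of j] by (cases "j \<in> A") (auto simp: A_def)

lemma sg_ge_1: "sg j \<ge> 1"
proof (cases "j \<in> A")
  case True
  then obtain i where i: "j \<in> W i" by (auto simp: A_def)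
  have "0 \<le> real (j - JJ i) * dl i" using dl_pos[of i] by simp
  thus ?thesis using sg_W_bounds(1)[OF i] tt_ge(1)[of i] by linarith
next
  case False
  thus ?thesis using sg_not_A[of j] cell_ptsD(3)[OF om, of j] by simp
qed

lemma sg_Suc: "sg j \<le> sg (Suc j)"
proof (cases "Suc j \<in> A")
  case False
  thus ?thesis using sg_le[of j] cell_ptsD(1)[OF om, of "Suc j"] sg_not_A[of "Suc j"] by linarith
next
  case True
  then obtain i where i: "Suc j \<in> W i" by (auto simp: A_def)
  show ?thesis
  proof (cases "Suc j = JJ i")
    case True
    have "T (Suc j) = tt i" using True by (simp add: tt_def)
    thus ?thesis using sg_W_bounds(1)[OF i] sg_le[of j] True by simp
  next
    case False
    hence "j \<in> W i" using i by (auto simp: W_def)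
    moreover from False i have "Suc j - JJ i = Suc (j - JJ i)" by (auto simp: W_def)
    ultimately show ?thesis using sg_W[OF i] sg_W[of j i] dl_pos[of i] by (simp add: algebra_simps)
  qed
qed

lemma sg_mono: "j \<le> j' \<Longrightarrow> sg j \<le> sg j'"
  by (rule lift_Suc_mono_le[of sg]) (rule sg_Suc)

text \<open>Inside a window the progression lags behind the cells. The window has length at most K i
  / phi (tt i), and by \<open>phi_deriv_bound\<close> the accumulated lag, measured by
  \<open>Phi\<close>, is at most 2 * K i * K i / phi (tt i) \<le> 2; the offset 2 in
  \<open>Phi_T\<close> absorbs it. This is why the windows have about sqrt (phi (tt i))
  elements.\<close>

lemma Phi_sg: "real j \<le> Phi (sg j)" "Phi (sg j) \<le> real j + 3"
proof -
  have "sg j \<ge> 0" "T (Suc j) \<ge> 0" using sg_ge_1[of j] T_ge_1[of "Suc j"] by linarith+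
  hence "Phi (sg j) \<le> Phi (T (Suc j))" using sg_le[of j] by (simp add: Phi_le_iff)
  thus "Phi (sg j) \<le> real j + 3" by (simp add: Phi_T)
  show "real j \<le> Phi (sg j)"
  proof (cases "j \<in> A")
    case False
    have "Phi (T j) \<le> Phi (sg j)" using False sg_not_A[of j] cell_ptsD(1)[OF om, of j] T_ge_1[of j] by (subst Phi_le_iff) auto
    thus ?thesis by (simp add: Phi_T)
  next
    case True
    then obtain i where i: "j \<in> W i" by (auto simp: A_def)
    define r where "r = j - JJ i"
    have r: "j = JJ i + r" "r < K i" using i by (auto simp: W_def r_def)
    define b where "b = T (JJ i + K i)"
    have t0: "0 \<le> tt i" using tt_ge(1)[of i] by linarith
    have tb: "tt i \<le> b" by (simp add: b_def tt_def T_le_iff)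
    have pt: "phi (tt i) > 0" using phi_ge_half[OF t0] by linarith
    have pb: "phi b > 0" using phi_ge_half[of b] tb t0 by linarith
    have d: "dl i = 1 / phi b" by (simp add: dl_def b_def)
    have "phi (tt i) * (b - tt i) \<le> Phi b - Phi (tt i)" using Phi_MVT(1)[OF t0 tb] .
    also have "\<dots> = real (K i)" by (simp add: b_def tt_def Phi_T)
    finally have "b - tt i \<le> real (K i) / phi (tt i)" using pt by (simp add: field_simps)
    moreover have "phi b - phi (tt i) \<le> 2 * (b - tt i) * phi b" by (rule phi_deriv_bound[OF t0 tb])
    ultimately have "1 - phi (tt i) / phi b \<le> 2 * (b - tt i)" using pb by (simp add: field_simps)
    hence "real r * (1 - phi (tt i) / phi b) \<le> real r * (2 * (b - tt i))" by (intro mult_left_mono) auto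
    also have "\<dots> \<le> real (K i) * (2 * (real (K i) / phi (tt i)))"
      using r \<open>b - tt i \<le> _\<close> tb by (intro mult_mono) auto
    also have "\<dots> = 2 * (real (K i) * real (K i)) / phi (tt i)" by simp
    also have "\<dots> \<le> 2 * (sqrt (phi (tt i)) * sqrt (phi (tt i))) / phi (tt i)"
      using K_le[of i] pt by (intro divide_right_mono mult_left_mono mult_mono) auto
    also have "\<dots> = 2" using pt by simp
    finally have 1: "real r \<le> real r * (phi (tt i) / phi b) + 2" by (simp add: right_diff_distrib)
    have rd: "0 \<le> real r * dl i" using dl_pos[of i] by simp
    have "phi (tt i) * (real r * dl i) \<le> Phi (tt i + real r * dl i) - Phi (tt i)"
      using Phi_MVT(1)[of "tt i" "tt i + real r * dl i"] t0 rd by simp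
    moreover have "Phi (tt i + real r * dl i) \<le> Phi (sg j)"
      using sg_W_bounds(1)[OF i] t0 rd \<open>sg j \<ge> 0\<close> by (subst Phi_le_iff) (auto simp: r_def)
    moreover have "phi (tt i) * (real r * dl i) = real r * (phi (tt i) / phi b)" by (simp add: d)
    moreover have "Phi (tt i) = real (JJ i) + 2" by (simp add: tt_def Phi_T)
    ultimately show ?thesis using 1 r by simp
  qed
qed

lemma finite_sg_le: "finite {j. sg j \<le> t}"
proof (rule finite_subset)
  show "{j. sg j \<le> t} \<subseteq> {..nat \<lceil>Phi (max t 1)\<rceil>}"
  proof
    fix j assume "j \<in> {j. sg j \<le> t}"
    hence "Phi (sg j) \<le> Phi (max t 1)" using sg_ge_1[of j] by (subst Phi_le_iff) auto
    hence "real j \<le> Phi (max t 1)" using Phi_sg(1)[of j] by linarith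
    thus "j \<in> {..nat \<lceil>Phi (max t 1)\<rceil>}" by (simp add: le_nat_iff) linarith
  qed
qed simp

lemma exp_sg_facts:
  shows "loc_fin (\<lambda>j. exp (sg j))" "exp (sg j) \<ge> 2"
proof -
  show "exp (sg j) \<ge> 2" using exp_ge_add_one_self[of "sg j"] sg_ge_1[of j] by linarith
  have "finite {j. exp (sg j) \<le> x}" for x
  proof (rule finite_subset)
    show "{j. exp (sg j) \<le> x} \<subseteq> {j. sg j \<le> ln x}" using ln_mono by fastforce
  qed (rule finite_sg_le)
  moreover have "exp (sg j) > 1" for j using sg_ge_1[of j] by simp
  ultimately show "loc_fin (\<lambda>j. exp (sg j))" by (simp add: loc_fin_def)
qed

text \<open>Window i contributes at most K i * exp (- tt i / 2) \<le> 1 / sqrt (tt i) \<le>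
  \<open>(1/2) ^ i\<close>, the last because tt i \<ge> 4 ^ i.\<close>

lemma summable_A:
  assumes "\<And>i j. j \<in> W i \<Longrightarrow> w j \<ge> tt i"
  shows "summable (\<lambda>j. if j \<in> A then 1 / sqrt (exp (w j)) else 0)"
proof (rule summableI_nonneg_bounded)
  fix n :: nat
  have win: "(\<Sum>j\<in>W i. 1 / sqrt (exp (w j))) \<le> (1/2) ^ i" for i
  proof -
    have t: "tt i > 0" using tt_ge(1)[of i] by linarith
    have "(\<Sum>j\<in>W i. 1 / sqrt (exp (w j))) \<le> (\<Sum>j\<in>W i. 1 / sqrt (exp (tt i)))"
      using assms by (intro sum_mono divide_left_mono) auto
    also have "\<dots> = real (K i) / sqrt (exp (tt i))" by (simp add: W_def)
    also have "\<dots> \<le> sqrt (phi (tt i)) / sqrt (exp (tt i))" using K_le by (intro divide_right_mono) auto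
    also have "\<dots> = sqrt (phi (tt i) / exp (tt i))" by (simp add: real_sqrt_divide)
    also have "\<dots> \<le> sqrt (1 / tt i)" using t_phi_le[of "tt i"] t by (intro real_sqrt_le_mono) (simp add: field_simps)
    also have "\<dots> \<le> sqrt (1 / 4 ^ i)" using tt_ge(2)[of i] t by (intro real_sqrt_le_mono divide_left_mono) auto
    also have "1 / (4::real) ^ i = ((1/2) ^ i)\<^sup>2" by (simp add: power_divide power2_eq_square flip: power_mult_distrib)
    also have "sqrt (((1/2) ^ i)\<^sup>2) = (1/2::real) ^ i" by simp
    finally show ?thesis .
  qed
  have "(\<Sum>j<n. if j \<in> A then 1 / sqrt (exp (w j)) else 0) = (\<Sum>j\<in>{..<n} \<inter> A. 1 / sqrt (exp (w j)))"
    by (simp add: sum.inter_restrict)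
  also have "\<dots> \<le> (\<Sum>j\<in>(\<Union>i<n. W i). 1 / sqrt (exp (w j)))"
  proof (rule sum_mono2)
    show "{..<n} \<inter> A \<subseteq> (\<Union>i<n. W i)"
    proof
      fix j assume j: "j \<in> {..<n} \<inter> A"
      then obtain i where i: "j \<in> W i" by (auto simp: A_def)
      hence "i < n" using j JJ_ge[of i] by (auto simp: W_def)
      thus "j \<in> (\<Union>i<n. W i)" using i by blast
    qed
  qed (auto simp: W_def)
  also have "\<dots> = (\<Sum>i<n. \<Sum>j\<in>W i. 1 / sqrt (exp (w j)))"
  proof (rule sum.UNION_disjoint)
    show "\<forall>i\<in>{..<n}. \<forall>j\<in>{..<n}. i \<noteq> j \<longrightarrow> W i \<inter> W j = {}" using W_unique by blast
  qed (auto simp: W_def)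
  also have "\<dots> \<le> (\<Sum>i<n. (1/2) ^ i)" by (intro sum_mono win)
  also have "\<dots> \<le> 2" by (simp add: geometric_sum)
  finally show "(\<Sum>j<n. if j \<in> A then 1 / sqrt (exp (w j)) else 0) \<le> 2" .
qed auto

lemma summable_om_sg:
  "summable (\<lambda>j. if j \<in> A then 1 / sqrt (exp (om j)) else 0)" "summable (\<lambda>j. if j \<in> A then 1 / sqrt (exp (sg j)) else 0)"
proof -
  show "summable (\<lambda>j. if j \<in> A then 1 / sqrt (exp (om j)) else 0)"
  proof (rule summable_A)
    fix i j assume "j \<in> W i"
    hence "T (JJ i) \<le> T j" by (simp add: W_def T_le_iff)
    thus "tt i \<le> om j" using cell_ptsD(1)[OF om, of j] by (simp add: tt_def)
  qed
  show "summable (\<lambda>j. if j \<in> A then 1 / sqrt (exp (sg j)) else 0)"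
  proof (rule summable_A)
    fix i j assume "j \<in> W i"
    moreover have "0 \<le> real (j - JJ i) * dl i" using dl_pos[of i] by simp
    ultimately show "tt i \<le> sg j" using sg_W_bounds(1)[of j i] by linarith
  qed
qed

lemma NR_sg:
  assumes "asym (EE q) r C (NR (\<lambda>j. exp (om j)) {})"
  shows "\<exists>r C. asym (EE q) r C (NR (\<lambda>j. exp (sg j)) {})"
proof -
  have "\<exists>r C. asym (EE q) r C (NR (\<lambda>j. exp (om j)) A)"
    by (rule NR_chain_set[OF exp_om_facts[OF om] _ assms]) (use summable_om_sg in simp)
  then obtain r C where a: "asym (EE q) r C (NR (\<lambda>j. exp (om j)) A)" by blast
  have "NR (\<lambda>j. exp (om j)) A = NR (\<lambda>j. exp (sg j)) A"
    by (rule ext, rule NR_cong[OF exp_om_facts(1)[OF om] exp_sg_facts(1)]) (simp_all add: sg_not_A)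
  hence a: "asym (EE q) r C (NR (\<lambda>j. exp (sg j)) A)" using a by simp
  show ?thesis
    by (rule NR_chain_set[OF exp_sg_facts _ a]) (use summable_om_sg in simp)
qed

lemma MR_sg:
  assumes "asym (EE q) 0 C (MR (\<lambda>j. exp (om j)) {})"
  shows "\<exists>C. asym (EE q) 0 C (MR (\<lambda>j. exp (sg j)) {})"
proof -
  have "\<exists>C. asym (EE q) 0 C (MR (\<lambda>j. exp (om j)) A)"
    by (rule MR_chain_set[OF exp_om_facts[OF om] _ assms]) (use summable_om_sg in simp)
  then obtain C where a: "asym (EE q) 0 C (MR (\<lambda>j. exp (om j)) A)" by blast
  have "MR (\<lambda>j. exp (om j)) A = MR (\<lambda>j. exp (sg j)) A"
    by (rule ext, rule MR_cong[OF exp_om_facts(1)[OF om] exp_sg_facts(1)]) (simp_all add: sg_not_A)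
  hence a: "asym (EE q) 0 C (MR (\<lambda>j. exp (sg j)) A)" using a by simp
  show ?thesis
    by (rule MR_chain_set[OF exp_sg_facts _ a]) (use summable_om_sg in simp)
qed

end

section \<open>Normalizing the density\<close>

lemma loc_fin_upd:
  assumes "loc_fin p" "v > 1" shows "loc_fin (p(k := v))"
  unfolding loc_fin_def
proof (intro conjI allI)
  fix j show "(p(k := v)) j > 1" using assms by (simp add: loc_fin_def)
next
  fix x have "{j. (p(k := v)) j \<le> x} \<subseteq> insert k {j. p j \<le> x}" by auto
  moreover have "finite {j. p j \<le> x}" using assms by (simp add: loc_fin_def)
  ultimately show "finite {j. (p(k := v)) j \<le> x}" by (meson finite_insert finite_subset)
qed

lemma NR_ge_card:
  assumes p: "loc_fin p" and J: "\<And>j. j \<in> J \<Longrightarrow> p j \<le> x" shows "real (card J) \<le> NR p {} x"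
proof -
  define f where "f i = (\<lambda>j. if j = i then 1 else 0 :: nat)" for i :: nat
  have s: "{j. f i j \<noteq> 0} = {i}" for i by (auto simp: f_def)
  have "inj_on f J" by (rule inj_onI) (metis s singleton_inject)
  moreover have "f ` J \<subseteq> gints p (\<lambda>j. if j \<in> {} then {0} else UNIV) x"
  proof
    fix e assume "e \<in> f ` J"
    then obtain i where i: "i \<in> J" "e = f i" by blast
    have "gen_int p (f i) = p i" unfolding gen_int_def s by (simp add: f_def)
    thus "e \<in> gints p (\<lambda>j. if j \<in> {} then {0} else UNIV) x" using i J[of i] s[of i] by (simp add: gints_def)
  qed
  ultimately have "card J \<le> card (gints p (\<lambda>j. if j \<in> {} then {0} else UNIV) x)"
    by (rule card_inj_on_le[OF _ _ finite_gints[OF p]])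
  thus ?thesis by (simp add: NR_def cnt_def)
qed

lemma NR_remove_finite:
  assumes p: "loc_fin p" and a: "asym (EE q) r C (NR p {})"
  shows "\<exists>C. asym (EE q) (r * (\<Prod>j<k. 1 - 1 / p j)) C (NR p {..<k})"
proof (induction k)
  case 0
  thus ?case using a by auto
next
  case (Suc k)
  then obtain C where C: "asym (EE q) (r * (\<Prod>j<k. 1 - 1 / p j)) C (NR p {..<k})" by blast
  have v: "p k > 1" using p by (simp add: loc_fin_def)
  have "asym (EE q) (r * (\<Prod>j<k. 1 - 1 / p j) * (1 - 1 / p k)) (C / (1 - 1 / sqrt (p k))) (NR p (insert k {..<k}))"
    by (rule step_remove_EE[OF NR_step[OF p] C v]) (use inverse_sqrt_facts[OF v] v in auto)
  thus ?case unfolding lessThan_Suc[symmetric] by (auto simp: mult.assoc)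
qed

lemma MR_remove_finite:
  assumes p: "loc_fin p" and a: "asym (EE q) 0 C (MR p {})"
  shows "\<exists>C. asym (EE q) 0 C (MR p {..<k})"
proof (induction k)
  case 0
  thus ?case using a by auto
next
  case (Suc k)
  then obtain C where C: "asym (EE q) 0 C (MR p {..<k})" by blast
  have v: "p k > 1" using p by (simp add: loc_fin_def)
  have "asym (EE q) (0 / (1 - 1 / p k)) (C / (1 - 1 / sqrt (p k))) (MR p (insert k {..<k}))"
    by (rule step_add_EE[OF MR_step[OF p] C v]) (use inverse_sqrt_facts[OF v] v in auto)
  thus ?case unfolding lessThan_Suc[symmetric] by auto
qed

lemma poly_exp_bound:
  assumes "e > (0::real)" shows "\<exists>D>0. \<forall>t\<ge>0. (1 + t) ^ q \<le> D * exp (e * t)"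
proof -
  have pe: "u ^ q \<le> fact q * exp u" if "u \<ge> 0" for u :: real
  proof -
    have "summable (\<lambda>n. u ^ n / fact n)" using exp_converges[of u] by (simp add: divide_inverse mult.commute sums_iff)
    hence "(\<Sum>n\<in>{q}. u ^ n / fact n) \<le> (\<Sum>n. u ^ n / fact n)" using that by (intro sum_le_suminf) auto
    also have "\<dots> = exp u" using exp_converges[of u] by (simp add: divide_inverse mult.commute sums_iff)
    finally show ?thesis by (simp add: field_simps)
  qed
  show ?thesis
  proof (intro exI[of _ "fact q * exp e / e ^ q"] conjI allI impI)
    show "fact q * exp e / e ^ q > 0" using assms by simp
    fix t :: real assume t: "t \<ge> 0"
    have "(e * (1 + t)) ^ q \<le> fact q * exp (e * (1 + t))" using pe assms t by simp
    also have "exp (e * (1 + t)) = exp e * exp (e * t)" by (simp add: distrib_left exp_add)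
    finally have "e ^ q * (1 + t) ^ q \<le> fact q * (exp e * exp (e * t))" by (simp only: power_mult_distrib)
    thus "(1 + t) ^ q \<le> fact q * exp e / e ^ q * exp (e * t)"
      using assms by (simp add: pos_le_divide_eq mult_ac)
  qed
qed

text \<open>Every fixed power of 1 + ln x is eventually below exp ((ln x) powr (2/3)), so that the
  constant c of the theorem can be 1.\<close>

lemma asym_bigo:
  assumes "asym (EE q) r C f"
  shows "(\<lambda>x. f x - r * x) \<in> O(\<lambda>x. sqrt x * exp (ln x powr (2/3)))"
proof (rule bigoI)
  have "eventually (\<lambda>L. real q * ln (1 + L) \<le> L powr (2/3)) at_top"
  proof (cases "q = 0")
    case False
    hence "real q > 0" by simp
    thus ?thesis by real_asymp
  qed simp
  hence "eventually (\<lambda>x. real q * ln (1 + ln x) \<le> ln x powr (2/3)) at_top"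
    by (rule eventually_compose_filterlim) (rule ln_at_top)
  moreover have "eventually (\<lambda>x::real. x > 1) at_top" by (rule eventually_gt_at_top)
  ultimately show "eventually (\<lambda>x. norm (f x - r * x) \<le> C * norm (sqrt x * exp (ln x powr (2/3)))) at_top"
  proof eventually_elim
    case (elim x)
    have C: "C \<ge> 0" "\<bar>f x - r * x\<bar> \<le> C * EE q x" using assms elim by (auto simp: asym_def)
    have "1 + ln x > 0" using ln_gt_zero[of x] elim by linarith
    hence "LL x = exp (ln (1 + ln x))" using elim by (simp add: LL_eq)
    hence "LL x ^ q = exp (real q * ln (1 + ln x))" by (simp only: exp_of_nat_mult)
    also have "\<dots> \<le> exp (ln x powr (2/3))" using elim by simp
    finally have "EE q x \<le> sqrt x * exp (ln x powr (2/3))" unfolding EE_def using elim by (intro mult_left_mono) auto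
    hence "C * EE q x \<le> C * (sqrt x * exp (ln x powr (2/3)))" using C by (intro mult_left_mono) auto
    thus ?case using C elim by (simp add: abs_mult)
  qed
qed

section \<open>Renumbering the primes after an initial segment is removed, and tuning the
  density\<close>

lemma N_P_shift: "N_P (\<lambda>n. p (n + k)) x = NR p {..<k} x"
proof -
  have fin: "finite {j. e j \<noteq> 0} \<longleftrightarrow> finite {n. e (n + k) \<noteq> 0}" and g: "gen_int p e = gen_int (\<lambda>n. p (n + k)) (\<lambda>n. e (n + k))"
    if "\<And>j. j < k \<Longrightarrow> e j = 0" for e :: "nat \<Rightarrow> nat"
  proof -
    have eq: "{j. e j \<noteq> 0} = (\<lambda>n. n + k) ` {n. e (n + k) \<noteq> 0}"
    proof (intro set_eqI iffI)
      fix j assume "j \<in> {j. e j \<noteq> 0}"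
      hence "j \<ge> k" "e j \<noteq> 0" using that[of j] by (auto simp: not_less[symmetric])
      thus "j \<in> (\<lambda>n. n + k) ` {n. e (n + k) \<noteq> 0}" by (intro image_eqI[of _ _ "j - k"]) auto
    qed auto
    have inj: "inj_on (\<lambda>n. n + k) X" for X by simp
    show "finite {j. e j \<noteq> 0} \<longleftrightarrow> finite {n. e (n + k) \<noteq> 0}" unfolding eq by (rule finite_image_iff[OF inj])
    show "gen_int p e = gen_int (\<lambda>n. p (n + k)) (\<lambda>n. e (n + k))"
      unfolding gen_int_def eq by (subst prod.reindex[OF inj]) simp
  qed
  have bij: "bij_betw (\<lambda>e n. e (n + k)) (gints p (\<lambda>j. if j \<in> {..<k} then {0} else UNIV) x)
     {e. finite {j. e j \<noteq> 0} \<and> gen_int (\<lambda>n. p (n + k)) e \<le> x}"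
  proof (rule bij_betw_byWitness[where f' = "\<lambda>e j. if j < k then 0 else e (j - k)"])
    have z: "e j = 0" if "e \<in> gints p (\<lambda>j. if j \<in> {..<k} then {0} else UNIV) x" "j < k" for e j
    proof -
      have "e j \<in> (if j \<in> {..<k} then {0} else UNIV)" using that(1) unfolding gints_def by blast
      thus ?thesis using that(2) by simp
    qed
    show "\<forall>e\<in>gints p (\<lambda>j. if j \<in> {..<k} then {0} else UNIV) x. (\<lambda>j. if j < k then 0 else e (j - k + k)) = e"
      using z by (auto simp: fun_eq_iff)
    show "\<forall>e\<in>{e. finite {j. e j \<noteq> 0} \<and> gen_int (\<lambda>n. p (n + k)) e \<le> x}. (\<lambda>n. if n + k < k then 0 else e (n + k - k)) = e"
      by auto
    show "(\<lambda>e n. e (n + k)) ` gints p (\<lambda>j. if j \<in> {..<k} then {0} else UNIV) x \<subseteq> {e. finite {j. e j \<noteq> 0} \<and> gen_int (\<lambda>n. p (n + k)) e \<le> x}"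
    proof clarify
      fix e assume e: "e \<in> gints p (\<lambda>j. if j \<in> {..<k} then {0} else UNIV) x"
      thus "finite {j. e (j + k) \<noteq> 0} \<and> gen_int (\<lambda>n. p (n + k)) (\<lambda>n. e (n + k)) \<le> x"
        using fin[of e] g[of e] z[OF e] unfolding gints_def by auto
    qed
    show "(\<lambda>e j. if j < k then 0 else e (j - k)) ` {e. finite {j. e j \<noteq> 0} \<and> gen_int (\<lambda>n. p (n + k)) e \<le> x} \<subseteq> gints p (\<lambda>j. if j \<in> {..<k} then {0} else UNIV) x"
    proof clarify
      fix e assume e: "finite {j. e j \<noteq> (0::nat)}" "gen_int (\<lambda>n. p (n + k)) e \<le> x"
      define e' where "e' = (\<lambda>j. if j < k then 0 else e (j - k))"
      have "(\<lambda>n. e' (n + k)) = e" by (auto simp: e'_def)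
      hence "finite {j. e' j \<noteq> 0}" "gen_int p e' \<le> x" using fin[of e'] g[of e'] e by (auto simp: e'_def)
      thus "(\<lambda>j. if j < k then 0 else e (j - k)) \<in> gints p (\<lambda>j. if j \<in> {..<k} then {0} else UNIV) x"
        unfolding e'_def[symmetric] gints_def by (simp add: e'_def)
    qed
  qed
  show ?thesis using bij_betw_same_card[OF bij] by (simp add: N_P_def NR_def cnt_def)
qed

lemma M_P_shift: "M_P (\<lambda>n. p (n + k)) x = MR p {..<k} x"
proof -
  have inj: "inj_on (\<lambda>n. n + k) X" for X by simp
  have bij: "bij_betw (\<lambda>S. (\<lambda>n. n + k) ` S) {S. finite S \<and> (\<Prod>j\<in>S. p (j + k)) \<le> x} (sfree p (- {..<k}) x)"
  proof (rule bij_betwI')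
    fix S S' show "((\<lambda>n. n + k) ` S = (\<lambda>n. n + k) ` S') = (S = S')" by (rule inj_image_eq_iff) simp
  next
    fix S assume "S \<in> {S. finite S \<and> (\<Prod>j\<in>S. p (j + k)) \<le> x}"
    thus "(\<lambda>n. n + k) ` S \<in> sfree p (- {..<k}) x" by (auto simp: sfree_def prod.reindex[OF inj])
  next
    fix S assume S: "S \<in> sfree p (- {..<k}) x"
    define S' where "S' = (\<lambda>j. j - k) ` S"
    have eq: "S = (\<lambda>n. n + k) ` S'" using S by (force simp: S'_def sfree_def image_image)
    have "prod p S = (\<Prod>j\<in>S'. p (j + k))" by (subst eq) (simp add: prod.reindex[OF inj])
    hence "S' \<in> {S. finite S \<and> (\<Prod>j\<in>S. p (j + k)) \<le> x}"
      using S by (auto simp: sfree_def S'_def)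
    note eq this
    then
    show "\<exists>S'\<in>{S. finite S \<and> (\<Prod>j\<in>S. p (j + k)) \<le> x}. S = (\<lambda>n. n + k) ` S'" by blast
  qed
  have "M_P (\<lambda>n. p (n + k)) x = (\<Sum>S | finite S \<and> (\<Prod>j\<in>S. p (j + k)) \<le> x. (-1) ^ card ((\<lambda>n. n + k) ` S))"
    by (simp add: M_P_def card_image[OF inj])
  also have "\<dots> = (\<Sum>S\<in>sfree p (- {..<k}) x. (-1) ^ card S)" by (rule sum.reindex_bij_betw[OF bij])
  finally show ?thesis by (simp add: MR_def msum_def)
qed

context windows begin

text \<open>With density 0 there would be at most sqrt x times a power of LL x integers up to x,
  fewer than the primes alone, whose number is at least of order x / ln x.\<close>

lemma density_pos:
  assumes a: "asym (EE q) r C (NR (\<lambda>j. exp (sg j)) {})" shows "r > 0"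
proof (rule ccontr)
  assume "\<not> r > 0"
  hence r: "r = 0" using a by (auto simp: asym_def)
  have C: "C \<ge> 0" "\<And>x. x > 0 \<Longrightarrow> \<bar>NR (\<lambda>j. exp (sg j)) {} x\<bar> \<le> C * EE q x" using a r by (auto simp: asym_def)
  obtain D :: real where D: "D > 0" "\<And>t. t \<ge> 0 \<Longrightarrow> (1 + t) ^ q \<le> D * exp (1/4 * t)" using poly_exp_bound[of "1/4" q] by force
  define B where "B = C * D + 1"
  have B: "B > 0" using C D by (simp add: B_def add_nonneg_pos)
  have "eventually (\<lambda>t. B * exp (3/4 * t) + 2 < exp (t - 1) / (4 * (t - 1))) at_top" using B by real_asymp
  then obtain t0 where t0: "\<And>t. t \<ge> t0 \<Longrightarrow> B * exp (3/4 * t) + 2 < exp (t - 1) / (4 * (t - 1))"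
    by (auto simp: eventually_at_top_linorder)
  obtain j where "T j > max t0 2" using T_unbounded by blast
  moreover have "T j \<le> T (Suc j)" by (simp add: T_le_iff)
  ultimately obtain t where t: "t = T (Suc j)" "t \<ge> t0" "t \<ge> 2" by force
  have "real (card {..j}) \<le> NR (\<lambda>j. exp (sg j)) {} (exp t)"
  proof (rule NR_ge_card[OF exp_sg_facts(1)])
    fix i assume "i \<in> {..j}"
    thus "exp (sg i) \<le> exp t" using sg_mono[of i j] sg_le[of j] t(1) by simp
  qed
  also have "\<dots> \<le> C * EE q (exp t)" using C(2)[of "exp t"] by simp
  also have "\<dots> = C * (exp (t/2) * (1 + t) ^ q)"
  proof -
    have "sqrt (exp t) = exp (t / 2)" by (rule real_sqrt_unique) (simp_all add: power2_eq_square flip: exp_add)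
    thus ?thesis using t by (simp add: EE_def LL_eq)
  qed
  also have "\<dots> \<le> C * (exp (t/2) * (D * exp (1/4 * t)))" using C D(2)[of t] t by (intro mult_left_mono) auto
  also have "\<dots> = C * D * exp (3/4 * t)"
  proof -
    have "exp (3/4 * t) = exp (t/2) * exp (1/4 * t)" by (simp flip: exp_add)
    thus ?thesis by simp
  qed
  also have "\<dots> \<le> B * exp (3/4 * t)" by (simp add: B_def)
  finally have 1: "real j + 1 \<le> B * exp (3/4 * t)" by simp
  have "exp (t - 1) / (4 * (t - 1)) \<le> phi (t - 1)" using t by (intro phi_ge) auto
  also have "\<dots> \<le> Phi t - Phi (t - 1)" using Phi_MVT(1)[of "t - 1" t] t by simp
  also have "\<dots> \<le> Phi t" using Phi_nonneg[of "t - 1"] t by simp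
  also have "\<dots> = real j + 3" using t by (simp add: Phi_T)
  finally show False using 1 t0[OF t(2)] by linarith
qed

text \<open>Removing primes multiplies the density by factors 1 - 1 / p j, whose product tends to 0
  because the sum of the 1 / p j diverges. Once the density is at most 1/2, a prime ps with 1 - 1 /
  ps equal to it brings it to 1, and ps \<le> 2 makes ps the smallest prime.\<close>

lemma tune:
  assumes N: "asym (EE q) r C (NR (\<lambda>j. exp (sg j)) {})" and M: "asym (EE q') 0 C' (MR (\<lambda>j. exp (sg j)) {})"
  shows "\<exists>k ps. 1 < ps \<and> ps \<le> 2 \<and> (\<exists>C. asym (EE q) 1 C (NR ((\<lambda>j. exp (sg j))(k := ps)) {..<k})) \<and>
    (\<exists>C. asym (EE q') 0 C (MR ((\<lambda>j. exp (sg j))(k := ps)) {..<k}))"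
proof -
  define p where "p = (\<lambda>j. exp (sg j))"
  have p: "loc_fin p" "\<And>j. p j \<ge> 2" using exp_sg_facts by (auto simp: p_def)
  have r: "r > 0" by (rule density_pos[OF N])
  define rho where "rho n = r * (\<Prod>j<n. 1 - 1 / p j)" for n
  have rho_pos: "rho n > 0" for n unfolding rho_def
  proof (intro mult_pos_pos r prod_pos)
    fix j show "0 < 1 - 1 / p j" using p(2)[of j] by (simp add: field_simps)
  qed
  obtain n where n: "(\<Sum>j<n. exp (- T (Suc j))) > max 0 (ln (2 * r))" using sum_exp_neg_T_unbounded by blast
  have "n \<noteq> 0" using n by (intro notI) simp
  \<comment> \<open>The new prime takes the slot k of the last removed one, so afterwards exactly
    the indices below k have to be skipped.\<close>
  then obtain k where k: "n = Suc k" by (cases n) auto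
  have "rho n \<le> 1/2"
  proof -
    have "(\<Prod>j<n. 1 - 1 / p j) \<le> (\<Prod>j<n. exp (- exp (- T (Suc j))))"
    proof (intro prod_mono conjI)
      fix j show "0 \<le> 1 - 1 / p j" using p(2)[of j] by (simp add: field_simps)
      have "1 / p j = exp (- sg j)" by (simp add: p_def exp_minus field_simps)
      moreover have "exp (- T (Suc j)) \<le> exp (- sg j)" using sg_le[of j] by simp
      moreover have "1 + - exp (- T (Suc j)) \<le> exp (- exp (- T (Suc j)))" by (rule exp_ge_add_one_self)
      ultimately show "1 - 1 / p j \<le> exp (- exp (- T (Suc j)))" by linarith
    qed
    also have "\<dots> = exp (- (\<Sum>j<n. exp (- T (Suc j))))" by (simp add: exp_sum sum_negf[symmetric])
    also have "\<dots> \<le> exp (- ln (2 * r))" using n by simp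
    also have "\<dots> = 1 / (2 * r)" using r by (simp add: exp_minus inverse_eq_divide)
    finally have "rho n \<le> r * (1 / (2 * r))" unfolding rho_def using r by (intro mult_left_mono) auto
    thus ?thesis using r by simp
  qed
  define ps where "ps = 1 / (1 - rho n)"
  have ps: "1 < ps" "ps \<le> 2" using rho_pos[of n] \<open>rho n \<le> 1/2\<close> by (auto simp: ps_def field_simps)
  have ps1: "1 - 1 / ps = rho n" using rho_pos[of n] \<open>rho n \<le> 1/2\<close> by (simp add: ps_def)
  define p' where "p' = p(k := ps)"
  have p': "loc_fin p'" unfolding p'_def by (rule loc_fin_upd[OF p(1) ps(1)])
  have k': "{..<n} = insert k {..<k}" by (simp add: k lessThan_Suc)
  have eqN: "NR p {..<n} = NR p' {..<n}"
    by (rule ext, rule NR_cong[OF p(1) p']) (auto simp: p'_def k)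
  have eqM: "MR p {..<n} = MR p' {..<n}"
    by (rule ext, rule MR_cong[OF p(1) p']) (auto simp: p'_def k)
  have pk: "p' k = ps" by (simp add: p'_def)
  have sf: "1 / ps \<le> 1 / sqrt ps" "1 / sqrt ps < 1" using inverse_sqrt_facts[OF ps(1)] by auto
  obtain C1 where "asym (EE q) (rho n) C1 (NR p {..<n})" using NR_remove_finite[OF p(1), of q r C n] N unfolding p_def rho_def by blast
  hence C1: "asym (EE q) (rho n) C1 (NR p' (insert k {..<k}))" by (simp add: eqN flip: k')
  have SN: "Step ps (NR p' (insert k {..<k})) (NR p' {..<k})" using NR_step[OF p', of k "{..<k}"] by (simp add: pk)
  have "asym (EE q) (rho n / (1 - 1 / ps)) (C1 / (1 - 1 / sqrt ps)) (NR p' {..<k})"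
    by (rule step_add_EE[OF SN C1 ps(1)]) (use sf ps in auto)
  hence FN: "asym (EE q) 1 (C1 / (1 - 1 / sqrt ps)) (NR p' {..<k})" using rho_pos[of n] by (simp add: ps1)
  obtain C2 where "asym (EE q') 0 C2 (MR p {..<n})" using MR_remove_finite[OF p(1), of q' C' n] M unfolding p_def by blast
  hence C2: "asym (EE q') 0 C2 (MR p' (insert k {..<k}))" by (simp add: eqM flip: k')
  have SM: "Step ps (MR p' {..<k}) (MR p' (insert k {..<k}))" using MR_step[OF p', of k "{..<k}"] by (simp add: pk)
  have "asym (EE q') (0 * (1 - 1 / ps)) (C2 / (1 - 1 / sqrt ps)) (MR p' {..<k})"
    by (rule step_remove_EE[OF SM C2 ps(1)]) (use sf ps in auto)
  hence FM: "asym (EE q') 0 (C2 / (1 - 1 / sqrt ps)) (MR p' {..<k})" by simp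
  show ?thesis using ps FN FM unfolding p'_def p_def by blast
qed

end

section \<open>Lower bounds\<close>

text \<open>The nonzero members of F have countably many roots in all, and the interval (0, 1) is
  uncountable.\<close>

lemma poly_generic_point:
  fixes F :: "real poly set"
  assumes "countable F" shows "\<exists>s. 0 < s \<and> s < 1 \<and> (\<forall>Q\<in>F. poly Q s = 0 \<longrightarrow> Q = 0)"
proof -
  have "countable (\<Union>Q\<in>F - {0}. {s. poly Q s = 0})"
    using assms by (intro countable_UN) (auto intro: countable_finite poly_roots_finite)
  moreover have "uncountable {0<..<1::real}" by (simp add: uncountable_open_interval)
  ultimately have "\<not> {0<..<1} \<subseteq> (\<Union>Q\<in>F - {0}. {s. poly Q s = 0})" using countable_subset by blast
  thus ?thesis by auto
qed

text \<open>Only finitely many products lie below X. Taking for y the largest of them, or X / 2 if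
  that is larger, leaves just the products equal to X in (y, X].\<close>

lemma msum_jump:
  assumes p: "loc_fin p" and X: "X > 0"
  shows "\<exists>y. X / 2 \<le> y \<and> y < X \<and> msum p I X - msum p I y = (\<Sum>S | finite S \<and> S \<subseteq> I \<and> prod p S = X. (-1) ^ card S)"
proof -
  define V where "V = {v \<in> prod p ` sfree p I X. v < X}"
  have fV: "finite (insert (X/2) V)" using finite_sfree[OF p] by (simp add: V_def)
  define y where "y = Max (insert (X/2) V)"
  have y: "X / 2 \<le> y" "\<And>v. v \<in> V \<Longrightarrow> v \<le> y" unfolding y_def by (rule Max_ge[OF fV], simp)+
  have "y \<in> insert (X/2) V" unfolding y_def using fV by (intro Max_in) auto
  hence yX: "y < X" using X by (auto simp: V_def)
  have "sfree p I y \<subseteq> sfree p I X" using yX by (auto simp: sfree_def)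
  moreover have "sfree p I X - sfree p I y = {S. finite S \<and> S \<subseteq> I \<and> prod p S = X}"
  proof (intro set_eqI iffI)
    fix S assume S: "S \<in> sfree p I X - sfree p I y"
    hence "prod p S > y" by (auto simp: sfree_def)
    hence "prod p S \<notin> V" using y(2) by (auto simp: not_le[symmetric])
    moreover have "prod p S \<in> prod p ` sfree p I X" using S by blast
    ultimately have "\<not> prod p S < X" by (auto simp: V_def)
    thus "S \<in> {S. finite S \<and> S \<subseteq> I \<and> prod p S = X}" using S by (auto simp: sfree_def)
  qed (use yX in \<open>auto simp: sfree_def\<close>)
  ultimately have "msum p I X = msum p I y + (\<Sum>S | finite S \<and> S \<subseteq> I \<and> prod p S = X. (-1) ^ card S)"
    unfolding msum_def using sum.subset_diff[of "sfree p I y" "sfree p I X" "\<lambda>S. (-1::real) ^ card S"] finite_sfree[OF p] by simp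
  thus ?thesis using y(1) yX by (intro exI[of _ y]) auto
qed

context windows begin

definition PP :: "nat \<Rightarrow> real poly" where
  "PP j = (if j \<in> A then [:tt (wi j) + real (j - JJ (wi j)) * dl (wi j):] + monom (dl (wi j)) (Suc (wi j)) else [:om j:])"

text \<open>Difference between the sum of the log-primes in S and the target
  \<open>ln (XX i k m)\<close>, as a polynomial in the parameter s. It does not involve s itself,
  and finite S give only countably many such polynomials.\<close>

definition QQ :: "nat set \<times> nat \<times> nat \<times> nat \<Rightarrow> real poly" where
  "QQ = (\<lambda>(S, i, k, m). (\<Sum>j\<in>S. PP j) - smult (real k) ([:tt i:] + monom (dl i) (Suc i)) - [:real m * dl i:])"

lemma poly_PP: "poly (PP j) s = sg j"
  by (simp add: PP_def sg_def poly_monom)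

text \<open>Coincidences at the chosen s occur only if they hold identically in s.\<close>

definition generic :: bool where
  "generic \<longleftrightarrow> (\<forall>S i k m. finite S \<longrightarrow> poly (QQ (S, i, k, m)) s = 0 \<longrightarrow> QQ (S, i, k, m) = 0)"

lemma coeff_PP: "coeff (PP j) (Suc i) = (if j \<in> W i then dl i else 0)"
  and coeff_PP_0: "j \<in> W i \<Longrightarrow> coeff (PP j) 0 = tt i + real (j - JJ i) * dl i" "j \<notin> A \<Longrightarrow> coeff (PP j) 0 = om j"
proof -
  show "coeff (PP j) (Suc i) = (if j \<in> W i then dl i else 0)"
  proof (cases "j \<in> A")
    case True
    then obtain i' where i': "j \<in> W i'" by (auto simp: A_def)
    have "wi j = i'" by (rule wi_eq[OF i'])
    moreover have "j \<in> W i \<longleftrightarrow> i = i'" using i' W_unique by blast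
    ultimately show ?thesis using True by (auto simp: PP_def)
  next
    case False
    hence "j \<notin> W i" by (auto simp: A_def)
    thus ?thesis using False by (simp add: PP_def)
  qed
  show "j \<in> W i \<Longrightarrow> coeff (PP j) 0 = tt i + real (j - JJ i) * dl i"
    using wi_eq[of j i] by (auto simp: PP_def A_def)
  show "j \<notin> A \<Longrightarrow> coeff (PP j) 0 = om j" by (simp add: PP_def)
qed

text \<open>The coefficient of degree Suc i' counts the elements of S in window i', so there are k
  of them in window i and none in other windows. The constant coefficient then rules out primes
  outside the windows: each would contribute at least 1, but m * dl i is less than 1.\<close>

lemma generic_sum:
  assumes g: generic and S: "finite S" and m: "real (k * K i) * dl i < 1" "m \<le> k * K i"
    and eq: "(\<Sum>j\<in>S. sg j) = real k * (tt i + dl i * s ^ Suc i) + real m * dl i"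
  shows "S \<subseteq> W i \<and> card S = k \<and> (\<Sum>j\<in>S. j - JJ i) = m"
proof -
  have "poly (QQ (S, i, k, m)) s = 0" using eq by (simp add: QQ_def poly_sum poly_PP poly_monom)
  hence Q0: "QQ (S, i, k, m) = 0" using g S by (simp add: generic_def)
  have c: "coeff (QQ (S, i, k, m)) (Suc i') = dl i' * real (card (S \<inter> W i')) - (if i' = i then real k * dl i else 0)" for i'
  proof -
    have "(\<Sum>j\<in>S. coeff (PP j) (Suc i')) = (\<Sum>j\<in>S. if j \<in> W i' then dl i' else 0)" by (simp add: coeff_PP)
    also have "\<dots> = (\<Sum>j\<in>S \<inter> W i'. dl i')" by (rule sum.inter_restrict[OF S, symmetric])
    finally have "(\<Sum>j\<in>S. coeff (PP j) (Suc i')) = dl i' * real (card (S \<inter> W i'))" by simp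
    thus ?thesis by (simp add: QQ_def coeff_sum)
  qed
  have other: "S \<inter> W i' = {}" if "i' \<noteq> i" for i'
    using c[of i'] that dl_pos[of i'] S by (simp add: Q0)
  have cardk: "card (S \<inter> W i) = k" using c[of i] dl_pos[of i] by (simp add: Q0)
  have nA: "j \<notin> A" if "j \<in> S - W i" for j
    using that other by (auto simp: A_def) (metis IntI empty_iff)
  have "0 = coeff (QQ (S, i, k, m)) 0" by (simp add: Q0)
  also have "\<dots> = (\<Sum>j\<in>S. coeff (PP j) 0) - real k * tt i - real m * dl i"
    by (simp add: QQ_def coeff_sum)
  also have "(\<Sum>j\<in>S. coeff (PP j) 0) = (\<Sum>j\<in>S \<inter> W i. coeff (PP j) 0) + (\<Sum>j\<in>S - W i. coeff (PP j) 0)"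
    using S by (rule sum.Int_Diff)
  also have "(\<Sum>j\<in>S \<inter> W i. coeff (PP j) 0) = (\<Sum>j\<in>S \<inter> W i. tt i + real (j - JJ i) * dl i)"
    by (intro sum.cong) (auto simp: coeff_PP_0)
  also have "\<dots> = real k * tt i + real (\<Sum>j\<in>S \<inter> W i. j - JJ i) * dl i"
    using cardk by (simp add: sum.distrib sum_distrib_right)
  also have "(\<Sum>j\<in>S - W i. coeff (PP j) 0) = (\<Sum>j\<in>S - W i. om j)"
    by (intro sum.cong) (auto simp: coeff_PP_0 nA)
  finally have sm: "(\<Sum>j\<in>S - W i. om j) + real (\<Sum>j\<in>S \<inter> W i. j - JJ i) * dl i = real m * dl i" by simp
  have "S - W i = {}"
  proof (rule ccontr)
    assume "S - W i \<noteq> {}"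
    then obtain j where j: "j \<in> S - W i" by blast
    have "1 \<le> om j" by (rule cell_ptsD(3)[OF om])
    also have "om j \<le> (\<Sum>j\<in>S - W i. om j)"
      using j S cell_ptsD(3)[OF om] by (intro member_le_sum) (auto intro: order_trans[of 0 1])
    also have "\<dots> \<le> real m * dl i"
    proof -
      have "0 \<le> real (\<Sum>j\<in>S \<inter> W i. j - JJ i) * dl i" by (intro mult_nonneg_nonneg of_nat_0_le_iff less_imp_le[OF dl_pos])
      thus ?thesis using sm by linarith
    qed
    also have "\<dots> \<le> real (k * K i) * dl i" using m dl_pos[of i] by (intro mult_right_mono) (auto simp del: of_nat_mult)
    finally show False using m by simp
  qed
  hence SW: "S \<subseteq> W i" by blast
  hence e: "S - W i = {}" "S \<inter> W i = S" by blast+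
  have "real (\<Sum>j\<in>S. j - JJ i) * dl i = real m * dl i" using sm unfolding e by (simp only: sum.empty add_0)
  hence "real (\<Sum>j\<in>S. j - JJ i) = real m" using dl_pos[of i] by (metis less_irrefl mult_cancel_right)
  hence "(\<Sum>j\<in>S. j - JJ i) = m" by (simp only: of_nat_eq_iff)
  thus ?thesis using SW cardk e by simp
qed

section \<open>Coinciding products from one window\<close>

definition SW :: "nat \<Rightarrow> nat \<Rightarrow> nat \<Rightarrow> nat set set" where
  "SW i k m = {S. S \<subseteq> W i \<and> card S = k \<and> (\<Sum>j\<in>S. j - JJ i) = m}"

definition XX :: "nat \<Rightarrow> nat \<Rightarrow> nat \<Rightarrow> real" where
  "XX i k m = exp (real k * (tt i + dl i * s ^ Suc i) + real m * dl i)"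

lemma finite_SW: "finite (SW i k m)"
  by (rule finite_subset[of _ "Pow (W i)"]) (auto simp: SW_def W_def)

lemma SW_sum: assumes "S \<in> SW i k m" shows "(\<Prod>j\<in>S. exp (sg j)) = XX i k m"
proof -
  have S: "S \<subseteq> W i" "card S = k" "(\<Sum>j\<in>S. j - JJ i) = m" using assms by (auto simp: SW_def)
  hence f: "finite S" by (auto simp: W_def intro: finite_subset)
  have "(\<Sum>j\<in>S. sg j) = (\<Sum>j\<in>S. (tt i + dl i * s ^ Suc i) + real (j - JJ i) * dl i)"
    using S by (intro sum.cong) (auto simp: sg_W)
  also have "\<dots> = real k * (tt i + dl i * s ^ Suc i) + real m * dl i"
    using S by (simp add: sum.distrib algebra_simps flip: sum_distrib_right sum_distrib_left of_nat_sum)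
  finally show ?thesis using f by (simp add: XX_def exp_sum[symmetric])
qed

lemma XX_bounds:
  assumes "real (k * K i) * dl i < 1" "m \<le> k * K i" "k \<ge> 1"
  shows "XX i k m \<le> exp (real k * (tt i + 3))" "XX i k m \<ge> exp (tt i)"
proof -
  have "s ^ Suc i \<le> 1" "0 \<le> s ^ Suc i" using s01 by (auto intro!: power_le_one simp del: power_Suc)
  hence "dl i * s ^ Suc i \<le> 2 * 1" "0 \<le> dl i * s ^ Suc i" using dl_le_2[of i] dl_pos[of i]
    by (intro mult_mono mult_nonneg_nonneg; simp)+
  hence d: "dl i * s ^ Suc i \<le> 2" "0 \<le> dl i * s ^ Suc i" by simp_all
  have "real m * dl i \<le> real (k * K i) * dl i" using assms dl_pos[of i] by (intro mult_right_mono) (auto simp del: of_nat_mult)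
  hence m: "real m * dl i \<le> real k" using assms by linarith
  have "real k * (tt i + dl i * s ^ Suc i) \<le> real k * (tt i + 2)" using d by (intro mult_left_mono) auto
  thus "XX i k m \<le> exp (real k * (tt i + 3))" unfolding XX_def using m by (simp add: algebra_simps)
  have "1 * tt i \<le> real k * (tt i + dl i * s ^ Suc i)" using d assms tt_ge(1)[of i] by (intro mult_mono) auto
  moreover have "0 \<le> real m * dl i" using dl_pos[of i] by simp
  ultimately show "XX i k m \<ge> exp (tt i)" unfolding XX_def by simp
qed

text \<open>By pigeonhole some integer has at least \<open>(K i choose k) / (k * K i + 1)\<close> representations, which is
  about \<open>X powr (1/2 - 1/(2*k))\<close>.\<close>
lemma count_contra:
  assumes al: "0 < al" "al < 1/2"
    and H: "\<And>i k m. i \<ge> i0 \<Longrightarrow> k \<ge> 1 \<Longrightarrow> real (k * K i) * dl i < 1 \<Longrightarrow> m \<le> k * K i \<Longrightarrow>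
       real (card (SW i k m)) \<le> B * XX i k m powr al"
  shows False
proof -
  \<comment> \<open>\<open>ga\<close> lies halfway between al and 1/2, and k is taken with k * de >
    1. Then the exponent (k - 1) * ga - k * al, which equals k * de - ga, exceeds 1/2.\<close>
  define de where "de = (1/2 - al) / 2"
  define ga where "ga = 1/2 - de"
  have de: "de > 0" "ga - al = de" "ga > 0" "ga < 1/2" using al by (auto simp: de_def ga_def field_simps)
  obtain k where k: "1 < real k * de" using reals_Archimedean3[OF de(1)] by blast
  have k1: "k \<ge> 1" using k by (cases k) auto
  define B' where "B' = real k ^ k * real (k + 1) * \<bar>B\<bar> * exp (al * real k * 3)"
  have "eventually (\<lambda>t. exp (ga * t) + 1 \<le> sqrt (exp t / (4 * t))) at_top" using de(3,4) by real_asymp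
  moreover have "eventually (\<lambda>t. exp (ga * t) > real k) at_top" using de(3) by real_asymp
  moreover have "eventually (\<lambda>t. exp (t / 2) > B') at_top" by real_asymp
  ultimately have "eventually (\<lambda>t. exp (ga * t) + 1 \<le> sqrt (exp t / (4 * t)) \<and> exp (ga * t) > real k \<and> exp (t / 2) > B') at_top"
    by (intro eventually_conj)
  then obtain t0 where t0: "\<And>t. t \<ge> t0 \<Longrightarrow> exp (ga * t) + 1 \<le> sqrt (exp t / (4 * t)) \<and> exp (ga * t) > real k \<and> exp (t / 2) > B'"
    by (auto simp: eventually_at_top_linorder)
  obtain n where n: "t0 < 4 ^ n" using real_arch_pow[of 4 t0] by auto
  define i where "i = max n i0"
  define t where "t = tt i"
  have "(4::real) ^ n \<le> 4 ^ i" by (intro power_increasing) (auto simp: i_def)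
  hence "t \<ge> t0" unfolding t_def using n tt_ge(2)[of i] by linarith
  from t0[OF this] have t1: "exp (ga * t) + 1 \<le> sqrt (exp t / (4 * t))" and t2: "exp (ga * t) > real k" and t3: "exp (t / 2) > B'" by auto
  have t: "t \<ge> 1" using tt_ge(1)[of i] by (simp add: t_def)
  have "sqrt (exp t / (4 * t)) \<le> sqrt (phi t)" by (intro real_sqrt_le_mono phi_ge t)
  hence sq: "exp (ga * t) + 1 \<le> sqrt (phi t)" using t1 by linarith
  have Kge: "exp (ga * t) \<le> real (K i)" using K_ge[of i] sq by (simp add: t_def)
  have kK: "k \<le> K i" using Kge t2 by linarith
  have phi0: "phi t > 0" using phi_ge_half[of t] t by linarith
  \<comment> \<open>A whole window has length of order 1 / sqrt (phi t), so even k of them are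
    shorter than 1 once t is large.\<close>
  have cond: "real (k * K i) * dl i < 1"
  proof -
    have "real (K i) * dl i \<le> sqrt (phi t) * (1 / phi t)" using K_le[of i] dl_le[of i] dl_pos[of i] phi0
      by (intro mult_mono) (auto simp: t_def)
    also have "\<dots> = 1 / sqrt (phi t)" using phi0 by (simp add: real_div_sqrt field_simps)
    finally have "real k * (real (K i) * dl i) \<le> real k * (1 / sqrt (phi t))" by (intro mult_left_mono) auto
    also have "\<dots> < 1" using sq t2 phi0 by (simp add: field_simps)
    finally show ?thesis by (simp add: mult.assoc)
  qed
  have fW: "finite (W i)" "card (W i) = K i" by (auto simp: W_def)
  have un: "{S. S \<subseteq> W i \<and> card S = k} \<subseteq> (\<Union>m\<in>{..k * K i}. SW i k m)"
  proof
    fix S assume S: "S \<in> {S. S \<subseteq> W i \<and> card S = k}"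
    have "j - JJ i \<le> K i" if "j \<in> S" for j
    proof -
      have "j \<in> W i" using S that by blast
      thus ?thesis by (auto simp: W_def)
    qed
    hence "(\<Sum>j\<in>S. j - JJ i) \<le> (\<Sum>j\<in>S. K i)" by (rule sum_mono)
    also have "\<dots> = k * K i" using S by simp
    finally show "S \<in> (\<Union>m\<in>{..k * K i}. SW i k m)" using S by (auto simp: SW_def)
  qed
  define U where "U = \<bar>B\<bar> * exp (al * (real k * (t + 3)))"
  have U: "real (card (SW i k m)) \<le> U" if m: "m \<le> k * K i" for m
  proof -
    have "real (card (SW i k m)) \<le> B * XX i k m powr al" by (rule H[OF _ k1 cond m]) (simp add: i_def)
    also have "\<dots> \<le> \<bar>B\<bar> * XX i k m powr al" by (intro mult_right_mono) auto
    also have "\<dots> \<le> \<bar>B\<bar> * exp (real k * (t + 3)) powr al"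
      using XX_bounds(1)[OF cond m k1] al by (intro mult_left_mono powr_mono2) (auto simp: t_def XX_def)
    also have "\<dots> = U" by (simp add: U_def powr_def)
    finally show ?thesis .
  qed
  have "real (K i choose k) = real (card {S. S \<subseteq> W i \<and> card S = k})" using n_subsets[OF fW(1), of k] fW by simp
  also have "\<dots> \<le> real (card (\<Union>m\<in>{..k * K i}. SW i k m))" using card_mono[OF _ un] finite_SW by simp
  also have "\<dots> \<le> real (\<Sum>m\<in>{..k * K i}. card (SW i k m))" by (intro of_nat_mono card_UN_le) auto
  also have "\<dots> \<le> (\<Sum>m\<in>{..k * K i}. U)" unfolding of_nat_sum by (intro sum_mono U) auto
  also have "\<dots> = (real (k * K i) + 1) * U" by simp
  also have "\<dots> \<le> (real (k + 1) * real (K i)) * U"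
  proof (rule mult_right_mono)
    have "1 \<le> real (K i)" using kK k1 by simp
    thus "real (k * K i) + 1 \<le> real (k + 1) * real (K i)" by (simp add: algebra_simps)
  qed (simp add: U_def)
  finally have 1: "real (K i choose k) \<le> real (k + 1) * real (K i) * U" .
  have "(real (K i) / real k) ^ k \<le> real (K i choose k)" using binomial_ge_n_over_k_pow_k[OF kK, where 'a = real] by simp
  hence "real (K i) ^ k / real k ^ k \<le> real (k + 1) * real (K i) * U" using 1 by (simp add: power_divide)
  hence 2: "real (K i) ^ k \<le> real k ^ k * (real (k + 1) * real (K i) * U)" using k1 by (simp add: field_simps)
  obtain k' where k': "k = Suc k'" using k1 by (cases k) auto
  have Kpos: "real (K i) > 0" using kK k1 by simp
  have "real (K i) * real (K i) ^ k' \<le> real (K i) * (real k ^ k * (real (k + 1) * U))" using 2 by (simp add: k' mult_ac)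
  hence 3: "real (K i) ^ k' \<le> real k ^ k * (real (k + 1) * U)" using Kpos by (simp only: mult_le_cancel_left_pos)
  have "exp (ga * t) ^ k' \<le> real (K i) ^ k'" using Kge by (intro power_mono) auto
  hence "exp (real k' * (ga * t)) \<le> real k ^ k * (real (k + 1) * U)" using 3 by (simp add: exp_of_nat_mult)
  also have "\<dots> = B' * exp (al * real k * t)"
  proof -
    have "al * (real k * (t + 3)) = al * real k * 3 + al * real k * t" by (simp add: algebra_simps)
    thus ?thesis unfolding U_def B'_def by (simp add: exp_add)
  qed
  finally have "exp (real k' * (ga * t)) * exp (- (al * real k * t)) \<le> B' * exp (al * real k * t) * exp (- (al * real k * t))"
    by (intro mult_right_mono) auto
  hence 4: "exp (real k' * (ga * t) - al * real k * t) \<le> B'" by (simp add: mult.assoc flip: exp_add)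
  have "real k' * (ga * t) - al * real k * t = (real k * de - ga) * t"
  proof -
    have al_eq: "al = ga - de" using de(2) by linarith
    show ?thesis unfolding al_eq by (simp add: k' algebra_simps)
  qed
  moreover have "1/2 * t \<le> (real k * de - ga) * t" using k de t by (intro mult_right_mono) auto
  ultimately have "t / 2 \<le> real k' * (ga * t) - al * real k * t" by simp
  hence "exp (t / 2) \<le> B'" using 4 by (meson exp_le_cancel_iff order_trans)
  thus False using t3 by simp
qed

text \<open>Integers are counted positively, so other products can only enlarge the jump: N X - N (X
  - 1) is at least \<open>card (SW i k m)\<close>, whereas the assumed error term allows only O(X
  powr al).\<close>

lemma N_Omega:
  assumes ps: "loc_fin ((\<lambda>j. exp (sg j))(n := ps))" and al: "0 < al" "al < 1/2"
    and ev: "eventually (\<lambda>x. \<bar>NR ((\<lambda>j. exp (sg j))(n := ps)) {..<n} x - x\<bar> \<le> C * x powr al) at_top"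
  shows False
proof -
  define p where "p = (\<lambda>j. exp (sg j))(n := ps)"
  define N where "N = NR p {..<n}"
  obtain x0 where x0: "\<And>x. x \<ge> x0 \<Longrightarrow> \<bar>N x - x\<bar> \<le> C * x powr al" using ev unfolding p_def N_def by (auto simp: eventually_at_top_linorder)
  obtain n1 where n1: "max x0 1 + 1 < 4 ^ n1" using real_arch_pow[of 4 "max x0 1 + 1"] by auto
  show False
  proof (rule count_contra[OF al, of "max (Suc n) n1" "1 + 2 * \<bar>C\<bar>"])
    fix i k m assume i: "max (Suc n) n1 \<le> i" and k: "k \<ge> 1" and cond: "real (k * K i) * dl i < 1" "m \<le> k * K i"
    define X where "X = XX i k m"
    have "(4::real) ^ n1 \<le> 4 ^ i" using i by (intro power_increasing) auto
    also have "\<dots> \<le> tt i" by (rule tt_ge)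
    also have "\<dots> \<le> exp (tt i)" using exp_ge_add_one_self[of "tt i"] by linarith
    also have "\<dots> \<le> X" unfolding X_def by (rule XX_bounds(2)[OF cond k])
    finally have X: "X > max x0 1 + 1" using n1 by linarith
    let ?A = "\<lambda>j. if j \<in> {..<n} then {0} else UNIV :: nat set"
    define f where "f S = (\<lambda>j. if j \<in> S then 1 else 0 :: nat)" for S :: "nat set"
    have supp: "{j. f S j \<noteq> 0} = S" for S by (auto simp: f_def)
    \<comment> \<open>Windows with i > n lie entirely behind the removed generators and the modified
      slot n.\<close>
    have nW: "j > n" if "j \<in> W i" for j using that i JJ_ge[of i] by (auto simp: W_def)
    have gi: "f S \<in> gints p ?A X - gints p ?A (X - 1)" if S: "S \<in> SW i k m" for S
    proof -
      have SW: "S \<subseteq> W i" using S by (simp add: SW_def)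
      have "finite S" using SW by (auto simp: W_def intro: finite_subset)
      moreover have "gen_int p (f S) = (\<Prod>j\<in>S. exp (sg j))" unfolding gen_int_def supp
        using SW nW by (intro prod.cong) (force simp: f_def p_def)+
      moreover have "f S j \<in> ?A j" for j using SW nW[of j] by (auto simp: f_def)
      ultimately show ?thesis using SW_sum[OF S] supp[of S] by (simp add: gints_def X_def)
    qed
    have "card (SW i k m) \<le> card (gints p ?A X - gints p ?A (X - 1))"
    proof (rule card_inj_on_le[of f])
      show "inj_on f (SW i k m)" by (rule inj_onI) (metis supp)
      show "f ` SW i k m \<subseteq> gints p ?A X - gints p ?A (X - 1)" using gi by blast
      show "finite (gints p ?A X - gints p ?A (X - 1))" using finite_gints[of p] ps by (simp add: p_def)
    qed
    also have "gints p ?A (X - 1) \<subseteq> gints p ?A X" by (auto simp: gints_def)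
    hence "card (gints p ?A X - gints p ?A (X - 1)) = card (gints p ?A X) - card (gints p ?A (X - 1))"
      using finite_gints[of p] ps by (intro card_Diff_subset) (auto simp: p_def)
    finally have "real (card (SW i k m)) \<le> N X - N (X - 1)"
      unfolding N_def NR_def cnt_def using card_mono[OF _ \<open>gints p ?A (X - 1) \<subseteq> gints p ?A X\<close>] finite_gints[of p] ps
      by (simp add: p_def)
    also have "\<dots> \<le> 1 + C * X powr al + C * (X - 1) powr al" using x0[of X] x0[of "X - 1"] X by linarith
    also have "\<dots> \<le> X powr al + \<bar>C\<bar> * X powr al + \<bar>C\<bar> * X powr al"
    proof (intro add_mono)
      show "1 \<le> X powr al" using X al by (intro ge_one_powr_ge_zero) auto
      show "C * X powr al \<le> \<bar>C\<bar> * X powr al" by (intro mult_right_mono) auto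
      have "C * (X - 1) powr al \<le> \<bar>C\<bar> * (X - 1) powr al" by (intro mult_right_mono) auto
      also have "\<dots> \<le> \<bar>C\<bar> * X powr al" using X al by (intro mult_left_mono powr_mono2) auto
      finally show "C * (X - 1) powr al \<le> \<bar>C\<bar> * X powr al" .
    qed
    also have "\<dots> = (1 + 2 * \<bar>C\<bar>) * X powr al" by (simp add: algebra_simps)
    finally show "real (card (SW i k m)) \<le> (1 + 2 * \<bar>C\<bar>) * XX i k m powr al" by (simp add: X_def)
  qed
qed

text \<open>\<open>generic\<close> speaks about the primes exp (sg j) and not about ps. Therefore ps
  is taken out first, by \<open>step_add\<close> with error function x powr al. Then all products
  equal to X consist of k primes of one window, share the sign (-1) ^ k and cannot cancel.\<close>

lemma M_Omega:
  assumes g: generic and ps: "1 < ps" and lf: "loc_fin ((\<lambda>j. exp (sg j))(n := ps))" and al: "0 < al" "al < 1/2"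
    and ev: "eventually (\<lambda>x. \<bar>MR ((\<lambda>j. exp (sg j))(n := ps)) {..<n} x\<bar> \<le> C * x powr al) at_top"
  shows False
proof -
  define p where "p = (\<lambda>j. exp (sg j))(n := ps)"
  have p: "loc_fin p" using lf by (simp add: p_def)
  obtain x0 where x0: "\<And>x. x \<ge> x0 \<Longrightarrow> \<bar>MR p {..<n} x\<bar> \<le> C * x powr al" using ev unfolding p_def by (auto simp: eventually_at_top_linorder)
  \<comment> \<open>The step for ps visits x / ps, x / ps ^ 2 and so on, so the bound is required at
    all x > 0; below x0 the number of terms serves.\<close>
  define C1 where "C1 = \<bar>C\<bar> + real (card (sfree p (- {..<n}) x0))"
  have "\<bar>MR p {..<n} x\<bar> \<le> C1 * x powr al" if x: "x > 0" for x
  proof -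
    consider "x < 1" | "x \<ge> x0" | "1 \<le> x" "x \<le> x0" by linarith
    thus ?thesis
    proof cases
      case 1
      thus ?thesis using msum_below_1[OF p, of x] by (simp add: MR_def C1_def)
    next
      case 2
      have "C * x powr al \<le> C1 * x powr al" by (intro mult_right_mono) (auto simp: C1_def)
      thus ?thesis using x0[OF 2] by linarith
    next
      case 3
      have "\<bar>MR p {..<n} x\<bar> \<le> (\<Sum>S\<in>sfree p (- {..<n}) x. \<bar>(-1) ^ card S\<bar>)" unfolding MR_def msum_def by (rule sum_abs)
      also have "\<dots> = real (card (sfree p (- {..<n}) x))" by (simp add: power_abs)
      also have "\<dots> \<le> real (card (sfree p (- {..<n}) x0))" using 3 finite_sfree[OF p]
        by (intro of_nat_mono card_mono) (auto simp: sfree_def)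
      also have "\<dots> \<le> C1 * 1" by (simp add: C1_def)
      also have "\<dots> \<le> C1 * x powr al" using 3 al by (intro mult_left_mono ge_one_powr_ge_zero) (auto simp: C1_def)
      finally show ?thesis .
    qed
  qed
  hence a: "asym (\<lambda>x. x powr al) 0 C1 (MR p {..<n})" by (simp add: asym_def C1_def)
  define w where "w = ps powr (- al)"
  have "Step (p n) (MR p {..<n}) (MR p (insert n {..<n}))" by (rule MR_step[OF p]) simp
  hence st: "Step ps (MR p {..<n}) (MR p {..<Suc n})" by (simp add: p_def lessThan_Suc)
  have "asym (\<lambda>x. x powr al) (0 / (1 - 1 / ps)) (C1 / (1 - w)) (MR p {..<Suc n})"
  proof (rule step_add[OF st a ps])
    have "ps powr (-1) \<le> ps powr (- al)" using ps al by (intro powr_mono) auto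
    thus "1 / ps \<le> w" using ps by (simp add: w_def powr_minus_divide)
    show "w < 1" unfolding w_def using ps al by (simp add: powr_less_one)
    show "(x / ps) powr al \<le> w * x powr al" if "x > 0" for x
      using that ps by (simp add: w_def powr_divide powr_minus_divide)
    show "x \<le> x powr al" if "0 < x" "x < 1" for x
      using powr_mono'[of al 1 x] that al by simp
  qed
  moreover have "MR p {..<Suc n} = MR (\<lambda>j. exp (sg j)) {..<Suc n}"
    by (rule ext, rule MR_cong[OF p exp_sg_facts(1)]) (auto simp: p_def)
  moreover define D where "D = C1 / (1 - w)"
  ultimately have D: "\<And>x. x > 0 \<Longrightarrow> \<bar>MR (\<lambda>j. exp (sg j)) {..<Suc n} x\<bar> \<le> D * x powr al" "D \<ge> 0"
    unfolding asym_def by simp_all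
  show False
  proof (rule count_contra[OF al, of "Suc n" "2 * D"])
    fix i k m assume i: "Suc n \<le> i" and k: "k \<ge> 1" and cond: "real (k * K i) * dl i < 1" "m \<le> k * K i"
    define X where "X = XX i k m"
    have X: "X > 0" by (simp add: X_def XX_def)
    obtain y where y: "X / 2 \<le> y" "y < X" and
      J: "MR (\<lambda>j. exp (sg j)) {..<Suc n} X - MR (\<lambda>j. exp (sg j)) {..<Suc n} y =
        (\<Sum>S | finite S \<and> S \<subseteq> - {..<Suc n} \<and> (\<Prod>j\<in>S. exp (sg j)) = X. (-1) ^ card S)"
      using msum_jump[OF exp_sg_facts(1) X, of "- {..<Suc n}"] unfolding MR_def by blast
    have "{S. finite S \<and> S \<subseteq> - {..<Suc n} \<and> (\<Prod>j\<in>S. exp (sg j)) = X} = SW i k m"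
    proof (intro set_eqI iffI)
      fix S assume "S \<in> {S. finite S \<and> S \<subseteq> - {..<Suc n} \<and> (\<Prod>j\<in>S. exp (sg j)) = X}"
      hence S: "finite S" "(\<Prod>j\<in>S. exp (sg j)) = X" by auto
      have "(\<Sum>j\<in>S. sg j) = real k * (tt i + dl i * s ^ Suc i) + real m * dl i"
        using S by (simp add: X_def XX_def flip: exp_sum)
      from generic_sum[OF g S(1) cond this] show "S \<in> SW i k m" by (simp add: SW_def)
    next
      fix S assume S: "S \<in> SW i k m"
      hence SW: "S \<subseteq> W i" by (simp add: SW_def)
      have "finite S" using SW by (auto simp: W_def intro: finite_subset)
      moreover have "S \<subseteq> - {..<Suc n}" using SW i JJ_ge[of i] by (auto simp: W_def)
      ultimately show "S \<in> {S. finite S \<and> S \<subseteq> - {..<Suc n} \<and> (\<Prod>j\<in>S. exp (sg j)) = X}"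
        using SW_sum[OF S] by (simp add: X_def)
    qed
    hence "MR (\<lambda>j. exp (sg j)) {..<Suc n} X - MR (\<lambda>j. exp (sg j)) {..<Suc n} y = (\<Sum>S\<in>SW i k m. (-1) ^ card S)" using J by simp
    also have "\<dots> = (\<Sum>S\<in>SW i k m. (-1) ^ k)" by (intro sum.cong) (auto simp: SW_def)
    also have "\<dots> = real (card (SW i k m)) * (-1) ^ k" by simp
    finally have "real (card (SW i k m)) = \<bar>MR (\<lambda>j. exp (sg j)) {..<Suc n} X - MR (\<lambda>j. exp (sg j)) {..<Suc n} y\<bar>"
      by (simp add: abs_mult power_abs)
    also have "\<dots> \<le> D * X powr al + D * y powr al" using D(1)[of X] D(1)[of y] X y by linarith
    also have "D * y powr al \<le> D * X powr al" using y X al D(2) by (intro mult_left_mono powr_mono2) auto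
    finally show "real (card (SW i k m)) \<le> 2 * D * XX i k m powr al" by (simp add: X_def)
  qed
qed

end

section \<open>The prime counting function\<close>

lemma harmonic_le: "(\<Sum>i<Suc n. 1 / real (Suc i)) \<le> 1 + ln (real (Suc n))"
proof (induction n)
  case (Suc n)
  have "ln (real (Suc n) / real (Suc (Suc n))) \<le> real (Suc n) / real (Suc (Suc n)) - 1" by (intro ln_le_minus_one) simp
  also have "\<dots> = - (1 / real (Suc (Suc n)))" by (simp add: field_simps)
  also have "ln (real (Suc n) / real (Suc (Suc n))) = ln (real (Suc n)) - ln (real (Suc (Suc n)))" by (rule ln_divide_pos) simp_all
  finally show ?case using Suc by simp
qed simp

text \<open>Prime powers are grouped by their exponent \<open>Suc i\<close>; from i = n on the roots
  of x lie below the least prime and nothing is counted.\<close>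

lemma Pi_eq:
  assumes p: "\<And>j. p j \<ge> exp l0" "\<And>x. finite {j. p j \<le> x}" and x: "x > 0" and n: "\<And>i. i \<ge> n \<Longrightarrow> ln x / real (Suc i) < l0"
  shows "Pi_P p x = (\<Sum>i<n. real (card {j. p j \<le> exp (ln x / real (Suc i))}) / real (Suc i))"
proof -
  define B where "B i = {j. p j \<le> exp (ln x / real (Suc i))}" for i
  have p0: "p j > 0" for j using p(1)[of j] by (meson exp_gt_zero less_le_trans)
  have iff: "p j ^ Suc i \<le> x \<longleftrightarrow> j \<in> B i" for i j
  proof -
    have "exp (ln x / real (Suc i)) ^ Suc i = exp (real (Suc i) * (ln x / real (Suc i)))" by (rule exp_of_nat_mult[symmetric])
    also have "\<dots> = x" using x by simp
    finally have "p j ^ Suc i \<le> x \<longleftrightarrow> p j ^ Suc i \<le> exp (ln x / real (Suc i)) ^ Suc i" by simp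
    also have "\<dots> \<longleftrightarrow> p j \<le> exp (ln x / real (Suc i))" using p0[of j] by (intro power_mono_iff) auto
    finally show ?thesis by (simp add: B_def)
  qed
  have emp: "B i = {}" if "i \<ge> n" for i
  proof -
    have "exp (ln x / real (Suc i)) < p j" for j using n[OF that] p(1)[of j] by (meson exp_less_cancel_iff less_le_trans)
    thus ?thesis by (auto simp: B_def not_le)
  qed
  have bij: "bij_betw (\<lambda>(i, j). (j, Suc i)) (Sigma {..<n} B) {(j, \<nu>). \<nu> \<ge> 1 \<and> p j ^ \<nu> \<le> x}"
  proof (rule bij_betw_byWitness[where f' = "\<lambda>(j, \<nu>). (\<nu> - 1, j)"])
    show "(\<lambda>(i, j). (j, Suc i)) ` Sigma {..<n} B \<subseteq> {(j, \<nu>). 1 \<le> \<nu> \<and> p j ^ \<nu> \<le> x}"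
      using iff by (auto simp del: power_Suc)
    show "(\<lambda>(j, \<nu>). (\<nu> - 1, j)) ` {(j, \<nu>). 1 \<le> \<nu> \<and> p j ^ \<nu> \<le> x} \<subseteq> Sigma {..<n} B"
    proof clarify
      fix j \<nu> assume a: "1 \<le> \<nu>" "p j ^ \<nu> \<le> x"
      then obtain i where i: "\<nu> = Suc i" by (cases \<nu>) auto
      hence "j \<in> B i" using a iff by blast
      moreover have "i < n"
      proof (rule ccontr)
        assume "\<not> i < n"
        hence "B i = {}" by (intro emp) simp
        thus False using \<open>j \<in> B i\<close> by blast
      qed
      ultimately show "\<nu> - 1 \<in> {..<n} \<and> j \<in> B (\<nu> - 1)" by (simp add: i)
    qed
  qed auto
  have "Pi_P p x = (\<Sum>y\<in>Sigma {..<n} B. case (case y of (i, j) \<Rightarrow> (j, Suc i)) of (j, \<nu>) \<Rightarrow> 1 / real \<nu>)"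
    unfolding Pi_P_def by (rule sum.reindex_bij_betw[OF bij, symmetric])
  also have "\<dots> = (\<Sum>(i, j)\<in>Sigma {..<n} B. 1 / real (Suc i))" by (intro sum.cong) auto
  also have "\<dots> = (\<Sum>i<n. \<Sum>j\<in>B i. 1 / real (Suc i))" by (rule sum.Sigma[symmetric]) (use p(2) in \<open>auto simp: B_def\<close>)
  finally show ?thesis by (simp add: B_def)
qed

text \<open>An error O(1) in the prime count costs C / \<nu> for each of the O(ln x) exponents \<nu>
  at which prime powers occur, a harmonic sum of size ln (ln x). For larger \<nu> only Phi (t /
  \<nu>) / \<nu> remains, which is O(t / \<nu> ^ 2) and sums to O(1) because \<nu> exceeds a
  multiple of t.\<close>

lemma Pi_bigo:
  assumes p: "\<And>j. p j \<ge> exp l0" "\<And>x. finite {j. p j \<le> x}" and l0: "l0 > 0"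
    and c: "\<And>u. u \<ge> 0 \<Longrightarrow> \<bar>real (card {j. p j \<le> exp u}) - Phi u\<bar> \<le> C"
  shows "(\<lambda>x. Pi_P p x - Li x) \<in> O(\<lambda>x. ln (ln x))"
proof -
  have C: "C \<ge> 0" using c[of 0] by linarith
  define D where "D = C * (1 + ln (1 / l0 + 1)) + phi l0 * l0"
  have main: "\<bar>Pi_P p x - Li x\<bar> \<le> C * ln (ln x) + D" if x: "x \<ge> exp 1" for x
  proof -
    have x0: "x > 0" using x exp_gt_zero[of 1] by linarith
    have x1: "x \<ge> 1" using x exp_ge_add_one_self[of "1::real"] by linarith
    define t where "t = ln x"
    have t: "t \<ge> 1" using x x0 by (simp add: t_def ln_ge_iff)
    define V where "V = nat \<lceil>t / l0\<rceil>"
    have tl: "t / l0 > 0" using t l0 by simp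
    have V: "real V \<ge> t / l0" "real V \<le> t / l0 + 1" "V > 0" using tl by (auto simp: V_def)
    have small: "t / real (Suc i) < l0" if "i \<ge> V" for i
    proof -
      have "t / l0 < real (Suc i)" using V that by linarith
      thus ?thesis using l0 by (simp add: field_simps)
    qed
    define cc where "cc i = real (card {j. p j \<le> exp (t / real (Suc i))}) / real (Suc i)" for i
    define ph where "ph i = Phi (t / real (Suc i)) / real (Suc i)" for i
    have PiV: "Pi_P p x = (\<Sum>i<n. cc i)" if "n \<ge> V" for n
      unfolding cc_def t_def by (rule Pi_eq[OF p x0]) (use small that in \<open>auto simp: t_def\<close>)
    have "(\<Sum>i<Suc n. \<bar>cc i - ph i\<bar>) \<le> C * ln t + D" if n: "n \<ge> V" for n
    proof -
      have "(\<Sum>i<V. \<bar>cc i - ph i\<bar>) \<le> (\<Sum>i<V. C * (1 / real (Suc i)))"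
      proof (rule sum_mono)
        fix i
        have "\<bar>cc i - ph i\<bar> = \<bar>real (card {j. p j \<le> exp (t / real (Suc i))}) - Phi (t / real (Suc i))\<bar> / real (Suc i)"
          by (simp add: cc_def ph_def abs_divide flip: diff_divide_distrib)
        also have "\<dots> \<le> C / real (Suc i)" using t by (intro divide_right_mono c) auto
        finally show "\<bar>cc i - ph i\<bar> \<le> C * (1 / real (Suc i))" by simp
      qed
      also have "\<dots> = C * (\<Sum>i<V. 1 / real (Suc i))" by (rule sum_distrib_left[symmetric])
      also have "\<dots> \<le> C * (1 + ln (real V))" using harmonic_le[of "V - 1"] V C by (intro mult_left_mono) auto
      also have "\<dots> \<le> C * (1 + (ln t + ln (1 / l0 + 1)))"
      proof -
        have "real V \<le> t * (1 / l0 + 1)" using V(2) t by (simp add: algebra_simps)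
        hence "ln (real V) \<le> ln (t * (1 / l0 + 1))" using V by (intro ln_mono) auto
        also have "\<dots> = ln t + ln (1 / l0 + 1)" using t l0 by (intro ln_mult_pos) (auto intro: add_pos_pos)
        finally show ?thesis using C by (intro mult_left_mono) auto
      qed
      finally have 1: "(\<Sum>i<V. \<bar>cc i - ph i\<bar>) \<le> C * (1 + (ln t + ln (1 / l0 + 1)))" .
      \<comment> \<open>No primes are left from index V on, and the bound on the comparison term is
        put into a form that telescopes.\<close>
      have b: "\<bar>cc i - ph i\<bar> \<le> phi l0 * t * (1 / real i - 1 / real (Suc i))" if i: "i \<ge> V" for i
      proof -
        define u where "u = t / real (Suc i)"
        have u: "0 \<le> u" "u \<le> l0" using small[OF i] t by (auto simp: u_def)
        have "{j. p j \<le> exp u} = {}"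
        proof -
          have "exp u < p j" for j using small[OF i] p(1)[of j] by (metis exp_less_cancel_iff less_le_trans u_def)
          thus ?thesis by (auto simp: not_le)
        qed
        hence "cc i = 0" by (simp add: cc_def u_def)
        hence "\<bar>cc i - ph i\<bar> = Phi u / real (Suc i)" using Phi_nonneg[OF u(1)] by (simp add: ph_def u_def)
        also have "Phi u \<le> phi l0 * u"
        proof -
          have "Phi u \<le> phi u * u" using Phi_MVT(2)[of 0 u] u by simp
          also have "\<dots> \<le> phi l0 * u" using u by (intro mult_right_mono phi_mono) auto
          finally show ?thesis .
        qed
        hence "Phi u / real (Suc i) \<le> phi l0 * u / real (Suc i)" by (intro divide_right_mono) auto
        also have "\<dots> = phi l0 * t * (1 / (real (Suc i) * real (Suc i)))" by (simp add: u_def)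
        also have "\<dots> \<le> phi l0 * t * (1 / (real i * real (Suc i)))"
        proof (intro mult_left_mono divide_left_mono mult_right_mono)
          show "0 \<le> phi l0 * t" using phi_ge_half[of l0] l0 t by simp
        qed (use i V in auto)
        also have "1 / (real i * real (Suc i)) = 1 / real i - 1 / real (Suc i)" using i V by (simp add: field_simps)
        finally show ?thesis .
      qed
      have "(\<Sum>i=V..m. \<bar>cc i - ph i\<bar>) \<le> phi l0 * t * (1 / real V - 1 / real (Suc m))" if "m \<ge> V" for m
        using that
      proof (induction m rule: dec_induct)
        case base
        show ?case using b[of V] by simp
      next
        case (step m)
        have "\<bar>cc (Suc m) - ph (Suc m)\<bar> \<le> phi l0 * t * (1 / real (Suc m) - 1 / real (Suc (Suc m)))" using step by (intro b) auto
        moreover have "(\<Sum>i=V..Suc m. \<bar>cc i - ph i\<bar>) = (\<Sum>i=V..m. \<bar>cc i - ph i\<bar>) + \<bar>cc (Suc m) - ph (Suc m)\<bar>" using step by (intro sum.cl_ivl_Suc[THEN trans]) simp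
        moreover have "phi l0 * t * (1 / real V - 1 / real (Suc (Suc m))) = phi l0 * t * (1 / real V - 1 / real (Suc m)) + phi l0 * t * (1 / real (Suc m) - 1 / real (Suc (Suc m)))"
          by (simp only: distrib_left[symmetric]) simp
        ultimately show ?case using step.IH by linarith
      qed
      note 2 = this[OF n]
      have "phi l0 * t * (1 / real V - 1 / real (Suc n)) \<le> phi l0 * t * (l0 / t)"
      proof (rule mult_left_mono)
        have "1 / real V \<le> l0 / t" using V(1,3) l0 t by (simp add: field_simps)
        moreover have "1 / real (Suc n) \<ge> 0" by simp
        ultimately show "1 / real V - 1 / real (Suc n) \<le> l0 / t" by linarith
        show "0 \<le> phi l0 * t" using phi_ge_half[of l0] l0 t by simp
      qed
      also have "\<dots> = phi l0 * l0" using t by simp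
      finally have 3: "(\<Sum>i=V..n. \<bar>cc i - ph i\<bar>) \<le> phi l0 * l0" using 2 by linarith
      have "{..<Suc n} = {..<V} \<union> {V..n}" "{..<V} \<inter> {V..n} = {}" using n by auto
      hence "(\<Sum>i<Suc n. \<bar>cc i - ph i\<bar>) = (\<Sum>i<V. \<bar>cc i - ph i\<bar>) + (\<Sum>i=V..n. \<bar>cc i - ph i\<bar>)"
        by (simp add: sum.union_disjoint)
      thus ?thesis using 1 3 by (simp add: D_def algebra_simps)
    qed
    hence bnd: "\<bar>Pi_P p x - (\<Sum>i<Suc n. ph i)\<bar> \<le> C * ln t + D" if "n \<ge> V" for n
    proof -
      have "\<bar>Pi_P p x - (\<Sum>i<Suc n. ph i)\<bar> = \<bar>\<Sum>i<Suc n. cc i - ph i\<bar>" using PiV[of "Suc n"] that by (simp add: sum_subtractf)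
      also have "\<dots> \<le> (\<Sum>i<Suc n. \<bar>cc i - ph i\<bar>)" by (rule sum_abs)
      finally show ?thesis using \<open>\<And>n. V \<le> n \<Longrightarrow> _ n \<le> _\<close>[OF that] by linarith
    qed
    have "ph sums Lt t" using Phi_sum_sums[of t] t by (simp add: ph_def[abs_def])
    hence "(\<lambda>n. \<Sum>i<Suc n. ph i) \<longlonglongrightarrow> Lt t" unfolding sums_def by (rule LIMSEQ_Suc)
    hence "(\<lambda>n. \<bar>Pi_P p x - (\<Sum>i<Suc n. ph i)\<bar>) \<longlonglongrightarrow> \<bar>Pi_P p x - Lt t\<bar>" by (intro tendsto_intros)
    hence "\<bar>Pi_P p x - Lt t\<bar> \<le> C * ln t + D" by (rule LIMSEQ_le_const2) (use bnd in blast)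
    thus ?thesis using Li_eq[OF x1] by (simp add: t_def)
  qed
  have "eventually (\<lambda>x::real. ln (ln x) \<ge> 1) at_top" by real_asymp
  moreover have "eventually (\<lambda>x::real. x \<ge> exp 1) at_top" by (rule eventually_ge_at_top)
  ultimately have "eventually (\<lambda>x. norm (Pi_P p x - Li x) \<le> (C + \<bar>D\<bar>) * norm (ln (ln x))) at_top"
  proof eventually_elim
    case (elim x)
    have "D \<le> \<bar>D\<bar> * ln (ln x)" using mult_left_mono[OF elim(1), of "\<bar>D\<bar>"] by simp
    thus ?case using main[OF elim(2)] elim by (simp add: distrib_right)
  qed
  thus ?thesis by (rule bigoI)
qed

text \<open>\<open>Phi_sg\<close> determines the number of \<open>sg j\<close> up to u within 3 of
  \<open>Phi u\<close>; skipping the first k indices and replacing slot k by ps accounts for the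
  rest.\<close>

lemma (in windows) count_sg:
  assumes "u \<ge> 0" "1 < ps" "p = (\<lambda>n. ((\<lambda>j. exp (sg j))(k := ps)) (n + k))"
  shows "\<bar>real (card {n. p n \<le> exp u}) - Phi u\<bar> \<le> real k + 5"
proof -
  define S where "S = {j. sg j \<le> u}"
  have fS: "finite S" unfolding S_def by (rule finite_sg_le)
  have P0: "Phi u \<ge> 0" using Phi_nonneg assms by simp
  have "S \<subseteq> {..nat \<lfloor>Phi u\<rfloor>}"
  proof
    fix j assume "j \<in> S"
    hence "Phi (sg j) \<le> Phi u" using sg_ge_1[of j] by (subst Phi_le_iff) (auto simp: S_def)
    hence "real j \<le> Phi u" using Phi_sg(1)[of j] by linarith
    thus "j \<in> {..nat \<lfloor>Phi u\<rfloor>}" by (simp add: le_nat_floor)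
  qed
  hence "card S \<le> card {..nat \<lfloor>Phi u\<rfloor>}" by (intro card_mono) auto
  hence "real (card S) \<le> real (nat \<lfloor>Phi u\<rfloor>) + 1" by simp
  hence up: "real (card S) \<le> Phi u + 1" using of_nat_floor[OF P0] by linarith
  have lo: "Phi u - 3 \<le> real (card S)"
  proof (cases "Phi u \<ge> 3")
    case True
    have "{..nat \<lfloor>Phi u - 3\<rfloor>} \<subseteq> S"
    proof
      fix j assume "j \<in> {..nat \<lfloor>Phi u - 3\<rfloor>}"
      hence "real j \<le> real (nat \<lfloor>Phi u - 3\<rfloor>)" by simp
      also have "\<dots> \<le> Phi u - 3" using True by (intro of_nat_floor) simp
      finally have "real j \<le> Phi u - 3" .
      hence "Phi (sg j) \<le> Phi u" using Phi_sg(2)[of j] by linarith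
      moreover have "0 \<le> sg j" using sg_ge_1[of j] by linarith
      ultimately have "sg j \<le> u" using assms(1) Phi_le_iff[of "sg j" u] by blast
      thus "j \<in> S" by (simp add: S_def)
    qed
    hence "card {..nat \<lfloor>Phi u - 3\<rfloor>} \<le> card S" by (intro card_mono fS)
    hence "real (nat \<lfloor>Phi u - 3\<rfloor>) + 1 \<le> real (card S)" by simp
    moreover have "real (nat \<lfloor>Phi u - 3\<rfloor>) = of_int \<lfloor>Phi u - 3\<rfloor>" using True by simp
    ultimately show ?thesis using floor_correct[of "Phi u - 3"] by linarith
  qed auto
  define R where "R = {n. p n \<le> exp u}"
  have pn: "p n = exp (sg (n + k))" if "n > 0" for n using that assms(3) by simp
  have R1: "(\<lambda>n. n + k) ` (R - {0}) \<subseteq> S" using pn by (auto simp: R_def S_def)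
  have fR': "finite (R - {0})" using finite_subset[OF R1 fS] by (simp add: finite_image_iff)
  hence fR: "finite R" by simp
  have "card (R - {0}) \<le> card S" using card_mono[OF fS R1] by (simp add: card_image)
  moreover have "card R \<le> card (R - {0}) + 1" using diff_card_le_card_Diff[of "{0}" R] by simp
  moreover have "card S \<le> card R + (k + 1)"
  proof -
    have "S \<subseteq> (\<lambda>n. n + k) ` R \<union> {..k}"
    proof
      fix j assume j: "j \<in> S"
      show "j \<in> (\<lambda>n. n + k) ` R \<union> {..k}"
      proof (cases "j \<le> k")
        case False
        hence "j - k \<in> R" using pn[of "j - k"] j by (auto simp: R_def S_def)
        moreover have "j = (j - k) + k" using False by simp
        ultimately show ?thesis by blast
      qed simp
    qed
    hence "card S \<le> card ((\<lambda>n. n + k) ` R \<union> {..k})" using fR by (intro card_mono) auto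
    also have "\<dots> \<le> card ((\<lambda>n. n + k) ` R) + card {..k}" by (rule card_Un_le)
    also have "\<dots> \<le> card R + (k + 1)" using card_image_le[OF fR] by simp
    finally show ?thesis .
  qed
  ultimately have "real (card R) \<le> real (card S) + 1" "real (card S) \<le> real (card R) + (real k + 1)" by linarith+
  thus ?thesis using up lo unfolding R_def by linarith
qed

text \<open>The maximum with 1/4 keeps the exponent positive even for e \<ge> 1/2, as
  \<open>count_contra\<close> requires.\<close>

lemma smallo_powr_imp:
  fixes f :: "real \<Rightarrow> real"
  assumes "f \<in> o(\<lambda>x. x powr (1/2 - e))" "e > 0"
  shows "\<exists>al. 0 < al \<and> al < 1/2 \<and> eventually (\<lambda>x. \<bar>f x\<bar> \<le> 1 * x powr al) at_top"
proof (intro exI[of _ "max (1/2 - e) (1/4)"] conjI)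
  have "eventually (\<lambda>x. norm (f x) \<le> 1 * norm (x powr (1/2 - e))) at_top"
    by (rule landau_o.smallD[OF assms(1)]) simp
  moreover have "eventually (\<lambda>x::real. x \<ge> 1) at_top" by (rule eventually_ge_at_top)
  ultimately show "eventually (\<lambda>x. \<bar>f x\<bar> \<le> 1 * x powr (max (1/2 - e) (1/4))) at_top"
  proof eventually_elim
    case (elim x)
    have "x powr (1/2 - e) \<le> x powr (max (1/2 - e) (1/4))" using elim by (intro powr_mono) auto
    thus ?case using elim by simp
  qed
qed (use assms(2) in \<open>auto simp: max_def field_simps\<close>)

lemma exists_windows: "\<exists>JJ :: nat \<Rightarrow> nat. \<forall>i. T (JJ i) \<ge> 4 ^ i \<and> JJ i + nat \<lfloor>sqrt (phi (T (JJ i)))\<rfloor> < JJ (Suc i)"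
proof -
  have ex: "\<exists>n>m. T n \<ge> B" for m B
  proof -
    obtain n where "T n > B" using T_unbounded by blast
    moreover have "T n \<le> T (max n (Suc m))" by (simp add: T_le_iff)
    ultimately show ?thesis by (intro exI[of _ "max n (Suc m)"]) auto
  qed
  have "\<exists>JJ. \<forall>i. T (JJ i) \<ge> 4 ^ i \<and> JJ i + nat \<lfloor>sqrt (phi (T (JJ i)))\<rfloor> < JJ (Suc i)"
  proof (rule dependent_nat_choice)
    show "\<exists>n. 4 ^ 0 \<le> T n" using T_ge_1[of 0] by auto
    show "\<exists>n. 4 ^ Suc i \<le> T n \<and> m + nat \<lfloor>sqrt (phi (T m))\<rfloor> < n" for m i
      using ex[of "m + nat \<lfloor>sqrt (phi (T m))\<rfloor>" "4 ^ Suc i"] by blast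
  qed
  thus ?thesis .
qed

theorem theorem3p1:
  shows "\<exists>p. beurling_primes p \<and>
    (\<lambda>x. Pi_P p x - Li x) \<in> O(\<lambda>x. ln (ln x)) \<and>
    (\<exists>c>0. (\<lambda>x. N_P p x - x) \<in> O(\<lambda>x. sqrt x * exp (c * ln x powr (2/3))) \<and>
           (\<lambda>x. M_P p x) \<in> O(\<lambda>x. sqrt x * exp (c * ln x powr (2/3)))) \<and>
    (\<forall>\<epsilon>>0. (\<lambda>x. N_P p x - x) \<notin> o(\<lambda>x. x powr (1/2 - \<epsilon>)) \<and>
           (\<lambda>x. M_P p x) \<notin> o(\<lambda>x. x powr (1/2 - \<epsilon>)))"
proof -
  obtain om C0 q0 where U: "U_bound om C0 q0" using random_bound unfolding U_bound_def by blast
  have om: "cell_pts om" using U by (simp add: U_bound_def)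
  obtain q r C where N0: "asym (EE q) r C (NR (\<lambda>j. exp (om j)) {})" using NR_random[OF U] by blast
  obtain q' C' where M0: "asym (EE q') 0 C' (MR (\<lambda>j. exp (om j)) {})" using MR_random[OF U] by blast
  obtain JJ where JJ: "\<And>i. T (JJ i) \<ge> 4 ^ i" "\<And>i. JJ i + nat \<lfloor>sqrt (phi (T (JJ i)))\<rfloor> < JJ (Suc i)"
    using exists_windows by blast
  \<comment> \<open>The polynomials \<open>QQ\<close> depend on \<open>om\<close> and
    \<open>JJ\<close> only, so s can be chosen after them and before the locale is
    interpreted.\<close>
  have "countable ({S :: nat set. finite S} \<times> (UNIV :: (nat \<times> nat \<times> nat) set))"
    by (intro countable_SIGMA countable_Collect_finite) auto
  hence "countable (windows.QQ om JJ ` ({S. finite S} \<times> UNIV))" by (rule countable_image)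
  then obtain s where s: "0 < s" "s < 1" "\<And>Q. Q \<in> windows.QQ om JJ ` ({S. finite S} \<times> UNIV) \<Longrightarrow> poly Q s = 0 \<Longrightarrow> Q = 0"
    using poly_generic_point by meson
  interpret windows om JJ s by unfold_locales (use om JJ s in auto)
  have gen: generic unfolding generic_def
  proof (intro allI impI)
    fix S i k m assume "finite (S :: nat set)" "poly (QQ (S, i, k, m)) s = 0"
    thus "QQ (S, i, k, m) = 0" by (intro s(3)) auto
  qed
  obtain r1 C1 where N1: "asym (EE q) r1 C1 (NR (\<lambda>j. exp (sg j)) {})" using NR_sg[OF N0] by blast
  obtain C1' where M1: "asym (EE q') 0 C1' (MR (\<lambda>j. exp (sg j)) {})" using MR_sg[OF M0] by blast
  obtain k ps C2 C2' where ps: "1 < ps" "ps \<le> 2" and N2: "asym (EE q) 1 C2 (NR ((\<lambda>j. exp (sg j))(k := ps)) {..<k})"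
    and M2: "asym (EE q') 0 C2' (MR ((\<lambda>j. exp (sg j))(k := ps)) {..<k})" using tune[OF N1 M1] by blast
  define p' where "p' = (\<lambda>j. exp (sg j))(k := ps)"
  have p': "loc_fin p'" unfolding p'_def by (rule loc_fin_upd[OF exp_sg_facts(1) ps(1)])
  define p where "p = (\<lambda>n. p' (n + k))"
  have NP: "N_P p = NR p' {..<k}" and MP: "M_P p = MR p' {..<k}" unfolding p_def using N_P_shift M_P_shift by blast+
  have p0: "p 0 = ps" and pn: "\<And>n. n > 0 \<Longrightarrow> p n = exp (sg (n + k))" by (auto simp: p_def p'_def)
  have ge: "p n \<ge> ps" for n using p0 pn[of n] exp_sg_facts(2)[of "n + k"] ps by (cases "n = 0") auto
  have fin: "finite {n. p n \<le> x}" for x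
  proof -
    have "(\<lambda>n. n + k) ` {n. p n \<le> x} \<subseteq> {j. p' j \<le> x}" by (auto simp: p_def)
    moreover have "finite {j. p' j \<le> x}" using p' by (simp add: loc_fin_def)
    ultimately have "finite ((\<lambda>n. n + k) ` {n. p n \<le> x})" by (rule finite_subset)
    thus ?thesis by (simp add: finite_image_iff)
  qed
  have "beurling_primes p"
    unfolding beurling_primes_def
  proof (intro conjI notI)
    show "mono p"
    proof (rule monoI)
      fix m n :: nat assume mn: "m \<le> n"
      show "p m \<le> p n"
      proof (cases "m = 0")
        case True thus ?thesis using ge p0 by simp
      next
        case False thus ?thesis using mn sg_mono[of "m + k" "n + k"] by (simp add: pn)
      qed
    qed
    assume "bdd_above (range p)"
    then obtain B where "\<And>n. p n \<le> B" by (auto simp: bdd_above_def)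
    hence "{n. p n \<le> B} = UNIV" by auto
    thus False using fin[of B] by simp
  qed (use p0 ps in simp)
  moreover have "(\<lambda>x. Pi_P p x - Li x) \<in> O(\<lambda>x. ln (ln x))"
  proof (rule Pi_bigo[of "ln ps" p "real k + 5"])
    show "p j \<ge> exp (ln ps)" for j using ge[of j] ps by simp
    show "finite {j. p j \<le> x}" for x by (rule fin)
    show "ln ps > 0" using ps by simp
    show "\<bar>real (card {j. p j \<le> exp u}) - Phi u\<bar> \<le> real k + 5" if "u \<ge> 0" for u
      by (rule count_sg[OF that ps(1)]) (simp add: p_def p'_def)
  qed
  moreover have "(\<lambda>x. N_P p x - x) \<in> O(\<lambda>x. sqrt x * exp (1 * ln x powr (2/3)))"
    using asym_bigo[OF N2] by (simp add: NP p'_def)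
  moreover have "(\<lambda>x. M_P p x) \<in> O(\<lambda>x. sqrt x * exp (1 * ln x powr (2/3)))"
    using asym_bigo[OF M2] by (simp add: MP p'_def)
  moreover have "(\<lambda>x. N_P p x - x) \<notin> o(\<lambda>x. x powr (1/2 - \<epsilon>))" if "\<epsilon> > 0" for \<epsilon>
  proof
    assume "(\<lambda>x. N_P p x - x) \<in> o(\<lambda>x. x powr (1/2 - \<epsilon>))"
    from smallo_powr_imp[OF this that] obtain al where "0 < al" "al < 1/2" "eventually (\<lambda>x. \<bar>N_P p x - x\<bar> \<le> 1 * x powr al) at_top" by blast
    thus False using N_Omega[of k ps al 1] p' by (simp add: NP p'_def)
  qed
  moreover have "(\<lambda>x. M_P p x) \<notin> o(\<lambda>x. x powr (1/2 - \<epsilon>))" if "\<epsilon> > 0" for \<epsilon>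
  proof
    assume "(\<lambda>x. M_P p x) \<in> o(\<lambda>x. x powr (1/2 - \<epsilon>))"
    from smallo_powr_imp[OF this that] obtain al where "0 < al" "al < 1/2" "eventually (\<lambda>x. \<bar>M_P p x\<bar> \<le> 1 * x powr al) at_top" by blast
    thus False using M_Omega[OF gen ps(1), of k al 1] p' by (simp add: MP p'_def)
  qed
  ultimately show ?thesis by (intro exI[of _ p] conjI exI[of _ 1] allI impI) auto
qed

end
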